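(* (1) Every real chord diagram with at most $3$ chords is the real chord diagram of some nodal rational real plane projective curve of degree $4$. (2) Let $C_1$ and $C_2$ be nodal rational real plane projective curves of degree $4$ all of whose nodes are real (each node being either solitary or non-solitary). Then $C_1$ and $C_2$ are rigidly isotopic if and only if they have the same real chord diagram.
   Context: **Rational real curves.** A rational real plane projective curve $C$ of degree $d$ is a plane projective curve of degree $d$ that is the image of a regular map $\theta:[s:t]\mapsto[p_0(s,t):p_1(s,t):p_2(s,t)]$ of the projective line, where $p_0,p_1,p_2$ are homogeneous polynomials of the same degree $d$ with real coefficients and with no common root (in $\mathbb{CP}^1$). Its maps on complex and real points are $\mathbb{C}\theta:\mathbb{CP}^1\to\mathbb{CP}^2$, with image $\mathbb{C}C$, and $\mathbb{R}\theta:\mathbb{RP}^1\to\mathbb{RP}^2$. The real points of $C$ are the points of $\mathbb{C}C\cap\mathbb{RP}^2$. **Nodes.** A point $x\in\mathbb{C}C$ is a node if $\mathbb{C}\theta^{-1}(x)$ consists of exactly two points and the corresponding two branches of $\mathbb{C}C$ at $x$ are transversal. The curve $C$ is nodal (equivalently, generic) if its only singularities are nodes; then $\mathbb{C}\theta$ is an immersion, injective except over the nodes, and there are $\frac{(d-1)(d-2)}{2}$ nodes (so $3$ when $d=4$). A node is real if it lies in $\mathbb{RP}^2$. A real node $x$ is non-solitary if $\mathbb{C}\theta^{-1}(x)$ consists of two real points (points of $\mathbb{RP}^1$), and solitary if $\mathbb{C}\theta^{-1}(x)$ consists of two imaginary points (points of $\mathbb{CP}^1\setminus\mathbb{RP}^1$,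 which are then complex conjugate to each other). **Real chord diagrams.** A real chord diagram is a graph consisting of a circle together with finitely many chords, each connecting two points of the circle, all end points of chords being distinct. The real chord diagram of a nodal rational real curve $C$ has as its circle the copy of $\mathbb{RP}^1$ parametrizing $C$, and has one chord for each non-solitary real node $x$ of $C$, connecting the two points of $\mathbb{R}\theta^{-1}(x)$. Chord diagrams are regarded as the same if a homeomorphism of the circles (possibly orientation reversing) carries the pairs of end points of the chords of one to those of the other. **Rigid isotopy.** A rigid isotopy between nodal rational real plane projective curves of degree $d$ is a continuous one-parameter deformation $C_t$, $t\in[0,1]$, consisting of nodal rational real plane projective curves of the same degree $d$ (continuity is with respect to the coefficients of the curves). Two curves are rigidly isotopic if they are joined by a rigid isotopy. *)

theory Defs
  imports "HOL-Analysis.Analysis"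
begin

section \<open>Projective spaces\<close>

text \<open>A point of projective space is the set of all its homogeneous coordinate vectors. \<open>RP\<close> is
  the set of those points of \<open>CP\<close> that have real homogeneous coordinates.\<close>

definition pt :: "complex ^ 'n \<Rightarrow> (complex ^ 'n) set" where
  "pt v = {c *s v | c. c \<noteq> 0}"

definition cvec :: "real ^ 'n \<Rightarrow> complex ^ 'n" where
  "cvec u = (\<chi> i. complex_of_real (u $ i))"

definition CP :: "(complex ^ 'n) set set" where
  "CP = {pt v | v. v \<noteq> 0}"

definition RP :: "(complex ^ 'n) set set" where
  "RP = {pt (cvec u) | u. u \<noteq> 0}"

section \<open>Plane projective curves\<close>

definition ternary_form :: "nat \<Rightarrow> (complex ^ 3 \<Rightarrow> complex) \<Rightarrow> bool" where
  "ternary_form d F \<longleftrightarrow> (\<exists>c :: nat \<Rightarrow> nat \<Rightarrow> complex.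
     F = (\<lambda>v. \<Sum>i\<le>d. \<Sum>j\<le>d - i. c i j * (v $ 1) ^ i * (v $ 2) ^ j * (v $ 3) ^ (d - i - j)))"

definition zero_locus :: "(complex ^ 3 \<Rightarrow> complex) \<Rightarrow> (complex ^ 3) set set" where
  "zero_locus F = {x \<in> CP. \<forall>v\<in>x. F v = 0}"

text \<open>\<open>F\<close> is the reduced equation, of degree \<open>d\<close>, of the point set \<open>C\<close>: the minimality condition
  makes \<open>F\<close> a generator of the homogeneous ideal of \<open>C\<close>, excluding multiple components
  (e.g. \<open>Q\<^sup>2\<close> as an equation of degree 4 of a conic).\<close>

definition curve_equation :: "nat \<Rightarrow> (complex ^ 3 \<Rightarrow> complex) \<Rightarrow> (complex ^ 3) set set \<Rightarrow> bool" where
  "curve_equation d F C \<longleftrightarrow>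
     ternary_form d F \<and> F \<noteq> (\<lambda>_. 0) \<and> C = zero_locus F \<and>
     (\<forall>e<d. \<forall>G. ternary_form e G \<and> C \<subseteq> zero_locus G \<longrightarrow> G = (\<lambda>_. 0))"

definition plane_curve :: "nat \<Rightarrow> (complex ^ 3) set set \<Rightarrow> bool" where
  "plane_curve d C \<longleftrightarrow> (\<exists>F. curve_equation d F C)"

definition singular_point :: "nat \<Rightarrow> (complex ^ 3) set set \<Rightarrow> (complex ^ 3) set \<Rightarrow> bool" where
  "singular_point d C x \<longleftrightarrow>
     x \<in> C \<and> (\<exists>F. curve_equation d F C \<and> (\<forall>v\<in>x. (F has_derivative (\<lambda>_. 0)) (at v)))"

section \<open>Rational real curves\<close>

text \<open>A triple of real binary forms of degree \<open>d\<close> is given by \<open>a :: nat \<Rightarrow> real ^ 3\<close>: the component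
  \<open>a k $ i\<close>, for \<open>k \<le> d\<close>, is the coefficient of \<open>s ^ k * t ^ (d - k)\<close> in the \<open>i\<close>-th form (the values
  \<open>a k\<close> for \<open>k > d\<close> are irrelevant). \<open>theta_lift\<close> acts on homogeneous coordinates, \<open>Ctheta\<close> on
  points.\<close>

definition theta_lift :: "nat \<Rightarrow> (nat \<Rightarrow> real ^ 3) \<Rightarrow> complex ^ 2 \<Rightarrow> complex ^ 3" where
  "theta_lift d a v =
     (\<chi> i. \<Sum>k\<le>d. complex_of_real (a k $ i) * (v $ 1) ^ k * (v $ 2) ^ (d - k))"

definition Ctheta :: "nat \<Rightarrow> (nat \<Rightarrow> real ^ 3) \<Rightarrow> (complex ^ 2) set \<Rightarrow> (complex ^ 3) set" where
  "Ctheta d a P = (\<Union>v\<in>P. pt (theta_lift d a v))"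

definition parametrizes :: "nat \<Rightarrow> (nat \<Rightarrow> real ^ 3) \<Rightarrow> (complex ^ 3) set set \<Rightarrow> bool" where
  "parametrizes d a C \<longleftrightarrow>
     (\<forall>v. v \<noteq> 0 \<longrightarrow> theta_lift d a v \<noteq> 0) \<and> C = Ctheta d a ` CP \<and> plane_curve d C"

definition preimages :: "nat \<Rightarrow> (nat \<Rightarrow> real ^ 3) \<Rightarrow> (complex ^ 3) set \<Rightarrow> (complex ^ 2) set set" where
  "preimages d a x = {P \<in> CP. Ctheta d a P = x}"

section \<open>Nodes\<close>

text \<open>The cone in \<open>complex ^ 3\<close> over the tangent line at the branch through \<open>pt v\<close>. It contains
  \<open>theta_lift d a v\<close> by Euler's identity, and it is a plane iff \<open>Ctheta d a\<close> is an immersion at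
  \<open>pt v\<close>. Two branches through the same point are transversal iff these cones together span
  \<open>complex ^ 3\<close>.\<close>

definition tangent_cone :: "nat \<Rightarrow> (nat \<Rightarrow> real ^ 3) \<Rightarrow> complex ^ 2 \<Rightarrow> (complex ^ 3) set" where
  "tangent_cone d a v = range (frechet_derivative (theta_lift d a) (at v))"

definition transversal_branches ::
    "nat \<Rightarrow> (nat \<Rightarrow> real ^ 3) \<Rightarrow> (complex ^ 2) set \<Rightarrow> (complex ^ 2) set \<Rightarrow> bool" where
  "transversal_branches d a P Q \<longleftrightarrow>
     (\<forall>v\<in>P. \<forall>w\<in>Q. {y + z | y z. y \<in> tangent_cone d a v \<and> z \<in> tangent_cone d a w} = UNIV)"

definition node :: "nat \<Rightarrow> (nat \<Rightarrow> real ^ 3) \<Rightarrow> (complex ^ 3) set \<Rightarrow> bool" where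
  "node d a x \<longleftrightarrow>
     (\<exists>P Q. P \<noteq> Q \<and> preimages d a x = {P, Q} \<and> transversal_branches d a P Q)"

definition nodal_parametrization :: "nat \<Rightarrow> (nat \<Rightarrow> real ^ 3) \<Rightarrow> (complex ^ 3) set set \<Rightarrow> bool" where
  "nodal_parametrization d a C \<longleftrightarrow>
     parametrizes d a C \<and> (\<forall>x. singular_point d C x \<longrightarrow> node d a x)"

definition real_node :: "nat \<Rightarrow> (nat \<Rightarrow> real ^ 3) \<Rightarrow> (complex ^ 3) set \<Rightarrow> bool" where
  "real_node d a x \<longleftrightarrow> node d a x \<and> x \<in> RP"

definition non_solitary :: "nat \<Rightarrow> (nat \<Rightarrow> real ^ 3) \<Rightarrow> (complex ^ 3) set \<Rightarrow> bool" where
  "non_solitary d a x \<longleftrightarrow> real_node d a x \<and> preimages d a x \<subseteq> RP"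

section \<open>Real chord diagrams\<close>

text \<open>The circle is the unit circle in the complex plane; a chord is its set of end points.\<close>

definition chord_diagram :: "complex set set \<Rightarrow> bool" where
  "chord_diagram D \<longleftrightarrow>
     finite D \<and> (\<forall>c\<in>D. c \<subseteq> sphere 0 1 \<and> card c = 2) \<and> pairwise disjnt D"

definition same_diagram :: "complex set set \<Rightarrow> complex set set \<Rightarrow> bool" where
  "same_diagram D D' \<longleftrightarrow>
     (\<exists>f g. homeomorphism (sphere 0 1) (sphere 0 1) f g \<and> D' = (\<lambda>c. f ` c) ` D)"

text \<open>The real projective line is identified with the unit circle by the homeomorphism
  \<open>[s : t] \<mapsto> (s + i t)\<^sup>2 / \<bar>s + i t\<bar>\<^sup>2\<close>.\<close>

definition circle_point :: "real ^ 2 \<Rightarrow> complex" where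
  "circle_point u = (sgn (Complex (u $ 1) (u $ 2)))\<^sup>2"

definition chord :: "nat \<Rightarrow> (nat \<Rightarrow> real ^ 3) \<Rightarrow> (complex ^ 3) set \<Rightarrow> complex set" where
  "chord d a x = {circle_point u | u. u \<noteq> 0 \<and> pt (cvec u) \<in> preimages d a x}"

definition real_chord_diagram :: "nat \<Rightarrow> (nat \<Rightarrow> real ^ 3) \<Rightarrow> complex set set" where
  "real_chord_diagram d a = {chord d a x | x. non_solitary d a x}"

section \<open>Rigid isotopy\<close>

text \<open>The curves of the family move continuously in the sense that they can be parametrized by
  triples of forms whose coefficients depend continuously on the time.\<close>

definition rigid_isotopy :: "nat \<Rightarrow> (real \<Rightarrow> (complex ^ 3) set set) \<Rightarrow> bool" where
  "rigid_isotopy d K \<longleftrightarrow>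
     (\<exists>a :: real \<Rightarrow> nat \<Rightarrow> real ^ 3.
        (\<forall>k\<le>d. continuous_on {0..1} (\<lambda>t. a t k)) \<and>
        (\<forall>t\<in>{0..1}. nodal_parametrization d (a t) (K t)))"

definition rigidly_isotopic :: "nat \<Rightarrow> (complex ^ 3) set set \<Rightarrow> (complex ^ 3) set set \<Rightarrow> bool" where
  "rigidly_isotopic d C C' \<longleftrightarrow> (\<exists>K. rigid_isotopy d K \<and> K 0 = C \<and> K 1 = C')"

end

theory Submission
  imports Defs "HOL-Complex_Analysis.Complex_Analysis" "HOL-Computational_Algebra.Fundamental_Theorem_Algebra"
begin

text \<open>The functionals on quartic binary forms that annihilate the three components of a nodal
  quartic form a pencil, which contains three functionals with singular Hankel matrix. Their kernels
  are quadratic forms \<open>k\<^sub>1, k\<^sub>2, k\<^sub>3\<close> whose roots are the preimages of the three nodes, and the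
  curve is parametrized, up to a linear map, by \<open>(k\<^sub>2 k\<^sub>3, k\<^sub>1 k\<^sub>3, k\<^sub>1 k\<^sub>2)\<close>, a quadratic transform
  of a conic. The nodes are real iff the \<open>k\<^sub>i\<close> can be taken real; then the chords are the root pairs
  of the indefinite ones. Conversely, three real forms give a nodal quartic iff their discriminants
  and mutual resultants do not vanish and they are linearly independent, and the curve depends only
  on the Gram matrix of the \<open>k\<^sub>i\<close> with respect to the discriminant form.

  If two such curves have the same chord diagram, moving the end points of the chords monotonically
  gives a path of triples along which only linear independence may fail. Replacing the signed
  distance of \<open>k\<^sub>3\<close> from the plane of \<open>k\<^sub>1, k\<^sub>2\<close> by its absolute value does not change Gram
  matrices, and a small push off the plane then yields an isotopy. In the other direction,
  compactness shows that the triples of a continuous family of curves converge, so that the chord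
  diagram is locally constant.\<close>

text \<open>\<open>nodal_parametrization\<close> constrains only the singular points of the set
  \<open>C\<close>. Injectivity off the nodes and immersivity must be derived: a violation over a
  smooth point would create infinitely many degenerate functionals, up to scaling, or a vanishing
  derivative of an injective function. Quartic binary forms have dimension 5 and the components of
  the parametrization span 3, whence a pencil; the Hankel determinant is a cubic on it, whence three
  nodes. Transversality forbids that the square of a kernel is the pullback of a line. This makes
  the zeros of the cubic simple, and in limits it stops two kernels from merging. The same fact
  controls reality: a rigid isotopy does not demand real nodes at intermediate times, but a non-real
  kernel comes with its conjugate, and the two would merge in a real limit. Linear independence of
  the triple is one determinant condition whose sign may have to change along a path; a reflection
  for the discriminant form changes that sign and leaves the curve fixed. The real general linear
  group has two components, but \<open>M\<close> and \<open>- M\<close> define the same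
  curve.\<close>

unbundle no Formal_Power_Series.fps_syntax
unbundle no Formal_Laurent_Series.fps_syntax

section \<open>Homogeneous coordinates\<close>

definition det2 :: "'a::comm_ring_1 ^ 2 \<Rightarrow> 'a ^ 2 \<Rightarrow> 'a" where
  "det2 v w = v $ 1 * w $ 2 - v $ 2 * w $ 1"

text \<open>Bilinear over the complex numbers, with \<open>m\<close> read as the coefficient vector
  of a line; \<open>inner\<close> on complex vectors is real valued and cannot take this
  role.\<close>

definition lin :: "complex ^ 3 \<Rightarrow> complex ^ 3 \<Rightarrow> complex" where
  "lin m y = (\<Sum>i\<in>UNIV. m $ i * y $ i)"

lemma lin_3: "lin m y = m $ 1 * y $ 1 + m $ 2 * y $ 2 + m $ 3 * y $ 3"
  by (simp add: lin_def sum_3)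

lemma lin_scale: "lin m (c *s y) = c * lin m y" "lin (c *s m) y = c * lin m y"
  and lin_add: "lin m (y + z) = lin m y + lin m z" "lin (m + m') y = lin m y + lin m' y"
  and lin_zero: "lin m 0 = 0" "lin 0 y = 0"
  by (simp_all add: lin_3 algebra_simps)

lemma vec2_eqI: "v $ 1 = w $ 1 \<Longrightarrow> v $ 2 = w $ 2 \<Longrightarrow> v = (w :: 'a ^ 2)"
  by (simp add: vec_eq_iff forall_2)

lemma vec3_eqI: "v $ 1 = w $ 1 \<Longrightarrow> v $ 2 = w $ 2 \<Longrightarrow> v $ 3 = w $ 3 \<Longrightarrow> v = (w :: 'a ^ 3)"
  by (simp add: vec_eq_iff forall_3)

lemma mem_pt: "w \<in> pt v \<longleftrightarrow> (\<exists>c. c \<noteq> 0 \<and> w = c *s v)"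
  by (auto simp: pt_def)

lemma pt_self: "v \<in> pt v"
  unfolding mem_pt by (rule exI[of _ 1]) auto

lemma pt_scale: "c \<noteq> 0 \<Longrightarrow> pt (c *s v) = pt v"
proof -
  assume c: "c \<noteq> 0"
  have "w \<in> pt v" if "w \<in> pt (c *s v)" for w
    using that c unfolding mem_pt by (metis no_zero_divisors vector_smult_assoc)
  moreover have "w \<in> pt (c *s v)" if "w \<in> pt v" for w
  proof -
    obtain e where "e \<noteq> 0" "w = e *s v" using \<open>w \<in> pt v\<close> unfolding mem_pt by auto
    then have "e / c \<noteq> 0 \<and> w = (e / c) *s (c *s v)" using c by simp
    then show ?thesis unfolding mem_pt by blast
  qed
  ultimately show ?thesis by blast
qed

lemma pt_eq_iff: "pt v = pt w \<longleftrightarrow> (\<exists>c. c \<noteq> 0 \<and> w = c *s v)"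
  by (metis mem_pt pt_self pt_scale)

lemma pt_in_CP: "pt v \<in> CP \<longleftrightarrow> v \<noteq> 0"
proof -
  have "v \<noteq> 0" if "pt v = pt w" "w \<noteq> 0" for w
    using that unfolding pt_eq_iff by auto
  then show ?thesis unfolding CP_def by auto
qed

lemma CP_cases: assumes "x \<in> CP" obtains v where "v \<noteq> 0" "x = pt v"
  using assms unfolding CP_def by auto

lemma det2_prop:
  fixes v w :: "'a::field ^ 2"
  assumes "v \<noteq> 0" "det2 v w = 0"
  shows "\<exists>c. w = c *s v"
proof (cases "v $ 1 = 0")
  case True
  with assms(1) have "v $ 2 \<noteq> 0" by (auto simp: vec_eq_iff forall_2)
  with True assms(2) show ?thesis
    by (intro exI[of _ "w $ 2 / v $ 2"] vec2_eqI) (auto simp: det2_def)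
next
  case False
  with assms(2) show ?thesis
    by (intro exI[of _ "w $ 1 / v $ 1"] vec2_eqI) (auto simp: det2_def field_simps)
qed

lemma pt_eq_det2:
  assumes "v \<noteq> 0" "w \<noteq> (0 :: complex ^ 2)"
  shows "pt v = pt w \<longleftrightarrow> det2 v w = 0"
proof
  assume "pt v = pt w"
  then show "det2 v w = 0" by (auto simp: pt_eq_iff det2_def)
next
  assume "det2 v w = 0"
  then obtain c where "w = c *s v" using det2_prop assms by blast
  with assms show "pt v = pt w" unfolding pt_eq_iff by (metis vector_smult_lzero)
qed

lemma det2_complement:
  assumes "v \<noteq> (0 :: complex ^ 2)"
  obtains w where "w \<noteq> 0" "det2 v w = 1"
proof (cases "v $ 1 = 0")
  case True
  with assms have "v $ 2 \<noteq> 0" by (auto simp: vec_eq_iff forall_2)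
  with True show ?thesis
    by (intro that[of "vector [- 1 / v $ 2, 0]"]) (auto simp: det2_def vec_eq_iff forall_2)
next
  case False
  then show ?thesis
    by (intro that[of "vector [0, 1 / v $ 1]"]) (auto simp: det2_def vec_eq_iff forall_2)
qed

lemma det2_decomp:
  fixes v w u :: "complex ^ 2"
  assumes "det2 v w \<noteq> 0"
  shows "u = (det2 u w / det2 v w) *s v + (det2 v u / det2 v w) *s w"
proof (rule vec2_eqI)
  have "det2 v w * u $ 1 = det2 u w * v $ 1 + det2 v u * w $ 1"
    "det2 v w * u $ 2 = det2 u w * v $ 2 + det2 v u * w $ 2"
    by (simp_all add: det2_def algebra_simps)
  with assms show "u $ 1 = ((det2 u w / det2 v w) *s v + (det2 v u / det2 v w) *s w) $ 1"
   "u $ 2 = ((det2 u w / det2 v w) *s v + (det2 v u / det2 v w) *s w) $ 2"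
    by (simp_all add: field_simps)
qed

lemma cvec_nth [simp]: "cvec u $ i = complex_of_real (u $ i)"
  by (simp add: cvec_def)

lemma cvec_eq_0 [simp]: "cvec u = 0 \<longleftrightarrow> u = 0"
  by (simp add: vec_eq_iff)

lemma cvec_inj [simp]: "cvec u = cvec w \<longleftrightarrow> u = w"
  by (simp add: vec_eq_iff)

lemma pt_cvec_RP: "u \<noteq> 0 \<Longrightarrow> pt (cvec u) \<in> RP"
  unfolding RP_def by auto

text \<open>If conjugation multiplies a vector by a scalar, the ratios of its coordinates are fixed
  by conjugation; dividing by one nonzero coordinate therefore makes all of them real.\<close>

lemma conj_prop_real:
  fixes z :: "complex ^ 'n"
  assumes "z \<noteq> 0" "(\<chi> i. cnj (z $ i)) = c *s z"
  shows "\<exists>l u. l \<noteq> 0 \<and> u \<noteq> 0 \<and> z = l *s cvec u"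
proof -
  obtain j where j: "z $ j \<noteq> 0" using assms(1) by (auto simp: vec_eq_iff)
  have c: "cnj (z $ i) = c * z $ i" for i
    using assms(2) by (simp add: vec_eq_iff)
  have r: "z $ i = z $ j * complex_of_real (Re (z $ i / z $ j))" for i
  proof -
    have "c \<noteq> 0" using c[of j] j by auto
    then have "cnj (z $ i / z $ j) = z $ i / z $ j"
      using j by (simp add: c)
    then have "z $ i / z $ j \<in> \<real>" by (simp add: Reals_cnj_iff)
    then have "complex_of_real (Re (z $ i / z $ j)) = z $ i / z $ j"
      by (simp only: of_real_Re)
    with j show ?thesis by simp
  qed
  have "z = (z $ j) *s cvec (\<chi> i. Re (z $ i / z $ j))"
    using r by (simp add: vec_eq_iff)
  moreover have "(\<chi> i. Re (z $ i / z $ j)) \<noteq> 0"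
    using j by (auto simp: vec_eq_iff intro!: exI[of _ j])
  ultimately show ?thesis using j by blast
qed

section \<open>The parametrization in homogeneous coordinates\<close>

abbreviation lift4 :: "(nat \<Rightarrow> real ^ 3) \<Rightarrow> complex ^ 2 \<Rightarrow> complex ^ 3" where
  "lift4 \<equiv> theta_lift 4"

abbreviation nodal :: "(nat \<Rightarrow> real ^ 3) \<Rightarrow> (complex ^ 3) set set \<Rightarrow> bool" where
  "nodal \<equiv> nodal_parametrization 4"

lemma theta_nth: "theta_lift d a v $ i =
    (\<Sum>k\<le>d. complex_of_real (a k $ i) * (v $ 1) ^ k * (v $ 2) ^ (d - k))"
  by (simp add: theta_lift_def)

lemma theta_scale: "theta_lift d a (c *s v) = c ^ d *s theta_lift d a v"
proof -
  have "complex_of_real (a k $ i) * (c * v $ 1) ^ k * (c * v $ 2) ^ (d - k) =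
     c ^ d * (complex_of_real (a k $ i) * (v $ 1) ^ k * (v $ 2) ^ (d - k))" if "k \<le> d" for k i
  proof -
    have "c ^ d = c ^ k * c ^ (d - k)" using that by (simp flip: power_add)
    then show ?thesis by (simp add: power_mult_distrib)
  qed
  then have "(\<Sum>k\<le>d. complex_of_real (a k $ i) * (c * v $ 1) ^ k * (c * v $ 2) ^ (d - k)) =
     (\<Sum>k\<le>d. c ^ d * (complex_of_real (a k $ i) * (v $ 1) ^ k * (v $ 2) ^ (d - k)))" for i
    by (intro sum.cong) simp_all
  then show ?thesis by (simp add: vec_eq_iff theta_nth sum_distrib_left)
qed

lemma theta_cong: "(\<And>k. k \<le> d \<Longrightarrow> a k = b k) \<Longrightarrow> theta_lift d a = theta_lift d b"
  by (auto simp: theta_lift_def fun_eq_iff vec_eq_iff)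

lemma Ctheta_pt: "Ctheta d a (pt v) = pt (theta_lift d a v)"
proof -
  have "pt (theta_lift d a w) = pt (theta_lift d a v)" if "w \<in> pt v" for w
    using that by (auto simp: mem_pt theta_scale pt_scale)
  then show ?thesis unfolding Ctheta_def using pt_self[of v] by blast
qed

lemma pt_in_preimages: "pt v \<in> preimages d a x \<longleftrightarrow> v \<noteq> 0 \<and> x = pt (theta_lift d a v)"
  by (auto simp: preimages_def pt_in_CP Ctheta_pt)

lemma preimages_cases:
  assumes "P \<in> preimages d a x"
  obtains v where "v \<noteq> 0" "P = pt v" "x = pt (theta_lift d a v)"
proof -
  obtain v where v: "v \<noteq> 0" "P = pt v"
    using assms CP_cases unfolding preimages_def by blast
  with assms have "x = pt (theta_lift d a v)" by (simp add: pt_in_preimages)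
  with v that show ?thesis by blast
qed

text \<open>The derivative at \<open>v\<close> in direction \<open>h\<close>, written out so that
  its complex linearity in \<open>h\<close> is visible. The truncated exponents \<open>k - 1\<close>
  and \<open>d - k - 1\<close> are harmless because they come with the factors
  \<open>of_nat k\<close> and \<open>of_nat (d - k)\<close>.\<close>

definition Dtheta :: "nat \<Rightarrow> (nat \<Rightarrow> real ^ 3) \<Rightarrow> complex ^ 2 \<Rightarrow> complex ^ 2 \<Rightarrow> complex ^ 3" where
  "Dtheta d a v h = (\<chi> i. \<Sum>k\<le>d. complex_of_real (a k $ i) *
     (of_nat k * (v $ 1) ^ (k - 1) * h $ 1 * (v $ 2) ^ (d - k) +
      (v $ 1) ^ k * (of_nat (d - k) * (v $ 2) ^ (d - k - 1) * h $ 2)))"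

lemma has_derivative_vec_lambda:
  fixes f :: "'a::real_normed_vector \<Rightarrow> complex ^ 'n"
  assumes "\<And>i. ((\<lambda>v. f v $ i) has_derivative (\<lambda>h. f' h $ i)) (at x)"
  shows "(f has_derivative f') (at x)"
proof (subst has_derivative_componentwise_within, intro ballI)
  fix b :: "complex ^ 'n" assume "b \<in> Basis"
  then obtain i c where b: "b = axis i c" by (auto simp: Basis_vec_def)
  show "((\<lambda>x. f x \<bullet> b) has_derivative (\<lambda>x. f' x \<bullet> b)) (at x)"
    unfolding b inner_axis using assms[of i] by (intro has_derivative_inner_left)
qed

lemma has_derivative_vec_nth [derivative_intros]:
  "((\<lambda>v. v $ i) has_derivative (\<lambda>h. h $ i)) F"
  by (rule bounded_linear.has_derivative[OF bounded_linear_vec_nth]) simp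

lemma has_derivative_theta: "(theta_lift d a has_derivative Dtheta d a v) (at v)"
  unfolding theta_lift_def Dtheta_def
  by (rule has_derivative_vec_lambda)
     (auto intro!: derivative_eq_intros sum.cong simp: algebra_simps)

lemma tangent_cone_eq: "tangent_cone d a v = range (Dtheta d a v)"
  using frechet_derivative_at[OF has_derivative_theta] by (simp add: tangent_cone_def)

lemma Dtheta_add: "Dtheta d a v (h + g) = Dtheta d a v h + Dtheta d a v g"
  and Dtheta_scale: "Dtheta d a v (c *s h) = c *s Dtheta d a v h"
proof -
  have a: "c * (x * (h + g) * y + z * (t * (h' + g'))) = c * (x * h * y + z * (t * h')) + c * (x * g * y + z * (t * g'))"
    and b: "c * (x * (e * h) * y + z * (t * (e * h'))) = e * (c * (x * h * y + z * (t * h')))"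
    for c x h g y z t h' g' e :: complex
    by (simp_all add: algebra_simps)
  show "Dtheta d a v (h + g) = Dtheta d a v h + Dtheta d a v g"
    by (simp add: vec_eq_iff Dtheta_def a sum.distrib)
  show "Dtheta d a v (c *s h) = c *s Dtheta d a v h"
    by (simp add: vec_eq_iff Dtheta_def b sum_distrib_left)
qed

text \<open>Euler's identity: the radial direction contributes only the point itself to a tangent
  cone, so one direction independent of \<open>v\<close> carries the rest of the
  information.\<close>

lemma euler_theta: "Dtheta d a v v = of_nat d *s theta_lift d a v"
proof -
  have e: "c * (of_nat k * x ^ (k - 1) * x * z ^ (d - k) + x ^ k * (of_nat (d - k) * z ^ (d - k - 1) * z)) =
     of_nat d * (c * x ^ k * z ^ (d - k))"
    if "k \<le> d" for k and c x z :: complex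
  proof -
    have 1: "of_nat n * x ^ (n - 1) * x = of_nat n * x ^ n" for n and x :: complex by (cases n) auto
    have "c * (of_nat k * x ^ (k - 1) * x * z ^ (d - k) + x ^ k * (of_nat (d - k) * z ^ (d - k - 1) * z)) =
      c * (of_nat k * x ^ k * z ^ (d - k) + x ^ k * (of_nat (d - k) * z ^ (d - k)))"
      by (simp only: 1)
    also have "\<dots> = (of_nat k + of_nat (d - k)) * (c * x ^ k * z ^ (d - k))" by (simp only: algebra_simps)
    also have "of_nat k + of_nat (d - k) = (of_nat d :: complex)"
      using that(1) by (metis le_add_diff_inverse of_nat_add)
    finally show ?thesis .
  qed
  show ?thesis
    unfolding vec_eq_iff Dtheta_def theta_nth vector_smult_component vec_lambda_beta sum_distrib_left
    by (intro allI sum.cong refl e) simp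
qed

lemma theta_cnj: "theta_lift d a (\<chi> i. cnj (v $ i)) = (\<chi> i. cnj (theta_lift d a v $ i))"
  by (simp add: vec_eq_iff theta_nth)

section \<open>Ternary forms\<close>

lemma tfI:
  "F = (\<lambda>v. \<Sum>i\<le>d. \<Sum>j\<le>d - i. c i j * (v $ 1) ^ i * (v $ 2) ^ j * (v $ 3) ^ (d - i - j)) \<Longrightarrow>
    ternary_form d F"
  by (auto simp: ternary_form_def)

lemma tf_zero: "ternary_form d (\<lambda>_. 0)"
  unfolding ternary_form_def by (rule exI[of _ "\<lambda>_ _. 0"]) simp

lemma tf_const: "ternary_form 0 (\<lambda>_. c)"
  unfolding ternary_form_def by (rule exI[of _ "\<lambda>_ _. c"]) simp

lemma tf_add:
  assumes "ternary_form d F" "ternary_form d G"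
  shows "ternary_form d (\<lambda>v. F v + G v)"
proof -
  obtain c e where "F = (\<lambda>v. \<Sum>i\<le>d. \<Sum>j\<le>d - i. c i j * (v $ 1) ^ i * (v $ 2) ^ j * (v $ 3) ^ (d - i - j))"
    "G = (\<lambda>v. \<Sum>i\<le>d. \<Sum>j\<le>d - i. e i j * (v $ 1) ^ i * (v $ 2) ^ j * (v $ 3) ^ (d - i - j))"
    using assms unfolding ternary_form_def by blast
  then show ?thesis unfolding ternary_form_def
    by (intro exI[of _ "\<lambda>i j. c i j + e i j"]) (simp add: sum.distrib distrib_right)
qed

lemma tf_scale:
  assumes "ternary_form d F"
  shows "ternary_form d (\<lambda>v. c * F v)"
proof -
  obtain e where "F = (\<lambda>v. \<Sum>i\<le>d. \<Sum>j\<le>d - i. e i j * (v $ 1) ^ i * (v $ 2) ^ j * (v $ 3) ^ (d - i - j))"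
    using assms unfolding ternary_form_def by blast
  then show ?thesis unfolding ternary_form_def
    by (intro exI[of _ "\<lambda>i j. c * e i j"]) (simp add: sum_distrib_left mult.assoc)
qed

lemma tf_sum:
  assumes "\<And>i. i \<in> I \<Longrightarrow> ternary_form d (F i)"
  shows "ternary_form d (\<lambda>v. \<Sum>i\<in>I. F i v)"
  using assms by (induction I rule: infinite_finite_induct) (auto simp: tf_zero tf_add)

lemma tf_coord:
  assumes "ternary_form d F"
  shows "ternary_form (Suc d) (\<lambda>v. v $ 1 * F v)" "ternary_form (Suc d) (\<lambda>v. v $ 2 * F v)"
    "ternary_form (Suc d) (\<lambda>v. v $ 3 * F v)"
proof -
  obtain c where F: "F = (\<lambda>v. \<Sum>i\<le>d. \<Sum>j\<le>d - i. c i j * (v $ 1) ^ i * (v $ 2) ^ j * (v $ 3) ^ (d - i - j))"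
    using assms unfolding ternary_form_def by blast
  have "(\<lambda>v. v $ 1 * F v) = (\<lambda>v. \<Sum>i\<le>Suc d. \<Sum>j\<le>Suc d - i. (if i = 0 then 0 else c (i - 1) j) *
     (v $ 1) ^ i * (v $ 2) ^ j * (v $ 3) ^ (Suc d - i - j))"
    unfolding F
    by (subst sum.atMost_Suc_shift) (simp add: sum_distrib_left mult_ac)
  then show "ternary_form (Suc d) (\<lambda>v. v $ 1 * F v)" by (rule tfI)
  have "(\<lambda>v. v $ 2 * F v) = (\<lambda>v. \<Sum>i\<le>Suc d. \<Sum>j\<le>Suc d - i. (if j = 0 then 0 else c i (j - 1)) *
     (v $ 1) ^ i * (v $ 2) ^ j * (v $ 3) ^ (Suc d - i - j))"
  proof
    fix v :: "complex ^ 3"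
    have "(\<Sum>j\<le>Suc d - i. (if j = 0 then 0 else c i (j - 1)) * (v $ 1) ^ i * (v $ 2) ^ j * (v $ 3) ^ (Suc d - i - j))
      = v $ 2 * (\<Sum>j\<le>d - i. c i j * (v $ 1) ^ i * (v $ 2) ^ j * (v $ 3) ^ (d - i - j))" if "i \<le> d" for i
      unfolding Suc_diff_le[OF that]
      by (subst sum.atMost_Suc_shift) (simp add: sum_distrib_left mult_ac)
    then show "v $ 2 * F v = (\<Sum>i\<le>Suc d. \<Sum>j\<le>Suc d - i. (if j = 0 then 0 else c i (j - 1)) *
     (v $ 1) ^ i * (v $ 2) ^ j * (v $ 3) ^ (Suc d - i - j))"
      by (simp add: F sum_distrib_left)
  qed
  then show "ternary_form (Suc d) (\<lambda>v. v $ 2 * F v)" by (rule tfI)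
  have "(\<lambda>v. v $ 3 * F v) = (\<lambda>v. \<Sum>i\<le>Suc d. \<Sum>j\<le>Suc d - i. (if i + j \<le> d then c i j else 0) *
     (v $ 1) ^ i * (v $ 2) ^ j * (v $ 3) ^ (Suc d - i - j))"
  proof
    fix v :: "complex ^ 3"
    have "(\<Sum>j\<le>Suc d - i. (if i + j \<le> d then c i j else 0) * (v $ 1) ^ i * (v $ 2) ^ j * (v $ 3) ^ (Suc d - i - j))
      = v $ 3 * (\<Sum>j\<le>d - i. c i j * (v $ 1) ^ i * (v $ 2) ^ j * (v $ 3) ^ (d - i - j))" if "i \<le> d" for i
    proof -
      have "(\<Sum>j\<le>d - i. (if i + j \<le> d then c i j else 0) * (v $ 1) ^ i * (v $ 2) ^ j * (v $ 3) ^ (Suc d - i - j))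
        = (\<Sum>j\<le>d - i. v $ 3 * (c i j * (v $ 1) ^ i * (v $ 2) ^ j * (v $ 3) ^ (d - i - j)))"
      proof (rule sum.cong)
        fix j assume "j \<in> {..d - i}"
        then have "i + j \<le> d" "Suc d - i - j = Suc (d - i - j)" using that by auto
        then show "(if i + j \<le> d then c i j else 0) * (v $ 1) ^ i * (v $ 2) ^ j * (v $ 3) ^ (Suc d - i - j)
          = v $ 3 * (c i j * (v $ 1) ^ i * (v $ 2) ^ j * (v $ 3) ^ (d - i - j))" by simp
      qed simp
      then show ?thesis using that
        by (simp add: Suc_diff_le sum_distrib_left)
    qed
    then show "v $ 3 * F v = (\<Sum>i\<le>Suc d. \<Sum>j\<le>Suc d - i. (if i + j \<le> d then c i j else 0) *
     (v $ 1) ^ i * (v $ 2) ^ j * (v $ 3) ^ (Suc d - i - j))"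
      by (simp add: F sum_distrib_left)
  qed
  then show "ternary_form (Suc d) (\<lambda>v. v $ 3 * F v)" by (rule tfI)
qed

lemma tf_lin_mult:
  assumes "ternary_form d F"
  shows "ternary_form (Suc d) (\<lambda>v. lin m v * F v)"
proof -
  have "ternary_form (Suc d) (\<lambda>v. (m $ 1 * (v $ 1 * F v) + m $ 2 * (v $ 2 * F v)) + m $ 3 * (v $ 3 * F v))"
    by (intro tf_add tf_scale tf_coord assms)
  then show ?thesis by (simp add: lin_3 algebra_simps)
qed

lemma tf_lin: "ternary_form 1 (lin m)"
  using tf_lin_mult[OF tf_const[of 1], of m] by simp

lemma tf_lin2: "ternary_form 2 (\<lambda>v. lin m v * lin n v)"
  using tf_lin_mult[OF tf_lin[of n], of m] by (simp add: numeral_2_eq_2)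

section \<open>Binary quadratic forms\<close>

definition qf :: "'a::comm_ring_1 ^ 3 \<Rightarrow> 'a ^ 2 \<Rightarrow> 'a" where
  "qf k v = k $ 1 * (v $ 1)\<^sup>2 + k $ 2 * (v $ 1 * v $ 2) + k $ 3 * (v $ 2)\<^sup>2"

text \<open>The coefficient of \<open>s ^ n * t ^ (4 - n)\<close> in the product of two quadratic forms.\<close>

definition qm :: "'a::comm_ring_1 ^ 3 \<Rightarrow> 'a ^ 3 \<Rightarrow> nat \<Rightarrow> 'a" where
  "qm p q n = (if n = 0 then p $ 3 * q $ 3 else if n = 1 then p $ 2 * q $ 3 + p $ 3 * q $ 2
     else if n = 2 then p $ 1 * q $ 3 + p $ 2 * q $ 2 + p $ 3 * q $ 1
     else if n = 3 then p $ 1 * q $ 2 + p $ 2 * q $ 1 else p $ 1 * q $ 1)"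

lemma atMost_4: "{..4::nat} = {0, 1, 2, 3, 4}"
  by auto

lemma sum_le_4: "(\<Sum>n\<le>4. f n) = f 0 + f 1 + f 2 + f 3 + f (4::nat)"
  by (simp add: atMost_4 add.assoc)

lemma all_le_4: "(\<forall>n\<le>4. P n) \<longleftrightarrow> P 0 \<and> P 1 \<and> P 2 \<and> P 3 \<and> P (4::nat)"
proof -
  have "(\<forall>n\<le>4. P n) \<longleftrightarrow> (\<forall>n\<in>{..4}. P n)" by auto
  then show ?thesis by (simp add: atMost_4)
qed

lemma qm_simps: "qm p q 0 = p $ 3 * q $ 3" "qm p q 1 = p $ 2 * q $ 3 + p $ 3 * q $ 2"
  "qm p q (Suc 0) = p $ 2 * q $ 3 + p $ 3 * q $ 2"
  "qm p q 2 = p $ 1 * q $ 3 + p $ 2 * q $ 2 + p $ 3 * q $ 1"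
  "qm p q 3 = p $ 1 * q $ 2 + p $ 2 * q $ 1" "qm p q 4 = p $ 1 * q $ 1"
  by (simp_all add: qm_def)

lemma qm_eval: "(\<Sum>n\<le>4. qm p q n * (v $ 1) ^ n * (v $ 2) ^ (4 - n)) = qf p v * qf q v"
  by (simp add: sum_le_4 qm_simps qf_def power_numeral_reduce algebra_simps)

lemma qm_commute: "qm p q = qm q p"
  by (simp add: qm_def fun_eq_iff algebra_simps)

lemma qf_scale: "qf k (c *s v) = c\<^sup>2 * qf k v" "qf (c *s k) v = c * qf k v"
  by (simp_all add: qf_def algebra_simps power2_eq_square)

lemma qm_eq_0:
  fixes p q :: "'a::idom ^ 3"
  assumes "\<forall>n\<le>4. qm p q n = 0"
  shows "p = 0 \<or> q = 0"
proof -
  have e: "p $ 3 * q $ 3 = 0" "p $ 2 * q $ 3 + p $ 3 * q $ 2 = 0"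
    "p $ 1 * q $ 3 + p $ 2 * q $ 2 + p $ 3 * q $ 1 = 0" "p $ 1 * q $ 2 + p $ 2 * q $ 1 = 0"
    "p $ 1 * q $ 1 = 0"
    using assms unfolding all_le_4 qm_simps by blast+
  have "(p $ 1 = 0 \<and> p $ 2 = 0 \<and> p $ 3 = 0) \<or> (q $ 1 = 0 \<and> q $ 2 = 0 \<and> q $ 3 = 0)"
  proof (cases "p $ 1 = 0")
    case True
    show ?thesis
    proof (cases "q $ 1 = 0")
      case q: True
      show ?thesis using e True q by (cases "p $ 2 = 0"; cases "q $ 2 = 0"; auto)
    next
      case False
      then show ?thesis using e True by auto
    qed
  next
    case False
    then show ?thesis using e by auto
  qed
  then show ?thesis by (auto simp: vec_eq_iff forall_3)
qed

lemma quartic_eq_0: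
  fixes h :: "nat \<Rightarrow> complex"
  assumes "\<And>v :: complex ^ 2. (\<Sum>n\<le>4. h n * (v $ 1) ^ n * (v $ 2) ^ (4 - n)) = 0"
  shows "\<forall>n\<le>4. h n = 0"
proof -
  have "\<forall>x. (\<Sum>n\<le>4. h n * x ^ n) = 0"
    using assms[of "vector [x, 1]" for x] by simp
  then show ?thesis by (simp add: polyfun_eq_0)
qed

lemma qf_eq_0:
  fixes k :: "complex ^ 3"
  assumes "\<And>v. qf k v = 0"
  shows "k = 0"
proof -
  have "qf k (vector [1, 0]) = 0" "qf k (vector [0, 1]) = 0" "qf k (vector [1, 1]) = 0"
    by (rule assms)+
  then show ?thesis by (simp add: qf_def vec_eq_iff forall_3)
qed

lemma qf_mult_eq_0:
  fixes p q :: "complex ^ 3"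
  assumes "\<And>v. qf p v * qf q v = 0"
  shows "p = 0 \<or> q = 0"
proof -
  have "\<forall>n\<le>4. qm p q n = 0"
    by (rule quartic_eq_0) (simp add: qm_eval assms)
  then show ?thesis by (rule qm_eq_0)
qed

text \<open>The quadratic form with roots \<open>v\<close> and \<open>w\<close>.\<close>

definition lq :: "'a::comm_ring_1 ^ 2 \<Rightarrow> 'a ^ 2 \<Rightarrow> 'a ^ 3" where
  "lq v w = vector [v $ 2 * w $ 2, - (v $ 1 * w $ 2 + v $ 2 * w $ 1), v $ 1 * w $ 1]"

lemma lq_nth: "lq v w $ 1 = v $ 2 * w $ 2" "lq v w $ 2 = - (v $ 1 * w $ 2 + v $ 2 * w $ 1)"
  "lq v w $ 3 = v $ 1 * w $ 1"
  by (simp_all add: lq_def)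

lemma qf_lq: "qf (lq v w) u = det2 v u * det2 w u"
  by (simp add: qf_def lq_nth det2_def power2_eq_square algebra_simps)

lemma lq_commute: "lq v w = lq w v"
  by (rule vec3_eqI) (simp_all add: lq_nth algebra_simps)

lemma lq_nonzero:
  fixes v w :: "'a::idom ^ 2"
  assumes "v \<noteq> 0" "w \<noteq> 0" shows "lq v w \<noteq> 0"
proof
  assume "lq v w = 0"
  then have "v $ 2 * w $ 2 = 0" "v $ 1 * w $ 2 + v $ 2 * w $ 1 = 0" "v $ 1 * w $ 1 = 0"
    using lq_nth[of v w] by (simp, metis neg_0_equal_iff_equal zero_index, simp)
  with assms show False by (auto simp: vec_eq_iff forall_2)
qed

text \<open>The quadratic formula; a vanishing leading coefficient puts one root at
  \<open>[1:0]\<close>.\<close>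

lemma qf_factor:
  fixes k :: "complex ^ 3"
  assumes "k \<noteq> 0"
  obtains v w where "v \<noteq> 0" "w \<noteq> 0" "k = lq v w"
proof (cases "k $ 1 = 0")
  case True
  have "vector [k $ 3, - k $ 2] \<noteq> (0 :: complex ^ 2)" "vector [1, 0] \<noteq> (0 :: complex ^ 2)"
    using assms True by (auto simp: vec_eq_iff forall_2 forall_3)
  moreover have "k = lq (vector [k $ 3, - k $ 2]) (vector [1, 0])"
    by (rule vec3_eqI) (simp_all add: lq_nth True)
  ultimately show ?thesis by (rule that)
next
  case False
  define s where "s = csqrt ((k $ 2)\<^sup>2 - 4 * k $ 1 * k $ 3)"
  have s: "s * s = (k $ 2)\<^sup>2 - 4 * k $ 1 * k $ 3"
    by (simp add: s_def flip: power2_eq_square)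
  define v :: "complex ^ 2" where "v = vector [(- k $ 2 + s) / 2, k $ 1]"
  define w :: "complex ^ 2" where "w = vector [(- k $ 2 - s) / (2 * k $ 1), 1]"
  have "v \<noteq> 0" "w \<noteq> 0" using False by (auto simp: v_def w_def vec_eq_iff forall_2)
  moreover have "k = lq v w"
    by (rule vec3_eqI) (use False s in \<open>simp_all add: lq_nth v_def w_def field_simps power2_eq_square\<close>)
  ultimately show ?thesis by (rule that)
qed

lemma qf_root:
  fixes k :: "complex ^ 3"
  shows "\<exists>v. v \<noteq> 0 \<and> qf k v = 0"
proof (cases "k = 0")
  case True
  then show ?thesis by (intro exI[of _ "vector [1, 0]"]) (simp add: qf_def vec_eq_iff forall_2)
next
  case False
  then obtain v w where "v \<noteq> 0" "k = lq v w" using qf_factor by metis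
  then show ?thesis by (intro exI[of _ v]) (simp add: qf_lq det2_def)
qed

section \<open>Apolarity\<close>

text \<open>A functional on quartic forms is given by its values \<open>l 0, \<dots>, l 4\<close> on the monomials
  \<open>s ^ n * t ^ (4 - n)\<close>. The functionals \<open>ann a\<close> annihilate the three components of the
  parametrization; those of the shape \<open>\<alpha> ev v + \<beta> ev w\<close> correspond to pairs of points with
  the same image, and they are characterized by annihilating all multiples of the quadratic form
  \<open>k\<close> with roots \<open>v\<close> and \<open>w\<close>, i.e. by the Hankel matrix of \<open>l\<close> being singular with
  kernel \<open>k\<close>.\<close>

definition ev :: "complex ^ 2 \<Rightarrow> nat \<Rightarrow> complex" where
  "ev v n = (v $ 1) ^ n * (v $ 2) ^ (4 - n)"

definition pr :: "(nat \<Rightarrow> complex) \<Rightarrow> (nat \<Rightarrow> complex) \<Rightarrow> complex" where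
  "pr l h = (\<Sum>n\<le>4. l n * h n)"

definition prow :: "(nat \<Rightarrow> real ^ 3) \<Rightarrow> complex ^ 3 \<Rightarrow> nat \<Rightarrow> complex" where
  "prow a m n = lin m (cvec (a n))"

definition ann :: "(nat \<Rightarrow> real ^ 3) \<Rightarrow> (nat \<Rightarrow> complex) \<Rightarrow> bool" where
  "ann a l \<longleftrightarrow> (\<forall>m. pr l (prow a m) = 0)"

text \<open>\<open>W\<close> is the space of pullbacks of linear forms of the plane, that is, the
  span of the three components. Entries beyond index 4 are ignored, here as in \<open>nz\<close> and
  \<open>indep2\<close>.\<close>

definition inW :: "(nat \<Rightarrow> real ^ 3) \<Rightarrow> (nat \<Rightarrow> complex) \<Rightarrow> bool" where
  "inW a h \<longleftrightarrow> (\<exists>m. \<forall>n\<le>4. h n = prow a m n)"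

text \<open>The three equations say that \<open>l\<close> vanishes on \<open>k\<close> times t^2, s
  t and s^2. The coefficient \<open>k $ 3\<close> comes first because it belongs to t^2, whereas
  \<open>l n\<close> is the value on the monomial with s-exponent \<open>n\<close>.\<close>

definition qker :: "complex ^ 3 \<Rightarrow> (nat \<Rightarrow> complex) \<Rightarrow> bool" where
  "qker k l \<longleftrightarrow> k $ 3 * l 0 + k $ 2 * l 1 + k $ 1 * l 2 = 0 \<and>
     k $ 3 * l 1 + k $ 2 * l 2 + k $ 1 * l 3 = 0 \<and> k $ 3 * l 2 + k $ 2 * l 3 + k $ 1 * l 4 = 0"

definition nz :: "(nat \<Rightarrow> complex) \<Rightarrow> bool" where
  "nz l \<longleftrightarrow> (\<exists>n\<le>4. l n \<noteq> 0)"

definition indep2 :: "(nat \<Rightarrow> complex) \<Rightarrow> (nat \<Rightarrow> complex) \<Rightarrow> bool" where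
  "indep2 l l' \<longleftrightarrow> (\<forall>x y. (\<forall>n\<le>4. x * l n + y * l' n = 0) \<longrightarrow> x = 0 \<and> y = 0)"

text \<open>The determinant of the 3 x 3 Hankel matrix with entries \<open>l (i + j)\<close>, the
  catalecticant of \<open>l\<close>.\<close>

definition hdet :: "(nat \<Rightarrow> complex) \<Rightarrow> complex" where
  "hdet l = l 0 * (l 2 * l 4 - l 3 * l 3) - l 1 * (l 1 * l 4 - l 2 * l 3) + l 2 * (l 1 * l 3 - l 2 * l 2)"

lemma pr_simps: "pr l h = l 0 * h 0 + l 1 * h 1 + l 2 * h 2 + l 3 * h 3 + l 4 * h 4"
  by (simp add: pr_def sum_le_4)

lemma pr_cong: "(\<And>n. n \<le> 4 \<Longrightarrow> l n = l' n) \<Longrightarrow> (\<And>n. n \<le> 4 \<Longrightarrow> h n = h' n) \<Longrightarrow> pr l h = pr l' h'"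
  by (simp add: pr_def)

lemma qkerD: "qker k l \<Longrightarrow> n < 3 \<Longrightarrow> k $ 3 * l n + k $ 2 * l (Suc n) + k $ 1 * l (Suc (Suc n)) = 0"
proof -
  assume k: "qker k l" and "n < 3"
  then consider "n = 0" | "n = 1" | "n = 2" by linarith
  then show ?thesis using k by cases (auto simp: qker_def eval_nat_numeral)
qed

lemma pr_qker: assumes "qker k l" shows "pr l (qm k q) = 0"
proof -
  have "pr l (qm k q) = q $ 3 * (k $ 3 * l 0 + k $ 2 * l 1 + k $ 1 * l 2) +
    q $ 2 * (k $ 3 * l 1 + k $ 2 * l 2 + k $ 1 * l 3) + q $ 1 * (k $ 3 * l 2 + k $ 2 * l 3 + k $ 1 * l 4)"
    by (simp add: pr_simps qm_simps algebra_simps)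
  also have "\<dots> = 0" using assms unfolding qker_def by (metis add_0 mult_zero_right)
  finally show ?thesis .
qed

lemma lin_theta: "lin m (lift4 a v) = pr (ev v) (prow a m)"
  by (simp add: lin_3 pr_simps ev_def prow_def theta_nth sum_le_4 algebra_simps)

lemma lin_theta': "lin m (lift4 a v) = (\<Sum>n\<le>4. prow a m n * (v $ 1) ^ n * (v $ 2) ^ (4 - n))"
  by (simp add: lin_theta pr_def ev_def algebra_simps)

lemma lin_axis: "lin (axis i 1) y = y $ i"
  using exhaust_3[of i] by (auto simp: lin_3 axis_def)

lemma lin_all_eqI: "(\<And>m. lin m y = lin m z) \<Longrightarrow> y = z"
  by (metis lin_axis vec_eq_iff)

lemma pr_ev: "pr (\<lambda>n. x * ev v n + y * ev w n) (prow a m) = lin m (x *s lift4 a v + y *s lift4 a w)"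
  by (simp add: lin_add lin_scale lin_theta pr_simps algebra_simps)

lemma ann_ev_iff:
  assumes "\<And>n. n \<le> 4 \<Longrightarrow> l n = x * ev v n + y * ev w n"
  shows "ann a l \<longleftrightarrow> x *s lift4 a v + y *s lift4 a w = 0"
proof -
  have e: "pr l (prow a m) = lin m (x *s lift4 a v + y *s lift4 a w)" for m
  proof -
    have "pr l (prow a m) = pr (\<lambda>n. x * ev v n + y * ev w n) (prow a m)"
      using assms by (rule pr_cong) simp_all
    then show ?thesis by (simp only: pr_ev)
  qed
  show ?thesis
  proof
    assume "ann a l"
    then show "x *s lift4 a v + y *s lift4 a w = 0"
      by (intro lin_all_eqI) (simp only: ann_def e[symmetric] lin_zero)
  next
    assume "x *s lift4 a v + y *s lift4 a w = 0"
    then show "ann a l" by (simp only: ann_def e lin_zero simp_thms)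
  qed
qed

lemma qker_ev: "qker (lq v w) (\<lambda>n. x * ev v n + y * ev w n)"
  by (simp add: qker_def lq_nth ev_def power_numeral_reduce algebra_simps)

text \<open>A functional vanishing on the multiples of the linear form with root \<open>v\<close> is a multiple
  of the evaluation at \<open>v\<close>.\<close>

lemma geometric:
  fixes v :: "complex ^ 2"
  assumes "v \<noteq> 0" "\<And>n. n < N \<Longrightarrow> v $ 1 * f n = v $ 2 * f (Suc n)"
  shows "\<exists>x. \<forall>n\<le>N. f n = x * ((v $ 1) ^ n * (v $ 2) ^ (N - n))"
proof (cases "v $ 2 = 0")
  case True
  with assms(1) have v: "v $ 1 \<noteq> 0" by (auto simp: vec_eq_iff forall_2)
  have "f n = 0" if "n < N" for n using assms(2)[OF that] True v by simp
  then have "\<forall>n\<le>N. f n = f N / (v $ 1) ^ N * ((v $ 1) ^ n * (v $ 2) ^ (N - n))"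
    using True v by (auto simp: le_less)
  then show ?thesis by blast
next
  case False
  have "f n = f 0 / (v $ 2) ^ N * ((v $ 1) ^ n * (v $ 2) ^ (N - n))" if "n \<le> N" for n
    using that
  proof (induction n)
    case (Suc n)
    have "N - n = Suc (N - Suc n)" using Suc.prems by simp
    have "f (Suc n) = v $ 1 * f n / v $ 2" using assms(2)[of n] Suc.prems False by simp
    also have "f n = f 0 / (v $ 2) ^ N * ((v $ 1) ^ n * (v $ 2) ^ (N - n))" using Suc by simp
    finally show ?case using \<open>N - n = Suc (N - Suc n)\<close> False by simp
  qed (use False in simp)
  then show ?thesis by blast
qed

text \<open>\<open>qker\<close> is a second order linear recurrence whose characteristic roots are
  the two points. Factoring out either root leaves a first order recurrence, so \<open>f\<close> and
  \<open>g\<close> are geometric sequences, and \<open>l\<close> is recovered from them by dividing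
  by \<open>det2 v w\<close>.\<close>

lemma qker_two_points:
  assumes k: "qker (lq v w) l" and d: "det2 v w \<noteq> 0"
  shows "\<exists>x y. \<forall>n\<le>4. l n = x * ev v n + y * ev w n"
proof -
  have nz: "v \<noteq> 0" "w \<noteq> 0" using d by (auto simp: det2_def)
  define f where "f n = w $ 1 * l n - w $ 2 * l (Suc n)" for n
  define g where "g n = v $ 1 * l n - v $ 2 * l (Suc n)" for n
  have "v $ 1 * f n = v $ 2 * f (Suc n)" "w $ 1 * g n = w $ 2 * g (Suc n)" if "n < 3" for n
  proof -
    have "v $ 1 * f n - v $ 2 * f (Suc n) = lq v w $ 3 * l n + lq v w $ 2 * l (Suc n) + lq v w $ 1 * l (Suc (Suc n))"
     "w $ 1 * g n - w $ 2 * g (Suc n) = lq v w $ 3 * l n + lq v w $ 2 * l (Suc n) + lq v w $ 1 * l (Suc (Suc n))"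
      by (simp_all add: lq_nth f_def g_def algebra_simps)
    then show "v $ 1 * f n = v $ 2 * f (Suc n)" "w $ 1 * g n = w $ 2 * g (Suc n)"
      using qkerD[OF k that] by simp_all
  qed
  then obtain x y where x: "\<forall>n\<le>3. f n = x * ((v $ 1) ^ n * (v $ 2) ^ (3 - n))"
    and y: "\<forall>n\<le>3. g n = y * ((w $ 1) ^ n * (w $ 2) ^ (3 - n))"
    using geometric[OF nz(1), of 3 f] geometric[OF nz(2), of 3 g] by blast
  \<comment> \<open>The sequences \<open>f\<close> and \<open>g\<close> are controlled up to index 3
    only, so \<open>l 4\<close> is recovered from their values at 3 by another combination than the
    earlier entries.\<close>
  have "l n = (- x / det2 v w) * ev v n + (y / det2 v w) * ev w n" if "n \<le> 4" for n
  proof (cases "n = 4")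
    case True
    have "det2 v w * l 4 = w $ 1 * g 3 - v $ 1 * f 3"
      by (simp add: det2_def f_def g_def algebra_simps)
    also have "\<dots> = - x * ev v 4 + y * ev w 4"
      using x y by (simp add: ev_def power_numeral_reduce)
    finally show ?thesis using d True by (simp add: field_simps)
  next
    case False
    with that have n: "n \<le> 3" "4 - n = Suc (3 - n)" by auto
    have "det2 v w * l n = w $ 2 * g n - v $ 2 * f n"
      by (simp add: det2_def f_def g_def algebra_simps)
    also have "\<dots> = - x * ev v n + y * ev w n"
      using x y n by (simp add: ev_def)
    finally show ?thesis using d by (simp add: field_simps)
  qed
  then show ?thesis by blast
qed

text \<open>The confluent case of the recurrence: with a double root its solutions are spanned by
  the evaluation at \<open>v\<close> and the derivative at \<open>v\<close> in a transversal
  direction \<open>w\<close>.\<close>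

lemma qker_one_point:
  assumes k: "qker (lq v v) l" and d: "det2 v w = 1"
  shows "\<exists>x y. (\<forall>m. pr l (prow a m) = lin m (x *s Dtheta 4 a v w + y *s lift4 a v)) \<and>
    (x = 0 \<and> y = 0 \<longrightarrow> (\<forall>n\<le>4. l n = 0))"
proof -
  have nz: "v \<noteq> 0" using d by (auto simp: det2_def)
  define g where "g n = v $ 1 * l n - v $ 2 * l (Suc n)" for n
  have "v $ 1 * g n = v $ 2 * g (Suc n)" if "n < 3" for n
  proof -
    have "v $ 1 * g n - v $ 2 * g (Suc n) = lq v v $ 3 * l n + lq v v $ 2 * l (Suc n) + lq v v $ 1 * l (Suc (Suc n))"
      by (simp add: lq_nth g_def algebra_simps)
    then show ?thesis using qkerD[OF k that] by simp
  qed
  then obtain x where x: "\<forall>n\<le>3. g n = x * ((v $ 1) ^ n * (v $ 2) ^ (3 - n))"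
    using geometric[OF nz(1), of 3 g] by blast
  \<comment> \<open>\<open>e\<close> is the functional taking the derivative at \<open>v\<close> in
    direction \<open>w\<close>. Its first order difference is the geometric sequence with factor
    \<open>det2 v w\<close>, which is 1, so subtracting \<open>x * e n\<close> leaves a multiple of
    the evaluation at \<open>v\<close>.\<close>
  define e where "e n = of_nat n * (v $ 1) ^ (n - 1) * w $ 1 * (v $ 2) ^ (4 - n) +
      (v $ 1) ^ n * (of_nat (4 - n) * (v $ 2) ^ (4 - n - 1) * w $ 2)" for n
  define h where "h n = l n - x * e n" for n
  have e: "v $ 1 * e n - v $ 2 * e (Suc n) = det2 v w * ((v $ 1) ^ n * (v $ 2) ^ (3 - n))" if "n < 4" for n
  proof -
    consider "n = 0" | "n = 1" | "n = 2" | "n = 3" using \<open>n < 4\<close> by linarith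
    then show ?thesis
      by cases (simp_all add: e_def det2_def eval_nat_numeral, (simp add: algebra_simps)+)
  qed
  have "v $ 1 * h n = v $ 2 * h (Suc n)" if "n < 4" for n
  proof -
    have "v $ 1 * h n - v $ 2 * h (Suc n) = g n - x * (v $ 1 * e n - v $ 2 * e (Suc n))"
      by (simp add: h_def g_def algebra_simps)
    also have "\<dots> = 0" using e[OF that] x that d by simp
    finally show ?thesis by simp
  qed
  then obtain y where y: "\<forall>n\<le>4. h n = y * ((v $ 1) ^ n * (v $ 2) ^ (4 - n))"
    using geometric[OF nz(1), of 4 h] by blast
  have le: "l n = x * e n + y * ev v n" if "n \<le> 4" for n
    using y that by (simp add: h_def ev_def algebra_simps)
  have "pr l (prow a m) = lin m (x *s Dtheta 4 a v w + y *s lift4 a v)" for m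
  proof -
    have "pr l (prow a m) = pr (\<lambda>n. x * e n + y * ev v n) (prow a m)"
      using le by (rule pr_cong) simp_all
    also have "\<dots> = x * pr e (prow a m) + y * pr (ev v) (prow a m)"
      by (simp add: pr_simps algebra_simps)
    also have "pr e (prow a m) = lin m (Dtheta 4 a v w)"
      by (simp add: pr_simps e_def prow_def lin_3 Dtheta_def sum_le_4 algebra_simps)
    finally show ?thesis by (simp add: lin_add lin_scale lin_theta)
  qed
  moreover have "x = 0 \<and> y = 0 \<longrightarrow> (\<forall>n\<le>4. l n = 0)" using le by simp
  ultimately show ?thesis by blast
qed

section \<open>The pencil of functionals annihilating the parametrization\<close>

text \<open>A basis of the annihilator of \<open>W\<close>, which has dimension 5 - 3 = 2; the last
  clause is the double annihilator property, by which conclusions about functionals return to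
  \<open>W\<close>.\<close>

definition pencil :: "(nat \<Rightarrow> real ^ 3) \<Rightarrow> (nat \<Rightarrow> complex) \<Rightarrow> (nat \<Rightarrow> complex) \<Rightarrow> bool" where
  "pencil a u w \<longleftrightarrow> ann a u \<and> ann a w \<and> indep2 u w \<and>
     (\<forall>l. ann a l \<longrightarrow> (\<exists>x y. \<forall>n\<le>4. l n = x * u n + y * w n)) \<and>
     (\<forall>h. pr u h = 0 \<and> pr w h = 0 \<longrightarrow> inW a h)"

lemma exhaust_5: "i = 1 \<or> i = 2 \<or> i = 3 \<or> i = 4 \<or> i = (0 :: 5)"
proof (induct i)
  case (of_int z)
  then have "0 \<le> z" "z < 5" by simp_all
  then have "z = 0 \<or> z = 1 \<or> z = 2 \<or> z = 3 \<or> z = 4" by arith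
  then show ?case by auto
qed

lemma UNIV_5: "UNIV = {0, 1, 2, 3, 4 :: 5}"
  using exhaust_5 by auto

lemma sum_5: "sum f (UNIV :: 5 set) = f 0 + f 1 + f 2 + f 3 + f 4"
  unfolding UNIV_5 by (simp add: add.assoc)

text \<open>The passage to vectors of length 5 makes bases and matrix inverses available. In the
  index type the numeral 5 equals 0, so 0 to 4 enumerate all indices.\<close>

definition to5 :: "(nat \<Rightarrow> complex) \<Rightarrow> complex ^ 5" where
  "to5 h = (\<chi> i. if i = 0 then h 0 else if i = 1 then h 1 else if i = 2 then h 2
     else if i = 3 then h 3 else h 4)"

definition from5 :: "complex ^ 5 \<Rightarrow> nat \<Rightarrow> complex" where
  "from5 x n = x $ of_nat n"

lemma to5_nth: "to5 h $ 0 = h 0" "to5 h $ 1 = h 1" "to5 h $ 2 = h 2" "to5 h $ 3 = h 3" "to5 h $ 4 = h 4"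
  by (simp_all add: to5_def)

lemma from5_to5: "n \<le> 4 \<Longrightarrow> from5 (to5 h) n = h n"
proof -
  have "\<forall>n\<le>4. from5 (to5 h) n = h n"
    unfolding all_le_4 by (simp add: from5_def to5_nth)
  then show "n \<le> 4 \<Longrightarrow> from5 (to5 h) n = h n" by blast
qed

lemma pr_dot: "pr (from5 x) h = (\<Sum>i\<in>UNIV. x $ i * to5 h $ i)"
  by (simp add: pr_simps sum_5 from5_def to5_nth)

lemma prow_add: "prow a (m + m') n = prow a m n + prow a m' n"
  and prow_scale: "prow a (c *s m) n = c * prow a m n"
  by (simp_all add: prow_def lin_add lin_scale)

lemma prow_axis: "prow a m n = (\<Sum>i\<in>UNIV. m $ i * prow a (axis i 1) n)"
  by (simp add: prow_def lin_3 sum_3 axis_def)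

lemma pr_prow_axis: "pr l (prow a m) = (\<Sum>i\<in>UNIV. m $ i * pr l (prow a (axis i 1)))"
  by (simp add: pr_simps sum_3 prow_axis[of a m] algebra_simps)

text \<open>The three coefficient rows of the parametrization are completed to a basis
  \<open>B\<close> of the 5-dimensional space. The inverse \<open>T\<close> of the matrix
  \<open>N\<close> of basis vectors contains the dual basis in its columns; the two columns dual to
  the added vectors span the annihilator.\<close>

lemma pencil_exists:
  assumes ind: "\<And>m. m \<noteq> 0 \<Longrightarrow> \<exists>n\<le>4. prow a m n \<noteq> 0"
  shows "\<exists>u w. pencil a u w"
proof -
  define r where "r i = to5 (prow a (axis i 1))" for i :: 3
  define S where "S = range r"
  have to5_sum: "(\<Sum>i\<in>UNIV. m $ i *s r i) = to5 (prow a m)" for m :: "complex ^ 3"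
    by (simp add: vec_eq_iff r_def to5_def prow_axis[of a m])
  have zero: "m = 0" if "to5 (prow a m) = 0" for m
  proof (rule ccontr)
    assume "m \<noteq> 0"
    then obtain n where "n \<le> 4" "prow a m n \<noteq> 0" using ind by blast
    then show False using from5_to5[of n "prow a m"] that by (simp add: from5_def)
  qed
  have inj: "inj r"
  proof (rule injI)
    fix i j assume "r i = r j"
    have "to5 (prow a (axis i 1 - axis j 1)) = (\<Sum>k\<in>UNIV. (axis i 1 - axis j 1) $ k *s r k)"
      by (simp only: to5_sum)
    also have "\<dots> = (\<Sum>k\<in>UNIV. (if k = i then r k else 0)) - (\<Sum>k\<in>UNIV. (if k = j then r k else 0))"
      unfolding sum_subtractf[symmetric] by (rule sum.cong) (auto simp: axis_def)
    also have "\<dots> = r i - r j" by (simp add: sum.delta)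
    also have "\<dots> = 0" using \<open>r i = r j\<close> by simp
    finally have "axis i 1 - axis j 1 = (0 :: complex ^ 3)" by (rule zero)
    then show "i = j" by (simp add: axis_eq_axis)
  qed
  have fS: "finite S" and cS: "card S = 3"
    using inj by (auto simp: S_def card_image)
  have indS: "vec.independent S"
  proof
    assume "vec.dependent S"
    then obtain c x where cx: "x \<in> S" "c x \<noteq> 0" "(\<Sum>v\<in>S. c v *s v) = 0"
      using vec.dependent_finite[OF fS] by auto
    have "(\<Sum>v\<in>S. c v *s v) = (\<Sum>i\<in>UNIV. (\<chi> i. c (r i)) $ i *s r i)"
      unfolding S_def using inj by (subst sum.reindex) auto
    with cx(3) have "(\<chi> i. c (r i)) = 0" using zero to5_sum by metis
    then have "c (r i) = 0" for i by (simp add: vec_eq_iff)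
    with cx show False by (auto simp: S_def)
  qed
  define B where "B = vec.extend_basis S"
  have SB: "S \<subseteq> B" and indB: "vec.independent B" and spB: "vec.span B = UNIV"
    unfolding B_def using vec.extend_basis_superset[OF indS] vec.independent_extend_basis[OF indS]
      vec.span_extend_basis[OF indS] by auto
  have finB: "finite B" using indB by (rule vec.finiteI_independent)
  have cB: "card B = 5"
    using vec.dim_span_eq_card_independent[OF indB] spB by (simp add: card_cart_basis)
  obtain f where f: "bij_betw f (UNIV :: 5 set) B"
    using finite_same_card_bij[of "UNIV :: 5 set" B] finB cB by auto
  define N :: "complex ^ 5 ^ 5" where "N = (\<chi> i. f i)"
  have "rows N = B"
    using f by (auto simp: rows_def row_def N_def bij_betw_def vec_lambda_eta)
  then obtain T where T: "T ** N = mat 1"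
    using matrix_left_invertible_span_rows_gen[of N] spB by auto
  then have T': "N ** T = mat 1" by (simp add: matrix_left_right_inverse)
  define R where "R = {i. f i \<notin> S}"
  have "card R = 2"
  proof -
    have "bij_betw f R (B - S)"
      using f unfolding R_def bij_betw_def by (auto simp: inj_on_def)
    then have "card R = card (B - S)" by (rule bij_betw_same_card)
    also have "\<dots> = 2" using SB fS cS cB by (simp add: card_Diff_subset)
    finally show ?thesis .
  qed
  then obtain r1 r2 where R: "R = {r1, r2}" and r12: "r1 \<noteq> r2" by (auto simp: card_2_iff)
  define col where "col j = (\<chi> i. T $ i $ j)" for j
  have NT: "(\<Sum>i\<in>UNIV. f j $ i * col l $ i) = of_bool (j = l)" for j l
    using T' by (auto simp: vec_eq_iff matrix_matrix_mult_def N_def col_def mat_def)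
  have annR: "ann a (from5 (col j))" if "j \<in> R" for j
  proof -
    have *: "pr (from5 (col j)) (prow a (axis i 1)) = 0" for i
    proof -
      have "r i \<in> B" using SB by (auto simp: S_def)
      then obtain k where k: "f k = r i" using f by (metis bij_betw_def imageE)
      then have "k \<noteq> j" using that by (auto simp: R_def S_def)
      then show ?thesis using NT[of k j]
        by (simp add: pr_dot k r_def mult.commute)
    qed
    have "pr (from5 (col j)) (prow a m) = 0" for m
      by (subst pr_prow_axis) (simp add: *)
    then show ?thesis by (simp add: ann_def)
  qed
  have sum2: "(\<Sum>j\<in>UNIV. g j *s e j) = g r1 *s e r1 + g r2 *s e r2" if "\<And>j. j \<notin> R \<Longrightarrow> g j = 0" for g :: "5 \<Rightarrow> complex" and e :: "5 \<Rightarrow> complex ^ 5"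
  proof -
    have "(\<Sum>j\<in>UNIV. g j *s e j) = (\<Sum>j\<in>R. g j *s e j)"
      by (rule sum.mono_neutral_right) (use that in auto)
    then show ?thesis by (simp add: R r12)
  qed
  have span: "\<exists>x y. \<forall>n\<le>4. l n = x * from5 (col r1) n + y * from5 (col r2) n" if "ann a l" for l
  proof -
    define g where "g j = (N *v to5 l) $ j" for j
    have g0: "g j = 0" if "j \<notin> R" for j
    proof -
      obtain i where i: "f j = r i" using \<open>j \<notin> R\<close> by (auto simp: R_def S_def)
      have "g j = (\<Sum>k\<in>UNIV. f j $ k * to5 l $ k)" by (simp add: g_def matrix_vector_mult_def N_def)
      also have "\<dots> = pr l (prow a (axis i 1))"
        by (simp add: i r_def sum_5 pr_simps to5_nth mult.commute)
      also have "\<dots> = 0" using \<open>ann a l\<close> by (simp add: ann_def)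
      finally show ?thesis .
    qed
    have "to5 l = T *v (N *v to5 l)" by (simp add: matrix_vector_mul_assoc T)
    also have "\<dots> = (\<Sum>j\<in>UNIV. g j *s col j)"
      by (simp add: vec_eq_iff matrix_vector_mult_def g_def col_def mult.commute)
    also have "\<dots> = g r1 *s col r1 + g r2 *s col r2" by (rule sum2) (rule g0)
    finally have e: "to5 l = g r1 *s col r1 + g r2 *s col r2" .
    have "l n = g r1 * from5 (col r1) n + g r2 * from5 (col r2) n" if "n \<le> 4" for n
      using from5_to5[OF that, of l] unfolding e by (simp add: from5_def)
    then show ?thesis by blast
  qed
  have dbl: "inW a h" if "pr (from5 (col r1)) h = 0" "pr (from5 (col r2)) h = 0" for h
  proof -
    define g where "g j = (\<Sum>i\<in>UNIV. col j $ i * to5 h $ i)" for j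
    \<comment> \<open>Expansion of \<open>h\<close> in the rows of \<open>N\<close>: the coefficient
      of row \<open>j\<close> is the pairing of \<open>h\<close> with column \<open>j\<close> of
      \<open>T\<close>. It vanishes for the two rows outside \<open>S\<close>, so only rows of the
      parametrization remain.\<close>
    have "to5 h = to5 h v* (T ** N)" by (simp add: T)
    also have "\<dots> = (to5 h v* T) v* N" by (simp add: vector_matrix_mul_assoc)
    also have "\<dots> = (\<Sum>j\<in>UNIV. g j *s f j)"
      by (simp add: vec_eq_iff vector_matrix_mult_def g_def col_def N_def mult.commute)
    also have "\<dots> \<in> vec.span S"
    proof (rule vec.span_sum)
      fix j
      show "g j *s f j \<in> vec.span S"
      proof (cases "j \<in> R")
        case True
        then have "g j = 0" using that by (auto simp: R g_def pr_dot)
        then show ?thesis by (simp add: vec.span_zero)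
      next
        case False
        then show ?thesis by (intro vec.span_scale vec.span_base) (simp add: R_def)
      qed
    qed
    also have "vec.span S \<subseteq> {to5 (prow a m) | m. True}"
    proof (rule vec.span_minimal)
      show "S \<subseteq> {to5 (prow a m) | m. True}" by (auto simp: S_def r_def)
      show "vec.subspace {to5 (prow a m) | m. True}"
      proof (rule vec.subspaceI)
        have "0 = to5 (prow a 0)" by (simp add: vec_eq_iff to5_def prow_def lin_zero)
        then show "0 \<in> {to5 (prow a m) | m. True}" by blast
      next
        fix x y assume "x \<in> {to5 (prow a m) | m. True}" "y \<in> {to5 (prow a m) | m. True}"
        then obtain m m' where "x = to5 (prow a m)" "y = to5 (prow a m')" by blast
        then have "x + y = to5 (prow a (m + m'))" by (simp add: vec_eq_iff to5_def prow_add)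
        then show "x + y \<in> {to5 (prow a m) | m. True}" by blast
      next
        fix c x assume "x \<in> {to5 (prow a m) | m. True}"
        then obtain m where "x = to5 (prow a m)" by blast
        then have "c *s x = to5 (prow a (c *s m))" by (simp add: vec_eq_iff to5_def prow_scale)
        then show "c *s x \<in> {to5 (prow a m) | m. True}" by blast
      qed
    qed
    finally obtain m where m: "to5 h = to5 (prow a m)" by blast
    have "h n = prow a m n" if "n \<le> 4" for n
      using from5_to5[OF that, of h] from5_to5[OF that, of "prow a m"] m by simp
    then show ?thesis unfolding inW_def by blast
  qed
  have "indep2 (from5 (col r1)) (from5 (col r2))"
    unfolding indep2_def
  proof (intro allI impI)
    fix x y assume e: "\<forall>n\<le>4. x * from5 (col r1) n + y * from5 (col r2) n = 0"
    have z: "x * col r1 $ i + y * col r2 $ i = 0" for i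
    proof -
      have "x * col r1 $ of_nat n + y * col r2 $ of_nat n = 0" if "n \<le> 4" for n
        using e that by (simp add: from5_def)
      from this[of 0] this[of 1] this[of 2] this[of 3] this[of 4]
      show ?thesis using exhaust_5[of i] by (elim disjE) simp_all
    qed
    have "x * of_bool (j = r1) + y * of_bool (j = r2) = 0" for j
    proof -
      have "x * of_bool (j = r1) + y * of_bool (j = r2) =
        (\<Sum>i\<in>UNIV. f j $ i * (x * col r1 $ i + y * col r2 $ i))"
        by (simp add: NT[symmetric] sum_distrib_left sum.distrib[symmetric] algebra_simps)
      then show ?thesis by (simp add: z)
    qed
    from this[of r1] this[of r2] show "x = 0 \<and> y = 0" using r12 by auto
  qed
  then show ?thesis unfolding pencil_def using annR span dbl R by blast
qed

lemma pencilD: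
  assumes "pencil a u w"
  shows "ann a u" "ann a w" "indep2 u w" "ann a l \<Longrightarrow> \<exists>x y. \<forall>n\<le>4. l n = x * u n + y * w n"
    "pr u h = 0 \<Longrightarrow> pr w h = 0 \<Longrightarrow> inW a h"
  using assms by (simp_all add: pencil_def)

text \<open>Cramer's rule with determinant \<open>d\<close> expresses the old basis of the
  annihilator through the new one.\<close>

lemma pencil_of_indep:
  assumes p: "pencil a u w" and l: "ann a l" "ann a l'" and i: "indep2 l l'"
  shows "pencil a l l'"
proof -
  obtain x y where xy: "\<And>n. n \<le> 4 \<Longrightarrow> l n = x * u n + y * w n" using pencilD(4)[OF p l(1)] by blast
  obtain x' y' where xy': "\<And>n. n \<le> 4 \<Longrightarrow> l' n = x' * u n + y' * w n" using pencilD(4)[OF p l(2)] by blast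
  define d where "d = x * y' - x' * y"
  have du: "d * u n = y' * l n - y * l' n" and dw: "d * w n = x * l' n - x' * l n" if "n \<le> 4" for n
    using xy[OF that] xy'[OF that] by (simp_all add: d_def algebra_simps)
  have "d \<noteq> 0"
  proof
    assume "d = 0"
    then have "\<forall>n\<le>4. y' * l n + (- y) * l' n = 0" "\<forall>n\<le>4. (- x') * l n + x * l' n = 0"
      using du dw by (simp_all add: algebra_simps)
    then have "y' = 0" "x = 0" "- y = 0" "- x' = 0" using i unfolding indep2_def by blast+
    then have "\<forall>n\<le>4. 1 * l n + 0 * l' n = 0" using xy by simp
    then show False using i unfolding indep2_def by (metis zero_neq_one)
  qed
  then have u: "u n = y' / d * l n + (- y / d) * l' n" and w: "w n = (- x' / d) * l n + x / d * l' n" if "n \<le> 4" for n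
    using du[OF that] dw[OF that] by (simp_all add: field_simps)
  have "\<exists>s t. \<forall>n\<le>4. m n = s * l n + t * l' n" if "ann a m" for m
  proof -
    obtain s t where st: "\<forall>n\<le>4. m n = s * u n + t * w n" using pencilD(4)[OF p \<open>ann a m\<close>] by blast
    have "m n = (s * (y' / d) + t * (- x' / d)) * l n + (s * (- y / d) + t * (x / d)) * l' n" if "n \<le> 4" for n
    proof -
      have "m n = s * (y' / d * l n + (- y / d) * l' n) + t * ((- x' / d) * l n + x / d * l' n)"
        using st that by (simp only: u[OF that, symmetric] w[OF that, symmetric])
      also have "\<dots> = (s * (y' / d) + t * (- x' / d)) * l n + (s * (- y / d) + t * (x / d)) * l' n"
        by (simp only: algebra_simps)
      finally show ?thesis .
    qed
    then show ?thesis by blast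
  qed
  moreover have "inW a h" if "pr l h = 0" "pr l' h = 0" for h
  proof -
    have "pr u h = pr (\<lambda>n. y' / d * l n + (- y / d) * l' n) h" using u by (rule pr_cong) auto
    also have "\<dots> = y' / d * pr l h + (- y / d) * pr l' h" by (simp add: pr_simps algebra_simps)
    finally have 1: "pr u h = 0" by (simp add: that)
    have "pr w h = pr (\<lambda>n. (- x' / d) * l n + x / d * l' n) h" using w by (rule pr_cong) auto
    also have "\<dots> = (- x' / d) * pr l h + x / d * pr l' h" by (simp add: pr_simps algebra_simps)
    finally have "pr w h = 0" by (simp add: that)
    with 1 show ?thesis by (rule pencilD(5)[OF p])
  qed
  ultimately show ?thesis using l i by (simp add: pencil_def)
qed

section \<open>Singular Hankel matrices\<close>

text \<open>The adjugate of a symmetric matrix with kernel vector \<open>x\<close> is a multiple of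
  the rank one matrix x x^T. The relations \<open>R\<close> say that its rows are proportional to
  \<open>x\<close>; which entry to divide by depends on the nonzero coordinate of
  \<open>x\<close>.\<close>

lemma hankel_adjugate:
  fixes x1 x2 x3 l0 l1 l2 l3 l4 :: "'a::field"
  assumes e: "x1 * l0 + x2 * l1 + x3 * l2 = 0" "x1 * l1 + x2 * l2 + x3 * l3 = 0"
    "x1 * l2 + x2 * l3 + x3 * l4 = 0" and nz: "x1 \<noteq> 0 \<or> x2 \<noteq> 0 \<or> x3 \<noteq> 0"
  shows "\<exists>r. l2 * l4 - l3 * l3 = r * (x1 * x1) \<and> l2 * l3 - l1 * l4 = r * (x1 * x2) \<and>
    l1 * l3 - l2 * l2 = r * (x1 * x3) \<and> l0 * l4 - l2 * l2 = r * (x2 * x2) \<and>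
    l1 * l2 - l0 * l3 = r * (x2 * x3) \<and> l0 * l2 - l1 * l1 = r * (x3 * x3)"
proof -
  define A11 where "A11 = l2 * l4 - l3 * l3"
  define A12 where "A12 = l2 * l3 - l1 * l4"
  define A13 where "A13 = l1 * l3 - l2 * l2"
  define A22 where "A22 = l0 * l4 - l2 * l2"
  define A23 where "A23 = l1 * l2 - l0 * l3"
  define A33 where "A33 = l0 * l2 - l1 * l1"
  note d = A11_def A12_def A13_def A22_def A23_def A33_def
  have R: "x2 * A11 = x1 * A12" "x3 * A11 = x1 * A13" "x2 * A12 = x1 * A22" "x3 * A12 = x1 * A23"
    "x2 * A13 = x1 * A23" "x3 * A13 = x1 * A33" "x3 * A12 = x2 * A13" "x3 * A22 = x2 * A23"
    "x3 * A23 = x2 * A33"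
    unfolding d using e by algebra+
  consider "x1 \<noteq> 0" | "x2 \<noteq> 0" | "x3 \<noteq> 0" using nz by blast
  then have "\<exists>r. A11 = r * (x1 * x1) \<and> A12 = r * (x1 * x2) \<and> A13 = r * (x1 * x3) \<and>
    A22 = r * (x2 * x2) \<and> A23 = r * (x2 * x3) \<and> A33 = r * (x3 * x3)"
  proof cases
    case 1
    have a: "A12 = x2 * A11 / x1" "A13 = x3 * A11 / x1" using R(1,2) 1 by (simp_all add: field_simps)
    have b: "A22 = x2 * A12 / x1" "A23 = x3 * A12 / x1" "A33 = x3 * A13 / x1"
      using R(3,4,6) 1 by (simp_all add: field_simps)
    show ?thesis by (rule exI[of _ "A11 / (x1 * x1)"]) (use 1 in \<open>simp add: b a\<close>)
  next
    case 2
    have a: "A12 = x1 * A22 / x2" "A23 = x3 * A22 / x2" using R(3,8) 2 by (simp_all add: field_simps)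
    have b: "A11 = x1 * A12 / x2" "A13 = x1 * A23 / x2" "A33 = x3 * A23 / x2"
      using R(1,5,9) 2 by (simp_all add: field_simps)
    show ?thesis by (rule exI[of _ "A22 / (x2 * x2)"]) (use 2 in \<open>simp add: b a\<close>)
  next
    case 3
    have a: "A13 = x1 * A33 / x3" "A23 = x2 * A33 / x3" using R(6,9) 3 by (simp_all add: field_simps)
    have b: "A11 = x1 * A13 / x3" "A12 = x2 * A13 / x3" "A22 = x2 * A23 / x3"
      using R(2,7,8) 3 by (simp_all add: field_simps)
    show ?thesis by (rule exI[of _ "A33 / (x3 * x3)"]) (use 3 in \<open>simp add: b a\<close>)
  qed
  then show ?thesis unfolding d .
qed

text \<open>The adjugate of the Hankel matrix of \<open>l\<close> is \<open>r\<close> times the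
  square of \<open>(k $ 3, k $ 2, k $ 1)\<close>, which is the order in which \<open>qker\<close>
  pairs \<open>k\<close> with \<open>l\<close>.\<close>

definition adj_is :: "(nat \<Rightarrow> complex) \<Rightarrow> complex \<Rightarrow> complex ^ 3 \<Rightarrow> bool" where
  "adj_is l r k \<longleftrightarrow>
    l 2 * l 4 - l 3 * l 3 = r * (k $ 3 * k $ 3) \<and> l 2 * l 3 - l 1 * l 4 = r * (k $ 3 * k $ 2) \<and>
    l 1 * l 3 - l 2 * l 2 = r * (k $ 3 * k $ 1) \<and> l 0 * l 4 - l 2 * l 2 = r * (k $ 2 * k $ 2) \<and>
    l 1 * l 2 - l 0 * l 3 = r * (k $ 2 * k $ 1) \<and> l 0 * l 2 - l 1 * l 1 = r * (k $ 1 * k $ 1)"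

lemma adj_exists:
  assumes "qker k l" "k \<noteq> 0"
  obtains r where "adj_is l r k"
proof -
  have "k $ 3 \<noteq> 0 \<or> k $ 2 \<noteq> 0 \<or> k $ 1 \<noteq> 0" using assms(2) by (auto simp: vec_eq_iff forall_3)
  then show ?thesis
    using hankel_adjugate[of "k $ 3" "l 0" "k $ 2" "l 1" "k $ 1" "l 2" "l 3" "l 4"] assms(1) that
    unfolding qker_def adj_is_def by blast
qed

lemma qker_imp_hdet: assumes "qker k l" "k \<noteq> 0" shows "hdet l = 0"
proof -
  obtain r where r: "adj_is l r k" using adj_exists[OF assms] .
  have "hdet l = l 0 * (l 2 * l 4 - l 3 * l 3) + l 1 * (l 2 * l 3 - l 1 * l 4) + l 2 * (l 1 * l 3 - l 2 * l 2)"
    by (simp add: hdet_def algebra_simps)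
  also have "\<dots> = r * k $ 3 * (k $ 3 * l 0 + k $ 2 * l 1 + k $ 1 * l 2)"
    using r unfolding adj_is_def by (elim conjE, simp only:) (simp add: algebra_simps)
  also have "\<dots> = 0" using assms(1) unfolding qker_def by (metis mult_zero_right)
  finally show ?thesis .
qed

text \<open>The derivative of \<open>hdet\<close> at \<open>l\<close> in direction \<open>l'\<close>.\<close>

definition hmix :: "(nat \<Rightarrow> complex) \<Rightarrow> (nat \<Rightarrow> complex) \<Rightarrow> complex" where
  "hmix l l' = (l 2 * l 4 - l 3 * l 3) * l' 0 + 2 * (l 2 * l 3 - l 1 * l 4) * l' 1 +
     2 * (l 1 * l 3 - l 2 * l 2) * l' 2 + (l 0 * l 4 - l 2 * l 2) * l' 2 +
     2 * (l 1 * l 2 - l 0 * l 3) * l' 3 + (l 0 * l 2 - l 1 * l 1) * l' 4"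

lemma hdet_expand: "hdet (\<lambda>n. x * l n + y * l' n) =
    x ^ 3 * hdet l + x * y * (x * hmix l l' + y * hmix l' l) + y ^ 3 * hdet l'"
  by (simp add: hdet_def hmix_def power3_eq_cube algebra_simps)

text \<open>The derivative of a determinant is the trace of the adjugate times the increment. For a
  rank one adjugate this trace is, up to \<open>r\<close>, the value of \<open>l'\<close> on the
  square of \<open>k\<close>.\<close>

lemma hmix_adj: "adj_is l r k \<Longrightarrow> hmix l l' = r * pr l' (qm k k)"
  unfolding hmix_def adj_is_def
  by (elim conjE, simp only:) (simp add: pr_simps qm_simps algebra_simps)

lemma hdet_combination:
  assumes "qker k l" "k \<noteq> 0" "adj_is l r k" "qker k' l'" "k' \<noteq> 0" "adj_is l' r' k'"
  shows "hdet (\<lambda>n. x * l n + y * l' n) = x * y * (x * (r * pr l' (qm k k)) + y * (r' * pr l (qm k' k')))"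
proof -
  show ?thesis
    using qker_imp_hdet[OF assms(1,2)] qker_imp_hdet[OF assms(4,5)]
    by (simp only: hdet_expand hmix_adj[OF assms(3)] hmix_adj[OF assms(6)]) simp
qed

lemma hdet_eq_0_imp_qker:
  assumes "hdet l = 0"
  shows "\<exists>k. k \<noteq> 0 \<and> qker k l"
proof -
  define A :: "complex ^ 3 ^ 3" where
    "A = vector [vector [l 0, l 1, l 2], vector [l 1, l 2, l 3], vector [l 2, l 3, l 4]]"
  have "det A = hdet l" by (simp add: det_3 A_def hdet_def algebra_simps)
  then have "\<not> invertible A" using assms by (simp add: invertible_det_nz)
  then obtain x where x: "x \<noteq> 0" "A *v x = 0"
    using invertible_left_inverse matrix_left_invertible_ker by metis
  have "vector [x $ 3, x $ 2, x $ 1] \<noteq> (0 :: complex ^ 3)" using x(1) by (auto simp: vec_eq_iff forall_3)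
  moreover have "qker (vector [x $ 3, x $ 2, x $ 1]) l"
    using x(2) by (simp add: qker_def vec_eq_iff forall_3 matrix_vector_mult_def sum_3 A_def mult.commute)
  ultimately show ?thesis by blast
qed

text \<open>The equations are the vanishing of the 2 x 2 minors, which cut out the cone over the
  rational normal quartic: \<open>l\<close> is a geometric sequence, and \<open>l 0 = 0\<close> is
  the case of the point \<open>[1:0]\<close>.\<close>

lemma rank_one_hankel:
  assumes "l 2 * l 4 = l 3 * l 3" "l 2 * l 3 = l 1 * l 4" "l 1 * l 3 = l 2 * l 2" "l 0 * l 4 = l 2 * l 2"
    "l 1 * l 2 = l 0 * l 3" "l 0 * l 2 = l 1 * l (1::nat)"
  shows "\<exists>c v. v \<noteq> 0 \<and> (\<forall>n\<le>4. l n = c * ev v n)"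
proof (cases "l 0 = 0")
  case True
  with assms have "l 1 = 0" "l 2 = 0" "l 3 = 0" by auto
  then have "\<forall>n\<le>4. l n = l 4 * ev (vector [1, 0]) n" using True unfolding all_le_4 by (simp add: ev_def)
  moreover have "vector [1, 0] \<noteq> (0 :: complex ^ 2)" by (simp add: vec_eq_iff forall_2)
  ultimately show ?thesis by blast
next
  case False
  define z where "z = l 1 / l 0"
  have 1: "l 1 = l 0 * z" using False by (simp add: z_def)
  have 2: "l 2 = l 0 * z ^ 2"
    using assms(6) False unfolding 1 by (simp add: power2_eq_square)
  have 3: "l 3 = l 0 * z ^ 3"
    using assms(5) False unfolding 1 2 by (simp add: power2_eq_square power3_eq_cube mult_ac)
  have 4: "l 4 = l 0 * z ^ 4"
    using assms(4) False unfolding 2 by (simp add: power_numeral_reduce)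
  have "\<forall>n\<le>4. l n = l 0 * ev (vector [z, 1]) n"
    unfolding all_le_4 by (simp add: ev_def 1[symmetric] 2[symmetric] 3[symmetric] 4[symmetric])
  moreover have "vector [z, 1] \<noteq> (0 :: complex ^ 2)" by (simp add: vec_eq_iff forall_2)
  ultimately show ?thesis by blast
qed

section \<open>Degenerate functionals\<close>

text \<open>What is kept of \<open>parametrizes\<close> when the point set is forgotten: no base
  points, and no curve of degree below 4 through the image. The second condition excludes, for
  instance, double covers of conics.\<close>

definition regular :: "(nat \<Rightarrow> real ^ 3) \<Rightarrow> bool" where
  "regular a \<longleftrightarrow> (\<forall>v. v \<noteq> 0 \<longrightarrow> lift4 a v \<noteq> 0) \<and>
     (\<forall>e<4. \<forall>G. ternary_form e G \<and> (\<forall>v. G (lift4 a v) = 0) \<longrightarrow> G = (\<lambda>_. 0))"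

lemma fourth_root: "\<exists>l :: complex. l ^ 4 = c"
proof -
  have "x ^ 4 = (x\<^sup>2)\<^sup>2" for x :: complex by (simp flip: power_mult)
  then have "csqrt (csqrt c) ^ 4 = c" by (simp only: power2_csqrt)
  then show ?thesis by blast
qed

text \<open>A scalar factor is absorbed into the source by a fourth root, so every representative of
  an image point is itself a value of \<open>lift4 a\<close>.\<close>

lemma multiple_of_theta:
  assumes "y \<in> pt (lift4 a v)"
  obtains l where "l \<noteq> 0" "y = lift4 a (l *s v)"
proof -
  obtain c where c: "c \<noteq> 0" "y = c *s lift4 a v" using assms by (auto simp: mem_pt)
  obtain l where l: "l ^ 4 = c" using fourth_root by blast
  have "l \<noteq> 0" using c l by auto
  then show ?thesis using that[of l] c l by (simp add: theta_scale)
qed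

lemma zero_locus_theta:
  assumes "\<And>v. v \<noteq> 0 \<Longrightarrow> lift4 a v \<noteq> 0"
  shows "Ctheta 4 a ` CP \<subseteq> zero_locus G \<longleftrightarrow> (\<forall>v. v \<noteq> 0 \<longrightarrow> G (lift4 a v) = 0)"
proof
  assume s: "Ctheta 4 a ` CP \<subseteq> zero_locus G"
  show "\<forall>v. v \<noteq> 0 \<longrightarrow> G (lift4 a v) = 0"
  proof (intro allI impI)
    fix v :: "complex ^ 2" assume "v \<noteq> 0"
    then have "Ctheta 4 a (pt v) \<in> Ctheta 4 a ` CP" by (intro imageI) (simp add: pt_in_CP)
    then have "pt (lift4 a v) \<in> zero_locus G" using s by (auto simp: Ctheta_pt)
    then show "G (lift4 a v) = 0" using pt_self by (auto simp: zero_locus_def)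
  qed
next
  assume z: "\<forall>v. v \<noteq> 0 \<longrightarrow> G (lift4 a v) = 0"
  show "Ctheta 4 a ` CP \<subseteq> zero_locus G"
  proof
    fix x assume "x \<in> Ctheta 4 a ` CP"
    then obtain v where v: "v \<noteq> 0" "x = pt (lift4 a v)"
      by (auto elim!: CP_cases simp: Ctheta_pt)
    have "G y = 0" if "y \<in> x" for y
    proof -
      obtain l where "l \<noteq> 0" "y = lift4 a (l *s v)"
        using \<open>y \<in> x\<close> v(2) multiple_of_theta by blast
      then show ?thesis using z v(1) by simp
    qed
    moreover have "x \<in> CP" using assms v by (simp add: pt_in_CP)
    ultimately show "x \<in> zero_locus G" by (simp add: zero_locus_def)
  qed
qed

lemma regular_of_parametrizes:
  assumes "parametrizes 4 a C"
  shows "regular a"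
proof -
  have z: "\<And>v. v \<noteq> 0 \<Longrightarrow> lift4 a v \<noteq> 0" and C: "C = Ctheta 4 a ` CP"
    using assms by (auto simp: parametrizes_def)
  obtain F where "curve_equation 4 F C" using assms by (auto simp: parametrizes_def plane_curve_def)
  then have m: "\<And>e G. e < 4 \<Longrightarrow> ternary_form e G \<Longrightarrow> C \<subseteq> zero_locus G \<Longrightarrow> G = (\<lambda>_. 0)"
    by (auto simp: curve_equation_def)
  show ?thesis
    unfolding regular_def
  proof (intro conjI allI impI)
    fix e G assume "e < (4::nat)" "ternary_form e G \<and> (\<forall>v. G (lift4 a v) = 0)"
    then show "G = (\<lambda>_. 0)" using m[of e G] zero_locus_theta[OF z, of G] C by auto
  qed (use z in auto)
qed

lemma regularD: "regular a \<Longrightarrow> v \<noteq> 0 \<Longrightarrow> lift4 a v \<noteq> 0"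
  by (simp add: regular_def)

lemma regular_no_form:
  "regular a \<Longrightarrow> e < 4 \<Longrightarrow> ternary_form e G \<Longrightarrow> (\<And>v. G (lift4 a v) = 0) \<Longrightarrow> G y = 0"
  unfolding regular_def by metis

lemma lin_eq_0:
  assumes "\<And>y. lin m y = 0" shows "m = 0"
proof -
  have "m $ i = 0" for i using assms[of "axis i 1"] exhaust_3[of i] by (auto simp: lin_3 axis_def)
  then show ?thesis by (simp add: vec_eq_iff)
qed

lemma regular_no_line:
  assumes "regular a" "\<And>v. lin m (lift4 a v) = 0"
  shows "m = 0"
  by (rule lin_eq_0, rule regular_no_form[OF assms(1) _ tf_lin assms(2)]) simp

lemma regular_pencil:
  assumes "regular a"
  shows "\<exists>u w. pencil a u w"
proof (rule pencil_exists)
  fix m :: "complex ^ 3" assume m: "m \<noteq> 0"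
  show "\<exists>n\<le>4. prow a m n \<noteq> 0"
  proof (rule ccontr)
    assume "\<not> (\<exists>n\<le>4. prow a m n \<noteq> 0)"
    then have "lin m (lift4 a v) = 0" for v by (simp add: lin_theta')
    then show False using regular_no_line[OF assms] m by blast
  qed
qed

lemma indep_pencil:
  assumes "regular a" "ann a l" "ann a l'" "indep2 l l'"
  shows "pencil a l l'"
  using regular_pencil[OF assms(1)] pencil_of_indep assms by blast

text \<open>Read as "degenerate", not as degree: \<open>l\<close> is a nonzero member of the
  annihilator with singular Hankel matrix, and \<open>k\<close> is its kernel.\<close>

definition deg :: "(nat \<Rightarrow> real ^ 3) \<Rightarrow> complex ^ 3 \<Rightarrow> (nat \<Rightarrow> complex) \<Rightarrow> bool" where
  "deg a k l \<longleftrightarrow> ann a l \<and> nz l \<and> k \<noteq> 0 \<and> qker k l"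

lemma degD: assumes "deg a k l" shows "ann a l" "nz l" "k \<noteq> 0" "qker k l"
  using assms by (simp_all add: deg_def)

text \<open>A vanishing adjugate means that the Hankel matrix has rank one, so \<open>l\<close> is a
  multiple of an evaluation; since \<open>l\<close> annihilates the components, its point would be a
  base point.\<close>

lemma deg_adj_nonzero:
  assumes "regular a" "deg a k l" "adj_is l r k"
  shows "r \<noteq> 0"
proof
  assume "r = 0"
  have e: "l 2 * l 4 - l 3 * l 3 = 0" "l 2 * l 3 - l 1 * l 4 = 0" "l 1 * l 3 - l 2 * l 2 = 0"
    "l 0 * l 4 - l 2 * l 2 = 0" "l 1 * l 2 - l 0 * l 3 = 0" "l 0 * l 2 - l 1 * l 1 = 0"
    using assms(3) unfolding adj_is_def \<open>r = 0\<close> mult_zero_left by blast+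
  obtain c v where v: "v \<noteq> 0" "\<forall>n\<le>4. l n = c * ev v n"
    using rank_one_hankel[of l] e unfolding right_minus_eq by blast
  then have "\<And>n. n \<le> 4 \<Longrightarrow> l n = c * ev v n + 0 * ev v n" by simp
  from ann_ev_iff[OF this] have "c *s lift4 a v + 0 *s lift4 a v = 0"
    using degD(1)[OF assms(2)] by blast
  then have "c *s lift4 a v = 0" by simp
  moreover have "c \<noteq> 0" using degD(2)[OF assms(2)] v by (auto simp: nz_def)
  ultimately show False using regularD[OF assms(1) v(1)] by simp
qed

text \<open>Both kernels have nonzero squares proportional to the same adjugate, and a vector is
  determined up to scaling by its square.\<close>

lemma deg_unique:
  assumes "regular a" "deg a k l" "deg a k' l"
  shows "\<exists>c. c \<noteq> 0 \<and> k' = c *s k"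
proof -
  obtain r where r: "adj_is l r k" using adj_exists degD[OF assms(2)] by blast
  obtain r' where r': "adj_is l r' k'" using adj_exists degD[OF assms(3)] by blast
  have nz: "r \<noteq> 0" "r' \<noteq> 0" using deg_adj_nonzero assms r r' by blast+
  have e: "r * (k $ i * k $ j) = r' * (k' $ i * k' $ j)" for i j
  proof -
    have "r * (k $ 3 * k $ 3) = r' * (k' $ 3 * k' $ 3)" "r * (k $ 3 * k $ 2) = r' * (k' $ 3 * k' $ 2)"
      "r * (k $ 3 * k $ 1) = r' * (k' $ 3 * k' $ 1)" "r * (k $ 2 * k $ 2) = r' * (k' $ 2 * k' $ 2)"
      "r * (k $ 2 * k $ 1) = r' * (k' $ 2 * k' $ 1)" "r * (k $ 1 * k $ 1) = r' * (k' $ 1 * k' $ 1)"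
      using r r' unfolding adj_is_def by metis+
    then show ?thesis using exhaust_3[of i] exhaust_3[of j] by (auto simp: mult.commute)
  qed
  obtain j where j: "k $ j \<noteq> 0" using degD(3)[OF assms(2)] by (auto simp: vec_eq_iff)
  have j': "k' $ j \<noteq> 0" using e[of j j] j nz by auto
  define c where "c = r * k $ j / (r' * k' $ j)"
  have "k' $ i = c * k $ i" for i
    using e[of i j] nz j' by (simp add: c_def field_simps)
  then have "k' = c *s k" by (simp add: vec_eq_iff)
  moreover have "c \<noteq> 0" using nz j j' by (simp add: c_def)
  ultimately show ?thesis by blast
qed

lemma deg_scale_l:
  assumes "deg a k l" "\<And>n. n \<le> 4 \<Longrightarrow> l n = x * l' n" "ann a l'"
  shows "deg a k l'"
proof -
  have x: "x \<noteq> 0" and "nz l'" using degD(2)[OF assms(1)] assms(2) by (auto simp: nz_def)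
  have "x * (k $ 3 * l' 0 + k $ 2 * l' 1 + k $ 1 * l' 2) = k $ 3 * l 0 + k $ 2 * l 1 + k $ 1 * l 2"
    "x * (k $ 3 * l' 1 + k $ 2 * l' 2 + k $ 1 * l' 3) = k $ 3 * l 1 + k $ 2 * l 2 + k $ 1 * l 3"
    "x * (k $ 3 * l' 2 + k $ 2 * l' 3 + k $ 1 * l' 4) = k $ 3 * l 2 + k $ 2 * l 3 + k $ 1 * l 4"
    by (simp_all add: assms(2) algebra_simps)
  then have "qker k l'" using degD(4)[OF assms(1)] x unfolding qker_def by (metis no_zero_divisors)
  then show ?thesis using \<open>nz l'\<close> degD(3)[OF assms(1)] assms(3) by (simp add: deg_def)
qed

lemma not_indep2D:
  assumes "\<not> indep2 l l'" "nz l"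
  obtains x where "\<And>n. n \<le> 4 \<Longrightarrow> l' n = x * l n"
proof -
  obtain x y where xy: "\<forall>n\<le>4. x * l n + y * l' n = 0" "x \<noteq> 0 \<or> y \<noteq> 0"
    using assms(1) unfolding indep2_def by blast
  have y: "y \<noteq> 0"
  proof
    assume "y = 0"
    with xy have "x \<noteq> 0" "\<forall>n\<le>4. x * l n = 0" by auto
    then show False using assms(2) by (auto simp: nz_def)
  qed
  have "l' n = (- x / y) * l n" if "n \<le> 4" for n
  proof -
    have "y * l' n = - (x * l n)" using xy(1) that by (metis add.inverse_unique)
    then show ?thesis using y by (simp add: field_simps)
  qed
  then show ?thesis by (rule that)
qed

lemma indep_of_kernels:
  assumes "regular a" "deg a k l" "deg a k' l'" "\<And>c. k' \<noteq> c *s k"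
  shows "indep2 l l'"
proof (rule ccontr)
  assume "\<not> indep2 l l'"
  then obtain x where "\<And>n. n \<le> 4 \<Longrightarrow> l' n = x * l n" using degD(2)[OF assms(2)] not_indep2D by metis
  then have "deg a k' l" using deg_scale_l assms(3) degD(1)[OF assms(2)] by blast
  then show False using deg_unique assms by blast
qed

lemma inW_qm:
  assumes "inW a (qm p q)"
  obtains m where "\<And>v. lin m (lift4 a v) = qf p v * qf q v"
proof -
  obtain m where m: "\<forall>n\<le>4. qm p q n = prow a m n" using assms unfolding inW_def by blast
  have "lin m (lift4 a v) = qf p v * qf q v" for v
    unfolding qm_eval[symmetric] lin_theta' using m by simp
  then show ?thesis by (rule that)
qed

text \<open>Linear forms with linearly independent pullbacks \<open>h i\<close> are themselves
  independent, hence are coordinates of the plane; \<open>N\<close> is the inverse coordinate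
  change.\<close>

lemma theta_of_independent:
  fixes m :: "3 \<Rightarrow> complex ^ 3"
  assumes h: "\<And>i v. lin (m i) (lift4 a v) = h i v"
    and ind: "\<And>c :: complex ^ 3. (\<And>v. (\<Sum>i\<in>UNIV. c $ i * h i v) = 0) \<Longrightarrow> c = 0"
  obtains N where "N ** (\<chi> i. m i) = mat 1" "(\<chi> i. m i) ** N = mat 1"
    "\<And>v. lift4 a v = N *v (\<chi> i. h i v)"
proof -
  define R where "R = (\<chi> i. m i)"
  have R: "R *v lift4 a v = (\<chi> i. h i v)" for v
    by (simp add: vec_eq_iff matrix_vector_mult_def R_def h[symmetric] lin_def)
  have "c = 0" if "transpose R *v c = 0" for c
  proof (rule ind)
    fix v
    have "(\<Sum>i\<in>UNIV. c $ i * h i v) = lin (transpose R *v c) (lift4 a v)"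
      by (simp add: h[symmetric] lin_3 sum_3 matrix_vector_mult_def transpose_def R_def algebra_simps)
    also have "\<dots> = 0" using that by (simp add: lin_zero)
    finally show "(\<Sum>i\<in>UNIV. c $ i * h i v) = 0" .
  qed
  then obtain B where "B ** transpose R = mat 1" using matrix_left_invertible_ker by blast
  then have "R ** transpose B = mat 1" by (metis matrix_transpose_mul transpose_mat transpose_transpose)
  moreover then have N: "transpose B ** R = mat 1" by (simp add: matrix_left_right_inverse)
  moreover have "lift4 a v = transpose B *v (\<chi> i. h i v)" for v
    by (simp flip: R add: matrix_vector_mul_assoc N)
  ultimately show ?thesis using that unfolding R_def by blast
qed

text \<open>If the two kernels agreed, the whole pencil would annihilate all multiples of
  \<open>k\<close>. These already form a 3-dimensional space, so \<open>W\<close> would consist of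
  multiples of \<open>k\<close>, and a root of \<open>k\<close> would be a base point.\<close>

lemma kernels_of_indep:
  assumes reg: "regular a" and d: "deg a k l" "deg a k' l'" and i: "indep2 l l'"
  shows "k' \<noteq> c *s k"
proof
  assume k': "k' = c *s k"
  have p: "pencil a l l'" using indep_pencil[OF reg] d i by (simp add: deg_def)
  have c: "c \<noteq> 0" using degD(3)[OF d(2)] k' by auto
  have "inW a (qm k q)" for q
  proof (rule pencilD(5)[OF p])
    show "pr l (qm k q) = 0" using pr_qker degD(4)[OF d(1)] .
    have "pr l' (qm k' q) = 0" using pr_qker degD(4)[OF d(2)] .
    moreover have "pr l' (qm k' q) = c * pr l' (qm k q)"
      by (simp add: k' pr_simps qm_simps algebra_simps)
    ultimately show "pr l' (qm k q) = 0" using c by simp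
  qed
  then have "\<exists>m. \<forall>v. lin m (lift4 a v) = qf k v * qf (axis i 1) v" for i
    using inW_qm by metis
  then obtain m where m: "\<And>i v. lin (m i) (lift4 a v) = qf k v * qf (axis i 1) v" by metis
  obtain N where N: "\<And>v. lift4 a v = N *v (\<chi> i. qf k v * qf (axis i 1) v)"
  proof (rule theta_of_independent[OF m])
    fix e :: "complex ^ 3"
    assume e: "\<And>v. (\<Sum>i\<in>UNIV. e $ i * (qf k v * qf (axis i 1) v)) = 0"
    have "qf k v * qf e v = 0" for v
    proof -
      have "qf k v * qf e v = (\<Sum>i\<in>UNIV. e $ i * (qf k v * qf (axis i 1) v))"
        by (simp add: sum_3 qf_def axis_def algebra_simps)
      then show ?thesis using e by simp
    qed
    then show "e = 0" using qf_mult_eq_0 degD(3)[OF d(1)] by blast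
  qed blast
  obtain v where "v \<noteq> 0" "qf k v = 0" using qf_root by blast
  then have "lift4 a v = N *v 0" using N[of v] by (simp add: zero_vec_def)
  then show False using regularD[OF reg \<open>v \<noteq> 0\<close>] by simp
qed

text \<open>The product is a multiple of both kernels, so both functionals annihilate it, and the
  double annihilator property puts it into \<open>W\<close>.\<close>

lemma inW_product:
  assumes "regular a" "deg a k l" "deg a k' l'" "indep2 l l'"
  shows "inW a (qm k k')"
proof (rule pencilD(5)[OF indep_pencil[OF assms(1) _ _ assms(4)]])
  show "pr l (qm k k') = 0" using pr_qker degD(4)[OF assms(2)] .
  show "pr l' (qm k k') = 0" using pr_qker[of k' l' k] degD(4)[OF assms(3)] by (simp add: qm_commute)
qed (use assms degD in auto)

text \<open>Over the complex numbers a binary quadratic relation between the two forms splits into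
  linear factors, so a product of two linear combinations of \<open>k\<close> and \<open>k'\<close>
  would vanish; forms have no zero divisors.\<close>

lemma quadratic_relation:
  fixes k k' c :: "complex ^ 3"
  assumes "\<And>v. c $ 1 * (qf k v)\<^sup>2 + c $ 2 * (qf k v * qf k' v) + c $ 3 * (qf k' v)\<^sup>2 = 0"
    and k: "k \<noteq> 0" and np: "\<And>x. k' \<noteq> x *s k"
  shows "c = 0"
proof (rule ccontr)
  assume "c \<noteq> 0"
  then obtain x y where xy: "x \<noteq> 0" "y \<noteq> 0" "c = lq x y" by (rule qf_factor)
  have "qf (x $ 1 *s k' - x $ 2 *s k) v * qf (y $ 1 *s k' - y $ 2 *s k) v = 0" for v
  proof -
    have "qf (x $ 1 *s k' - x $ 2 *s k) v * qf (y $ 1 *s k' - y $ 2 *s k) v =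
      (x $ 1 * qf k' v - x $ 2 * qf k v) * (y $ 1 * qf k' v - y $ 2 * qf k v)"
      by (simp add: qf_def algebra_simps)
    also have "\<dots> = c $ 1 * (qf k v)\<^sup>2 + c $ 2 * (qf k v * qf k' v) + c $ 3 * (qf k' v)\<^sup>2"
      by (simp add: xy lq_nth power2_eq_square algebra_simps)
    finally show ?thesis using assms(1) by simp
  qed
  then have "x $ 1 *s k' - x $ 2 *s k = 0 \<or> y $ 1 *s k' - y $ 2 *s k = 0" by (rule qf_mult_eq_0)
  moreover have "z = 0" if "z $ 1 *s k' - z $ 2 *s k = 0" for z :: "complex ^ 2"
  proof -
    have e: "z $ 1 * k' $ i = z $ 2 * k $ i" for i using that by (simp add: vec_eq_iff)
    have "z $ 1 = 0"
    proof (rule ccontr)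
      assume "z $ 1 \<noteq> 0"
      then have "k' = (z $ 2 / z $ 1) *s k" using e by (simp add: vec_eq_iff field_simps)
      then show False using np by blast
    qed
    with e k show ?thesis by (auto simp: vec_eq_iff forall_2)
  qed
  ultimately show False using xy by blast
qed

text \<open>Otherwise \<open>W\<close> would be spanned by the two squares and the product of the
  kernels, and the image would lie on a conic.\<close>

lemma not_both_double:
  assumes reg: "regular a" and d: "deg a k l" "deg a k' l'" and i: "indep2 l l'"
  shows "pr l' (qm k k) \<noteq> 0 \<or> pr l (qm k' k') \<noteq> 0"
proof (rule ccontr)
  assume n: "\<not> ?thesis"
  have p: "pencil a l l'" using indep_pencil[OF reg] d i by (simp add: deg_def)
  have "inW a (qm k k)" "inW a (qm k' k')"
    using pencilD(5)[OF p] pr_qker degD(4)[OF d(1)] degD(4)[OF d(2)] n by blast+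
  moreover have "inW a (qm k k')" by (rule inW_product[OF assms])
  ultimately obtain m1 m2 m3 where m: "\<And>v. lin m1 (lift4 a v) = qf k v * qf k v"
    "\<And>v. lin m2 (lift4 a v) = qf k v * qf k' v"
    "\<And>v. lin m3 (lift4 a v) = qf k' v * qf k' v" using inW_qm by metis
  define m where "m i = (if i = 1 then m1 else if i = 2 then m2 else m3)" for i :: 3
  define h where "h i v = lin (m i) (lift4 a v)" for i v
  obtain N where N: "(\<chi> i. m i) ** N = mat 1"
  proof (rule theta_of_independent[of m a h])
    fix c :: "complex ^ 3"
    assume c: "\<And>v. (\<Sum>i\<in>UNIV. c $ i * h i v) = 0"
    show "c = 0"
    proof (rule quadratic_relation)
      show "c $ 1 * (qf k v)\<^sup>2 + c $ 2 * (qf k v * qf k' v) + c $ 3 * (qf k' v)\<^sup>2 = 0" for v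
        using c[of v] by (simp add: sum_3 h_def m_def m power2_eq_square)
    qed (use degD(3)[OF d(1)] kernels_of_indep[OF assms] in auto)
  qed (auto simp: h_def)
  define G where "G y = lin m1 y * lin m3 y + (- 1) * (lin m2 y * lin m2 y)" for y
  have "ternary_form 2 G" unfolding G_def by (intro tf_add tf_scale tf_lin2)
  then have G0: "G y = 0" for y
    by (rule regular_no_form[OF reg, rotated]) (simp_all add: G_def m)
  \<comment> \<open>In the coordinates \<open>m1, m2, m3\<close> the conic is m1 m3 = m2^2. This
    point lies off it, so \<open>G\<close> is not identically zero.\<close>
  define y where "y = N *v vector [1, 0, 1]"
  have "(\<chi> i. m i) *v y = vector [1, 0, 1]" by (simp add: y_def matrix_vector_mul_assoc N)
  then have "((\<chi> i. m i) *v y) $ 1 = 1" "((\<chi> i. m i) *v y) $ 2 = 0" "((\<chi> i. m i) *v y) $ 3 = 1" by simp_all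
  then have "lin m1 y = 1" "lin m2 y = 0" "lin m3 y = 1"
    by (simp_all add: matrix_vector_mult_def lin_def m_def)
  then show False using G0[of y] by (simp add: G_def)
qed

text \<open>Restricted to the pencil spanned by two degenerate functionals, the Hankel determinant is a
  product of three linear factors; hence there are only finitely many degenerate functionals up
  to scaling.\<close>

lemma finite_kernels:
  assumes reg: "regular a"
  obtains K where "finite K" "0 \<notin> K" "\<And>k l. deg a k l \<Longrightarrow> \<exists>k'\<in>K. \<exists>c. k = c *s k'"
proof (cases "\<exists>k l k' l'. deg a k l \<and> deg a k' l' \<and> indep2 l l'")
  case True
  then obtain k l k' l' where d: "deg a k l" "deg a k' l'" and i: "indep2 l l'" by blast
  have p: "pencil a l l'" using indep_pencil[OF reg] d i by (simp add: deg_def)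
  obtain r where r: "adj_is l r k" using adj_exists degD[OF d(1)] by blast
  obtain r' where r': "adj_is l' r' k'" using adj_exists degD[OF d(2)] by blast
  have nz: "r \<noteq> 0" "r' \<noteq> 0" using deg_adj_nonzero reg d r r' by blast+
  define P where "P = r * pr l' (qm k k)"
  define Q where "Q = r' * pr l (qm k' k')"
  have PQ: "P \<noteq> 0 \<or> Q \<noteq> 0" using not_both_double[OF reg d i] nz by (simp add: P_def Q_def)
  \<comment> \<open>The zero of the third linear factor \<open>x * P + y * Q\<close>; it is
    proportional to \<open>l\<close> or \<open>l'\<close> when \<open>P\<close> or \<open>Q\<close>
    vanishes.\<close>
  define l3 where "l3 n = Q * l n + (- P) * l' n" for n
  define K3 where "K3 = (if \<exists>k. deg a k l3 then {SOME k. deg a k l3} else {})"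
  have K3: "deg a x l3" if "x \<in> K3" for x
    using that someI_ex[of "\<lambda>k. deg a k l3"] by (auto simp: K3_def split: if_splits)
  have 0: "\<exists>x\<in>{k, k'} \<union> K3. \<exists>c. q = c *s x" if q: "deg a q m" for q m
  proof -
    obtain x y where xy: "\<And>n. n \<le> 4 \<Longrightarrow> m n = x * l n + y * l' n"
      using pencilD(4)[OF p degD(1)[OF q]] by blast
    have "hdet m = hdet (\<lambda>n. x * l n + y * l' n)" by (simp add: hdet_def xy)
    also have "\<dots> = x * y * (x * P + y * Q)"
      unfolding P_def Q_def using degD[OF d(1)] degD[OF d(2)] r r' by (intro hdet_combination) auto
    finally have "x * y * (x * P + y * Q) = 0" using qker_imp_hdet degD(3,4)[OF q] by metis
    then consider "x = 0" | "y = 0" | "x * P + y * Q = 0" by auto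
    then show ?thesis
    proof cases
      case 1
      then have "deg a q l'" using deg_scale_l[OF q, of y l'] xy degD(1)[OF d(2)] by simp
      then show ?thesis using deg_unique[OF reg d(2)] by blast
    next
      case 2
      then have "deg a q l" using deg_scale_l[OF q, of x l] xy degD(1)[OF d(1)] by simp
      then show ?thesis using deg_unique[OF reg d(1)] by blast
    next
      case 3
      obtain t where t: "x = t * Q" "y = t * (- P)"
      proof (cases "P = 0")
        case True
        then have "Q \<noteq> 0" "y = 0" using PQ 3 by auto
        then show ?thesis using that[of "x / Q"] True by simp
      next
        case False
        have "x * P = - (y * Q)" using 3 by (simp add: eq_neg_iff_add_eq_0)
        then show ?thesis using that[of "- y / P"] False by (simp add: field_simps)
      qed
      have m3: "m n = t * l3 n" if "n \<le> 4" for n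
        using xy[OF that] by (simp add: l3_def t algebra_simps)
      have "ann a l3"
      proof -
        have "pr l3 (prow a e) = Q * pr l (prow a e) + (- P) * pr l' (prow a e)" for e
          by (simp add: pr_simps l3_def algebra_simps)
        then show ?thesis using degD(1)[OF d(1)] degD(1)[OF d(2)] by (simp add: ann_def)
      qed
      then have q3: "deg a q l3" using deg_scale_l[OF q m3] by blast
      then have "\<exists>k. deg a k l3" by blast
      then have "K3 \<noteq> {}" by (simp add: K3_def)
      then obtain x where "x \<in> K3" by blast
      then show ?thesis using deg_unique[OF reg K3 q3] by blast
    qed
  qed
  have "0 \<notin> {k, k'} \<union> K3" using degD(3)[OF d(1)] degD(3)[OF d(2)] degD(3)[OF K3] by blast
  moreover have "finite ({k, k'} \<union> K3)" by (simp add: K3_def)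
  ultimately show ?thesis using 0 that by blast
next
  case False
  show ?thesis
  proof (cases "\<exists>k l. deg a k l")
    case True
    then obtain k l where d: "deg a k l" by blast
    have "\<exists>c. q = c *s k" if q: "deg a q m" for q m
    proof -
      have "\<not> indep2 l m" using False d q by blast
      then obtain x where "\<And>n. n \<le> 4 \<Longrightarrow> m n = x * l n" using degD(2)[OF d] not_indep2D by metis
      then have "deg a q l" using deg_scale_l[OF q] degD(1)[OF d] by blast
      then show ?thesis using deg_unique[OF reg d] by blast
    qed
    then show ?thesis using that[of "{k}"] degD(3)[OF d] by blast
  next
    case False
    then show ?thesis using that[of "{}"] by blast
  qed
qed

text \<open>Equality of the images up to the factor \<open>c\<close> says that \<open>c\<close>
  times the evaluation at \<open>v\<close> minus the evaluation at \<open>w\<close> annihilates the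
  components.\<close>

lemma pair_deg:
  assumes reg: "regular a" and d: "det2 v w \<noteq> 0" and e: "lift4 a w = c *s lift4 a v"
  obtains l where "deg a (lq v w) l"
proof -
  have vw: "v \<noteq> 0" "w \<noteq> 0" using d by (auto simp: det2_def)
  have c: "c \<noteq> 0" using regularD[OF reg vw(2)] e by auto
  define l where "l n = c * ev v n + (- 1) * ev w n" for n
  have "ann a l" using ann_ev_iff[of l c v "- 1" w a] e by (simp add: l_def)
  moreover have "qker (lq v w) l" unfolding l_def by (rule qker_ev)
  moreover have "nz l"
  proof (rule ccontr)
    assume "\<not> nz l"
    then have z: "l 0 = 0" "l 1 = 0" "l 3 = 0" "l 4 = 0" by (auto simp: nz_def)
    \<comment> \<open>These two differences eliminate the evaluation at \<open>w\<close> and isolate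
      powers of the coordinates of \<open>v\<close>.\<close>
    have "w $ 1 * l 0 - w $ 2 * l 1 = - (c * det2 v w * (v $ 2) ^ 3)"
      "w $ 1 * l 3 - w $ 2 * l 4 = - (c * det2 v w * (v $ 1) ^ 3)"
      by (simp_all add: l_def ev_def det2_def power_numeral_reduce algebra_simps)
    then have "v $ 2 = 0" "v $ 1 = 0" using z c d by auto
    then show False using vw by (simp add: vec_eq_iff forall_2)
  qed
  ultimately show ?thesis using that lq_nonzero[OF vw] by (simp add: deg_def)
qed

section \<open>Smooth points of the curve\<close>

lemma poly_on_line: "\<exists>P. \<forall>z. poly P z =
  (\<Sum>n\<le>4. h n * ((v + z *s w) $ 1) ^ n * ((v + z *s w) $ 2) ^ (4 - n))"
  for h :: "nat \<Rightarrow> complex" and v w :: "complex ^ 2"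
  by (rule exI[of _ "\<Sum>n\<le>4. smult (h n) ([:v $ 1, w $ 1:] ^ n * [:v $ 2, w $ 2:] ^ (4 - n))"])
     (simp add: poly_sum mult.assoc)

text \<open>A form vanishing on the affine line \<open>v + z *s w\<close> vanishes by homogeneity at
  every vector with nonzero \<open>v\<close>-coordinate, and then everywhere, because a polynomial
  with one possible non-root is zero.\<close>

lemma finite_zeros_on_line:
  fixes h :: "nat \<Rightarrow> complex" and v w u :: "complex ^ 2"
  assumes d: "det2 v w \<noteq> 0" and nz: "(\<Sum>n\<le>4. h n * (u $ 1) ^ n * (u $ 2) ^ (4 - n)) \<noteq> 0"
  shows "finite {z. (\<Sum>n\<le>4. h n * ((v + z *s w) $ 1) ^ n * ((v + z *s w) $ 2) ^ (4 - n)) = 0}"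
proof -
  define F where "F u = (\<Sum>n\<le>4. h n * (u $ 1) ^ n * (u $ 2) ^ (4 - n))" for u :: "complex ^ 2"
  have scale: "F (c *s u) = c ^ 4 * F u" for c u
    by (simp add: F_def sum_le_4 power_numeral_reduce algebra_simps)
  obtain P where P: "\<And>z. poly P z = F (v + z *s w)" using poly_on_line[of h v w] unfolding F_def by blast
  have "P \<noteq> 0"
  proof
    assume "P = 0"
    then have z: "F (v + z *s w) = 0" for z using P[of z] by simp
    obtain x y where u: "u = x *s v + y *s w" using det2_decomp[OF d] by blast
    obtain Q where Q: "\<And>t. poly Q t = F (u + t *s v)" using poly_on_line[of h u v] unfolding F_def by blast
    have "F (u + t *s v) = 0" if "t \<noteq> - x" for t
    proof -
      have nx: "x + t \<noteq> 0" using that by (auto simp: add_eq_0_iff)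
      have "(x + t) * (p + y / (x + t) * q) = x * p + y * q + t * p" for p q
        using nx by (simp add: distrib_left) (simp add: distrib_right)
      then have "u + t *s v = (x + t) *s (v + (y / (x + t)) *s w)"
        unfolding vec_eq_iff u using nx by simp
      then have "F (u + t *s v) = F ((x + t) *s (v + (y / (x + t)) *s w))" by (rule arg_cong)
      also have "\<dots> = 0" by (simp only: scale z mult_zero_right)
      finally show ?thesis .
    qed
    then have "- {- x} \<subseteq> {t. poly Q t = 0}" using Q by auto
    moreover have "infinite (- {- x :: complex})"
      using finite_compl[of "{- x}"] infinite_UNIV_char_0 by auto
    ultimately have "infinite {t. poly Q t = 0}" by (metis finite_subset)
    then have "Q = 0" using poly_roots_finite by blast
    then have "F u = 0" using Q[of 0] by simp
    then show False using nz by (simp add: F_def)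
  qed
  then have "finite {z. poly P z = 0}" by (rule poly_roots_finite)
  then show ?thesis by (simp only: P F_def)
qed

lemma finite_zeros_qf:
  assumes "k \<noteq> (0 :: complex ^ 3)" "det2 v w \<noteq> 0"
  shows "finite {z. qf k (v + z *s w) = 0}"
proof -
  obtain u where "qf k u \<noteq> 0" using qf_eq_0 assms(1) by blast
  then have "(\<Sum>n\<le>4. qm k k n * (u $ 1) ^ n * (u $ 2) ^ (4 - n)) \<noteq> 0" by (simp add: qm_eval)
  from finite_zeros_on_line[OF assms(2) this] show ?thesis by (simp only: qm_eval) simp
qed

lemma finite_zeros_lin:
  assumes "regular a" "m \<noteq> 0" "det2 v w \<noteq> 0"
  shows "finite {z. lin m (lift4 a (v + z *s w)) = 0}"
proof -
  obtain u where "lin m (lift4 a u) \<noteq> 0" using regular_no_line assms(1,2) by blast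
  from finite_zeros_on_line[OF assms(3) this[unfolded lin_theta']] show ?thesis
    by (simp only: lin_theta')
qed

lemma pair_root:
  assumes reg: "regular a" and K: "\<forall>k l. deg a k l \<longrightarrow> (\<exists>k'\<in>K. \<exists>c. k = c *s k')"
    and d: "det2 v w \<noteq> 0" and e: "lift4 a w = c *s lift4 a v"
  shows "(\<exists>k\<in>K. qf k v = 0) \<and> (\<exists>k\<in>K. qf k w = 0)"
proof -
  obtain l where "deg a (lq v w) l" by (rule pair_deg[OF reg d e])
  then obtain k x where k: "k \<in> K" "lq v w = x *s k" using K by blast
  have "v \<noteq> 0" "w \<noteq> 0" using d by (auto simp: det2_def)
  then have "x \<noteq> 0" using lq_nonzero[of v w] k by auto
  moreover have "qf (lq v w) v = 0" "qf (lq v w) w = 0" unfolding qf_lq by (simp_all add: det2_def)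
  ultimately have "qf k v = 0" "qf k w = 0" unfolding k qf_scale by auto
  then show ?thesis using k(1) by blast
qed

lemma ternary_form_gradient:
  assumes "ternary_form d F"
  obtains G :: "3 \<Rightarrow> complex ^ 3 \<Rightarrow> complex" where "\<And>i. continuous_on UNIV (G i)"
    "\<And>v. (F has_derivative (\<lambda>h. \<Sum>i\<in>UNIV. G i v * h $ i)) (at v)"
proof -
  obtain c where F: "F = (\<lambda>v. \<Sum>i\<le>d. \<Sum>j\<le>d - i. c i j * (v $ 1) ^ i * (v $ 2) ^ j * (v $ 3) ^ (d - i - j))"
    using assms unfolding ternary_form_def by blast
  define g where "g r i j v =
     (if r = 1 then of_nat i * (v $ 1) ^ (i - 1) * (v $ 2) ^ j * (v $ 3) ^ (d - i - j)
      else if r = 2 then (v $ 1) ^ i * (of_nat j * (v $ 2) ^ (j - 1)) * (v $ 3) ^ (d - i - j)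
      else (v $ 1) ^ i * (v $ 2) ^ j * (of_nat (d - i - j) * (v $ 3) ^ (d - i - j - 1)))"
    for r :: 3 and i j and v :: "complex ^ 3"
  define G where "G r v = (\<Sum>i\<le>d. \<Sum>j\<le>d - i. c i j * g r i j v)" for r v
  have "continuous_on UNIV (G r)" for r
    using exhaust_3[of r] unfolding G_def g_def by (elim disjE) (auto intro!: continuous_intros)
  moreover have "(F has_derivative (\<lambda>h. \<Sum>i\<in>UNIV. G i v * h $ i)) (at v)" for v
  proof -
    have m: "((\<lambda>v. c i j * (v $ 1) ^ i * (v $ 2) ^ j * (v $ 3) ^ (d - i - j)) has_derivative
      (\<lambda>h. c i j * g 1 i j v * h $ 1 + c i j * g 2 i j v * h $ 2 + c i j * g 3 i j v * h $ 3)) (at v)" for i j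
      unfolding g_def by (rule derivative_eq_intros refl)+ (simp add: fun_eq_iff ring_distribs mult_ac)
    have "(F has_derivative (\<lambda>h. \<Sum>i\<le>d. \<Sum>j\<le>d - i.
       c i j * g 1 i j v * h $ 1 + c i j * g 2 i j v * h $ 2 + c i j * g 3 i j v * h $ 3)) (at v)"
      unfolding F by (intro has_derivative_sum m)
    then show ?thesis
      by (simp add: sum_3 G_def sum_distrib_right sum.distrib)
  qed
  ultimately show ?thesis by (rule that)
qed

lemma norm_vec_le_sum: "norm (x :: complex ^ 3) \<le> (\<Sum>i\<in>UNIV. norm (x $ i))"
  unfolding norm_vec_def by (rule L2_set_le_sum) auto

lemma ex_3: "(\<exists>i :: 3. P i) \<longleftrightarrow> P 1 \<or> P 2 \<or> P 3"
  using forall_3[of "\<lambda>i. \<not> P i"] by blast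

lemma third_index:
  fixes i j :: 3
  assumes "j \<noteq> i"
  shows "\<exists>l. l \<noteq> i \<and> l \<noteq> j \<and> (\<forall>r. r = i \<or> r = j \<or> r = l)"
  using assms exhaust_3[of i] exhaust_3[of j] by (elim disjE) (simp_all add: ex_3 forall_3)

text \<open>The uniqueness half of the implicit function theorem, in the affine chart where
  coordinate \<open>j\<close> is held at \<open>y $ j\<close>: the partial derivative in direction
  \<open>i\<close> stays close to its nonzero value at \<open>y\<close>, so coordinate
  \<open>l\<close> determines coordinate \<open>i\<close> on the curve.\<close>

lemma smooth_chart:
  assumes G: "\<And>i. continuous_on UNIV (G i)"
    "\<And>v. (F has_derivative (\<lambda>h. \<Sum>i\<in>UNIV. G i v * h $ i)) (at v)"
    and Z: "\<And>v s. v \<noteq> 0 \<Longrightarrow> s \<noteq> 0 \<Longrightarrow> F (s *s lift4 a v) = (0 :: complex)"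
    and v0: "v0 \<noteq> 0" "lift4 a v0 \<noteq> 0" and y: "y = c *s lift4 a v0" "c \<noteq> 0" and nz: "G i y \<noteq> 0"
  obtains j l e where "y $ j \<noteq> 0" "j \<noteq> l" "e > 0"
    "\<And>v w. v \<noteq> 0 \<Longrightarrow> w \<noteq> 0 \<Longrightarrow> lift4 a v $ j \<noteq> 0 \<Longrightarrow> lift4 a w $ j \<noteq> 0 \<Longrightarrow>
      norm ((y $ j / lift4 a v $ j) *s lift4 a v - y) < e \<Longrightarrow>
      norm ((y $ j / lift4 a w $ j) *s lift4 a w - y) < e \<Longrightarrow>
      lift4 a v $ l / lift4 a v $ j = lift4 a w $ l / lift4 a w $ j \<Longrightarrow>
      \<exists>s. lift4 a w = s *s lift4 a v"
proof -
  \<comment> \<open>\<open>F\<close> vanishes on the punctured line through \<open>y\<close>, hence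
    so does its radial derivative. Consequently \<open>i\<close> cannot be the only index of a
    nonzero coordinate of \<open>y\<close>, which provides the chart index \<open>j\<close>.\<close>
  have euler: "(\<Sum>r\<in>UNIV. G r y * y $ r) = 0"
  proof -
    have "((\<lambda>s. F (s *s y)) has_derivative (\<lambda>e. \<Sum>r\<in>UNIV. G r (1 *s y) * (e *s y) $ r)) (at 1)"
    proof (rule has_derivative_compose[of "\<lambda>s. s *s y" "\<lambda>e. e *s y"])
      show "((\<lambda>s. s *s y) has_derivative (\<lambda>e. e *s y)) (at 1)"
        by (rule has_derivative_vec_lambda) (auto intro!: derivative_eq_intros)
    qed (rule G)
    moreover have "((\<lambda>s. F (s *s y)) has_derivative (\<lambda>e. 0)) (at 1)"
    proof (rule has_derivative_transform_within_open[of "\<lambda>_. 0" _ _ _ "- {0}"])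
      show "0 = F (s *s y)" if "s \<in> - {0}" for s
        using Z[OF v0(1), of "s * c"] that y by (simp add: vector_smult_assoc)
    qed auto
    ultimately have "(\<lambda>e. \<Sum>r\<in>UNIV. G r (1 *s y) * (e *s y) $ r) = (\<lambda>e. 0)"
      by (rule has_derivative_unique)
    from fun_cong[OF this, of 1] show ?thesis by simp
  qed
  have "y \<noteq> 0" using y v0 by simp
  have "\<exists>j. j \<noteq> i \<and> y $ j \<noteq> 0"
  proof (rule ccontr)
    assume "\<not> ?thesis"
    then have z: "y $ j = 0" if "j \<noteq> i" for j using that by blast
    then have "(\<Sum>r\<in>UNIV. G r y * y $ r) = (\<Sum>r\<in>{i}. G r y * y $ r)"
      by (intro sum.mono_neutral_right) auto
    then have "y $ i = 0" using euler nz by simp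
    then have "y = 0" using z by (metis vec_eq_iff zero_index)
    then show False using \<open>y \<noteq> 0\<close> by simp
  qed
  then obtain j where j: "j \<noteq> i" "y $ j \<noteq> 0" by blast
  obtain l where l: "l \<noteq> i" "l \<noteq> j" "\<And>r. r = i \<or> r = j \<or> r = l"
    using third_index j(1) by blast
  define Y where "Y p q = (\<chi> r. if r = j then y $ j else if r = i then p else q)" for p q
  have Yy: "Y (y $ i) (y $ l) = y" using l by (auto simp: vec_eq_iff Y_def)
  define g where "g = G i y"
  obtain D where D: "D > 0" "\<And>v. dist v y < D \<Longrightarrow> dist (G i v) g < norm g / 2"
    using G(1)[of i] nz unfolding continuous_on_iff g_def
    by (metis UNIV_I half_gt_zero zero_less_norm_iff)
  have near: "norm (G i (Y p q) - g) \<le> norm g / 2" if "norm (p - y $ i) < D / 2" "norm (q - y $ l) < D / 2" for p q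
  proof -
    have "norm (Y p q - y) \<le> (\<Sum>r\<in>UNIV. norm ((Y p q - y) $ r))" by (rule norm_vec_le_sum)
    also have "\<dots> = (\<Sum>r\<in>{i, l}. norm ((Y p q - y) $ r))"
      using l by (intro sum.mono_neutral_right) (auto simp: Y_def)
    also have "\<dots> = norm (p - y $ i) + norm (q - y $ l)" using l j by (simp add: Y_def)
    also have "\<dots> < D" using that by simp
    finally show ?thesis using D(2)[of "Y p q"] by (simp add: dist_norm)
  qed
  have der: "((\<lambda>p. F (Y p q)) has_field_derivative G i (Y p q)) (at p)" for p q
  proof -
    have "((\<lambda>p. F (Y p q)) has_derivative (\<lambda>e. \<Sum>r\<in>UNIV. G r (Y p q) * (\<chi> r. if r = i then e else 0) $ r)) (at p)"
    proof (rule has_derivative_compose[of "\<lambda>p. Y p q" "\<lambda>e. \<chi> r. if r = i then e else 0"])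
      show "((\<lambda>p. Y p q) has_derivative (\<lambda>e. \<chi> r. if r = i then e else 0)) (at p)"
      proof (rule has_derivative_vec_lambda)
        fix r show "((\<lambda>p. Y p q $ r) has_derivative (\<lambda>e. (\<chi> r. if r = i then e else 0) $ r)) (at p)"
          using j by (cases "r = j"; cases "r = i") (simp_all add: Y_def)
      qed
    qed (rule G)
    also have "(\<lambda>e. \<Sum>r\<in>UNIV. G r (Y p q) * (\<chi> r. if r = i then e else 0) $ r) = (*) (G i (Y p q))"
      by (simp add: fun_eq_iff if_distrib[of "(*) _"] cong: if_cong)
    finally show ?thesis by (simp add: has_field_derivative_def)
  qed
  have uniq: "p = p'" if p: "norm (p - y $ i) < D / 2" "norm (p' - y $ i) < D / 2" "norm (q - y $ l) < D / 2"
    and F0: "F (Y p q) = 0" "F (Y p' q) = 0" for p p' q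
  proof -
    \<comment> \<open>After subtracting the linear part the derivative is at most half of
      \<open>norm g\<close>; two zeros of \<open>F\<close> on the same slice then give
      \<open>norm g * norm (p - p')\<close> at most half of itself.\<close>
    have "norm ((F (Y p q) - g * p) - (F (Y p' q) - g * p')) \<le> norm g / 2 * norm (p - p')"
    proof (rule field_differentiable_bound[of "ball (y $ i) (D / 2)" _ "\<lambda>p. G i (Y p q) - g"])
      fix p assume "p \<in> ball (y $ i) (D / 2)"
      then have "norm (p - y $ i) < D / 2" by (simp add: dist_norm norm_minus_commute)
      then show "norm (G i (Y p q) - g) \<le> norm g / 2" using near p(3) by blast
      show "((\<lambda>p. F (Y p q) - g * p) has_field_derivative G i (Y p q) - g) (at p within ball (y $ i) (D / 2))"
        by (rule has_field_derivative_at_within) (auto intro!: derivative_eq_intros der)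
    qed (use p in \<open>auto simp: dist_norm norm_minus_commute\<close>)
    also have "(F (Y p q) - g * p) - (F (Y p' q) - g * p') = - (g * (p - p'))" using F0 by (simp add: algebra_simps)
    finally have "norm g * norm (p - p') \<le> norm g / 2 * norm (p - p')" by (simp add: norm_mult)
    then have "norm g * norm (p - p') \<le> 0" by simp
    then show ?thesis using nz by (simp add: g_def mult_le_0_iff)
  qed
  show ?thesis
  proof (rule that[of j l "D / 2"])
    fix v w
    assume vw: "v \<noteq> 0" "w \<noteq> 0" "lift4 a v $ j \<noteq> 0" "lift4 a w $ j \<noteq> 0"
      and n: "norm ((y $ j / lift4 a v $ j) *s lift4 a v - y) < D / 2"
        "norm ((y $ j / lift4 a w $ j) *s lift4 a w - y) < D / 2"
      and e: "lift4 a v $ l / lift4 a v $ j = lift4 a w $ l / lift4 a w $ j"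
    define S where "S v = (y $ j / lift4 a v $ j) *s lift4 a v" for v
    have SY: "S v = Y (S v $ i) (S v $ l)" if "lift4 a v $ j \<noteq> 0" for v
      unfolding vec_eq_iff
    proof
      fix r show "S v $ r = Y (S v $ i) (S v $ l) $ r" using l(3)[of r] that j l by (auto simp: Y_def S_def)
    qed
    have F0: "F (S v) = 0" "F (S w) = 0" unfolding S_def using Z vw j by simp_all
    have q: "S w $ l = S v $ l" using arg_cong[OF e, of "(*) (y $ j)"] by (simp add: S_def)
    have "S v $ i = S w $ i"
    proof (rule uniq[of _ _ "S v $ l"])
      have nb: "norm (x $ r - y $ r) < D / 2" if "norm (x - y) < D / 2" for x r
        using Finite_Cartesian_Product.norm_nth_le[of "x - y" r] that by simp
      show "norm (S v $ i - y $ i) < D / 2" "norm (S v $ l - y $ l) < D / 2" "norm (S w $ i - y $ i) < D / 2"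
        unfolding S_def by (rule nb, rule n)+
      show "F (Y (S v $ i) (S v $ l)) = 0" using SY[of v] vw F0 by simp
      show "F (Y (S w $ i) (S v $ l)) = 0" using SY[of w] vw F0 q by simp
    qed
    then have "S w = S v" using SY[of v] SY[of w] vw q by simp
    then have e': "y $ j / lift4 a w $ j * lift4 a w $ r = y $ j / lift4 a v $ j * lift4 a v $ r" for r
      by (auto simp: S_def vec_eq_iff)
    have "lift4 a w = (lift4 a w $ j / lift4 a v $ j) *s lift4 a v"
      unfolding vec_eq_iff
    proof
      fix r show "lift4 a w $ r = ((lift4 a w $ j / lift4 a v $ j) *s lift4 a v) $ r"
        using e'[of r] vw j by (simp add: field_simps)
    qed
    then show "\<exists>s. lift4 a w = s *s lift4 a v" by blast
  qed (use j l D in auto)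
qed

lemma theta_line_derivative:
  "((\<lambda>z. lift4 a (v + z *s w) $ r) has_field_derivative Dtheta 4 a (v + z *s w) w $ r) (at z)"
proof -
  have "((\<lambda>z. lift4 a (v + z *s w)) has_derivative (\<lambda>e. Dtheta 4 a (v + z *s w) (e *s w))) (at z)"
  proof (rule has_derivative_compose[of "\<lambda>z. v + z *s w" "\<lambda>e. e *s w"])
    show "((\<lambda>z. v + z *s w) has_derivative (\<lambda>e. e *s w)) (at z)"
      by (rule has_derivative_vec_lambda) (auto intro!: derivative_eq_intros)
  qed (rule has_derivative_theta)
  then have "((\<lambda>z. lift4 a (v + z *s w) $ r) has_derivative
     (\<lambda>e. (e *s Dtheta 4 a (v + z *s w) w) $ r)) (at z)"
    unfolding Dtheta_scale by (rule has_derivative_compose[OF _ has_derivative_vec_nth])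
  then show ?thesis by (simp add: has_field_derivative_def mult.commute[of _ "Dtheta _ _ _ _ $ _"])
qed

text \<open>Near a smooth point the curve is a graph, so two branches through it would coincide, and a
  singular branch would not be injective. Both would produce infinitely many pairs of points with
  the same image.\<close>

lemma isCont_eventually:
  assumes "isCont f x" "open U" "f x \<in> U"
  shows "\<forall>\<^sub>F z in nhds x. f z \<in> U"
proof -
  have "\<forall>\<^sub>F z in at x. f z \<in> U" using assms unfolding isCont_def tendsto_def by blast
  then have "\<forall>\<^sub>F z in nhds x. z \<noteq> x \<longrightarrow> f z \<in> U" by (simp add: eventually_at_filter)
  then show ?thesis by (rule eventually_mono) (use assms in auto)
qed

text \<open>The quotient \<open>f\<close> of two coordinates along the branch at \<open>v0\<close>
  serves as a local parameter on the curve. It is open because it is not constant, and its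
  derivative at 0 detects whether the branch is immersed in this chart.\<close>

lemma smooth_local:
  assumes reg: "regular a" and d: "det2 v0 v1 \<noteq> 0" and y: "y = c *s lift4 a v0" "c \<noteq> 0"
    and j: "y $ j \<noteq> 0" "j \<noteq> l" and e: "e > 0"
  defines "f \<equiv> \<lambda>z. lift4 a (v0 + z *s v1) $ l / lift4 a (v0 + z *s v1) $ j"
  obtains r where "r > 0" "\<And>z. norm z < r \<Longrightarrow> lift4 a (v0 + z *s v1) $ j \<noteq> 0"
    "\<And>z. norm z < r \<Longrightarrow> norm ((y $ j / lift4 a (v0 + z *s v1) $ j) *s lift4 a (v0 + z *s v1) - y) < e"
    "\<And>z. v0 + z *s v1 \<noteq> 0"
    "\<And>s. 0 < s \<Longrightarrow> s \<le> r \<Longrightarrow> f holomorphic_on ball 0 s \<and> open (f ` ball 0 s)"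
    "f 0 = y $ l / y $ j"
    "(f has_field_derivative (Dtheta 4 a v0 v1 $ l * lift4 a v0 $ j - lift4 a v0 $ l * Dtheta 4 a v0 v1 $ j) /
       (lift4 a v0 $ j * lift4 a v0 $ j)) (at 0)"
proof -
  define T where "T r z = lift4 a (v0 + z *s v1) $ r" for r z
  have Tder: "(T r has_field_derivative Dtheta 4 a (v0 + z *s v1) v1 $ r) (at z)" for r z
    unfolding T_def by (rule theta_line_derivative)
  have Tcont: "isCont (T r) z" for r z using Tder DERIV_isCont by blast
  have j0: "T j 0 \<noteq> 0" using y j by (auto simp: T_def)
  define S where "S z = (\<Sum>r\<in>UNIV. norm (y $ j / T j z * T r z - y $ r))" for z
  have "isCont S 0" unfolding S_def using j0 by (intro continuous_intros Tcont)
  moreover have "S 0 = 0" using y j0 by (simp add: S_def T_def)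
  ultimately have "\<forall>\<^sub>F z in nhds 0. S z < e"
    using e isCont_eventually[of 0 S "{..<e}"] by simp
  moreover have "\<forall>\<^sub>F z in nhds 0. T j z \<noteq> 0"
    using isCont_eventually[OF Tcont[of 0 j], of "- {0}"] j0 by (simp add: open_Compl)
  ultimately have "\<forall>\<^sub>F z in nhds 0. S z < e \<and> T j z \<noteq> 0" by (rule eventually_conj)
  then obtain r where r: "r > 0" "\<And>z. dist z 0 < r \<Longrightarrow> S z < e \<and> T j z \<noteq> 0"
    unfolding eventually_nhds_metric by blast
  show ?thesis
  proof (rule that[OF r(1)])
    show Tj: "lift4 a (v0 + z *s v1) $ j \<noteq> 0" if "norm z < r" for z
      using r(2)[of z] that by (simp add: T_def)
    show "norm ((y $ j / lift4 a (v0 + z *s v1) $ j) *s lift4 a (v0 + z *s v1) - y) < e" if "norm z < r" for z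
    proof -
      have "norm ((y $ j / lift4 a (v0 + z *s v1) $ j) *s lift4 a (v0 + z *s v1) - y) \<le> S z"
        by (rule order_trans[OF norm_vec_le_sum]) (simp add: S_def T_def)
      then show ?thesis using r(2)[of z] that by simp
    qed
    show "v0 + z *s v1 \<noteq> 0" for z
    proof
      assume "v0 + z *s v1 = 0"
      then have "det2 (v0 + z *s v1) v1 = 0" by (simp add: det2_def)
      moreover have "det2 (v0 + z *s v1) v1 = det2 v0 v1" by (simp add: det2_def algebra_simps)
      ultimately show False using d by simp
    qed
    show "f 0 = y $ l / y $ j" using y j0 by (simp add: f_def T_def)
    show "(f has_field_derivative (Dtheta 4 a v0 v1 $ l * lift4 a v0 $ j - lift4 a v0 $ l * Dtheta 4 a v0 v1 $ j) /
       (lift4 a v0 $ j * lift4 a v0 $ j)) (at 0)"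
      using DERIV_divide[OF Tder[of l 0] Tder[of j 0] j0] by (simp add: f_def T_def)
    fix s assume s: "0 < s" "s \<le> r"
    have hol: "f holomorphic_on ball 0 s"
    proof -
      have hT: "T r holomorphic_on ball 0 s" for r
        using Tder by (meson field_differentiable_at_within field_differentiable_def holomorphic_on_def)
      have "(\<lambda>z. T l z / T j z) holomorphic_on ball 0 s"
        by (rule holomorphic_on_divide[OF hT hT]) (use s Tj in \<open>auto simp: T_def\<close>)
      then show ?thesis by (simp add: f_def T_def)
    qed
    moreover have "\<not> f constant_on ball 0 s"
    proof
      assume "f constant_on ball 0 s"
      then obtain q where q: "\<And>z. z \<in> ball 0 s \<Longrightarrow> f z = q" unfolding constant_on_def by blast
      \<comment> \<open>If the quotient were constantly \<open>q\<close>, infinitely many points of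
        the branch would lie on the line where coordinate \<open>l\<close> is \<open>q\<close> times
        coordinate \<open>j\<close>.\<close>
      define m where "m = axis l 1 - q *s axis j (1 :: complex)"
      have "m $ l = 1" using j by (simp add: m_def axis_def)
      then have "m \<noteq> 0" by auto
      then have fin: "finite {z. lin m (lift4 a (v0 + z *s v1)) = 0}" by (rule finite_zeros_lin[OF reg _ d])
      have "lin m (lift4 a (v0 + z *s v1)) = 0" if "z \<in> ball 0 s" for z
      proof -
        have "T l z = q * T j z" using q[OF that] Tj[of z] that s by (simp add: f_def T_def field_simps)
        moreover have "lin m x = x $ l - q * x $ j" for x
          by (simp add: m_def lin_def axis_def left_diff_distrib sum_subtractf if_distrib[of "\<lambda>t. t * _"] if_distrib[of "\<lambda>t. _ * t"] cong: if_cong)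
        ultimately show ?thesis by (simp add: T_def)
      qed
      then have "finite (ball (0 :: complex) s)" using fin by (meson finite_subset mem_Collect_eq subsetI)
      then show False using s uncountable_ball[of s 0] countable_finite by blast
    qed
    ultimately have "open (f ` ball 0 s)" by (intro open_mapping_thm[of f "ball 0 s"]) auto
    with hol show "f holomorphic_on ball 0 s \<and> open (f ` ball 0 s)" by simp
  qed
qed

lemma smooth_no_pair:
  assumes reg: "regular a" and G: "\<And>i. continuous_on UNIV (G i)"
    "\<And>v. (F has_derivative (\<lambda>h. \<Sum>i\<in>UNIV. G i v * h $ i)) (at v)"
    and Z: "\<And>v s. v \<noteq> 0 \<Longrightarrow> s \<noteq> 0 \<Longrightarrow> F (s *s lift4 a v) = (0 :: complex)"
    and y: "y = c *s lift4 a v0" "c \<noteq> 0" and nz: "G i y \<noteq> 0" and d: "det2 v0 w0 \<noteq> 0"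
  shows "lift4 a w0 \<noteq> t *s lift4 a v0"
proof
  assume t: "lift4 a w0 = t *s lift4 a v0"
  have vw: "v0 \<noteq> 0" "w0 \<noteq> 0" using d by (auto simp: det2_def)
  have t0: "t \<noteq> 0" using t regularD[OF reg vw(2)] by auto
  obtain K where K: "finite K" "0 \<notin> K" "\<And>k l. deg a k l \<Longrightarrow> \<exists>k'\<in>K. \<exists>c. k = c *s k'"
    by (rule finite_kernels[OF reg]) (rule that)
  have K': "\<forall>k l. deg a k l \<longrightarrow> (\<exists>k'\<in>K. \<exists>c. k = c *s k')" using K(3) by blast
  obtain j l e where j: "y $ j \<noteq> 0" "j \<noteq> l" "e > 0" and chart:
    "\<And>v w. v \<noteq> 0 \<Longrightarrow> w \<noteq> 0 \<Longrightarrow> lift4 a v $ j \<noteq> 0 \<Longrightarrow> lift4 a w $ j \<noteq> 0 \<Longrightarrow>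
      norm ((y $ j / lift4 a v $ j) *s lift4 a v - y) < e \<Longrightarrow>
      norm ((y $ j / lift4 a w $ j) *s lift4 a w - y) < e \<Longrightarrow>
      lift4 a v $ l / lift4 a v $ j = lift4 a w $ l / lift4 a w $ j \<Longrightarrow>
      \<exists>s. lift4 a w = s *s lift4 a v"
    by (rule smooth_chart[OF G Z vw(1) regularD[OF reg vw(1)] y nz]) blast+
  obtain v1 where v1: "det2 v0 v1 = 1" using det2_complement[OF vw(1)] by blast
  obtain w1 where w1: "det2 w0 w1 = 1" using det2_complement[OF vw(2)] by blast
  have d1: "det2 v0 v1 \<noteq> 0" and d2: "det2 w0 w1 \<noteq> 0" by (simp_all add: v1 w1)
  have y': "y = (c / t) *s lift4 a w0" "c / t \<noteq> 0" using y t t0 by simp_all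
  define f where "f z = lift4 a (v0 + z *s v1) $ l / lift4 a (v0 + z *s v1) $ j" for z
  define g where "g z = lift4 a (w0 + z *s w1) $ l / lift4 a (w0 + z *s w1) $ j" for z
  obtain r where r: "r > 0" "\<And>z. norm z < r \<Longrightarrow> lift4 a (v0 + z *s v1) $ j \<noteq> 0"
    "\<And>z. norm z < r \<Longrightarrow> norm ((y $ j / lift4 a (v0 + z *s v1) $ j) *s lift4 a (v0 + z *s v1) - y) < e"
    "\<And>z. v0 + z *s v1 \<noteq> 0" "\<And>s. 0 < s \<Longrightarrow> s \<le> r \<Longrightarrow> open (f ` ball 0 s)" "f 0 = y $ l / y $ j"
    by (rule smooth_local[OF reg d1 y j, folded f_def]) blast
  obtain r' where r': "r' > 0" "\<And>z. norm z < r' \<Longrightarrow> lift4 a (w0 + z *s w1) $ j \<noteq> 0"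
    "\<And>z. norm z < r' \<Longrightarrow> norm ((y $ j / lift4 a (w0 + z *s w1) $ j) *s lift4 a (w0 + z *s w1) - y) < e"
    "\<And>z. w0 + z *s w1 \<noteq> 0" "\<And>s. 0 < s \<Longrightarrow> s \<le> r' \<Longrightarrow> open (g ` ball 0 s)" "g 0 = y $ l / y $ j"
    by (rule smooth_local[OF reg d2 y' j, folded g_def]) blast
  define D where "D p = det2 (v0 + fst p *s v1) (w0 + snd p *s w1)" for p :: "complex \<times> complex"
  have "isCont D (0, 0)" unfolding D_def det2_def vector_add_component vector_smult_component by (intro continuous_intros)
  moreover have "D (0, 0) \<noteq> 0" using d by (simp add: D_def)
  ultimately have "\<forall>\<^sub>F p in nhds (0, 0). D p \<noteq> 0"
    using isCont_eventually[of "(0, 0)" D "- {0}"] by (simp add: open_Compl)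
  then obtain s where s: "s > 0" "\<And>p. dist p (0, 0) < s \<Longrightarrow> D p \<noteq> 0"
    unfolding eventually_nhds_metric by blast
  have D: "det2 (v0 + z *s v1) (w0 + z' *s w1) \<noteq> 0" if "norm z < s / 2" "norm z' < s / 2" for z z'
  proof -
    have "dist (z, z') (0, 0) = norm (z, z')" by (simp add: dist_norm flip: zero_prod_def)
    also have "\<dots> \<le> norm z + norm z'" by (rule norm_Pair_le)
    also have "\<dots> < s" using that by simp
    finally show ?thesis using s(2)[of "(z, z')"] by (simp add: D_def)
  qed
  define q where "q = min (s / 2) (min r r')"
  have q: "q > 0" "q \<le> r" "q \<le> r'" "q \<le> s / 2" using r r' s by (auto simp: q_def)
  define X where "X = (\<Union>k\<in>K. {z. qf k (v0 + z *s v1) = 0})"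
  have "finite X" unfolding X_def using K(1,2) v1 by (intro finite_UN_I finite_zeros_qf) auto
  \<comment> \<open>A value common to both branches comes from a pair of distinct points with the
    same image, hence from one of the finitely many roots collected in \<open>X\<close>. But two
    open sets sharing the value at 0 have uncountable intersection.\<close>
  have "f ` ball 0 q \<inter> g ` ball 0 q \<subseteq> f ` X"
  proof
    fix x assume "x \<in> f ` ball 0 q \<inter> g ` ball 0 q"
    then obtain z z' where z: "x = f z" "z \<in> ball 0 q" "x = g z'" "z' \<in> ball 0 q" by blast
    have "\<exists>s. lift4 a (w0 + z' *s w1) = s *s lift4 a (v0 + z *s v1)"
      using z q r r' by (intro chart) (auto simp: f_def g_def)
    then obtain s where "lift4 a (w0 + z' *s w1) = s *s lift4 a (v0 + z *s v1)" by blast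
    moreover have "det2 (v0 + z *s v1) (w0 + z' *s w1) \<noteq> 0" using z q by (intro D) auto
    ultimately have "\<exists>k\<in>K. qf k (v0 + z *s v1) = 0" using pair_root[OF reg K'] by blast
    then show "x \<in> f ` X" using z by (auto simp: X_def)
  qed
  then have "finite (f ` ball 0 q \<inter> g ` ball 0 q)" using \<open>finite X\<close> finite_subset by blast
  moreover have "open (f ` ball 0 q \<inter> g ` ball 0 q)" using r(5) r'(5) q by blast
  moreover have "f 0 \<in> f ` ball 0 q \<inter> g ` ball 0 q"
  proof
    show "f 0 \<in> f ` ball 0 q" using q by (intro imageI) simp
    have "g 0 \<in> g ` ball 0 q" using q by (intro imageI) simp
    then show "f 0 \<in> g ` ball 0 q" using r(6) r'(6) by simp
  qed
  ultimately show False
    by (meson countable_finite countable_subset open_contains_ball uncountable_ball)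
qed

lemma smooth_immersion:
  assumes reg: "regular a" and G: "\<And>i. continuous_on UNIV (G i)"
    "\<And>v. (F has_derivative (\<lambda>h. \<Sum>i\<in>UNIV. G i v * h $ i)) (at v)"
    and Z: "\<And>v s. v \<noteq> 0 \<Longrightarrow> s \<noteq> 0 \<Longrightarrow> F (s *s lift4 a v) = (0 :: complex)"
    and y: "y = c *s lift4 a v0" "c \<noteq> 0" and nz: "G i y \<noteq> 0" and d: "det2 v0 v1 \<noteq> 0"
  shows "Dtheta 4 a v0 v1 \<noteq> t *s lift4 a v0"
proof
  assume t: "Dtheta 4 a v0 v1 = t *s lift4 a v0"
  have v0: "v0 \<noteq> 0" using d by (auto simp: det2_def)
  obtain K where K: "finite K" "0 \<notin> K" "\<And>k l. deg a k l \<Longrightarrow> \<exists>k'\<in>K. \<exists>c. k = c *s k'"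
    by (rule finite_kernels[OF reg]) (rule that)
  have K': "\<forall>k l. deg a k l \<longrightarrow> (\<exists>k'\<in>K. \<exists>c. k = c *s k')" using K(3) by blast
  obtain j l e where j: "y $ j \<noteq> 0" "j \<noteq> l" "e > 0" and chart:
    "\<And>v w. v \<noteq> 0 \<Longrightarrow> w \<noteq> 0 \<Longrightarrow> lift4 a v $ j \<noteq> 0 \<Longrightarrow> lift4 a w $ j \<noteq> 0 \<Longrightarrow>
      norm ((y $ j / lift4 a v $ j) *s lift4 a v - y) < e \<Longrightarrow>
      norm ((y $ j / lift4 a w $ j) *s lift4 a w - y) < e \<Longrightarrow>
      lift4 a v $ l / lift4 a v $ j = lift4 a w $ l / lift4 a w $ j \<Longrightarrow>
      \<exists>s. lift4 a w = s *s lift4 a v"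
    by (rule smooth_chart[OF G Z v0 regularD[OF reg v0] y nz]) blast+
  define f where "f z = lift4 a (v0 + z *s v1) $ l / lift4 a (v0 + z *s v1) $ j" for z
  obtain r where r: "r > 0" "\<And>z. norm z < r \<Longrightarrow> lift4 a (v0 + z *s v1) $ j \<noteq> 0"
    "\<And>z. norm z < r \<Longrightarrow> norm ((y $ j / lift4 a (v0 + z *s v1) $ j) *s lift4 a (v0 + z *s v1) - y) < e"
    "\<And>z. v0 + z *s v1 \<noteq> 0" "\<And>s. 0 < s \<Longrightarrow> s \<le> r \<Longrightarrow> f holomorphic_on ball 0 s"
    "(f has_field_derivative (Dtheta 4 a v0 v1 $ l * lift4 a v0 $ j - lift4 a v0 $ l * Dtheta 4 a v0 v1 $ j) /
       (lift4 a v0 $ j * lift4 a v0 $ j)) (at 0)"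
    by (rule smooth_local[OF reg d y j, folded f_def]) blast
  \<comment> \<open>Proportionality of the derivative to the point kills the numerator of the
    quotient rule.\<close>
  have df: "deriv f 0 = 0" using DERIV_imp_deriv[OF r(6)] by (simp add: t)
  define X where "X = (\<Union>k\<in>K. {z. qf k (v0 + z *s v1) = 0})"
  have "finite X" unfolding X_def using K(1,2) d by (intro finite_UN_I finite_zeros_qf) auto
  then obtain s where s: "s > 0" "\<And>x. x \<in> X \<Longrightarrow> x \<noteq> 0 \<Longrightarrow> s \<le> dist 0 x"
    using finite_set_avoid[of X 0] by blast
  define q where "q = min r s"
  have q: "q > 0" "q \<le> r" "q \<le> s" using r s by (auto simp: q_def)
  \<comment> \<open>The disc contains no parameter from \<open>X\<close> except possibly 0, whereas
    equal values at two distinct parameters would put both into \<open>X\<close>. An injective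
    holomorphic function has no critical point.\<close>
  have "inj_on f (ball 0 q)"
  proof (rule inj_onI, rule ccontr)
    fix z z' assume z: "z \<in> ball 0 q" "z' \<in> ball 0 q" "f z = f z'" "z \<noteq> z'"
    have "\<exists>s. lift4 a (v0 + z' *s v1) = s *s lift4 a (v0 + z *s v1)"
      using z q r by (intro chart) (auto simp: f_def)
    then obtain s where "lift4 a (v0 + z' *s v1) = s *s lift4 a (v0 + z *s v1)" by blast
    moreover have "det2 (v0 + z *s v1) (v0 + z' *s v1) = (z' - z) * det2 v0 v1"
      by (simp add: det2_def algebra_simps)
    then have "det2 (v0 + z *s v1) (v0 + z' *s v1) \<noteq> 0" using z d by simp
    ultimately have "(\<exists>k\<in>K. qf k (v0 + z *s v1) = 0) \<and> (\<exists>k\<in>K. qf k (v0 + z' *s v1) = 0)"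
      using pair_root[OF reg K'] by blast
    then have "z \<in> X" "z' \<in> X" by (auto simp: X_def)
    then have "z = 0" "z' = 0" using s(2) z(1,2) q by fastforce+
    then show False using z by simp
  qed
  then have "deriv f 0 \<noteq> 0"
    using holomorphic_injective_imp_regular[of f "ball 0 q" 0] r(5) q by simp
  then show False using df by simp
qed

section \<open>Consequences of nodality\<close>

lemma not_singular_gradient:
  assumes p: "parametrizes 4 a C" and v: "v \<noteq> 0" and ns: "\<not> singular_point 4 C (pt (lift4 a v))"
  obtains F G i y c where "\<And>i. continuous_on UNIV (G i)"
    "\<And>v. (F has_derivative (\<lambda>h. \<Sum>i\<in>UNIV. G i v * h $ i)) (at v)"
    "\<And>v s. v \<noteq> 0 \<Longrightarrow> s \<noteq> 0 \<Longrightarrow> F (s *s lift4 a v) = (0 :: complex)"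
    "y = c *s lift4 a v" "c \<noteq> 0" "G (i :: 3) y \<noteq> (0 :: complex)"
proof -
  obtain F where F: "curve_equation 4 F C" using p by (auto simp: parametrizes_def plane_curve_def)
  then have tf: "ternary_form 4 F" by (simp add: curve_equation_def)
  obtain G where G: "\<And>i. continuous_on UNIV (G i)"
    "\<And>v. (F has_derivative (\<lambda>h. \<Sum>i\<in>UNIV. G i v * h $ i)) (at v)"
    by (rule ternary_form_gradient[OF tf]) (rule that)
  have inC: "pt (lift4 a v) \<in> C" if "v \<noteq> 0" for v
  proof -
    have "Ctheta 4 a (pt v) \<in> Ctheta 4 a ` CP" using that by (intro imageI) (simp add: pt_in_CP)
    then show ?thesis using p by (simp add: parametrizes_def Ctheta_pt)
  qed
  have Z: "F (s *s lift4 a v) = 0" if "v \<noteq> 0" "s \<noteq> 0" for v s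
  proof -
    have "pt (lift4 a v) \<in> zero_locus F" using inC[OF that(1)] F by (simp add: curve_equation_def)
    moreover have "s *s lift4 a v \<in> pt (lift4 a v)" using that by (auto simp: mem_pt)
    ultimately show ?thesis by (simp add: zero_locus_def)
  qed
  obtain y where y: "y \<in> pt (lift4 a v)" "\<not> (F has_derivative (\<lambda>_. 0)) (at y)"
    using ns F inC[OF v] unfolding singular_point_def by blast
  then obtain c where c: "c \<noteq> 0" "y = c *s lift4 a v" by (auto simp: mem_pt)
  have "\<exists>i. G i y \<noteq> 0"
  proof (rule ccontr)
    assume "\<nexists>i. G i y \<noteq> 0"
    then show False using G(2)[of y] y(2) by simp
  qed
  then show ?thesis using that[OF G Z c(2,1)] by blast
qed

lemma common_normal:
  fixes x y :: "complex ^ 3"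
  obtains m where "m \<noteq> 0" "lin m x = 0" "lin m y = 0"
proof -
  define A :: "complex ^ 3 ^ 3" where "A = vector [x, y, 0]"
  have "det A = 0" by (simp add: det_3 A_def)
  then have "\<not> invertible A" by (simp add: invertible_det_nz)
  then obtain m where m: "m \<noteq> 0" "A *v m = 0"
    using invertible_left_inverse matrix_left_invertible_ker by metis
  have "(A *v m) $ 1 = lin m x" "(A *v m) $ 2 = lin m y"
    by (simp_all add: matrix_vector_mult_def lin_def A_def mult.commute)
  then show ?thesis using that[of m] m by simp
qed

lemma not_transversal:
  assumes "m \<noteq> 0" "\<And>h. lin m (Dtheta d a v h) = 0" "\<And>h. lin m (Dtheta d a w h) = 0" "v \<in> P" "w \<in> Q"
  shows "\<not> transversal_branches d a P Q"
proof
  assume "transversal_branches d a P Q"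
  then have U: "{y + z | y z. y \<in> tangent_cone d a v \<and> z \<in> tangent_cone d a w} = UNIV"
    using assms unfolding transversal_branches_def by blast
  have "lin m x = 0" for x
  proof -
    have "x \<in> {y + z | y z. y \<in> tangent_cone d a v \<and> z \<in> tangent_cone d a w}" using U by simp
    then show ?thesis using assms(2,3) by (auto simp: tangent_cone_eq lin_add)
  qed
  then show False using assms(1) lin_eq_0 by blast
qed

text \<open>Nodality says something only at singular points; at a smooth point the pair itself is
  impossible.\<close>

lemma nodal_pair:
  assumes n: "nodal a C" and d: "det2 v w \<noteq> 0" and e: "lift4 a w = t *s lift4 a v"
  shows "node 4 a (pt (lift4 a v))"
proof (rule ccontr)
  assume "\<not> node 4 a (pt (lift4 a v))"
  then have ns: "\<not> singular_point 4 C (pt (lift4 a v))" and p: "parametrizes 4 a C"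
    using n unfolding nodal_parametrization_def by blast+
  have reg: "regular a" by (rule regular_of_parametrizes[OF p])
  have v: "v \<noteq> 0" using d by (auto simp: det2_def)
  show False
    by (rule not_singular_gradient[OF p v ns]) (use smooth_no_pair[OF reg] d e in blast)
qed

text \<open>A non-immersed branch has only a line as tangent cone. At a node that line already lies
  in the cone of the other branch, so the two cannot span the space; at a smooth point the local
  argument applies.\<close>

lemma nodal_immersion:
  assumes n: "nodal a C" and d: "det2 v w \<noteq> 0"
  shows "Dtheta 4 a v w \<noteq> t *s lift4 a v"
proof
  assume e: "Dtheta 4 a v w = t *s lift4 a v"
  have p: "parametrizes 4 a C" using n unfolding nodal_parametrization_def by blast
  have reg: "regular a" by (rule regular_of_parametrizes[OF p])
  have v: "v \<noteq> 0" using d by (auto simp: det2_def)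
  show False
  proof (cases "singular_point 4 C (pt (lift4 a v))")
    case True
    then obtain P Q where PQ: "P \<noteq> Q" "preimages 4 a (pt (lift4 a v)) = {P, Q}" "transversal_branches 4 a P Q"
      using n unfolding nodal_parametrization_def node_def by metis
    have Dv: "Dtheta 4 a v h = (4 * (det2 h w / det2 v w) + det2 v h / det2 v w * t) *s lift4 a v" for h
    proof -
      have "Dtheta 4 a v h = Dtheta 4 a v ((det2 h w / det2 v w) *s v + (det2 v h / det2 v w) *s w)"
        using det2_decomp[OF d] by metis
      also have "\<dots> = (det2 h w / det2 v w) *s (4 *s lift4 a v) + (det2 v h / det2 v w) *s (t *s lift4 a v)"
        by (simp only: Dtheta_add Dtheta_scale euler_theta e) simp
      also have "\<dots> = (4 * (det2 h w / det2 v w) + det2 v h / det2 v w * t) *s lift4 a v"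
        by (simp add: vec_eq_iff ring_distribs)
      finally show ?thesis .
    qed
    have tr: False if R: "R \<in> preimages 4 a (pt (lift4 a v))"
      "transversal_branches 4 a (pt v) R \<or> transversal_branches 4 a R (pt v)" for R
    proof -
      obtain u where u: "u \<noteq> 0" "R = pt u" "pt (lift4 a v) = pt (lift4 a u)"
        using R(1) by (rule preimages_cases)
      then obtain s where s: "lift4 a u = s *s lift4 a v" unfolding pt_eq_iff by blast
      obtain u' where u': "det2 u u' = 1" using det2_complement[OF u(1)] by blast
      \<comment> \<open>The plane through the image point and one tangent vector of the other branch
        contains both cones; \<open>m\<close> is its equation.\<close>
      obtain m where m: "m \<noteq> 0" "lin m (lift4 a v) = 0" "lin m (Dtheta 4 a u u') = 0"
        by (rule common_normal)
      have "lin m (Dtheta 4 a v h) = 0" for h by (simp add: Dv lin_scale lin_add m)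
      moreover have "lin m (Dtheta 4 a u h) = 0" for h
      proof -
        have "Dtheta 4 a u h = Dtheta 4 a u ((det2 h u' / det2 u u') *s u + (det2 u h / det2 u u') *s u')"
          using det2_decomp[of u u' h] u' by simp
        also have "\<dots> = (det2 h u' / det2 u u') *s (4 *s (s *s lift4 a v)) + (det2 u h / det2 u u') *s Dtheta 4 a u u'"
          by (simp only: Dtheta_add Dtheta_scale euler_theta s) simp
        finally show ?thesis by (simp add: lin_add lin_scale m)
      qed
      ultimately show False using not_transversal[OF m(1)] R(2) pt_self u(2) by metis
    qed
    have "pt v \<in> preimages 4 a (pt (lift4 a v))" using v by (simp add: pt_in_preimages)
    then have "pt v = P \<or> pt v = Q" using PQ(2) by simp
    then show False using tr[of P] tr[of Q] PQ by auto
  next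
    case False
    show False
      by (rule not_singular_gradient[OF p v False]) (use smooth_immersion[OF reg] d e in blast)
  qed
qed

section \<open>The three nodes\<close>

definition crit :: "(nat \<Rightarrow> real ^ 3) \<Rightarrow> complex ^ 3 \<Rightarrow> bool" where
  "crit a k \<longleftrightarrow> (\<exists>l. deg a k l)"

lemma crit_nonzero: "crit a k \<Longrightarrow> k \<noteq> 0"
  by (auto simp: crit_def deg_def)

lemma qker_scale: "c \<noteq> 0 \<Longrightarrow> qker (c *s k) l \<longleftrightarrow> qker k l"
proof -
  assume c: "c \<noteq> 0"
  have "(c *s k) $ 3 * x + (c *s k) $ 2 * y + (c *s k) $ 1 * z = 0 \<longleftrightarrow>
    k $ 3 * x + k $ 2 * y + k $ 1 * z = 0" for x y z
  proof -
    have "(c *s k) $ 3 * x + (c *s k) $ 2 * y + (c *s k) $ 1 * z = c * (k $ 3 * x + k $ 2 * y + k $ 1 * z)"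
      by (simp add: algebra_simps)
    then show ?thesis using c by simp
  qed
  then show ?thesis by (simp only: qker_def)
qed

lemma crit_scale: "c \<noteq> 0 \<Longrightarrow> crit a k \<Longrightarrow> crit a (c *s k)"
  by (auto simp: crit_def deg_def qker_scale)

lemma lq_scale: "lq (c *s v) w = c *s lq v w" "lq v (c *s w) = c *s lq v w"
  by (rule vec3_eqI; simp add: lq_nth algebra_simps)+

lemma node_two_preimages:
  assumes n: "node d a x" and "pt v \<in> preimages d a x" "pt w \<in> preimages d a x" "pt u \<in> preimages d a x"
    and d: "det2 v w \<noteq> 0"
  shows "det2 v u = 0 \<or> det2 w u = 0"
proof -
  obtain P Q where PQ: "preimages d a x = {P, Q}" using n unfolding node_def by blast
  have nz: "v \<noteq> 0" "w \<noteq> 0" "u \<noteq> 0" using assms pt_in_preimages by blast+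
  have "pt v \<noteq> pt w" using pt_eq_det2 nz d by blast
  then have "pt v = pt u \<or> pt w = pt u" using assms(2-4) unfolding PQ by auto
  then show ?thesis using pt_eq_det2 nz by blast
qed

text \<open>A double root of the kernel would turn the functional into a relation between point and
  derivative, i.e. a cusp, against immersivity. With distinct roots the functional is a combination
  of two evaluations and identifies their images.\<close>

lemma crit_roots:
  assumes n: "nodal a C" and d: "deg a k l"
  obtains v w x where "det2 v w \<noteq> 0" "k = lq v w" "x \<noteq> 0" "lift4 a w = x *s lift4 a v"
proof -
  have p: "parametrizes 4 a C" using n unfolding nodal_parametrization_def by blast
  have reg: "regular a" by (rule regular_of_parametrizes[OF p])
  obtain v w where vw: "v \<noteq> 0" "w \<noteq> 0" "k = lq v w" by (rule qf_factor[OF degD(3)[OF d]])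
  have dd: "det2 v w \<noteq> 0"
  proof
    assume "det2 v w = 0"
    then obtain c where c: "w = c *s v" using det2_prop vw by blast
    then have "c \<noteq> 0" using vw by auto
    then have q: "qker (lq v v) l" using degD(4)[OF d] qker_scale[of c "lq v v"] by (simp add: vw c lq_scale)
    obtain v' where v': "det2 v v' = 1" using det2_complement[OF vw(1)] by blast
    obtain x y where xy: "\<And>m. pr l (prow a m) = lin m (x *s Dtheta 4 a v v' + y *s lift4 a v)"
      "x = 0 \<Longrightarrow> y = 0 \<Longrightarrow> \<forall>n\<le>4. l n = 0" using qker_one_point[OF q v'] by blast
    have z: "x *s Dtheta 4 a v v' + y *s lift4 a v = 0"
      by (rule lin_all_eqI) (use degD(1)[OF d] in \<open>simp add: xy(1)[symmetric] ann_def lin_zero\<close>)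
    have "x = 0"
    proof (rule ccontr)
      assume x: "x \<noteq> 0"
      have "Dtheta 4 a v v' = (- y / x) *s lift4 a v"
        unfolding vec_eq_iff
      proof
        fix i
        have "x * Dtheta 4 a v v' $ i + y * lift4 a v $ i = 0" using z by (simp add: vec_eq_iff)
        then show "Dtheta 4 a v v' $ i = ((- y / x) *s lift4 a v) $ i"
          using x by (simp add: field_simps eq_neg_iff_add_eq_0)
      qed
      moreover have "det2 v v' \<noteq> 0" using v' by simp
      ultimately show False using nodal_immersion[OF n, of v v' "- y / x"] by blast
    qed
    then have "y = 0" using z regularD[OF reg vw(1)] by simp
    then have "\<forall>n\<le>4. l n = 0" using xy(2) \<open>x = 0\<close> by blast
    then show False using degD(2)[OF d] by (auto simp: nz_def)
  qed
  obtain x y where xy: "\<forall>n\<le>4. l n = x * ev v n + y * ev w n"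
    using qker_two_points[OF degD(4)[OF d, unfolded vw] dd] by blast
  have z: "x *s lift4 a v + y *s lift4 a w = 0"
    using ann_ev_iff[of l x v y w a] xy degD(1)[OF d] by blast
  have y: "y \<noteq> 0"
  proof
    assume "y = 0"
    then have "x = 0" using z regularD[OF reg vw(1)] by simp
    then show False using xy \<open>y = 0\<close> degD(2)[OF d] by (auto simp: nz_def)
  qed
  have "lift4 a w = (- x / y) *s lift4 a v"
    unfolding vec_eq_iff
  proof
    fix i
    have "x * lift4 a v $ i + y * lift4 a w $ i = 0" using z by (simp add: vec_eq_iff)
    then show "lift4 a w $ i = ((- x / y) *s lift4 a v) $ i"
      using y by (simp add: field_simps eq_neg_iff_add_eq_0)
  qed
  moreover then have "- x / y \<noteq> 0" using regularD[OF reg vw(2)] by auto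
  ultimately show ?thesis using that dd vw(3) by blast
qed

text \<open>A line whose pullback is the square of \<open>k\<close> would be tangent to both branches at the node.\<close>

lemma square_notin_W:
  assumes n: "nodal a C" and d: "deg a k l"
  shows "\<not> inW a (qm k k)"
proof
  assume "inW a (qm k k)"
  then obtain m where m: "\<And>v. lin m (lift4 a v) = qf k v * qf k v" by (rule inW_qm) (rule that)
  obtain v w x where vw: "det2 v w \<noteq> 0" "k = lq v w" "x \<noteq> 0" "lift4 a w = x *s lift4 a v"
    by (rule crit_roots[OF n d])
  have nz: "v \<noteq> 0" "w \<noteq> 0" using vw by (auto simp: det2_def)
  have m0: "m \<noteq> 0"
  proof
    assume "m = 0"
    then have "qf k v * qf k v = 0" for v using m[of v] by (simp add: lin_zero)
    then show False using qf_mult_eq_0 degD(3)[OF d] by blast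
  qed
  \<comment> \<open>The pullback of the line \<open>m\<close> is the square of \<open>qf k\<close>,
    so its derivative vanishes at the roots of \<open>k\<close>.\<close>
  have tan: "lin m (Dtheta 4 a u h) = 0" if "qf k u = 0" for u h
  proof -
    have "((\<lambda>u. lin m (lift4 a u)) has_derivative (\<lambda>h. lin m (Dtheta 4 a u h))) (at u)"
    proof -
      have "((\<lambda>u. lift4 a u $ i) has_derivative (\<lambda>h. Dtheta 4 a u h $ i)) (at u)" for i
        by (rule has_derivative_compose[OF has_derivative_theta has_derivative_vec_nth])
      then show ?thesis unfolding lin_def by (intro has_derivative_sum has_derivative_mult_right)
    qed
    moreover have "((\<lambda>u. lin m (lift4 a u)) has_derivative (\<lambda>h. 0)) (at u)"
    proof -
      have "(qf k has_derivative (\<lambda>h. k $ 1 * (2 * u $ 1 * h $ 1) + k $ 2 * (u $ 1 * h $ 2 + h $ 1 * u $ 2) +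
          k $ 3 * (2 * u $ 2 * h $ 2))) (at u)"
        unfolding qf_def by (auto intro!: derivative_eq_intros)
      from has_derivative_mult[OF this this] show ?thesis by (simp add: m that)
    qed
    ultimately have "(\<lambda>h. lin m (Dtheta 4 a u h)) = (\<lambda>h. 0)" by (rule has_derivative_unique)
    then show ?thesis by (rule fun_cong)
  qed
  have "qf k v = 0" "qf k w = 0" unfolding vw qf_lq by (simp_all add: det2_def)
  note t = tan[OF this(1)] tan[OF this(2)]
  have "node 4 a (pt (lift4 a v))" by (rule nodal_pair[OF n vw(1,4)])
  then obtain P Q where PQ: "preimages 4 a (pt (lift4 a v)) = {P, Q}" "transversal_branches 4 a P Q"
    unfolding node_def by blast
  have "pt v \<in> {P, Q}" "pt w \<in> {P, Q}"
    unfolding PQ(1)[symmetric] pt_in_preimages using nz vw(3,4) by (auto simp: pt_scale)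
  moreover have "pt v \<noteq> pt w" using pt_eq_det2[OF nz] vw(1) by blast
  ultimately have "(P = pt v \<and> Q = pt w) \<or> (P = pt w \<and> Q = pt v)" by auto
  then show False using PQ(2) not_transversal[OF m0 t pt_self pt_self] not_transversal[OF m0 t(2,1) pt_self pt_self]
    by blast
qed

lemma pr_square_nonzero:
  assumes n: "nodal a C" and d: "deg a k l" and p: "pencil a l l'"
  shows "pr l' (qm k k) \<noteq> 0"
  using square_notin_W[OF n d] pencilD(5)[OF p] pr_qker degD(4)[OF d] by blast

lemma degI: "ann a l \<Longrightarrow> nz l \<Longrightarrow> hdet l = 0 \<Longrightarrow> \<exists>k. deg a k l"
  using hdet_eq_0_imp_qker by (auto simp: deg_def)

lemma ann_combination: "ann a l \<Longrightarrow> ann a l' \<Longrightarrow> ann a (\<lambda>n. x * l n + y * l' n)"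
proof -
  have "pr (\<lambda>n. x * l n + y * l' n) h = x * pr l h + y * pr l' h" for h by (simp add: pr_simps algebra_simps)
  then show "ann a l \<Longrightarrow> ann a l' \<Longrightarrow> ann a (\<lambda>n. x * l n + y * l' n)" by (simp add: ann_def)
qed

lemma nz_combination: "indep2 l l' \<Longrightarrow> x \<noteq> 0 \<or> y \<noteq> 0 \<Longrightarrow> nz (\<lambda>n. x * l n + y * l' n)"
  unfolding indep2_def nz_def by blast

lemma indep2_combination:
  assumes "indep2 l l'" "x * y' - y * x' \<noteq> 0"
  shows "indep2 (\<lambda>n. x * l n + y * l' n) (\<lambda>n. x' * l n + y' * l' n)"
  unfolding indep2_def
proof (intro allI impI)
  fix s t assume e: "\<forall>n\<le>4. s * (x * l n + y * l' n) + t * (x' * l n + y' * l' n) = 0"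
  have id: "(s * x + t * x') * l n + (s * y + t * y') * l' n = s * (x * l n + y * l' n) + t * (x' * l n + y' * l' n)" for n
    by (simp add: algebra_simps)
  have "\<forall>n\<le>4. (s * x + t * x') * l n + (s * y + t * y') * l' n = 0" unfolding id using e .
  then have "s * x + t * x' = 0" "s * y + t * y' = 0" using assms(1) unfolding indep2_def by blast+
  moreover have "s * (x * y' - y * x') = (s * x + t * x') * y' - (s * y + t * y') * x'"
    "t * (x * y' - y * x') = (s * y + t * y') * x - (s * x + t * x') * y" by (simp_all add: algebra_simps)
  ultimately show "s = 0 \<and> t = 0" using assms(2) by simp
qed

lemma indep2_sym: "indep2 l l' \<Longrightarrow> indep2 l' l"
  unfolding indep2_def by (metis add.commute)

text \<open>The Hankel determinant is a cubic form on the pencil, and by transversality of the branches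
  none of its zeros is multiple.\<close>

lemma three_kernels:
  assumes n: "nodal a C"
  obtains k1 k2 k3 l1 l2 l3 where "deg a k1 l1" "deg a k2 l2" "deg a k3 l3"
    "indep2 l1 l2" "indep2 l1 l3" "indep2 l2 l3"
    "\<And>k. crit a k \<Longrightarrow> \<exists>c. k = c *s k1 \<or> k = c *s k2 \<or> k = c *s k3"
proof -
  have p: "parametrizes 4 a C" using n unfolding nodal_parametrization_def by blast
  have reg: "regular a" by (rule regular_of_parametrizes[OF p])
  obtain u w where uw: "pencil a u w" using regular_pencil[OF reg] by blast
  note uw' = pencilD(1-3)[OF uw]
  \<comment> \<open>A zero of the cubic on the projectivized pencil: either \<open>u\<close>, the
    point at infinity of the chart \<open>x u + w\<close>, or a root of \<open>P\<close>, whose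
    leading coefficient is then nonzero.\<close>
  have "\<exists>l1 l'. hdet l1 = 0 \<and> ann a l1 \<and> ann a l' \<and> indep2 l1 l'"
  proof (cases "hdet u = 0")
    case True
    then show ?thesis using uw' by blast
  next
    case False
    define P where "P = [:hdet w, hmix w u, hmix u w, hdet u:]"
    have "\<exists>x. poly P x = 0" by (rule fundamental_theorem_of_algebra_alt) (use False in \<open>auto simp: P_def\<close>)
    then obtain x where x: "poly P x = 0" by blast
    have "hdet (\<lambda>n. x * u n + 1 * w n) = poly P x"
      unfolding hdet_expand by (simp add: P_def power3_eq_cube algebra_simps)
    moreover have "indep2 (\<lambda>n. x * u n + 1 * w n) (\<lambda>n. 1 * u n + 0 * w n)"
      by (rule indep2_combination[OF uw'(3)]) simp
    then have "indep2 (\<lambda>n. x * u n + 1 * w n) u" by simp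
    ultimately show ?thesis using x ann_combination[OF uw'(1,2), of x 1] uw'(1) by metis
  qed
  then obtain l1 l' where l1: "hdet l1 = 0" "ann a l1" "ann a l'" "indep2 l1 l'" by blast
  have "nz l1" using nz_combination[OF l1(4), of 1 0] by simp
  then obtain k1 where d1: "deg a k1 l1" using degI l1 by blast
  have pl: "pencil a l1 l'" by (rule indep_pencil[OF reg l1(2-4)])
  obtain r where r: "adj_is l1 r k1" using adj_exists degD[OF d1] by blast
  have "r \<noteq> 0" by (rule deg_adj_nonzero[OF reg d1 r])
  then have h1: "hmix l1 l' \<noteq> 0" using pr_square_nonzero[OF n d1 pl] hmix_adj[OF r] by simp
  \<comment> \<open>Since \<open>hdet l1 = 0\<close>, the cubic on the chart
    \<open>x l1 + l'\<close> has degree 2, with leading coefficient nonzero by transversality. A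
    root gives a second zero, distinct from \<open>l1\<close>.\<close>
  define P where "P = [:hdet l', hmix l' l1, hmix l1 l':]"
  have "\<exists>x. poly P x = 0" by (rule fundamental_theorem_of_algebra_alt) (use h1 in \<open>auto simp: P_def\<close>)
  then obtain x where x: "poly P x = 0" by blast
  define l2 where "l2 n = x * l1 n + 1 * l' n" for n
  have "hdet l2 = poly P x"
    unfolding l2_def hdet_expand by (simp add: P_def l1(1) power3_eq_cube algebra_simps)
  moreover have a2: "ann a l2" unfolding l2_def by (rule ann_combination) (rule l1)+
  moreover have "nz l2" unfolding l2_def by (rule nz_combination[OF l1(4)]) simp
  ultimately obtain k2 where d2: "deg a k2 l2" using degI x by metis
  have "indep2 (\<lambda>n. 1 * l1 n + 0 * l' n) l2"
    unfolding l2_def by (rule indep2_combination[OF l1(4)]) simp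
  then have i12: "indep2 l1 l2" by simp
  have p12: "pencil a l1 l2" by (rule indep_pencil[OF reg l1(2) a2 i12])
  have p21: "pencil a l2 l1" by (rule indep_pencil[OF reg a2 l1(2) indep2_sym[OF i12]])
  obtain r2 where r2: "adj_is l2 r2 k2" using adj_exists degD[OF d2] by blast
  have "r2 \<noteq> 0" by (rule deg_adj_nonzero[OF reg d2 r2])
  define A where "A = hmix l1 l2"
  define B where "B = hmix l2 l1"
  have A: "A \<noteq> 0" using pr_square_nonzero[OF n d1 p12] hmix_adj[OF r] \<open>r \<noteq> 0\<close> by (simp add: A_def)
  have B: "B \<noteq> 0" using pr_square_nonzero[OF n d2 p21] hmix_adj[OF r2] \<open>r2 \<noteq> 0\<close> by (simp add: B_def)
  have z12: "hdet l1 = 0" "hdet l2 = 0" using qker_imp_hdet degD[OF d1] degD[OF d2] by blast+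
  have hd: "hdet (\<lambda>n. x * l1 n + y * l2 n) = x * y * (x * A + y * B)" for x y
    unfolding hdet_expand by (simp add: z12 A_def B_def)
  \<comment> \<open>The zero of the remaining factor \<open>x * A + y * B\<close>; it differs from
    \<open>l1\<close> and \<open>l2\<close> because neither \<open>A\<close> nor \<open>B\<close>
    vanishes.\<close>
  define l3 where "l3 n = B * l1 n + (- A) * l2 n" for n
  have a3: "ann a l3" unfolding l3_def by (rule ann_combination) (rule l1 a2)+
  moreover have "nz l3" unfolding l3_def by (rule nz_combination[OF i12]) (use A in simp)
  moreover have "hdet l3 = 0" unfolding l3_def hd by simp
  ultimately obtain k3 where d3: "deg a k3 l3" using degI by metis
  have "indep2 (\<lambda>n. 1 * l1 n + 0 * l2 n) l3" "indep2 (\<lambda>n. 0 * l1 n + 1 * l2 n) l3"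
    unfolding l3_def by (rule indep2_combination[OF i12]; use A B in simp)+
  then have i13: "indep2 l1 l3" "indep2 l2 l3" by simp_all
  have comp: "\<exists>c. q = c *s k1 \<or> q = c *s k2 \<or> q = c *s k3" if "crit a q" for q
  proof -
    obtain m where q: "deg a q m" using \<open>crit a q\<close> unfolding crit_def by blast
    obtain x y where xy: "\<And>n. n \<le> 4 \<Longrightarrow> m n = x * l1 n + y * l2 n"
      using pencilD(4)[OF p12 degD(1)[OF q]] by blast
    have "hdet m = hdet (\<lambda>n. x * l1 n + y * l2 n)" by (simp add: hdet_def xy)
    then have "x * y * (x * A + y * B) = 0" using hd qker_imp_hdet degD(3,4)[OF q] by metis
    then consider "x = 0" | "y = 0" | "x * A + y * B = 0" by auto
    then show ?thesis
    proof cases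
      case 1
      then have "deg a q l2" using deg_scale_l[OF q, of y l2] xy a2 by simp
      then show ?thesis using deg_unique[OF reg d2] by blast
    next
      case 2
      then have "deg a q l1" using deg_scale_l[OF q, of x l1] xy l1(2) by simp
      then show ?thesis using deg_unique[OF reg d1] by blast
    next
      case 3
      define t where "t = - y / A"
      have "x * A = - (y * B)" using 3 by (simp add: eq_neg_iff_add_eq_0)
      then have t: "x = t * B" "y = t * (- A)" using A by (simp_all add: t_def field_simps)
      have "m n = t * l3 n" if "n \<le> 4" for n
        using xy[OF that] by (simp add: l3_def t algebra_simps)
      then have "deg a q l3" using deg_scale_l[OF q] a3 by blast
      then show ?thesis using deg_unique[OF reg d3] by blast
    qed
  qed
  show ?thesis by (rule that[OF d1 d2 d3 i12 i13 comp])
qed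

section \<open>Invariants of real quadratic forms\<close>

text \<open>The polarization of the discriminant b^2 - 4 a c; over the reals it has signature
  (2,1).\<close>

definition bp :: "'a::comm_ring_1 ^ 3 \<Rightarrow> 'a ^ 3 \<Rightarrow> 'a" where
  "bp p q = p $ 2 * q $ 2 - 2 * p $ 1 * q $ 3 - 2 * p $ 3 * q $ 1"

abbreviation disc :: "'a::comm_ring_1 ^ 3 \<Rightarrow> 'a" where
  "disc q \<equiv> bp q q"

text \<open>Four times the resultant.\<close>

definition res :: "'a::comm_ring_1 ^ 3 \<Rightarrow> 'a ^ 3 \<Rightarrow> 'a" where
  "res p q = bp p q * bp p q - disc p * disc q"

definition det3 :: "'a::comm_ring_1 ^ 3 \<Rightarrow> 'a ^ 3 \<Rightarrow> 'a ^ 3 \<Rightarrow> 'a" where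
  "det3 p q r = p $ 1 * (q $ 2 * r $ 3 - q $ 3 * r $ 2) - p $ 2 * (q $ 1 * r $ 3 - q $ 3 * r $ 1) +
     p $ 3 * (q $ 1 * r $ 2 - q $ 2 * r $ 1)"

lemma det_vector3: "det (vector [p, q, r]) = det3 p q r"
  by (simp add: det_3 det3_def algebra_simps)

lemma bp_commute: "bp p q = bp q p"
  by (simp add: bp_def algebra_simps)

lemma bp_scale: "bp (c *s p) q = c * bp p q" "bp p (c *s q) = c * bp p q"
  by (simp_all add: bp_def algebra_simps)

lemma res_commute: "res p q = res q p"
  by (simp add: res_def bp_commute mult.commute)

lemma disc_lq: "disc (lq v w) = det2 v w * det2 v w"
  by (simp add: bp_def lq_nth det2_def algebra_simps)

lemma res_lq: "res (lq v w) q = 4 * (qf q v * qf q w)"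
  by (simp add: res_def bp_def lq_nth qf_def power2_eq_square algebra_simps)

lemma bp_cvec: "bp (cvec p) (cvec q) = complex_of_real (bp p q)"
  and res_cvec: "res (cvec p) (cvec q) = complex_of_real (res p q)"
  and det3_cvec: "det3 (cvec p) (cvec q) (cvec r) = complex_of_real (det3 p q r)"
  and qm_cvec: "qm (cvec p) (cvec q) n = complex_of_real (qm p q n)"
  by (simp_all add: bp_def res_def det3_def qm_def)

definition good :: "real ^ 3 \<Rightarrow> real ^ 3 \<Rightarrow> real ^ 3 \<Rightarrow> bool" where
  "good k1 k2 k3 \<longleftrightarrow> disc k1 \<noteq> 0 \<and> disc k2 \<noteq> 0 \<and> disc k3 \<noteq> 0 \<and>
     res k1 k2 \<noteq> 0 \<and> res k1 k3 \<noteq> 0 \<and> res k2 k3 \<noteq> 0 \<and> det3 k1 k2 k3 \<noteq> 0"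

definition cremona :: "real ^ 3 \<Rightarrow> real ^ 3 \<Rightarrow> real ^ 3 \<Rightarrow> nat \<Rightarrow> real ^ 3" where
  "cremona k1 k2 k3 n = vector [qm k2 k3 n, qm k1 k3 n, qm k1 k2 n]"

definition cm :: "real ^ 'n ^ 'm \<Rightarrow> complex ^ 'n ^ 'm" where
  "cm M = (\<chi> i j. complex_of_real (M $ i $ j))"

lemma cm_cvec: "cm M *v cvec u = cvec (M *v u)"
  by (simp add: vec_eq_iff cm_def matrix_vector_mult_def)

lemma cm_mult: "cm (A ** B) = cm A ** cm B"
  by (simp add: vec_eq_iff cm_def matrix_matrix_mult_def)

lemma cm_mat: "cm (mat 1) = mat 1"
  by (simp add: vec_eq_iff cm_def mat_def)

lemma theta_matrix: "theta_lift d (\<lambda>n. M *v a n) v = cm M *v theta_lift d a v"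
  by (simp add: vec_eq_iff theta_nth cm_def matrix_vector_mult_def sum_distrib_left sum_distrib_right
      sum.swap[of _ UNIV] mult_ac)

lemma theta_cremona:
  "lift4 (cremona k1 k2 k3) v = vector [qf (cvec k2) v * qf (cvec k3) v,
     qf (cvec k1) v * qf (cvec k3) v, qf (cvec k1) v * qf (cvec k2) v]"
proof -
  have "lift4 (cremona k1 k2 k3) v $ 1 = (\<Sum>n\<le>4. qm (cvec k2) (cvec k3) n * (v $ 1) ^ n * (v $ 2) ^ (4 - n))"
    "lift4 (cremona k1 k2 k3) v $ 2 = (\<Sum>n\<le>4. qm (cvec k1) (cvec k3) n * (v $ 1) ^ n * (v $ 2) ^ (4 - n))"
    "lift4 (cremona k1 k2 k3) v $ 3 = (\<Sum>n\<le>4. qm (cvec k1) (cvec k2) n * (v $ 1) ^ n * (v $ 2) ^ (4 - n))"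
    by (simp_all add: theta_nth cremona_def qm_cvec)
  then show ?thesis by (simp add: qm_eval vec_eq_iff forall_3)
qed

section \<open>Structure of nodal quartics with real nodes\<close>

lemma inW_crit:
  assumes "regular a" "crit a k" "crit a k'" "\<And>c. k' \<noteq> c *s k"
  shows "inW a (qm k k')"
proof -
  obtain l l' where d: "deg a k l" "deg a k' l'" using assms unfolding crit_def by blast
  show ?thesis by (rule inW_product[OF assms(1) d indep_of_kernels[OF assms(1) d assms(4)]])
qed

lemma rescale_root:
  assumes "det2 p q \<noteq> 0" "x \<noteq> 0" "lift4 a q = x *s lift4 a p" "det2 p v = 0" "v \<noteq> 0"
  shows "\<exists>w c y. det2 v w \<noteq> 0 \<and> c \<noteq> 0 \<and> lq p q = c *s lq v w \<and> y \<noteq> 0 \<and> lift4 a w = y *s lift4 a v"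
proof -
  have p0: "p \<noteq> 0" using assms(1) by (auto simp: det2_def)
  then obtain c where c: "v = c *s p" using det2_prop assms(4) by blast
  then have c0: "c \<noteq> 0" using assms(5) by auto
  have p: "p = (1 / c) *s v" using c c0 by simp
  have "det2 v q = c * det2 p q" by (simp add: c det2_def algebra_simps)
  then have "det2 v q \<noteq> 0" using assms(1) c0 by simp
  moreover have "lq p q = (1 / c) *s lq v q" by (subst p) (simp only: lq_scale)
  moreover have "lift4 a p = (1 / c) ^ 4 *s lift4 a v" by (subst p) (simp only: theta_scale)
  then have "lift4 a q = (x * (1 / c) ^ 4) *s lift4 a v" using assms(3) by simp
  moreover have "x * (1 / c) ^ 4 \<noteq> 0" "1 / c \<noteq> 0" using assms(2) c0 by simp_all
  ultimately show ?thesis by blast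
qed

lemma crit_root_form:
  assumes n: "nodal a C" and k: "crit a k" and v: "v \<noteq> 0" "qf k v = 0"
  obtains w c x where "det2 v w \<noteq> 0" "c \<noteq> 0" "k = c *s lq v w" "x \<noteq> 0" "lift4 a w = x *s lift4 a v"
proof -
  obtain l where d: "deg a k l" using k unfolding crit_def by blast
  obtain p q x where pq: "det2 p q \<noteq> 0" "k = lq p q" "x \<noteq> 0" "lift4 a q = x *s lift4 a p"
    by (rule crit_roots[OF n d])
  have "det2 p v * det2 q v = 0" using v(2) by (simp add: pq qf_lq)
  then consider "det2 p v = 0" | "det2 q v = 0" by auto
  then show thesis
  proof cases
    case 1
    then show ?thesis using rescale_root[OF pq(1,3,4) 1 v(1)] pq(2) that by metis
  next
    case 2
    have "det2 q p = - det2 p q" by (simp add: det2_def)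
    then have "det2 q p \<noteq> 0" using pq(1) by simp
    moreover have "lift4 a p = (1 / x) *s lift4 a q" "1 / x \<noteq> 0" using pq by simp_all
    ultimately show ?thesis using rescale_root[of q p "1 / x" a v] pq(2) 2 v(1) that lq_commute[of p q] by metis
  qed
qed

text \<open>A common root has the same image as the second root of either form. A node has only two
  preimages, so the second roots agree as well and the forms are proportional.\<close>

lemma crit_coprime:
  assumes n: "nodal a C" and k: "crit a k" "crit a k'" and np: "\<And>c. k' \<noteq> c *s k"
    and v: "v \<noteq> 0"
  shows "qf k v \<noteq> 0 \<or> qf k' v \<noteq> 0"
proof (rule ccontr)
  assume "\<not> ?thesis"
  then have z: "qf k v = 0" "qf k' v = 0" by auto
  obtain w c x where w: "det2 v w \<noteq> 0" "c \<noteq> 0" "k = c *s lq v w" "x \<noteq> 0" "lift4 a w = x *s lift4 a v"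
    by (rule crit_root_form[OF n k(1) v z(1)])
  obtain w' c' x' where w': "det2 v w' \<noteq> 0" "c' \<noteq> 0" "k' = c' *s lq v w'" "x' \<noteq> 0" "lift4 a w' = x' *s lift4 a v"
    by (rule crit_root_form[OF n k(2) v z(2)])
  have nz: "w \<noteq> 0" "w' \<noteq> 0" using w(1) w'(1) by (auto simp: det2_def)
  have "det2 v w' = 0 \<or> det2 w w' = 0"
  proof (rule node_two_preimages[OF nodal_pair[OF n w(1,5)] _ _ _ w(1)])
    show "pt v \<in> preimages 4 a (pt (lift4 a v))" "pt w \<in> preimages 4 a (pt (lift4 a v))"
      "pt w' \<in> preimages 4 a (pt (lift4 a v))"
      using v nz w(4,5) w'(4,5) by (simp_all add: pt_in_preimages pt_scale)
  qed
  then have "det2 w w' = 0" using w'(1) by simp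
  then obtain d where "w' = d *s w" using det2_prop[OF nz(1)] by blast
  then have "k' = (c' * d / c) *s k" using w w' by (simp add: lq_scale)
  then show False using np by blast
qed

definition real_crit :: "(nat \<Rightarrow> real ^ 3) \<Rightarrow> bool" where
  "real_crit a \<longleftrightarrow> (\<forall>k. crit a k \<longrightarrow> (\<exists>c u. c \<noteq> 0 \<and> u \<noteq> 0 \<and> k = c *s cvec u))"

lemma det2_cnj: "det2 (\<chi> i. cnj (v $ i)) (\<chi> i. cnj (w $ i)) = cnj (det2 v w)"
  by (simp add: det2_def)

lemma lq_cnj: "lq (\<chi> i. cnj (v $ i)) (\<chi> i. cnj (w $ i)) = (\<chi> i. cnj (lq v w $ i))"
  by (rule vec3_eqI) (simp_all add: lq_nth)

text \<open>Conjugation maps the fibre over a real point to itself, so it permutes the two roots of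
  the kernel; hence the kernel is conjugated to a multiple of itself.\<close>

lemma real_crit_of_real_nodes:
  assumes n: "nodal a C" and r: "\<And>x. node 4 a x \<Longrightarrow> real_node 4 a x"
  shows "real_crit a"
  unfolding real_crit_def
proof (intro allI impI)
  fix k assume "crit a k"
  then obtain l where d: "deg a k l" unfolding crit_def by blast
  obtain v w x where vw: "det2 v w \<noteq> 0" "k = lq v w" "x \<noteq> 0" "lift4 a w = x *s lift4 a v"
    by (rule crit_roots[OF n d])
  have nz: "v \<noteq> 0" "w \<noteq> 0" using vw(1) by (auto simp: det2_def)
  have nd: "node 4 a (pt (lift4 a v))" by (rule nodal_pair[OF n vw(1,4)])
  then have "pt (lift4 a v) \<in> RP" using r unfolding real_node_def by blast
  then obtain u where u: "pt (lift4 a v) = pt (cvec u)" unfolding RP_def by blast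
  define cj where "cj z = (\<chi> i. cnj (z $ i))" for z :: "complex ^ 2"
  have real: "pt (lift4 a (cj z)) = pt (lift4 a v)" if "pt (lift4 a z) = pt (lift4 a v)" for z
  proof -
    have "pt (cvec u) = pt (lift4 a z)" using that u by simp
    then obtain s where s: "s \<noteq> 0" "lift4 a z = s *s cvec u" unfolding pt_eq_iff by blast
    have "lift4 a (cj z) = cnj s *s cvec u"
      unfolding cj_def theta_cnj s by (simp add: vec_eq_iff)
    then show ?thesis using s(1) u by (simp add: pt_scale)
  qed
  have vp: "pt (lift4 a w) = pt (lift4 a v)" using vw by (simp add: pt_scale)
  have cj0: "cj z \<noteq> 0" if "z \<noteq> 0" for z using that by (auto simp: cj_def vec_eq_iff)
  have two: "det2 v (cj z) = 0 \<or> det2 w (cj z) = 0" if "z \<noteq> 0" "pt (lift4 a z) = pt (lift4 a v)" for z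
    by (rule node_two_preimages[OF nd _ _ _ vw(1)]) (use nz vp real that cj0 in \<open>auto simp: pt_in_preimages\<close>)
  have dc: "det2 (cj v) (cj w) \<noteq> 0" using vw(1) by (simp add: cj_def det2_cnj)
  have "\<exists>c. lq (cj v) (cj w) = c *s lq v w"
  proof -
    have A: "\<exists>s. z = s *s v" if "det2 v z = 0" for z using det2_prop[OF nz(1) that] .
    have B: "\<exists>s. z = s *s w" if "det2 w z = 0" for z using det2_prop[OF nz(2) that] .
    \<comment> \<open>Either each root is fixed or the two are exchanged. In the last two cases both
      conjugates would be the same point, although conjugation preserves distinctness.\<close>
    consider "det2 v (cj v) = 0" "det2 w (cj w) = 0" | "det2 v (cj w) = 0" "det2 w (cj v) = 0"
      | "det2 v (cj v) = 0" "det2 v (cj w) = 0" | "det2 w (cj v) = 0" "det2 w (cj w) = 0"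
      using two[OF nz(1)] two[OF nz(2) vp] by blast
    then show ?thesis
    proof cases
      case 1
      then obtain s t where "cj v = s *s v" "cj w = t *s w" using A B by blast
      then show ?thesis by (auto simp: lq_scale)
    next
      case 2
      then obtain s t where "cj w = s *s v" "cj v = t *s w" using A B by blast
      then show ?thesis by (auto simp: lq_scale lq_commute[of w v])
    next
      case 3
      then obtain s t where "cj v = s *s v" "cj w = t *s v" using A by blast
      then have "det2 (cj v) (cj w) = 0" by (simp add: det2_def)
      then show ?thesis using dc by simp
    next
      case 4
      then obtain s t where "cj v = s *s w" "cj w = t *s w" using B by blast
      then have "det2 (cj v) (cj w) = 0" by (simp add: det2_def)
      then show ?thesis using dc by simp
    qed
  qed
  then obtain c where "(\<chi> i. cnj (k $ i)) = c *s k" unfolding cj_def lq_cnj vw(2) by blast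
  from conj_prop_real[OF degD(3)[OF d] this]
  show "\<exists>c u. c \<noteq> 0 \<and> u \<noteq> 0 \<and> k = c *s cvec u" by metis
qed

lemma cvec_smult: "cvec (c *s u) = complex_of_real c *s cvec u"
  by (simp add: vec_eq_iff)

lemma inW_real:
  assumes "inW a (\<lambda>n. complex_of_real (h n))"
  obtains m :: "real ^ 3" where "\<And>n. n \<le> 4 \<Longrightarrow> h n = (\<Sum>j\<in>UNIV. m $ j * a n $ j)"
proof -
  obtain m where m: "\<forall>n\<le>4. complex_of_real (h n) = prow a m n" using assms unfolding inW_def by blast
  have "h n = (\<Sum>j\<in>UNIV. (\<chi> j. Re (m $ j)) $ j * a n $ j)" if "n \<le> 4" for n
  proof -
    have "h n = Re (prow a m n)" using m that by (metis Re_complex_of_real)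
    then show ?thesis by (simp add: prow_def lin_def)
  qed
  then show ?thesis by (rule that)
qed

lemma cvec_proportional:
  fixes p q :: "real ^ 3"
  assumes e: "cvec q = c *s cvec p" and p: "p \<noteq> 0"
  shows "\<exists>r. c = complex_of_real r \<and> q = r *s p"
proof -
  obtain i where i: "p $ i \<noteq> 0" using p by (auto simp: vec_eq_iff)
  have e': "complex_of_real (q $ j) = c * complex_of_real (p $ j)" for j using e by (simp add: vec_eq_iff)
  define r where "r = q $ i / p $ i"
  have c: "c = complex_of_real r" using i e'[of i] by (simp add: r_def)
  have "q $ j = r * p $ j" for j using e'[of j] unfolding c by (metis of_real_eq_iff of_real_mult)
  then show ?thesis using c by (auto simp: vec_eq_iff)
qed

lemma dependent_rows:
  fixes A :: "real ^ 3 ^ 3"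
  assumes "det A = 0"
  shows "\<exists>c :: real ^ 3. c \<noteq> 0 \<and> (\<forall>j. c $ 1 * A $ 1 $ j + c $ 2 * A $ 2 $ j + c $ 3 * A $ 3 $ j = 0)"
proof -
  have "\<not> invertible (transpose A)" using assms by (simp add: invertible_det_nz)
  then obtain c where c: "c \<noteq> 0" "transpose A *v c = 0"
    using invertible_left_inverse matrix_left_invertible_ker by metis
  have "c $ 1 * A $ 1 $ j + c $ 2 * A $ 2 $ j + c $ 3 * A $ 3 $ j = 0" for j
    using c(2) by (simp add: vec_eq_iff matrix_vector_mult_def transpose_def sum_3 mult.commute)
  then show ?thesis using c(1) by blast
qed

text \<open>The pairwise products of the kernels lie in \<open>W\<close> and are independent, as
  evaluation at the roots shows; hence they are linear coordinates of the curve, with matrix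
  \<open>R\<close>. A linear relation between the kernels themselves would put the curve on a
  conic.\<close>

lemma structure_of_crit:
  assumes n: "nodal a C" and k: "crit a (cvec k1)" "crit a (cvec k2)" "crit a (cvec k3)"
    and np: "\<And>c. k2 \<noteq> c *s k1" "\<And>c. k3 \<noteq> c *s k1" "\<And>c. k3 \<noteq> c *s k2"
  shows "good k1 k2 k3 \<and> (\<exists>M. det M \<noteq> 0 \<and> (\<forall>n\<le>4. a n = M *v cremona k1 k2 k3 n))"
proof -
  have p: "parametrizes 4 a C" using n unfolding nodal_parametrization_def by blast
  have reg: "regular a" by (rule regular_of_parametrizes[OF p])
  have np': "cvec q \<noteq> c *s cvec p" if np: "\<And>c. q \<noteq> c *s p" and p: "p \<noteq> 0" for p q :: "real ^ 3" and c
    using cvec_proportional[of q c p] np p by blast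
  have k0: "k1 \<noteq> 0" "k2 \<noteq> 0" "k3 \<noteq> 0" using crit_nonzero[OF k(1)] crit_nonzero[OF k(2)] crit_nonzero[OF k(3)] by simp_all
  have c12: "cvec k2 \<noteq> c *s cvec k1" and c13: "cvec k3 \<noteq> c *s cvec k1" and c23: "cvec k3 \<noteq> c *s cvec k2" for c
    using np' np k0 by blast+
  have W: "inW a (\<lambda>n. complex_of_real (qm k2 k3 n))" "inW a (\<lambda>n. complex_of_real (qm k1 k3 n))"
    "inW a (\<lambda>n. complex_of_real (qm k1 k2 n))"
    using inW_crit[OF reg k(2,3) c23] inW_crit[OF reg k(1,3) c13] inW_crit[OF reg k(1,2) c12]
    by (simp_all add: qm_cvec[abs_def, symmetric] fun_eq_iff[of "qm _ _"] qm_cvec)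
  obtain m1 where m1: "\<And>n. n \<le> 4 \<Longrightarrow> qm k2 k3 n = (\<Sum>j\<in>UNIV. m1 $ j * a n $ j)" by (rule inW_real[OF W(1)]) (rule that)
  obtain m2 where m2: "\<And>n. n \<le> 4 \<Longrightarrow> qm k1 k3 n = (\<Sum>j\<in>UNIV. m2 $ j * a n $ j)" by (rule inW_real[OF W(2)]) (rule that)
  obtain m3 where m3: "\<And>n. n \<le> 4 \<Longrightarrow> qm k1 k2 n = (\<Sum>j\<in>UNIV. m3 $ j * a n $ j)" by (rule inW_real[OF W(3)]) (rule that)
  define R :: "real ^ 3 ^ 3" where "R = vector [m1, m2, m3]"
  have R: "R *v a n = cremona k1 k2 k3 n" if "n \<le> 4" for n
    by (rule vec3_eqI) (simp_all add: R_def cremona_def m1[OF that] m2[OF that] m3[OF that] matrix_vector_mult_def)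
  have Rt: "cm R *v lift4 a v = lift4 (cremona k1 k2 k3) v" for v
    unfolding theta_matrix[symmetric] by (rule fun_cong[OF theta_cong]) (rule R)
  have cop: "qf (cvec k1) v \<noteq> 0 \<or> qf (cvec k2) v \<noteq> 0" "qf (cvec k1) v \<noteq> 0 \<or> qf (cvec k3) v \<noteq> 0"
    "qf (cvec k2) v \<noteq> 0 \<or> qf (cvec k3) v \<noteq> 0" if "v \<noteq> 0" for v
    using crit_coprime[OF n k(1,2) c12 that] crit_coprime[OF n k(1,3) c13 that] crit_coprime[OF n k(2,3) c23 that] .
  obtain v1 where v1: "v1 \<noteq> 0" "qf (cvec k1) v1 = 0" using qf_root by blast
  obtain v2 where v2: "v2 \<noteq> 0" "qf (cvec k2) v2 = 0" using qf_root by blast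
  obtain v3 where v3: "v3 \<noteq> 0" "qf (cvec k3) v3 = 0" using qf_root by blast
  have "det R \<noteq> 0"
  proof
    assume "det R = 0"
    then obtain c :: "real ^ 3" where c: "c \<noteq> 0" and z: "\<And>j. c $ 1 * R $ 1 $ j + c $ 2 * R $ 2 $ j + c $ 3 * R $ 3 $ j = 0"
      using dependent_rows[OF \<open>det R = 0\<close>] by blast
    have s: "lin (cvec c) (lift4 (cremona k1 k2 k3) v) = 0" for v
    proof -
      have "lin (cvec c) (lift4 (cremona k1 k2 k3) v) =
        (\<Sum>j\<in>UNIV. complex_of_real (c $ 1 * R $ 1 $ j + c $ 2 * R $ 2 $ j + c $ 3 * R $ 3 $ j) * lift4 a v $ j)"
        unfolding Rt[symmetric] by (simp add: lin_3 matrix_vector_mult_def sum_3 cm_def algebra_simps)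
      then show ?thesis by (simp add: z)
    qed
    \<comment> \<open>At a root of \<open>k1\<close> only the product of \<open>k2\<close> and
      \<open>k3\<close> survives, and coprimality makes it nonzero; likewise for the other
      two.\<close>
    have "c $ 1 = 0" using s[of v1] cop(1)[OF v1(1)] cop(2)[OF v1(1)] v1(2) by (simp add: lin_3 theta_cremona)
    moreover have "c $ 2 = 0" using s[of v2] cop(1)[OF v2(1)] cop(3)[OF v2(1)] v2(2) by (simp add: lin_3 theta_cremona)
    moreover have "c $ 3 = 0" using s[of v3] cop(2)[OF v3(1)] cop(3)[OF v3(1)] v3(2) by (simp add: lin_3 theta_cremona)
    ultimately show False using c by (simp add: vec_eq_iff forall_3)
  qed
  then have "invertible R" by (simp add: invertible_det_nz)
  then obtain M where M: "R ** M = mat 1" "M ** R = mat 1" unfolding invertible_def by blast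
  have "det R * det M = 1" using arg_cong[OF M(1), of det] by (simp add: det_mul)
  then have dM: "det M \<noteq> 0" by auto
  have aM: "a n = M *v cremona k1 k2 k3 n" if "n \<le> 4" for n
    by (simp flip: R[OF that] add: matrix_vector_mul_assoc M)
  have roots: "\<exists>v w. det2 v w \<noteq> 0 \<and> cvec k = lq v w \<and> v \<noteq> 0 \<and> w \<noteq> 0" if "crit a (cvec k)" for k
  proof -
    obtain l where d: "deg a (cvec k) l" using \<open>crit a (cvec k)\<close> unfolding crit_def by blast
    obtain v w x where vw: "det2 v w \<noteq> 0" "cvec k = lq v w" by (rule crit_roots[OF n d])
    then have "v \<noteq> 0" "w \<noteq> 0" by (auto simp: det2_def)
    with vw show ?thesis by blast
  qed
  have disc: "disc k \<noteq> 0" if "crit a (cvec k)" for k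
  proof -
    obtain v w where vw: "det2 v w \<noteq> 0" "cvec k = lq v w" using roots[OF \<open>crit a (cvec k)\<close>] by blast
    then have "disc (cvec k) \<noteq> 0" by (simp add: disc_lq)
    then show ?thesis by (simp add: bp_cvec)
  qed
  have res: "res k q \<noteq> 0" if "crit a (cvec k)" "\<And>v. v \<noteq> 0 \<Longrightarrow> qf (cvec k) v \<noteq> 0 \<or> qf (cvec q) v \<noteq> 0" for k q
  proof -
    obtain v w where vw: "cvec k = lq v w" "v \<noteq> 0" "w \<noteq> 0" using roots[OF \<open>crit a (cvec k)\<close>] by blast
    have "qf (cvec k) v = 0" "qf (cvec k) w = 0" by (simp_all add: vw qf_lq det2_def)
    then have "res (cvec k) (cvec q) \<noteq> 0" using that(2) vw by (auto simp: res_lq)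
    then show ?thesis by (simp add: res_cvec)
  qed
  have "det3 k1 k2 k3 \<noteq> 0"
  proof
    assume d0: "det3 k1 k2 k3 = 0"
    obtain c :: "real ^ 3" where c: "c \<noteq> 0" and z: "\<And>j. c $ 1 * k1 $ j + c $ 2 * k2 $ j + c $ 3 * k3 $ j = 0"
      using dependent_rows[of "vector [k1, k2, k3]"] d0 unfolding det_vector3 vector_3 by blast
    have zq: "c $ 1 * qf (cvec k1) v + c $ 2 * qf (cvec k2) v + c $ 3 * qf (cvec k3) v = 0" for v
    proof -
      have "c $ 1 * qf (cvec k1) v + c $ 2 * qf (cvec k2) v + c $ 3 * qf (cvec k3) v =
        complex_of_real (c $ 1 * k1 $ 1 + c $ 2 * k2 $ 1 + c $ 3 * k3 $ 1) * (v $ 1)\<^sup>2 +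
        complex_of_real (c $ 1 * k1 $ 2 + c $ 2 * k2 $ 2 + c $ 3 * k3 $ 2) * (v $ 1 * v $ 2) +
        complex_of_real (c $ 1 * k1 $ 3 + c $ 2 * k2 $ 3 + c $ 3 * k3 $ 3) * (v $ 2)\<^sup>2"
        by (simp add: qf_def algebra_simps)
      then show ?thesis by (simp add: z)
    qed
    \<comment> \<open>The conic obtained by pulling back the line with coefficients \<open>c\<close>
      under the standard quadratic transformation; on the curve it becomes the relation
      \<open>zq\<close> times the product of the three forms.\<close>
    define G where "G y = complex_of_real (c $ 1) * (lin (cvec m2) y * lin (cvec m3) y) +
      complex_of_real (c $ 2) * (lin (cvec m1) y * lin (cvec m3) y) +
      complex_of_real (c $ 3) * (lin (cvec m1) y * lin (cvec m2) y)" for y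
    have Rl: "lin (cvec m1) y = (cm R *v y) $ 1" "lin (cvec m2) y = (cm R *v y) $ 2"
      "lin (cvec m3) y = (cm R *v y) $ 3" for y
      by (simp_all add: lin_def matrix_vector_mult_def cm_def R_def)
    have "ternary_form 2 G" unfolding G_def by (intro tf_add tf_scale tf_lin2)
    moreover have "G (lift4 a v) = 0" for v
    proof -
      have "G (lift4 a v) = qf (cvec k1) v * qf (cvec k2) v * qf (cvec k3) v *
        (c $ 1 * qf (cvec k1) v + c $ 2 * qf (cvec k2) v + c $ 3 * qf (cvec k3) v)"
        unfolding G_def Rl Rt theta_cremona by (simp add: algebra_simps)
      then show ?thesis by (simp add: zq)
    qed
    ultimately have G0: "G y = 0" for y by (rule regular_no_form[OF reg, rotated]) simp
    have RM: "cm R *v (cm M *v cvec z) = cvec z" for z by (simp add: cm_cvec matrix_vector_mul_assoc M)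
    have "c $ 1 = 0" using G0[of "cm M *v cvec (vector [0, 1, 1])"] by (simp add: G_def Rl RM)
    moreover have "c $ 2 = 0" using G0[of "cm M *v cvec (vector [1, 0, 1])"] by (simp add: G_def Rl RM)
    moreover have "c $ 3 = 0" using G0[of "cm M *v cvec (vector [1, 1, 0])"] by (simp add: G_def Rl RM)
    ultimately show False using c by (simp add: vec_eq_iff forall_3)
  qed
  then have "good k1 k2 k3" unfolding good_def using disc k res[OF k(1) cop(1)] res[OF k(1) cop(2)] res[OF k(2) cop(3)] by blast
  then show ?thesis using dM aM by blast
qed

lemma structure_theorem:
  assumes n: "nodal a C" and r: "real_crit a"
  obtains M k1 k2 k3 where "good k1 k2 k3" "det M \<noteq> 0" "\<And>n. n \<le> 4 \<Longrightarrow> a n = M *v cremona k1 k2 k3 n"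
    "crit a (cvec k1)" "crit a (cvec k2)" "crit a (cvec k3)"
proof -
  have p: "parametrizes 4 a C" using n unfolding nodal_parametrization_def by blast
  have reg: "regular a" by (rule regular_of_parametrizes[OF p])
  obtain q1 q2 q3 l1 l2 l3 where q: "deg a q1 l1" "deg a q2 l2" "deg a q3 l3"
    and i: "indep2 l1 l2" "indep2 l1 l3" "indep2 l2 l3" by (rule three_kernels[OF n])
  obtain c1 k1 where 1: "c1 \<noteq> 0" "q1 = c1 *s cvec k1" using r q(1) unfolding real_crit_def crit_def by blast
  obtain c2 k2 where 2: "c2 \<noteq> 0" "q2 = c2 *s cvec k2" using r q(2) unfolding real_crit_def crit_def by blast
  obtain c3 k3 where 3: "c3 \<noteq> 0" "q3 = c3 *s cvec k3" using r q(3) unfolding real_crit_def crit_def by blast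
  have s: "crit a (cvec k)" if "deg a q l" "c \<noteq> 0" "q = c *s cvec k" for q l c k
  proof -
    have "crit a ((1 / c) *s q)" using that crit_scale[of "1 / c" a q] unfolding crit_def by auto
    then show ?thesis using that by simp
  qed
  have np: "k' \<noteq> x *s k" if "deg a q l" "deg a q' l'" "indep2 l l'" "q = c *s cvec k" "q' = c' *s cvec k'" "c \<noteq> 0" for q q' l l' c c' k k' x
  proof
    assume "k' = x *s k"
    then have "q' = (c' * complex_of_real x / c) *s q" using that by (simp add: cvec_smult)
    then show False using kernels_of_indep[OF reg that(1-3)] by blast
  qed
  have k: "crit a (cvec k1)" "crit a (cvec k2)" "crit a (cvec k3)" using s q 1 2 3 by blast+
  have "good k1 k2 k3 \<and> (\<exists>M. det M \<noteq> 0 \<and> (\<forall>n\<le>4. a n = M *v cremona k1 k2 k3 n))"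
    by (rule structure_of_crit[OF n k np[OF q(1,2) i(1) 1(2) 2(2) 1(1)] np[OF q(1,3) i(2) 1(2) 3(2) 1(1)] np[OF q(2,3) i(3) 2(2) 3(2) 2(1)]])
  then show ?thesis using that k by blast
qed

section \<open>Invariance under projective transformations\<close>

definition act :: "complex ^ 'n ^ 'n \<Rightarrow> (complex ^ 'n) set \<Rightarrow> (complex ^ 'n) set" where
  "act A x = (*v) A ` x"

lemma matrix_vector_smult: "A *v (c *s x) = c *s (A *v (x :: 'a::comm_ring_1 ^ 'n))"
  by (simp add: vec_eq_iff matrix_vector_mult_def sum_distrib_left mult_ac)

lemma act_pt: "act A (pt v) = pt (A *v v)"
proof -
  have "act A (pt v) = {A *v (c *s v) | c. c \<noteq> 0}" by (auto simp: act_def pt_def)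
  then show ?thesis by (simp add: matrix_vector_smult pt_def)
qed

lemma act_act: "act A (act B x) = act (A ** B) x"
  by (auto simp: act_def image_image matrix_vector_mul_assoc)

lemma act_mat1: "act (mat 1) x = x"
  by (simp add: act_def)

lemma tf_lin_power: "ternary_form d F \<Longrightarrow> ternary_form (i + d) (\<lambda>v. lin m v ^ i * F v)"
proof (induction i)
  case (Suc i)
  then show ?case using tf_lin_mult[of "i + d" "\<lambda>v. lin m v ^ i * F v" m] by (simp add: mult.assoc)
qed simp

lemma tf_compose:
  assumes "ternary_form d F"
  shows "ternary_form d (\<lambda>y. F (B *v y))"
proof -
  obtain c where F: "F = (\<lambda>v. \<Sum>i\<le>d. \<Sum>j\<le>d - i. c i j * (v $ 1) ^ i * (v $ 2) ^ j * (v $ 3) ^ (d - i - j))"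
    using assms unfolding ternary_form_def by blast
  have r: "(B *v y) $ i = lin (B $ i) y" for i y by (simp add: matrix_vector_mult_def lin_def)
  have "ternary_form d (\<lambda>y. c i j * ((B *v y) $ 1) ^ i * ((B *v y) $ 2) ^ j * ((B *v y) $ 3) ^ (d - i - j))"
    if "i \<le> d" "j \<le> d - i" for i j
  proof -
    have "ternary_form (i + (j + ((d - i - j) + 0)))
      (\<lambda>y. lin (B $ 1) y ^ i * (lin (B $ 2) y ^ j * (lin (B $ 3) y ^ (d - i - j) * c i j)))"
      by (intro tf_lin_power tf_const)
    moreover have "i + (j + ((d - i - j) + 0)) = d" using that by simp
    ultimately show ?thesis by (simp add: r mult_ac)
  qed
  then show ?thesis unfolding F by (intro tf_sum) auto
qed

lemma zero_locus_compose:
  assumes "A ** B = mat 1" "B ** A = mat 1"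
  shows "zero_locus (\<lambda>y. F (B *v y)) = act A ` zero_locus F"
proof -
  have AB: "A *v (B *v y) = y" "B *v (A *v y) = y" for y by (simp_all add: matrix_vector_mul_assoc assms)
  have *: "pt y \<in> zero_locus G \<longleftrightarrow> y \<noteq> 0 \<and> (\<forall>c. c \<noteq> 0 \<longrightarrow> G (c *s y) = 0)" for y G
    by (auto simp: zero_locus_def pt_in_CP mem_pt)
  have zl: "\<exists>y. x = pt y" if "x \<in> zero_locus G" for x G using that CP_cases unfolding zero_locus_def by blast
  show ?thesis
  proof (intro set_eqI iffI)
    fix x assume x: "x \<in> zero_locus (\<lambda>y. F (B *v y))"
    then obtain y where y: "x = pt y" using zl by blast
    have "y \<noteq> 0" "\<And>c. c \<noteq> 0 \<Longrightarrow> F (B *v (c *s y)) = 0" using x unfolding y * by blast+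
    moreover have "B *v y \<noteq> 0" using AB(1)[of y] \<open>y \<noteq> 0\<close> by (metis matrix_vector_mult_0_right)
    ultimately have "pt (B *v y) \<in> zero_locus F"
      unfolding * by (simp add: matrix_vector_smult)
    moreover have "x = act A (pt (B *v y))" by (simp add: act_pt AB y)
    ultimately show "x \<in> act A ` zero_locus F" by blast
  next
    fix x assume "x \<in> act A ` zero_locus F"
    then obtain y where y: "x = act A (pt y)" "pt y \<in> zero_locus F" using zl by blast
    have "y \<noteq> 0" "\<And>c. c \<noteq> 0 \<Longrightarrow> F (c *s y) = 0" using y(2) unfolding * by blast+
    moreover have "A *v y \<noteq> 0" using AB(2)[of y] \<open>y \<noteq> 0\<close> by (metis matrix_vector_mult_0_right)
    ultimately show "x \<in> zero_locus (\<lambda>y. F (B *v y))"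
      unfolding y(1) act_pt * by (simp add: matrix_vector_smult AB)
  qed
qed

lemma act_image_inverse:
  assumes "B ** A = mat 1"
  shows "act B ` (act A ` C) = C"
  by (simp add: image_image act_act assms act_mat1)

lemma curve_equation_act:
  assumes c: "curve_equation d F C" and AB: "A ** B = mat 1" "B ** A = mat 1"
  shows "curve_equation d (\<lambda>y. F (B *v y)) (act A ` C)"
  unfolding curve_equation_def
proof (intro conjI allI impI)
  have AB': "A *v (B *v y) = y" "B *v (A *v y) = y" for y by (simp_all add: matrix_vector_mul_assoc AB)
  show "ternary_form d (\<lambda>y. F (B *v y))" using c by (intro tf_compose) (simp add: curve_equation_def)
  show "(\<lambda>y. F (B *v y)) \<noteq> (\<lambda>_. 0)"
  proof
    assume "(\<lambda>y. F (B *v y)) = (\<lambda>_. 0)"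
    then have "F y = 0" for y using AB'(2)[of y] by metis
    then show False using c by (auto simp: curve_equation_def)
  qed
  show "act A ` C = zero_locus (\<lambda>y. F (B *v y))"
    using c by (simp add: zero_locus_compose[OF AB] curve_equation_def)
  fix e G assume e: "e < d" and G: "ternary_form e G \<and> act A ` C \<subseteq> zero_locus G"
  have "act B ` (act A ` C) \<subseteq> act B ` zero_locus G" using G by (intro image_mono) simp
  then have "C \<subseteq> zero_locus (\<lambda>y. G (A *v y))"
    by (simp add: act_image_inverse[OF AB(2)] zero_locus_compose[OF AB(2,1)])
  moreover have "ternary_form e (\<lambda>y. G (A *v y))" using G by (intro tf_compose) simp
  ultimately have "(\<lambda>y. G (A *v y)) = (\<lambda>_. 0)" using c e unfolding curve_equation_def by blast
  then show "G = (\<lambda>_. 0)" using AB'(1) by metis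
qed

lemma Ctheta_matrix:
  "P \<in> CP \<Longrightarrow> Ctheta d (\<lambda>n. M *v a n) P = act (cm M) (Ctheta d a P)"
  by (auto elim!: CP_cases simp: Ctheta_pt theta_matrix act_pt)

lemma cm_inverse:
  assumes "det M \<noteq> 0"
  obtains M' where "M ** M' = mat 1" "M' ** M = mat 1" "cm M ** cm M' = mat 1" "cm M' ** cm M = mat 1" "det M' \<noteq> 0"
proof -
  obtain M' where M': "M ** M' = mat 1" "M' ** M = mat 1"
    using assms invertible_det_nz[of M] unfolding invertible_def by blast
  have "det M * det M' = 1" using arg_cong[OF M'(1), of det] by (simp add: det_mul)
  then have "det M' \<noteq> 0" by auto
  with M' show ?thesis using that by (simp add: cm_mat flip: cm_mult)
qed

lemma act_inj:
  assumes "B ** A = mat 1" "act A x = act A y"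
  shows "x = y"
  using arg_cong[OF assms(2), of "act B"] by (simp add: act_act assms(1) act_mat1)

lemma preimages_matrix:
  assumes "det M \<noteq> 0"
  shows "preimages d (\<lambda>n. M *v a n) (act (cm M) x) = preimages d a x"
proof -
  obtain M' where M': "cm M' ** cm M = mat 1" using cm_inverse[OF assms] by metis
  show ?thesis unfolding preimages_def using Ctheta_matrix act_inj[OF M'] by metis
qed

lemma Dtheta_matrix: "Dtheta d (\<lambda>n. M *v a n) v h = cm M *v Dtheta d a v h"
proof -
  have "(theta_lift d (\<lambda>n. M *v a n) has_derivative (\<lambda>h. cm M *v Dtheta d a v h)) (at v)"
  proof (rule has_derivative_vec_lambda)
    fix i
    have mvm: "(A *v x) $ i = (\<Sum>j\<in>UNIV. A $ i $ j * x $ j)" for A :: "complex ^ 3 ^ 3" and x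
      by (simp add: matrix_vector_mult_def)
    have "((\<lambda>v. theta_lift d a v $ j) has_derivative (\<lambda>h. Dtheta d a v h $ j)) (at v)" for j
      by (rule has_derivative_compose[OF has_derivative_theta has_derivative_vec_nth])
    then show "((\<lambda>v. theta_lift d (\<lambda>n. M *v a n) v $ i) has_derivative (\<lambda>h. (cm M *v Dtheta d a v h) $ i)) (at v)"
      unfolding theta_matrix by (simp only: mvm) (intro has_derivative_sum has_derivative_mult_right)
  qed
  then have "Dtheta d (\<lambda>n. M *v a n) v = (\<lambda>h. cm M *v Dtheta d a v h)"
    by (rule has_derivative_unique[OF has_derivative_theta])
  then show ?thesis by simp
qed

lemma transversal_matrix:
  assumes "det M \<noteq> 0" "transversal_branches d a P Q"
  shows "transversal_branches d (\<lambda>n. M *v a n) P Q"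
  unfolding transversal_branches_def
proof (intro ballI)
  fix v w assume vw: "v \<in> P" "w \<in> Q"
  obtain M' where M': "cm M ** cm M' = mat 1" using cm_inverse[OF assms(1)] by metis
  have U: "{y + z |y z. y \<in> tangent_cone d a v \<and> z \<in> tangent_cone d a w} = UNIV"
    using assms(2) vw unfolding transversal_branches_def by blast
  have "x \<in> {y + z |y z. y \<in> tangent_cone d (\<lambda>n. M *v a n) v \<and> z \<in> tangent_cone d (\<lambda>n. M *v a n) w}" for x
  proof -
    have "cm M' *v x \<in> {y + z |y z. y \<in> tangent_cone d a v \<and> z \<in> tangent_cone d a w}" using U by simp
    then obtain g h where "cm M' *v x = Dtheta d a v g + Dtheta d a w h" by (auto simp: tangent_cone_eq)
    then have "cm M *v (cm M' *v x) = cm M *v (Dtheta d a v g + Dtheta d a w h)" by simp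
    then have "x = Dtheta d (\<lambda>n. M *v a n) v g + Dtheta d (\<lambda>n. M *v a n) w h"
      by (simp add: matrix_vector_mul_assoc M' matrix_vector_right_distrib Dtheta_matrix)
    then show ?thesis by (auto simp: tangent_cone_eq)
  qed
  then show "{y + z |y z. y \<in> tangent_cone d (\<lambda>n. M *v a n) v \<and> z \<in> tangent_cone d (\<lambda>n. M *v a n) w} = UNIV"
    by blast
qed

lemma node_matrix:
  assumes "det M \<noteq> 0" "node d a x"
  shows "node d (\<lambda>n. M *v a n) (act (cm M) x)"
proof -
  obtain P Q where "P \<noteq> Q" "preimages d a x = {P, Q}" "transversal_branches d a P Q"
    using assms(2) unfolding node_def by blast
  then show ?thesis using transversal_matrix[OF assms(1)] preimages_matrix[OF assms(1), of d a x]
    unfolding node_def by metis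
qed

lemma nodal_matrix:
  assumes n: "nodal_parametrization d a C" and M: "det M \<noteq> 0"
  shows "nodal_parametrization d (\<lambda>n. M *v a n) (act (cm M) ` C)"
proof -
  obtain M' where M': "cm M ** cm M' = mat 1" "cm M' ** cm M = mat 1" using cm_inverse[OF M] by metis
  note p = n[unfolded nodal_parametrization_def parametrizes_def]
  have AB: "cm M *v (cm M' *v y) = y" "cm M' *v (cm M *v y) = y" for y by (simp_all add: matrix_vector_mul_assoc M')
  have "theta_lift d (\<lambda>n. M *v a n) v \<noteq> 0" if "v \<noteq> 0" for v
  proof
    assume "theta_lift d (\<lambda>n. M *v a n) v = 0"
    then have "cm M' *v (cm M *v theta_lift d a v) = 0" by (simp add: theta_matrix)
    then show False using p that by (simp add: AB)
  qed
  moreover have "act (cm M) ` C = Ctheta d (\<lambda>n. M *v a n) ` CP"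
    using p by (auto simp: image_image Ctheta_matrix image_iff)
  moreover have "plane_curve d (act (cm M) ` C)"
    using p curve_equation_act[OF _ M'] unfolding plane_curve_def by blast
  moreover have "node d (\<lambda>n. M *v a n) x" if s: "singular_point d (act (cm M) ` C) x" for x
  proof -
    obtain F where x: "x \<in> act (cm M) ` C" and F: "curve_equation d F (act (cm M) ` C)"
      and dF: "\<And>v. v \<in> x \<Longrightarrow> (F has_derivative (\<lambda>_. 0)) (at v)" using s unfolding singular_point_def by blast
    obtain x' where x': "x' \<in> C" "x = act (cm M) x'" using x by blast
    have "curve_equation d (\<lambda>y. F (cm M *v y)) C"
      using curve_equation_act[OF F M'(2,1)] by (simp add: act_image_inverse[OF M'(2)])
    moreover have "((\<lambda>y. F (cm M *v y)) has_derivative (\<lambda>_. 0)) (at v)" if "v \<in> x'" for v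
    proof -
      have "((*v) (cm M) has_derivative (*v) (cm M)) (at v)"
        unfolding matrix_vector_mult_def
        by (rule has_derivative_vec_lambda) (auto intro!: derivative_eq_intros)
      moreover have "(F has_derivative (\<lambda>_. 0)) (at (cm M *v v))" using that x' by (intro dF) (simp add: act_def)
      ultimately show ?thesis by (rule has_derivative_compose)
    qed
    ultimately have "singular_point d C x'" using x' unfolding singular_point_def by blast
    then show ?thesis using p node_matrix[OF M] x' by blast
  qed
  ultimately show ?thesis unfolding nodal_parametrization_def parametrizes_def by blast
qed

lemma ternary_form_differentiable:
  assumes "ternary_form d F"
  obtains F' where "(F has_derivative F') (at v)"
proof -
  obtain c where c: "F = (\<lambda>v. \<Sum>i\<le>d. \<Sum>j\<le>d - i. c i j * (v $ 1) ^ i * (v $ 2) ^ j * (v $ 3) ^ (d - i - j))"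
    using assms unfolding ternary_form_def by blast
  have "(\<lambda>v :: complex ^ 3. v $ i) differentiable (at v)" for i
    by (rule bounded_linear_imp_differentiable[OF bounded_linear_vec_nth])
  then have "F differentiable (at v)" unfolding c
    by (intro differentiable_sum differentiable_mult differentiable_power differentiable_const) simp_all
  then show ?thesis using that unfolding differentiable_def by blast
qed

text \<open>The equation vanishes along both branches, so its derivative kills both tangent cones,
  and by transversality these span everything.\<close>

lemma node_singular:
  assumes p: "parametrizes d a C" and d: "d > 0" and n: "node d a x"
  shows "singular_point d C x"
proof -
  obtain F where F: "curve_equation d F C" using p by (auto simp: parametrizes_def plane_curve_def)
  obtain P Q where PQ: "preimages d a x = {P, Q}" "transversal_branches d a P Q" using n unfolding node_def by blast
  have P: "P \<in> CP" "Ctheta d a P = x" and Q: "Q \<in> CP" "Ctheta d a Q = x"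
    using PQ(1) unfolding preimages_def by blast+
  have F0: "F (theta_lift d a v) = 0" for v
  proof (cases "v = 0")
    case True
    have tf: "ternary_form d F" using F by (simp add: curve_equation_def)
    have "theta_lift d a v = 0" using theta_scale[of d a 0 v] True d by (simp add: zero_power)
    moreover have "F 0 = 0" using tf d by (auto simp: ternary_form_def power_0_left intro!: sum.neutral)
    ultimately show ?thesis by simp
  next
    case False
    then have "pt (theta_lift d a v) \<in> C" using p by (auto simp: parametrizes_def pt_in_CP simp flip: Ctheta_pt)
    then show ?thesis using F pt_self by (auto simp: curve_equation_def zero_locus_def)
  qed
  \<comment> \<open>Singularity refers to every representative \<open>y\<close> of the point; a
    \<open>d\<close>-th root lifts each of them to either preimage.\<close>
  have lift: "\<exists>v\<in>P. theta_lift d a v = y" if P: "P \<in> CP" "Ctheta d a P = x" and y: "y \<in> x" for P y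
  proof -
    obtain v where v: "v \<noteq> 0" "P = pt v" using P(1) unfolding CP_def by blast
    obtain c where c: "c \<noteq> 0" "y = c *s theta_lift d a v" 
      using y unfolding P(2)[symmetric] v(2) Ctheta_pt by (auto simp: pt_def)
    obtain r where r: "r ^ d = c" using d by (metis exists_complex_root neq0_conv)
    have "r \<noteq> 0" using r c d by (auto simp: power_0_left)
    then have "r *s v \<in> P" using v by (auto simp: pt_def)
    moreover have "theta_lift d a (r *s v) = y" by (simp add: theta_scale r c)
    ultimately show ?thesis by blast
  qed
  have "(F has_derivative (\<lambda>_. 0)) (at y)" if y: "y \<in> x" for y
  proof -
    obtain v where v: "v \<in> P" "theta_lift d a v = y" using lift[OF P y] by blast
    obtain w where w: "w \<in> Q" "theta_lift d a w = y" using lift[OF Q y] by blast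
    obtain F' where F': "(F has_derivative F') (at y)"
      using F ternary_form_differentiable unfolding curve_equation_def by metis
    have tc: "F' z = 0" if z: "z \<in> tangent_cone d a u" and u: "theta_lift d a u = y" for z u
    proof -
      have "((\<lambda>t. F (theta_lift d a t)) has_derivative (\<lambda>h. F' (Dtheta d a u h))) (at u)"
        by (rule has_derivative_compose[OF has_derivative_theta]) (use F' u in simp)
      then have "(\<lambda>h. F' (Dtheta d a u h)) = (\<lambda>_. 0)"
        unfolding F0 by (rule has_derivative_unique[OF _ has_derivative_const])
      then show ?thesis using z unfolding tangent_cone_eq by (metis imageE)
    qed
    have "F' z = 0" for z
    proof -
      have "z \<in> {y + z | y z. y \<in> tangent_cone d a v \<and> z \<in> tangent_cone d a w}"
        using PQ(2) v(1) w(1) unfolding transversal_branches_def by blast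
      then obtain s t where "z = s + t" "s \<in> tangent_cone d a v" "t \<in> tangent_cone d a w" by blast
      then show ?thesis using tc v(2) w(2) linear_add[OF has_derivative_linear[OF F']] by simp
    qed
    then have "F' = (\<lambda>_. 0)" by auto
    then show ?thesis using F' by simp
  qed
  moreover have "x \<in> C" using P p by (auto simp: parametrizes_def)
  ultimately show ?thesis unfolding singular_point_def using F by blast
qed

section \<open>Quadratic transforms of conics are nodal\<close>

lemma no_common_root:
  assumes "res p q \<noteq> 0" "v \<noteq> 0" "qf (cvec p) v = 0"
  shows "qf (cvec q) v \<noteq> 0"
proof
  assume z: "qf (cvec q) v = 0"
  have "p \<noteq> 0" using assms(1) by (auto simp: res_def bp_def)
  then have "cvec p \<noteq> 0" by simp
  then obtain x y where xy: "x \<noteq> 0" "y \<noteq> 0" "cvec p = lq x y" by (rule qf_factor)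
  have "qf (cvec q) u = 0" if "det2 u v = 0" "u \<noteq> 0" for u
  proof -
    obtain s where s: "v = s *s u" using det2_prop[OF \<open>u \<noteq> 0\<close> \<open>det2 u v = 0\<close>] by blast
    then have "s \<noteq> 0" using assms(2) by auto
    then show ?thesis using z by (simp add: s qf_scale)
  qed
  moreover have "det2 x v = 0 \<or> det2 y v = 0" using assms(3) by (simp add: xy qf_lq)
  ultimately have "qf (cvec q) x * qf (cvec q) y = 0" using xy by auto
  then have "res (cvec p) (cvec q) = 0" unfolding xy(3) res_lq by simp
  then show False using assms(1) by (simp add: res_cvec)
qed

lemma disc_roots:
  assumes "disc k \<noteq> 0"
  obtains r r' where "det2 r r' \<noteq> 0" "r \<noteq> 0" "r' \<noteq> 0" "cvec k = lq r r'"
proof -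
  have "cvec k \<noteq> 0" using assms by (auto simp: bp_def)
  then obtain x y where xy: "x \<noteq> 0" "y \<noteq> 0" "cvec k = lq x y" by (rule qf_factor)
  have "disc (cvec k) \<noteq> 0" using assms by (simp add: bp_cvec)
  then have "det2 x y \<noteq> 0" unfolding xy(3) disc_lq by simp
  with xy show ?thesis using that by blast
qed

lemma det3_lq: "qf p r * qf q r' - qf p r' * qf q r = det2 r r' * det3 (lq r r') p q"
  by (simp add: qf_def det2_def det3_def lq_nth power2_eq_square algebra_simps)

lemma continuous_qf: "continuous_on UNIV (\<lambda>v. qf (k :: complex ^ 3) v)"
  unfolding qf_def by (intro continuous_intros)

lemma continuous_line: "isCont (\<lambda>z. v + z *s (w :: complex ^ 'n)) x"
proof -
  have "continuous_on UNIV (\<lambda>z. v + z *s w)"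
    unfolding vector_scalar_mult_def by (intro continuous_intros continuous_on_vec_lambda)
  then show ?thesis by (simp add: continuous_on_eq_continuous_at)
qed

text \<open>The zeros of a nonzero form on a line are finite in number, so a continuous cofactor
  that is nonzero at \<open>v\<close>, hence near \<open>v\<close>, would contradict the vanishing
  of the product.\<close>

lemma qf_cancel:
  fixes g :: "complex ^ 2 \<Rightarrow> complex"
  assumes k: "k \<noteq> 0" and g: "continuous_on UNIV g" and z: "\<And>v. v \<noteq> 0 \<Longrightarrow> qf k v * g v = 0" and v: "v \<noteq> 0"
  shows "g v = 0"
proof (rule ccontr)
  assume nz: "g v \<noteq> 0"
  obtain w where w: "det2 v w = 1" using det2_complement[OF v] by blast
  have "isCont (\<lambda>z. g (v + z *s w)) 0"
    by (rule isCont_o2[OF continuous_line]) (use g in \<open>simp add: continuous_on_eq_continuous_at\<close>)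
  then have "\<forall>\<^sub>F z in nhds 0. g (v + z *s w) \<noteq> 0"
    using isCont_eventually[of 0 "\<lambda>z. g (v + z *s w)" "- {0}"] nz by (simp add: open_Compl)
  then obtain d where d: "d > 0" "\<And>z. dist z 0 < d \<Longrightarrow> g (v + z *s w) \<noteq> 0"
    unfolding eventually_nhds_metric by blast
  have "qf k (v + z *s w) = 0" if "z \<in> ball 0 d" for z
  proof -
    have "v + z *s w \<noteq> 0"
    proof
      assume "v + z *s w = 0"
      then have "det2 (v + z *s w) w = 0" by (simp add: det2_def)
      moreover have "det2 (v + z *s w) w = det2 v w" by (simp add: det2_def algebra_simps)
      ultimately show False using w by simp
    qed
    moreover have "g (v + z *s w) \<noteq> 0" using that by (intro d) (simp add: dist_norm)
    ultimately show ?thesis using z by (metis mult_eq_0_iff)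
  qed
  then have "ball 0 d \<subseteq> {z. qf k (v + z *s w) = 0}" by blast
  moreover have "finite {z. qf k (v + z *s w) = 0}" using finite_zeros_qf[OF k] w by simp
  ultimately have "countable (ball (0 :: complex) d)" by (meson countable_finite countable_subset)
  then show False using d(1) uncountable_ball by blast
qed

section \<open>The conic, the standard quadratic transformation and quadrics through the
  conic\<close>

definition ver :: "complex ^ 2 \<Rightarrow> complex ^ 3" where
  "ver v = vector [(v $ 1)\<^sup>2, v $ 1 * v $ 2, (v $ 2)\<^sup>2]"

lemma ver_nth: "ver v $ 1 = (v $ 1)\<^sup>2" "ver v $ 2 = v $ 1 * v $ 2" "ver v $ 3 = (v $ 2)\<^sup>2"
  by (simp_all add: ver_def)

lemma conic_point:
  assumes "z $ 1 * z $ 3 = z $ 2 * z $ 2" "z \<noteq> (0 :: complex ^ 3)"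
  obtains v s where "v \<noteq> 0" "s \<noteq> 0" "ver v = s *s z"
proof (cases "z $ 1 = 0")
  case True
  then have z: "z $ 2 = 0" "z $ 3 \<noteq> 0" using assms by (auto simp: vec_eq_iff forall_3)
  show ?thesis
  proof (rule that[of "vector [0, 1]" "1 / z $ 3"])
    show "vector [0, 1] \<noteq> (0 :: complex ^ 2)" by (simp add: vec_eq_iff forall_2)
    show "ver (vector [0, 1]) = (1 / z $ 3) *s z"
      using z True by (intro vec3_eqI) (simp_all add: ver_nth)
  qed (use z in simp)
next
  case False
  show ?thesis
  proof (rule that[of "vector [z $ 1, z $ 2]" "z $ 1"])
    show "vector [z $ 1, z $ 2] \<noteq> (0 :: complex ^ 2)" using False by (simp add: vec_eq_iff forall_2)
    show "ver (vector [z $ 1, z $ 2]) = z $ 1 *s z"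
      using assms(1) by (intro vec3_eqI) (simp_all add: ver_nth power2_eq_square)
  qed (rule False)
qed

lemma ver_prop:
  assumes "ver w = c *s ver v"
  shows "det2 v w = 0"
proof -
  have e: "(w $ 1)\<^sup>2 = c * (v $ 1)\<^sup>2" "w $ 1 * w $ 2 = c * (v $ 1 * v $ 2)" "(w $ 2)\<^sup>2 = c * (v $ 2)\<^sup>2"
    using assms by (simp_all add: vec_eq_iff forall_3 ver_nth)
  have "(det2 v w)\<^sup>2 = (v $ 1)\<^sup>2 * (w $ 2)\<^sup>2 - 2 * (v $ 1 * v $ 2) * (w $ 1 * w $ 2) + (v $ 2)\<^sup>2 * (w $ 1)\<^sup>2"
    by (simp add: det2_def power2_eq_square algebra_simps)
  also have "\<dots> = 0" unfolding e by (simp add: power2_eq_square algebra_simps)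
  finally show ?thesis by simp
qed

text \<open>The standard quadratic transformation of the plane, an involution off the coordinate
  triangle.\<close>

definition cr :: "complex ^ 3 \<Rightarrow> complex ^ 3" where
  "cr y = vector [y $ 2 * y $ 3, y $ 1 * y $ 3, y $ 1 * y $ 2]"

lemma cr_nth: "cr y $ 1 = y $ 2 * y $ 3" "cr y $ 2 = y $ 1 * y $ 3" "cr y $ 3 = y $ 1 * y $ 2"
  by (simp_all add: cr_def)

lemma cr_scale: "cr (c *s y) = c\<^sup>2 *s cr y"
  by (rule vec3_eqI) (simp_all add: cr_nth power2_eq_square)

lemma cr_cr: "cr (cr y) = (y $ 1 * y $ 2 * y $ 3) *s y"
  by (rule vec3_eqI) (simp_all add: cr_nth)

definition kq :: "(nat \<Rightarrow> complex) \<Rightarrow> complex ^ 3 \<Rightarrow> complex" where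
  "kq s u = s 0 * (u $ 1 * u $ 1) + s 1 * (u $ 2 * u $ 2) + s 2 * (u $ 3 * u $ 3) +
     s 3 * (u $ 1 * u $ 2) + s 4 * (u $ 1 * u $ 3) + s 5 * (u $ 2 * u $ 3)"

lemma kq_scale: "kq s (c *s u) = c\<^sup>2 * kq s u"
  by (simp add: kq_def power2_eq_square algebra_simps)

lemma kq_compose: "\<exists>t. \<forall>z. kq s (A *v z) = kq t z"
proof -
  define t where "t n = (if n = 0 then kq s (column 1 A) else if n = 1 then kq s (column 2 A)
    else if n = 2 then kq s (column 3 A)
    else if n = 3 then kq s (column 1 A + column 2 A) - kq s (column 1 A) - kq s (column 2 A)
    else if n = 4 then kq s (column 1 A + column 3 A) - kq s (column 1 A) - kq s (column 3 A)
    else kq s (column 2 A + column 3 A) - kq s (column 2 A) - kq s (column 3 A))" for n :: nat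
  have A: "(A *v z) $ i = A $ i $ 1 * z $ 1 + A $ i $ 2 * z $ 2 + A $ i $ 3 * z $ 3" for z i
    by (simp add: matrix_vector_mult_def sum_3)
  have "kq s (A *v z) = kq t z" for z
    unfolding kq_def[of t] unfolding t_def kq_def A by (simp add: column_def algebra_simps)
  then show ?thesis by blast
qed

text \<open>Restricted to the conic a quadric becomes a binary quartic with coefficients
  \<open>h\<close>; their vanishing leaves only the multiples of the equation of the conic.\<close>

lemma kq_veronese:
  assumes "\<And>v. v \<noteq> 0 \<Longrightarrow> kq t (ver v) = 0"
  shows "kq t z = t 4 * (z $ 1 * z $ 3 - z $ 2 * z $ 2)"
proof -
  define h where "h n = (if n = 0 then t 2 else if n = 1 then t 5 else if n = 2 then t 1 + t 4
    else if n = 3 then t 3 else t 0)" for n :: nat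
  have k: "kq t (ver v) = (\<Sum>n\<le>4. h n * (v $ 1) ^ n * (v $ 2) ^ (4 - n))" for v
    by (simp add: sum_le_4 h_def kq_def ver_nth power_numeral_reduce algebra_simps)
  have "\<forall>n\<le>4. h n = 0"
  proof (rule quartic_eq_0)
    fix v :: "complex ^ 2"
    show "(\<Sum>n\<le>4. h n * (v $ 1) ^ n * (v $ 2) ^ (4 - n)) = 0"
    proof (cases "v = 0")
      case True
      then show ?thesis by (simp add: sum_le_4)
    next
      case False
      then show ?thesis using assms k by metis
    qed
  qed
  then have "h 0 = 0" "h 1 = 0" "h 2 = 0" "h 3 = 0" "h 4 = 0" by auto
  then have t: "t 2 = 0" "t 5 = 0" "t 1 = - t 4" "t 3 = 0" "t 0 = 0"
    by (simp_all add: h_def eq_neg_iff_add_eq_0)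
  show ?thesis unfolding kq_def t by (simp add: algebra_simps)
qed

lemma tf_kq_cr: "ternary_form 4 (\<lambda>y. kq s (cr y))"
proof -
  have "ternary_form (Suc (Suc (Suc (Suc 0)))) (\<lambda>y. s 0 * (y $ 2 * (y $ 2 * (y $ 3 * (y $ 3 * 1)))) +
    s 1 * (y $ 1 * (y $ 1 * (y $ 3 * (y $ 3 * 1)))) + s 2 * (y $ 1 * (y $ 1 * (y $ 2 * (y $ 2 * 1)))) +
    s 3 * (y $ 1 * (y $ 2 * (y $ 3 * (y $ 3 * 1)))) + s 4 * (y $ 1 * (y $ 2 * (y $ 2 * (y $ 3 * 1)))) +
    s 5 * (y $ 1 * (y $ 1 * (y $ 2 * (y $ 3 * 1)))))"
    by (intro tf_add tf_scale tf_coord tf_const)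
  moreover have "(\<lambda>y. s 0 * (y $ 2 * (y $ 2 * (y $ 3 * (y $ 3 * 1)))) +
    s 1 * (y $ 1 * (y $ 1 * (y $ 3 * (y $ 3 * 1)))) + s 2 * (y $ 1 * (y $ 1 * (y $ 2 * (y $ 2 * 1)))) +
    s 3 * (y $ 1 * (y $ 2 * (y $ 3 * (y $ 3 * 1)))) + s 4 * (y $ 1 * (y $ 2 * (y $ 2 * (y $ 3 * 1)))) +
    s 5 * (y $ 1 * (y $ 1 * (y $ 2 * (y $ 3 * 1))))) = (\<lambda>y. kq s (cr y))"
    by (simp add: fun_eq_iff kq_def cr_nth algebra_simps)
  ultimately show ?thesis by (simp add: eval_nat_numeral)
qed

lemma tf4_expand:
  assumes "ternary_form 4 F"
  obtains c :: "nat \<Rightarrow> nat \<Rightarrow> complex" where "\<And>x y z. F (vector [x, y, z]) =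
    c 4 0 * x ^ 4 + c 0 4 * y ^ 4 + c 0 0 * z ^ 4 + c 3 1 * x ^ 3 * y + c 3 0 * x ^ 3 * z +
    c 1 3 * x * y ^ 3 + c 0 3 * y ^ 3 * z + c 1 0 * x * z ^ 3 + c 0 1 * y * z ^ 3 +
    c 2 2 * x\<^sup>2 * y\<^sup>2 + c 2 0 * x\<^sup>2 * z\<^sup>2 + c 0 2 * y\<^sup>2 * z\<^sup>2 +
    c 2 1 * x\<^sup>2 * y * z + c 1 2 * x * y\<^sup>2 * z + c 1 1 * x * y * z\<^sup>2"
proof -
  obtain c where F: "F = (\<lambda>v. \<Sum>i\<le>4. \<Sum>j\<le>4 - i. c i j * (v $ 1) ^ i * (v $ 2) ^ j * (v $ 3) ^ (4 - i - j))"
    using assms unfolding ternary_form_def by blast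
  have s: "(\<Sum>n\<le>3. f n) = f 0 + f 1 + f 2 + f (3::nat)" "(\<Sum>n\<le>2. f n) = f 0 + f 1 + f (2::nat)"
    "(\<Sum>n\<le>1. f n) = f 0 + f (1::nat)" "(\<Sum>n\<le>Suc 0. f n) = f 0 + f (1::nat)" for f :: "nat \<Rightarrow> complex"
    by (simp_all add: numeral_3_eq_3 numeral_2_eq_2)
  show ?thesis
    by (rule that[of c]) (simp add: F sum_le_4 s algebra_simps)
qed

lemma good_swap: "good k1 k2 k3 \<Longrightarrow> good k2 k1 k3" "good k1 k2 k3 \<Longrightarrow> good k3 k2 k1"
  by (auto simp: good_def res_commute det3_def algebra_simps)

text \<open>\<open>good\<close> is symmetric in the three forms. Inside the locale statements about
  the first form or first vertex suffice, and interpretations with permuted triples provide the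
  others.\<close>

locale cremona_triple =
  fixes k1 k2 k3 :: "real ^ 3"
  assumes good: "good k1 k2 k3"
begin

definition Q1 where "Q1 v = qf (cvec k1) v"
definition Q2 where "Q2 v = qf (cvec k2) v"
definition Q3 where "Q3 v = qf (cvec k3) v"
definition N where "N = cm (vector [k1, k2, k3] :: real ^ 3 ^ 3)"
definition N' where "N' = (SOME B. N ** B = mat 1 \<and> B ** N = mat 1)"

abbreviation quartic where "quartic \<equiv> cremona k1 k2 k3"

lemma goodD: "disc k1 \<noteq> 0" "disc k2 \<noteq> 0" "disc k3 \<noteq> 0" "res k1 k2 \<noteq> 0" "res k1 k3 \<noteq> 0" "res k2 k3 \<noteq> 0"
  "det3 k1 k2 k3 \<noteq> 0"
  using good by (simp_all add: good_def)

lemma NN: "N ** N' = mat 1" "N' ** N = mat 1"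
proof -
  have "det (vector [k1, k2, k3] :: real ^ 3 ^ 3) \<noteq> 0" using goodD by (simp add: det_vector3)
  then obtain B where "N ** B = mat 1 \<and> B ** N = mat 1" using cm_inverse unfolding N_def by metis
  then have "N ** N' = mat 1 \<and> N' ** N = mat 1" unfolding N'_def by (rule someI)
  then show "N ** N' = mat 1" "N' ** N = mat 1" by auto
qed

lemma NN_vec: "N *v (N' *v x) = x" "N' *v (N *v x) = x"
  by (simp_all add: matrix_vector_mul_assoc NN)

lemma N_ver: "N *v ver v = vector [Q1 v, Q2 v, Q3 v]"
  by (rule vec3_eqI) (simp_all add: N_def cm_def matrix_vector_mult_def sum_3 ver_nth Q1_def Q2_def Q3_def qf_def)

lemma theta_eq: "lift4 quartic v = cr (N *v ver v)"
  unfolding N_ver theta_cremona by (rule vec3_eqI) (simp_all add: cr_nth Q1_def Q2_def Q3_def)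

lemma theta_Q: "lift4 quartic v = vector [Q2 v * Q3 v, Q1 v * Q3 v, Q1 v * Q2 v]"
  by (simp add: theta_cremona Q1_def Q2_def Q3_def)

lemma no_common: "v \<noteq> 0 \<Longrightarrow> Q1 v = 0 \<Longrightarrow> Q2 v \<noteq> 0 \<and> Q3 v \<noteq> 0"
  "v \<noteq> 0 \<Longrightarrow> Q2 v = 0 \<Longrightarrow> Q1 v \<noteq> 0 \<and> Q3 v \<noteq> 0" "v \<noteq> 0 \<Longrightarrow> Q3 v = 0 \<Longrightarrow> Q1 v \<noteq> 0 \<and> Q2 v \<noteq> 0"
proof -
  have r: "res k2 k1 \<noteq> 0" "res k3 k1 \<noteq> 0" "res k3 k2 \<noteq> 0" using goodD res_commute by metis+
  show "v \<noteq> 0 \<Longrightarrow> Q1 v = 0 \<Longrightarrow> Q2 v \<noteq> 0 \<and> Q3 v \<noteq> 0"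
    unfolding Q1_def Q2_def Q3_def using no_common_root[OF goodD(4)] no_common_root[OF goodD(5)] by blast
  show "v \<noteq> 0 \<Longrightarrow> Q2 v = 0 \<Longrightarrow> Q1 v \<noteq> 0 \<and> Q3 v \<noteq> 0"
    unfolding Q1_def Q2_def Q3_def using no_common_root[OF r(1)] no_common_root[OF goodD(6)] by blast
  show "v \<noteq> 0 \<Longrightarrow> Q3 v = 0 \<Longrightarrow> Q1 v \<noteq> 0 \<and> Q2 v \<noteq> 0"
    unfolding Q1_def Q2_def Q3_def using no_common_root[OF r(2)] no_common_root[OF r(3)] by blast
qed

lemma theta_nonzero:
  assumes "v \<noteq> 0" shows "lift4 quartic v \<noteq> 0"
proof
  assume "lift4 quartic v = 0"
  then have e: "Q2 v * Q3 v = 0" "Q1 v * Q3 v = 0" "Q1 v * Q2 v = 0"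
    unfolding theta_Q by (simp_all add: vec_eq_iff forall_3)
  then have "Q2 v = 0 \<or> Q3 v = 0" by simp
  then show False
  proof
    assume "Q2 v = 0"
    from no_common(2)[OF assms this] e(2) show False by simp
  next
    assume "Q3 v = 0"
    from no_common(3)[OF assms this] e(3) show False by simp
  qed
qed

lemma N_ver_prop:
  assumes "N *v ver w = c *s (N *v ver v)"
  shows "det2 v w = 0"
proof (rule ver_prop)
  have "N' *v (N *v ver w) = N' *v (c *s (N *v ver v))" using assms by simp
  then show "ver w = c *s ver v" by (simp add: matrix_vector_smult NN_vec)
qed

text \<open>The equation of the conic traced by \<open>(Q1, Q2, Q3)\<close>, obtained from the
  standard conic by the coordinate change \<open>N'\<close>.\<close>

definition K where "K u = (N' *v u) $ 1 * (N' *v u) $ 3 - (N' *v u) $ 2 * (N' *v u) $ 2"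

lemma K_kq: "\<exists>s. \<forall>u. K u = kq s u"
proof -
  define t :: "nat \<Rightarrow> complex" where "t n = (if n = 4 then 1 else if n = 1 then - 1 else 0)" for n
  have "K u = kq t (N' *v u)" for u by (simp add: K_def kq_def t_def)
  then show ?thesis using kq_compose[of t N'] by simp
qed

lemma K_scale: "K (c *s u) = c\<^sup>2 * K u"
  using K_kq kq_scale by metis

lemma K_ver: "K (N *v ver v) = 0"
  by (simp add: K_def NN_vec ver_nth power2_eq_square)

lemma K_zero:
  assumes "K u = 0" "u \<noteq> 0"
  obtains v s where "v \<noteq> 0" "s \<noteq> 0" "N *v ver v = s *s u"
proof -
  have "N' *v u \<noteq> 0" using assms(2) NN_vec(1)[of u] by (metis matrix_vector_mult_0_right)
  then obtain v s where v: "v \<noteq> 0" "s \<noteq> 0" "ver v = s *s (N' *v u)"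
    using assms(1) conic_point[of "N' *v u"] unfolding K_def by (metis right_minus_eq)
  then have "N *v ver v = s *s u" by (simp add: matrix_vector_smult NN_vec)
  with v that show ?thesis by blast
qed

text \<open>The pullback of the conic under the quadratic transformation, which is the quartic
  equation of the curve.\<close>

definition F where "F y = K (cr y)"

lemma tf_F: "ternary_form 4 F"
proof -
  obtain s where "\<And>u. K u = kq s u" using K_kq by blast
  then have "F = (\<lambda>y. kq s (cr y))" by (simp add: F_def fun_eq_iff)
  then show ?thesis by (simp add: tf_kq_cr)
qed

lemma F_theta: "F (lift4 quartic v) = 0"
  by (simp add: F_def theta_eq cr_cr K_scale K_ver)

text \<open>A vertex on the conic would be a common root of two of the forms.\<close>

lemma K_axis: "K (axis i 1) \<noteq> 0"
proof
  assume "K (axis i 1) = 0"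
  then obtain v s where v: "v \<noteq> 0" "s \<noteq> 0" "N *v ver v = s *s axis i 1" using K_zero[of "axis i 1"] by (metis axis_eq_0_iff zero_neq_one)
  have e: "Q1 v = s * axis i 1 $ 1" "Q2 v = s * axis i 1 $ 2" "Q3 v = s * axis i 1 $ 3"
    using v(3) unfolding N_ver by (simp_all add: vec_eq_iff forall_3)
  show False using exhaust_3[of i] e no_common[OF v(1)] by (auto simp: axis_def)
qed

lemma theta_at_root:
  "Q1 v = 0 \<Longrightarrow> lift4 quartic v = (Q2 v * Q3 v) *s axis 1 1"
  "Q2 v = 0 \<Longrightarrow> lift4 quartic v = (Q1 v * Q3 v) *s axis 2 1"
  "Q3 v = 0 \<Longrightarrow> lift4 quartic v = (Q1 v * Q2 v) *s axis 3 1"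
  by (rule vec3_eqI; simp add: theta_Q axis_def)+

lemma axis_in_image: "\<exists>v s. v \<noteq> 0 \<and> s \<noteq> 0 \<and> lift4 quartic v = s *s axis i 1"
proof -
  obtain v1 v2 v3 where v: "v1 \<noteq> 0" "Q1 v1 = 0" "v2 \<noteq> 0" "Q2 v2 = 0" "v3 \<noteq> 0" "Q3 v3 = 0"
    unfolding Q1_def Q2_def Q3_def using qf_root by metis
  have "Q2 v1 * Q3 v1 \<noteq> 0" "Q1 v2 * Q3 v2 \<noteq> 0" "Q1 v3 * Q2 v3 \<noteq> 0"
    using no_common(1)[OF v(1,2)] no_common(2)[OF v(3,4)] no_common(3)[OF v(5,6)] by simp_all
  then show ?thesis
    using exhaust_3[of i] v theta_at_root(1)[OF v(2)] theta_at_root(2)[OF v(4)] theta_at_root(3)[OF v(6)] by blast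
qed

text \<open>A zero \<open>y\<close> of \<open>F\<close> with \<open>cr y\<close> nonzero is
  recovered by transforming back the point \<open>cr y\<close> of the conic. If
  \<open>cr y = 0\<close>, then \<open>y\<close> is a vertex, and vertices are images of the roots
  of the forms.\<close>

lemma zero_locus_F: "zero_locus F = Ctheta 4 quartic ` CP"
proof
  show "Ctheta 4 quartic ` CP \<subseteq> zero_locus F"
    using zero_locus_theta[OF theta_nonzero] F_theta by simp
  show "zero_locus F \<subseteq> Ctheta 4 quartic ` CP"
  proof
    fix x assume x: "x \<in> zero_locus F"
    then obtain y where y: "y \<noteq> 0" "x = pt y" unfolding zero_locus_def using CP_cases by blast
    have F0: "F y = 0" using x pt_self unfolding y(2) zero_locus_def by blast
    have "\<exists>v s. v \<noteq> 0 \<and> s \<noteq> 0 \<and> lift4 quartic v = s *s y"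
    proof (cases "cr y = 0")
      case False
      then obtain v s where v: "v \<noteq> 0" "s \<noteq> 0" "N *v ver v = s *s cr y"
        using K_zero[of "cr y"] F0 unfolding F_def by metis
      have "lift4 quartic v = (s\<^sup>2 * (y $ 1 * y $ 2 * y $ 3)) *s y"
        by (simp add: theta_eq v cr_scale cr_cr)
      moreover have "y $ 1 * y $ 2 * y $ 3 \<noteq> 0"
      proof
        assume z: "y $ 1 * y $ 2 * y $ 3 = 0"
        then have "lift4 quartic v = 0" using calculation by simp
        then show False using theta_nonzero v by blast
      qed
      ultimately show ?thesis using v by (metis no_zero_divisors power_not_zero)
    next
      case True
      then have "y $ 2 * y $ 3 = 0" "y $ 1 * y $ 3 = 0" "y $ 1 * y $ 2 = 0" by (metis cr_nth zero_index)+
      then have "\<exists>i. y = (y $ i) *s axis i 1 \<and> y $ i \<noteq> 0"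
        using y(1) by (auto simp: vec_eq_iff forall_3 ex_3 axis_def)
      then obtain i where i: "y = (y $ i) *s axis i 1" "y $ i \<noteq> 0" by blast
      obtain v s where v: "v \<noteq> 0" "s \<noteq> 0" "lift4 quartic v = s *s axis i 1"
        using axis_in_image by blast
      have "axis i 1 = (1 / y $ i) *s y" by (subst i(1)) (use i(2) in simp)
      then have "lift4 quartic v = (s / y $ i) *s y" using v(3) by simp
      then show ?thesis using v(1,2) i(2) by (metis divide_eq_0_iff)
    qed
    then obtain v s where v: "v \<noteq> 0" "s \<noteq> 0" "lift4 quartic v = s *s y" by blast
    then have "x = Ctheta 4 quartic (pt v)" by (simp add: y Ctheta_pt pt_scale)
    then show "x \<in> Ctheta 4 quartic ` CP" using v(1) by (simp add: pt_in_CP)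
  qed
qed

lemma F_nonzero: "F \<noteq> (\<lambda>_. 0)"
proof
  assume "F = (\<lambda>_. 0)"
  then have "F (vector [0, 1, 1]) = 0" by simp
  moreover have "cr (vector [0, 1, 1]) = axis 1 1" by (rule vec3_eqI) (simp_all add: cr_nth axis_def)
  ultimately show False using K_axis[of 1] by (simp add: F_def)
qed

text \<open>A linear system for \<open>c\<close> and \<open>e\<close> whose determinant is
  \<open>det2 r r'\<close> times the determinant of the triple.\<close>

lemma two_roots:
  assumes "c * Q3 r + e * Q2 r = 0" "c * Q3 r' + e * Q2 r' = 0" "cvec k1 = lq r r'" "det2 r r' \<noteq> 0"
  shows "c = 0 \<and> e = 0"
proof -
  have "det3 (lq r r') (cvec k2) (cvec k3) \<noteq> 0"
    unfolding assms(3)[symmetric] det3_cvec using goodD by simp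
  then have d: "Q2 r * Q3 r' - Q2 r' * Q3 r \<noteq> 0"
    unfolding Q2_def Q3_def det3_lq using assms(4) by simp
  have "c * (Q2 r * Q3 r' - Q2 r' * Q3 r) = (c * Q3 r' + e * Q2 r') * Q2 r - (c * Q3 r + e * Q2 r) * Q2 r'"
    "e * (Q2 r * Q3 r' - Q2 r' * Q3 r) = (c * Q3 r + e * Q2 r) * Q3 r' - (c * Q3 r' + e * Q2 r') * Q3 r"
    by (simp_all add: algebra_simps)
  then show ?thesis using assms(1,2) d by simp
qed

lemma triple_cancel:
  assumes "continuous_on UNIV g" "\<And>v. v \<noteq> 0 \<Longrightarrow> Q1 v * Q2 v * Q3 v * g v = 0" "v \<noteq> 0"
  shows "g v = 0"
proof -
  have k: "cvec k1 \<noteq> 0" "cvec k2 \<noteq> 0" "cvec k3 \<noteq> 0" using goodD by (auto simp: bp_def)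
  have c3: "continuous_on UNIV (\<lambda>v. qf (cvec k3) v * g v)"
    by (intro continuous_on_mult continuous_qf assms(1))
  have c2: "continuous_on UNIV (\<lambda>v. qf (cvec k2) v * (qf (cvec k3) v * g v))"
    by (intro continuous_on_mult continuous_qf c3)
  have 1: "qf (cvec k2) v * (qf (cvec k3) v * g v) = 0" if "v \<noteq> 0" for v
    by (rule qf_cancel[OF k(1) c2 _ that])
       (use assms(2) in \<open>simp only: Q1_def Q2_def Q3_def mult.assoc not_False_eq_True\<close>)
  have 2: "qf (cvec k3) v * g v = 0" if "v \<noteq> 0" for v
    by (rule qf_cancel[OF k(2) c3 1 that])
  show ?thesis by (rule qf_cancel[OF k(3) assms(1) 2 assms(3)])
qed

text \<open>The equation of the curve is unique up to scaling: after removing the monomials excluded by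
  the transversal branches at the vertices, a quartic vanishing on the curve is the pullback of a
  conic.\<close>

lemma quartic_unique:
  assumes tf: "ternary_form 4 G" and van: "\<And>v. v \<noteq> 0 \<Longrightarrow> G (lift4 quartic v) = 0"
  shows "\<exists>m. \<forall>y. G y = m * F y"
proof -
  obtain c :: "nat \<Rightarrow> nat \<Rightarrow> complex" where G: "\<And>x y z. G (vector [x, y, z]) =
    c 4 0 * x ^ 4 + c 0 4 * y ^ 4 + c 0 0 * z ^ 4 + c 3 1 * x ^ 3 * y + c 3 0 * x ^ 3 * z +
    c 1 3 * x * y ^ 3 + c 0 3 * y ^ 3 * z + c 1 0 * x * z ^ 3 + c 0 1 * y * z ^ 3 +
    c 2 2 * x\<^sup>2 * y\<^sup>2 + c 2 0 * x\<^sup>2 * z\<^sup>2 + c 0 2 * y\<^sup>2 * z\<^sup>2 +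
    c 2 1 * x\<^sup>2 * y * z + c 1 2 * x * y\<^sup>2 * z + c 1 1 * x * y * z\<^sup>2"
    by (rule tf4_expand[OF tf]) (rule that)
  have Gt: "G (vector [Q2 v * Q3 v, Q1 v * Q3 v, Q1 v * Q2 v]) = 0" if "v \<noteq> 0" for v
    using van[OF that] by (simp add: theta_Q)
  obtain r1 s1 where r1: "det2 r1 s1 \<noteq> 0" "r1 \<noteq> 0" "s1 \<noteq> 0" "cvec k1 = lq r1 s1" by (rule disc_roots[OF goodD(1)])
  obtain r2 s2 where r2: "det2 r2 s2 \<noteq> 0" "r2 \<noteq> 0" "s2 \<noteq> 0" "cvec k2 = lq r2 s2" by (rule disc_roots[OF goodD(2)])
  obtain r3 s3 where r3: "det2 r3 s3 \<noteq> 0" "r3 \<noteq> 0" "s3 \<noteq> 0" "cvec k3 = lq r3 s3" by (rule disc_roots[OF goodD(3)])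
  have z1: "Q1 r1 = 0" "Q1 s1 = 0" and z2: "Q2 r2 = 0" "Q2 s2 = 0" and z3: "Q3 r3 = 0" "Q3 s3 = 0"
    unfolding Q1_def Q2_def Q3_def r1(4) r2(4) r3(4) qf_lq by (simp_all add: det2_def)
  note n1 = no_common(1)[OF r1(2) z1(1)] no_common(1)[OF r1(3) z1(2)]
  note n2 = no_common(2)[OF r2(2) z2(1)] no_common(2)[OF r2(3) z2(2)]
  note n3 = no_common(3)[OF r3(2) z3(1)] no_common(3)[OF r3(3) z3(2)]
  \<comment> \<open>At a root of one of the forms the curve passes through a vertex, where
    \<open>G\<close> reduces to the fourth power of one coordinate.\<close>
  have c0: "c 4 0 = 0" "c 0 4 = 0" "c 0 0 = 0"
    using Gt[OF r1(2)] Gt[OF r2(2)] Gt[OF r3(2)] n1 n2 n3 unfolding G z1 z2 z3 by simp_all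
  \<comment> \<open>With the fourth powers gone, the substitution of
    \<open>(b * d, a * d, a * b)\<close> makes \<open>G\<close> divisible by
    \<open>a * b * d\<close>; \<open>H\<close> is the quotient, and \<open>triple_cancel\<close>
    makes it vanish on the conic.\<close>
  define H where "H a b d = c 3 1 * b\<^sup>2 * d ^ 3 + c 3 0 * b ^ 3 * d\<^sup>2 + c 1 3 * a\<^sup>2 * d ^ 3 + c 0 3 * a ^ 3 * d\<^sup>2 +
    c 1 0 * a\<^sup>2 * b ^ 3 + c 0 1 * a ^ 3 * b\<^sup>2 + a * b * d * (c 2 2 * d\<^sup>2 + c 2 0 * b\<^sup>2 + c 0 2 * a\<^sup>2 +
    c 2 1 * b * d + c 1 2 * a * d + c 1 1 * a * b)" for a b d
  have GH: "G (vector [b * d, a * d, a * b]) = a * b * d * H a b d" for a b d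
    unfolding G H_def c0 by (simp add: power_numeral_reduce algebra_simps)
  have cQ: "continuous_on UNIV Q1" "continuous_on UNIV Q2" "continuous_on UNIV Q3"
    unfolding Q1_def[abs_def] Q2_def[abs_def] Q3_def[abs_def] by (rule continuous_qf)+
  have H0: "H (Q1 v) (Q2 v) (Q3 v) = 0" if "v \<noteq> 0" for v
  proof (rule triple_cancel[OF _ _ that])
    show "continuous_on UNIV (\<lambda>v. H (Q1 v) (Q2 v) (Q3 v))" unfolding H_def by (intro continuous_intros cQ)
    show "Q1 v * Q2 v * Q3 v * H (Q1 v) (Q2 v) (Q3 v) = 0" if "v \<noteq> 0" for v
      using Gt[OF that] unfolding GH .
  qed
  have e1: "c 3 1 * d + c 3 0 * b = 0" if "H 0 b d = 0" "b \<noteq> 0" "d \<noteq> 0" for b d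
  proof -
    have "H 0 b d = b\<^sup>2 * d\<^sup>2 * (c 3 1 * d + c 3 0 * b)"
      unfolding H_def by (simp add: power_numeral_reduce algebra_simps)
    then show ?thesis using that by simp
  qed
  have e2: "c 1 3 * d + c 0 3 * a = 0" if "H a 0 d = 0" "a \<noteq> 0" "d \<noteq> 0" for a d
  proof -
    have "H a 0 d = a\<^sup>2 * d\<^sup>2 * (c 1 3 * d + c 0 3 * a)"
      unfolding H_def by (simp add: power_numeral_reduce algebra_simps)
    then show ?thesis using that by simp
  qed
  have e3: "c 1 0 * b + c 0 1 * a = 0" if "H a b 0 = 0" "a \<noteq> 0" "b \<noteq> 0" for a b
  proof -
    have "H a b 0 = a\<^sup>2 * b\<^sup>2 * (c 1 0 * b + c 0 1 * a)"
      unfolding H_def by (simp add: power_numeral_reduce algebra_simps)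
    then show ?thesis using that by simp
  qed
  interpret swap12: cremona_triple k2 k1 k3 using good by unfold_locales (rule good_swap)
  interpret swap13: cremona_triple k3 k2 k1 using good by unfold_locales (rule good_swap)
  \<comment> \<open>At a root of \<open>k1\<close> the quotient \<open>H\<close> reduces to the
    cubic-in-one-coordinate coefficients at the first vertex. The two roots give two independent
    equations, one for each branch through the vertex.\<close>
  have d1: "c 3 1 = 0 \<and> c 3 0 = 0"
  proof (rule two_roots[OF _ _ r1(4,1)])
    show "c 3 1 * Q3 r1 + c 3 0 * Q2 r1 = 0" using H0[OF r1(2)] z1 n1 by (intro e1) auto
    show "c 3 1 * Q3 s1 + c 3 0 * Q2 s1 = 0" using H0[OF r1(3)] z1 n1 by (intro e1) auto
  qed
  have d2: "c 1 3 = 0 \<and> c 0 3 = 0"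
  proof (rule swap12.two_roots[OF _ _ r2(4,1), unfolded swap12.Q2_def swap12.Q3_def, folded Q1_def Q3_def])
    show "c 1 3 * Q3 r2 + c 0 3 * Q1 r2 = 0" using H0[OF r2(2)] z2 n2 by (intro e2) auto
    show "c 1 3 * Q3 s2 + c 0 3 * Q1 s2 = 0" using H0[OF r2(3)] z2 n2 by (intro e2) auto
  qed
  have d3: "c 0 1 = 0 \<and> c 1 0 = 0"
  proof (rule swap13.two_roots[OF _ _ r3(4,1), unfolded swap13.Q2_def swap13.Q3_def, folded Q1_def Q2_def])
    show "c 0 1 * Q1 r3 + c 1 0 * Q2 r3 = 0" using e3[of "Q1 r3" "Q2 r3"] H0[OF r3(2)] z3 n3 by (simp add: add.commute)
    show "c 0 1 * Q1 s3 + c 1 0 * Q2 s3 = 0" using e3[of "Q1 s3" "Q2 s3"] H0[OF r3(3)] z3 n3 by (simp add: add.commute)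
  qed
  \<comment> \<open>What remains of \<open>H\<close> is \<open>a * b * d\<close> times a quadratic
    form in \<open>(a, b, d)\<close>; \<open>t\<close> lists its coefficients in the order of
    \<open>kq\<close>.\<close>
  define t where "t n = (if n = 0 then c 0 2 else if n = 1 then c 2 0 else if n = 2 then c 2 2
    else if n = 3 then c 1 1 else if n = 4 then c 1 2 else c 2 1)" for n :: nat
  have Hk: "H a b d = a * b * d * kq t (vector [a, b, d])" for a b d
    using d1 d2 d3 by (simp add: H_def kq_def t_def power2_eq_square)
  have k0: "kq t (N *v ver v) = 0" if "v \<noteq> 0" for v
    unfolding N_ver
  proof (rule triple_cancel[OF _ _ that])
    show "continuous_on UNIV (\<lambda>v. kq t (vector [Q1 v, Q2 v, Q3 v]))"
      unfolding kq_def vector_3 by (intro continuous_intros cQ)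
    show "Q1 v * Q2 v * Q3 v * kq t (vector [Q1 v, Q2 v, Q3 v]) = 0" if "v \<noteq> 0" for v
      using H0[OF that] unfolding Hk .
  qed
  obtain t' where t': "\<And>z. kq t (N *v z) = kq t' z" using kq_compose[of t N] by blast
  have "kq t u = t' 4 * K u" for u
  proof -
    have "kq t u = kq t' (N' *v u)" using t'[of "N' *v u"] by (simp add: NN_vec)
    also have "\<dots> = t' 4 * K u"
      unfolding K_def by (rule kq_veronese) (use k0 t' in simp)
    finally show ?thesis .
  qed
  moreover have "G y = kq t (cr y)" for y
  proof -
    have "y = vector [y $ 1, y $ 2, y $ 3]" by (rule vec3_eqI) simp_all
    then have "G y = G (vector [y $ 1, y $ 2, y $ 3])" by (rule arg_cong)
    also have "\<dots> = kq t (cr y)"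
      unfolding G c0 using d1 d2 d3 by (simp add: kq_def t_def cr_nth power2_eq_square)
    finally show ?thesis .
  qed
  ultimately show ?thesis unfolding F_def by metis
qed

text \<open>A form of lower degree vanishing on the curve, times a power of the first coordinate, is
  a multiple of \<open>F\<close>. Evaluation at \<open>(0, 1, 1)\<close>, where that coordinate
  vanishes and \<open>F\<close> does not, shows that the multiple is zero.\<close>

lemma F_curve_equation: "curve_equation 4 F (Ctheta 4 quartic ` CP)"
  unfolding curve_equation_def
proof (intro conjI allI impI)
  fix e G assume e: "e < (4::nat)" and "ternary_form e G \<and> Ctheta 4 quartic ` CP \<subseteq> zero_locus G"
  then have tf: "ternary_form e G" and z: "\<And>v. v \<noteq> 0 \<Longrightarrow> G (lift4 quartic v) = 0"
    using zero_locus_theta[OF theta_nonzero] by auto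
  have pw: "ternary_form (i + e) (\<lambda>y. lin m y ^ i * G y)" for i m by (rule tf_lin_power[OF tf])
  have zero: "G y = 0" if m: "lin m y \<noteq> 0" "m = axis 1 1" for m y
  proof -
    have "ternary_form 4 (\<lambda>y. lin m y ^ (4 - e) * G y)" using pw[of "4 - e" m] e by simp
    then obtain s where s: "\<And>y. lin m y ^ (4 - e) * G y = s * F y"
      using quartic_unique[of "\<lambda>y. lin m y ^ (4 - e) * G y"] z by auto
    have "cr (vector [0, 1, 1]) = axis 1 1" by (rule vec3_eqI) (simp_all add: cr_nth axis_def)
    then have "F (vector [0, 1, 1]) \<noteq> 0" using K_axis[of 1] by (simp add: F_def)
    moreover have "lin m (vector [0, 1, 1]) = 0" by (simp add: m(2) lin_axis)
    ultimately have "s = 0" using s[of "vector [0, 1, 1]"] e by (simp add: power_0_left)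
    then show ?thesis using s[of y] m by simp
  qed
  have contG: "isCont G v" for v
    by (rule ternary_form_gradient[OF tf]) (blast intro: has_derivative_continuous)
  show "G = (\<lambda>_. 0)"
  proof
    fix y
    show "G y = 0"
    proof (cases "y $ 1 = 0")
      case False
      then show ?thesis using zero by (simp add: lin_axis)
    next
      case True
      show ?thesis
      proof (rule ccontr)
        assume nz: "G y \<noteq> 0"
        \<comment> \<open>On the line where the first coordinate vanishes, continuity takes over:
          \<open>y\<close> is moved off this line in the direction of the first axis.\<close>
        have "isCont (\<lambda>z. G (y + z *s axis 1 1)) 0" by (rule isCont_o2[OF continuous_line contG])
        then have "\<forall>\<^sub>F z in nhds 0. G (y + z *s axis 1 1) \<noteq> 0"
          using isCont_eventually[of 0 "\<lambda>z. G (y + z *s axis 1 1)" "- {0}"] nz by (simp add: open_Compl)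
        then obtain d where d: "d > 0" "\<And>z. dist z 0 < d \<Longrightarrow> G (y + z *s axis 1 1) \<noteq> 0"
          unfolding eventually_nhds_metric by blast
        have "(y + complex_of_real (d / 2) *s axis 1 1) $ 1 \<noteq> 0" using d(1) True by (simp add: axis_def)
        then have "G (y + complex_of_real (d / 2) *s axis 1 1) = 0" using zero by (simp add: lin_axis)
        moreover have "dist (complex_of_real (d / 2)) 0 < d" using d(1) by (simp add: dist_norm)
        ultimately show False using d(2) by blast
      qed
    qed
  qed
qed (simp_all add: tf_F F_nonzero zero_locus_F)

text \<open>Off the coordinate triangle the derivative \<open>dcr\<close> of the quadratic
  transformation is surjective, and a smooth conic has nonzero gradient away from the
  origin.\<close>

lemma F_gradient:
  assumes "(F has_derivative (\<lambda>_. 0)) (at y)"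
  shows "y $ 1 = 0 \<or> y $ 2 = 0 \<or> y $ 3 = 0"
proof (rule ccontr)
  assume "\<not> ?thesis"
  then have y: "y $ 1 \<noteq> 0" "y $ 2 \<noteq> 0" "y $ 3 \<noteq> 0" by auto
  have lin': "((*v) N' has_derivative (*v) N') (at x)" for x
    unfolding matrix_vector_mult_def
    by (rule has_derivative_vec_lambda) (auto intro!: derivative_eq_intros)
  define dcr where "dcr h = (vector [y $ 2 * h $ 3 + h $ 2 * y $ 3, y $ 1 * h $ 3 + h $ 1 * y $ 3,
      y $ 1 * h $ 2 + h $ 1 * y $ 2] :: complex ^ 3)" for h :: "complex ^ 3"
  have "(cr has_derivative dcr) (at y)"
  proof (rule has_derivative_vec_lambda)
    fix i show "((\<lambda>v. cr v $ i) has_derivative (\<lambda>h. dcr h $ i)) (at y)"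
      using exhaust_3[of i] unfolding dcr_def
      by (elim disjE) (auto simp: cr_nth intro!: derivative_eq_intros)
  qed
  from has_derivative_compose[OF this lin']
  have "((\<lambda>y. N' *v cr y) has_derivative (\<lambda>h. N' *v dcr h)) (at y)" .
  then have dz: "((\<lambda>y. (N' *v cr y) $ i) has_derivative (\<lambda>h. (N' *v dcr h) $ i)) (at y)" for i
    by (rule has_derivative_compose[OF _ has_derivative_vec_nth])
  define z where "z = N' *v cr y"
  have "(F has_derivative (\<lambda>h. (z $ 1 * (N' *v dcr h) $ 3 + (N' *v dcr h) $ 1 * z $ 3) -
     (z $ 2 * (N' *v dcr h) $ 2 + (N' *v dcr h) $ 2 * z $ 2))) (at y)"
    unfolding F_def[abs_def] K_def z_def by (intro has_derivative_diff has_derivative_mult dz)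
  then have "(\<lambda>h. (z $ 1 * (N' *v dcr h) $ 3 + (N' *v dcr h) $ 1 * z $ 3) -
     (z $ 2 * (N' *v dcr h) $ 2 + (N' *v dcr h) $ 2 * z $ 2)) = (\<lambda>_. 0)"
    using assms by (rule has_derivative_unique)
  then have e: "z $ 1 * (N' *v dcr h) $ 3 + (N' *v dcr h) $ 1 * z $ 3 - 2 * z $ 2 * (N' *v dcr h) $ 2 = 0" for h
    by (drule_tac fun_cong[where x = h]) (simp add: algebra_simps)
  \<comment> \<open>In logarithmic coordinates \<open>h $ i = y $ i * g_i\<close> the system
    prescribes the pairwise sums of the \<open>g_i\<close>, which are solved by half sums.\<close>
  have sur: "\<exists>h. dcr h = w" for w
  proof -
    define g1 where "g1 = (w $ 2 / (y $ 1 * y $ 3) + w $ 3 / (y $ 1 * y $ 2) - w $ 1 / (y $ 2 * y $ 3)) / 2"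
    define g2 where "g2 = (w $ 1 / (y $ 2 * y $ 3) + w $ 3 / (y $ 1 * y $ 2) - w $ 2 / (y $ 1 * y $ 3)) / 2"
    define g3 where "g3 = (w $ 1 / (y $ 2 * y $ 3) + w $ 2 / (y $ 1 * y $ 3) - w $ 3 / (y $ 1 * y $ 2)) / 2"
    have g: "g2 + g3 = w $ 1 / (y $ 2 * y $ 3)" "g1 + g3 = w $ 2 / (y $ 1 * y $ 3)" "g1 + g2 = w $ 3 / (y $ 1 * y $ 2)"
      by (simp_all add: g1_def g2_def g3_def field_simps)
    have "dcr (vector [y $ 1 * g1, y $ 2 * g2, y $ 3 * g3]) = vector [y $ 2 * y $ 3 * (g2 + g3),
      y $ 1 * y $ 3 * (g1 + g3), y $ 1 * y $ 2 * (g1 + g2)]"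
      by (rule vec3_eqI) (simp_all add: dcr_def algebra_simps)
    also have "\<dots> = w" unfolding g by (rule vec3_eqI) (use y in simp_all)
    finally show ?thesis by blast
  qed
  have e': "z $ 1 * x $ 3 + x $ 1 * z $ 3 - 2 * z $ 2 * x $ 2 = 0" for x :: "complex ^ 3"
  proof -
    obtain h where "dcr h = N *v x" using sur by blast
    then show ?thesis using e[of h] by (simp add: NN_vec)
  qed
  have "z $ 1 = 0" "z $ 2 = 0" "z $ 3 = 0"
    using e'[of "axis 3 1"] e'[of "axis 2 1"] e'[of "axis 1 1"] by (simp_all add: axis_def)
  then have "z = 0" by (simp add: vec_eq_iff forall_3)
  then have "cr y = 0" using NN_vec(1)[of "cr y"] by (simp add: z_def)
  then have "cr y $ 1 = 0" by simp
  then show False using y by (simp add: cr_nth)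
qed

text \<open>The fibre over the first vertex is the root pair of \<open>k1\<close>. Modulo the
  vertex, the branch at a root \<open>u\<close> has direction \<open>(Q3 u, Q2 u)\<close>; two roots
  with proportional directions would be the same point of the conic.\<close>

lemma node_vertex:
  "preimages 4 quartic (pt (axis 1 1)) = {pt v | v. v \<noteq> 0 \<and> Q1 v = 0}"
  "node 4 quartic (pt (axis 1 1))"
proof -
  have 1: "pt (axis 1 1) = pt (lift4 quartic v) \<longleftrightarrow> Q1 v = 0" if "v \<noteq> 0" for v
  proof
    assume "Q1 v = 0"
    then show "pt (axis 1 1) = pt (lift4 quartic v)"
      using no_common(1)[OF that] by (simp add: theta_at_root pt_scale)
  next
    assume "pt (axis 1 1) = pt (lift4 quartic v)"
    then obtain c where c: "lift4 quartic v = c *s axis 1 1" unfolding pt_eq_iff by blast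
    then have "Q1 v * Q3 v = 0" "Q1 v * Q2 v = 0" unfolding theta_Q
      by (simp_all add: vec_eq_iff forall_3 axis_def)
    then show "Q1 v = 0" using no_common(2)[OF that] by auto
  qed
  show pre: "preimages 4 quartic (pt (axis 1 1)) = {pt v | v. v \<noteq> 0 \<and> Q1 v = 0}"
  proof (intro set_eqI iffI)
    fix P assume P: "P \<in> preimages 4 quartic (pt (axis 1 1))"
    obtain v where "v \<noteq> 0" "P = pt v" "pt (axis 1 1) = pt (lift4 quartic v)"
      using P by (rule preimages_cases)
    then show "P \<in> {pt v | v. v \<noteq> 0 \<and> Q1 v = 0}" using 1 by blast
  next
    fix P assume "P \<in> {pt v | v. v \<noteq> 0 \<and> Q1 v = 0}"
    then show "P \<in> preimages 4 quartic (pt (axis 1 1))" using 1 by (auto simp: pt_in_preimages)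
  qed
  obtain r s where r: "det2 r s \<noteq> 0" "r \<noteq> 0" "s \<noteq> 0" "cvec k1 = lq r s" by (rule disc_roots[OF goodD(1)])
  have Q1: "Q1 v = det2 r v * det2 s v" for v by (simp add: Q1_def r qf_lq)
  have two: "preimages 4 quartic (pt (axis 1 1)) = {pt r, pt s}"
    unfolding pre using r(2,3) pt_eq_det2 by (auto simp: Q1)
  have det: "Q2 u * Q3 w - Q2 w * Q3 u \<noteq> 0" if "Q1 u = 0" "Q1 w = 0" "u \<noteq> 0" "w \<noteq> 0" "pt u \<noteq> pt w" for u w
  proof
    assume z: "Q2 u * Q3 w - Q2 w * Q3 u = 0"
    have "det2 u w \<noteq> 0" using that pt_eq_det2 by blast
    define c where "c = Q2 u / Q2 w"
    have nz: "Q2 w \<noteq> 0" using no_common(1)[OF that(4,2)] by blast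
    have "Q2 u = c * Q2 w" using nz by (simp add: c_def)
    moreover have "Q3 u = c * Q3 w" using nz z by (simp add: c_def field_simps)
    ultimately have "N *v ver u = c *s (N *v ver w)" unfolding N_ver using that(1,2)
      by (intro vec3_eqI) simp_all
    then have "det2 w u = 0" by (rule N_ver_prop)
    then show False using \<open>det2 u w \<noteq> 0\<close> by (simp add: det2_def algebra_simps)
  qed
  have tan: "\<exists>h. \<exists>t. \<forall>x. Dtheta 4 quartic u (x *s h) = vector [x * t, x * Q3 u, x * Q2 u]"
    if u: "Q1 u = 0" "u \<noteq> 0" for u
  proof -
    define dq where dq: "dq k h = k $ 1 * (2 * u $ 1 * h $ 1) + k $ 2 * (u $ 1 * h $ 2 + h $ 1 * u $ 2) +
          k $ 3 * (2 * u $ 2 * h $ 2)" for k :: "complex ^ 3" and h :: "complex ^ 2"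
    have dqf: "(qf k has_derivative dq k) (at u)" for k
      unfolding qf_def dq[abs_def] by (auto intro!: derivative_eq_intros)
    define D where "D h = (vector [
       qf (cvec k2) u * dq (cvec k3) h + dq (cvec k2) h * qf (cvec k3) u,
       qf (cvec k1) u * dq (cvec k3) h + dq (cvec k1) h * qf (cvec k3) u,
       qf (cvec k1) u * dq (cvec k2) h + dq (cvec k1) h * qf (cvec k2) u] :: complex ^ 3)" for h
    have "(lift4 quartic has_derivative D) (at u)"
    proof (rule has_derivative_vec_lambda)
      fix i
      show "((\<lambda>v. lift4 quartic v $ i) has_derivative (\<lambda>h. D h $ i)) (at u)"
        using exhaust_3[of i] unfolding theta_cremona D_def
        by (elim disjE) (simp_all add: has_derivative_mult[OF dqf dqf])
    qed
    then have D: "Dtheta 4 quartic u = D" by (rule has_derivative_unique[OF has_derivative_theta])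
    obtain w where w: "det2 u w = 1" using det2_complement[OF u(2)] by blast
    have "dq (cvec k1) w \<noteq> 0"
    proof
      assume "dq (cvec k1) w = 0"
      \<comment> \<open>At a root, the squared derivative in direction \<open>w\<close> is the
        discriminant times the square of \<open>det2 u w\<close>: nonzero discriminant means simple
        roots.\<close>
      have "(dq (cvec k1) w)\<^sup>2 = disc (cvec k1) * (det2 u w)\<^sup>2 + 4 * qf (cvec k1) u * qf (cvec k1) w"
        unfolding dq by (simp add: bp_def qf_def det2_def power2_eq_square algebra_simps)
      then have "disc (cvec k1) = 0" using \<open>dq (cvec k1) w = 0\<close> u(1) w by (simp add: Q1_def)
      then show False using goodD(1) by (simp add: bp_cvec)
    qed
    define h where "h = (1 / dq (cvec k1) w) *s w"
    have lin_dq: "dq k (x *s h) = x * dq k h" for k x h by (simp add: dq algebra_simps)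
    have "dq (cvec k1) h = 1" using \<open>dq (cvec k1) w \<noteq> 0\<close> by (simp add: h_def lin_dq)
    then have "Dtheta 4 quartic u (x *s h) = vector [x * (qf (cvec k2) u * dq (cvec k3) h + dq (cvec k2) h * qf (cvec k3) u),
      x * Q3 u, x * Q2 u]" for x
      unfolding D D_def lin_dq using u(1) by (intro vec3_eqI) (simp_all add: Q1_def Q2_def Q3_def algebra_simps)
    then show ?thesis by blast
  qed
  have "transversal_branches 4 quartic (pt r) (pt s)"
    unfolding transversal_branches_def
  proof (intro ballI)
    fix u w assume "u \<in> pt r" "w \<in> pt s"
    then obtain p q where pq: "p \<noteq> 0" "u = p *s r" "q \<noteq> 0" "w = q *s s" by (auto simp: mem_pt)
    have u: "Q1 u = 0" "u \<noteq> 0" "Q1 w = 0" "w \<noteq> 0" using r pq by (auto simp: Q1 det2_def)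
    have "pt u \<noteq> pt w" using pq r pt_eq_det2[OF r(2,3)] by (simp add: pt_scale)
    then have d: "Q2 u * Q3 w - Q2 w * Q3 u \<noteq> 0" using det u by blast
    obtain h t where h: "\<And>x. Dtheta 4 quartic u (x *s h) = vector [x * t, x * Q3 u, x * Q2 u]" using tan u by blast
    obtain g t' where g: "\<And>x. Dtheta 4 quartic w (x *s g) = vector [x * t', x * Q3 w, x * Q2 w]" using tan u by blast
    have nz: "Q2 u * Q3 u \<noteq> 0" using no_common(1)[OF u(2,1)] by simp
    have Du: "Dtheta 4 quartic u (x *s u) = vector [x * 4 * (Q2 u * Q3 u), 0, 0]" for x
      unfolding Dtheta_scale euler_theta theta_at_root(1)[OF u(1)] by (rule vec3_eqI) (simp_all add: axis_def)
    have "x \<in> {y + z |y z. y \<in> tangent_cone 4 quartic u \<and> z \<in> tangent_cone 4 quartic w}" for x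
    proof -
      define d where "d = Q2 u * Q3 w - Q2 w * Q3 u"
      have dnz: "d \<noteq> 0" using \<open>Q2 u * Q3 w - Q2 w * Q3 u \<noteq> 0\<close> by (simp add: d_def)
      \<comment> \<open>Cramer's rule with determinant \<open>d\<close> fits the last two
        coordinates by one tangent vector of each branch; the radial direction \<open>u\<close>,
        which maps to the first axis, then corrects the first coordinate.\<close>
      define al where "al = (x $ 3 * Q3 w - x $ 2 * Q2 w) / d"
      define be where "be = (x $ 2 * Q2 u - x $ 3 * Q3 u) / d"
      define ga where "ga = (x $ 1 - al * t - be * t') / (4 * (Q2 u * Q3 u))"
      have 2: "al * Q3 u + be * Q3 w = x $ 2" and 3: "al * Q2 u + be * Q2 w = x $ 3"
      proof -
        have "d * (al * Q3 u + be * Q3 w) = (d * al) * Q3 u + (d * be) * Q3 w" by (simp add: algebra_simps)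
        also have "\<dots> = d * x $ 2" using dnz by (simp add: al_def be_def) (simp add: d_def algebra_simps)
        finally show "al * Q3 u + be * Q3 w = x $ 2" using dnz by simp
        have "d * (al * Q2 u + be * Q2 w) = (d * al) * Q2 u + (d * be) * Q2 w" by (simp add: algebra_simps)
        also have "\<dots> = d * x $ 3" using dnz by (simp add: al_def be_def) (simp add: d_def algebra_simps)
        finally show "al * Q2 u + be * Q2 w = x $ 3" using dnz by simp
      qed
      have 1: "al * t + ga * 4 * (Q2 u * Q3 u) + be * t' = x $ 1" using nz by (simp add: ga_def field_simps)
      have "x = Dtheta 4 quartic u (al *s h + ga *s u) + Dtheta 4 quartic w (be *s g)"
        unfolding Dtheta_add h g Du by (rule vec3_eqI) (use 1 2 3 in simp_all)
      then show ?thesis by (auto simp: tangent_cone_eq)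
    qed
    then show "{y + z |y z. y \<in> tangent_cone 4 quartic u \<and> z \<in> tangent_cone 4 quartic w} = UNIV"
      by blast
  qed
  moreover have "pt r \<noteq> pt s" using pt_eq_det2[OF r(2,3)] r(1) by simp
  ultimately show "node 4 quartic (pt (axis 1 1))" unfolding node_def using two by blast
qed

end

section \<open>Nodes and chord diagrams of the quadratic transforms\<close>

text \<open>From here on triples are functions on the index type 3, so that permutations and
  scalings of the forms act on them.\<close>

definition tc :: "(3 \<Rightarrow> real ^ 3) \<Rightarrow> nat \<Rightarrow> real ^ 3" where
  "tc k = cremona (k 1) (k 2) (k 3)"

definition goodf :: "(3 \<Rightarrow> real ^ 3) \<Rightarrow> bool" where
  "goodf k \<longleftrightarrow> good (k 1) (k 2) (k 3)"

definition param :: "real ^ 3 ^ 3 \<Rightarrow> (3 \<Rightarrow> real ^ 3) \<Rightarrow> nat \<Rightarrow> real ^ 3" where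
  "param M k n = M *v tc k n"

definition curve :: "real ^ 3 ^ 3 \<Rightarrow> (3 \<Rightarrow> real ^ 3) \<Rightarrow> (complex ^ 3) set set" where
  "curve M k = Ctheta 4 (param M k) ` CP"

definition swap12 :: "real ^ 3 ^ 3" where
  "swap12 = vector [vector [0, 1, 0], vector [1, 0, 0], vector [0, 0, 1]]"

definition swap13 :: "real ^ 3 ^ 3" where
  "swap13 = vector [vector [0, 0, 1], vector [0, 1, 0], vector [1, 0, 0]]"

lemma cremona_swap12: "cremona k1 k2 k3 = (\<lambda>n. swap12 *v cremona k2 k1 k3 n)"
  by (rule ext, rule vec3_eqI)
     (simp_all add: cremona_def swap12_def matrix_vector_mult_def sum_3 qm_commute)

lemma cremona_swap13: "cremona k1 k2 k3 = (\<lambda>n. swap13 *v cremona k3 k2 k1 n)"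
  by (rule ext, rule vec3_eqI)
     (simp_all add: cremona_def swap13_def matrix_vector_mult_def sum_3 qm_commute)

lemma det_swaps: "det swap12 \<noteq> 0" "det swap13 \<noteq> 0"
  unfolding swap12_def swap13_def det_vector3 by (simp_all add: det3_def)

lemma cm_axis: "cm M *v axis i 1 = cvec (column i M)"
  by (simp add: vec_eq_iff matrix_vector_mult_def cm_def column_def axis_def if_distrib[of "(*) _"] cong: if_cong)

lemma swap_vertex: "act (cm swap12) (pt (axis 1 1)) = pt (axis 2 1)" "act (cm swap13) (pt (axis 1 1)) = pt (axis 3 1)"
proof -
  have "cm swap12 *v axis 1 1 = axis 2 1" "cm swap13 *v axis 1 1 = axis 3 1"
    unfolding cm_axis by (rule vec3_eqI; simp add: column_def swap12_def swap13_def axis_def)+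
  then show "act (cm swap12) (pt (axis 1 1)) = pt (axis 2 1)" "act (cm swap13) (pt (axis 1 1)) = pt (axis 3 1)"
    by (simp_all add: act_pt)
qed

text \<open>A coordinate swap brings any vertex to the first one and permutes the triple
  accordingly.\<close>

lemma vertex_preimages:
  assumes "goodf k"
  shows "preimages 4 (tc k) (pt (axis i 1)) = {pt v | v. v \<noteq> 0 \<and> qf (cvec (k i)) v = 0}"
    and "node 4 (tc k) (pt (axis i 1))"
proof -
  interpret c1: cremona_triple "k 1" "k 2" "k 3" using assms by unfold_locales (simp add: goodf_def)
  interpret c2: cremona_triple "k 2" "k 1" "k 3" using c1.good by unfold_locales (rule good_swap)
  interpret c3: cremona_triple "k 3" "k 2" "k 1" using c1.good by unfold_locales (rule good_swap)
  have p: "preimages 4 (tc k) (pt (axis 1 1)) = {pt v | v. v \<noteq> 0 \<and> qf (cvec (k 1)) v = 0}"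
    "node 4 (tc k) (pt (axis 1 1))"
    using c1.node_vertex by (simp_all add: tc_def c1.Q1_def)
  have "preimages 4 (tc k) (pt (axis 2 1)) = {pt v | v. v \<noteq> 0 \<and> qf (cvec (k 2)) v = 0}"
    "node 4 (tc k) (pt (axis 2 1))"
    unfolding tc_def cremona_swap12[of "k 1"] swap_vertex(1)[symmetric] preimages_matrix[OF det_swaps(1)]
    using c2.node_vertex node_matrix[OF det_swaps(1)] by (simp_all add: c2.Q1_def)
  moreover have "preimages 4 (tc k) (pt (axis 3 1)) = {pt v | v. v \<noteq> 0 \<and> qf (cvec (k 3)) v = 0}"
    "node 4 (tc k) (pt (axis 3 1))"
    unfolding tc_def cremona_swap13[of "k 1"] swap_vertex(2)[symmetric] preimages_matrix[OF det_swaps(2)]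
    using c3.node_vertex node_matrix[OF det_swaps(2)] by (simp_all add: c3.Q1_def)
  ultimately show "preimages 4 (tc k) (pt (axis i 1)) = {pt v | v. v \<noteq> 0 \<and> qf (cvec (k i)) v = 0}"
    "node 4 (tc k) (pt (axis i 1))"
    using p exhaust_3[of i] by (elim disjE; simp)+
qed

lemma at_vertex:
  assumes "goodf k" "v \<noteq> 0" "qf (cvec (k i)) v = 0"
  shows "pt (lift4 (tc k) v) = pt (axis i 1)"
proof -
  have "pt v \<in> preimages 4 (tc k) (pt (axis i 1))" using assms vertex_preimages by blast
  then show ?thesis by (simp add: pt_in_preimages)
qed

text \<open>Off the roots of the three forms, the quadratic transformation recovers the point of the
  conic from the point of the curve; so two points with the same image must be roots.\<close>

lemma tc_node_iff:
  assumes "goodf k"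
  shows "node 4 (tc k) x \<longleftrightarrow> (\<exists>i. x = pt (axis i 1))"
proof
  assume "node 4 (tc k) x"
  then obtain P Q where PQ: "P \<noteq> Q" "preimages 4 (tc k) x = {P, Q}" unfolding node_def by blast
  then have PQ': "P \<in> preimages 4 (tc k) x" "Q \<in> preimages 4 (tc k) x" by auto
  obtain v where v: "v \<noteq> 0" "P = pt v" "x = pt (lift4 (tc k) v)" by (rule preimages_cases[OF PQ'(1)])
  obtain w where w: "w \<noteq> 0" "Q = pt w" "x = pt (lift4 (tc k) w)" by (rule preimages_cases[OF PQ'(2)])
  have d: "det2 v w \<noteq> 0" using PQ(1) v w pt_eq_det2 by blast
  interpret c1: cremona_triple "k 1" "k 2" "k 3" using assms by unfold_locales (simp add: goodf_def)
  have "\<exists>i. qf (cvec (k i)) v = 0"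
  proof (rule ccontr)
    assume "\<nexists>i. qf (cvec (k i)) v = 0"
    then have nz: "c1.Q1 v \<noteq> 0" "c1.Q2 v \<noteq> 0" "c1.Q3 v \<noteq> 0" by (simp_all add: c1.Q1_def c1.Q2_def c1.Q3_def)
    obtain c where c: "c \<noteq> 0" "lift4 (tc k) w = c *s lift4 (tc k) v"
      using v(3) w(3) pt_eq_iff by metis
    then have "cr (lift4 (tc k) w) = c\<^sup>2 *s cr (lift4 (tc k) v)" by (simp add: cr_scale)
    then have e: "(c1.Q1 w * c1.Q2 w * c1.Q3 w) *s (c1.N *v ver w) = (c\<^sup>2 * (c1.Q1 v * c1.Q2 v * c1.Q3 v)) *s (c1.N *v ver v)"
      by (simp add: tc_def c1.theta_eq cr_cr c1.N_ver)
    have nw: "c1.Q1 w * c1.Q2 w * c1.Q3 w \<noteq> 0"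
    proof
      assume "c1.Q1 w * c1.Q2 w * c1.Q3 w = 0"
      with e c(1) nz have "c1.N *v ver v = 0" by simp
      then have "(c1.N *v ver v) $ 1 = 0" by simp
      then show False using nz by (simp add: c1.N_ver)
    qed
    have "c1.N *v ver w = ((c\<^sup>2 * (c1.Q1 v * c1.Q2 v * c1.Q3 v)) / (c1.Q1 w * c1.Q2 w * c1.Q3 w)) *s (c1.N *v ver v)"
      using arg_cong[OF e, of "\<lambda>x. (1 / (c1.Q1 w * c1.Q2 w * c1.Q3 w)) *s x"] nw by simp
    then have "det2 v w = 0" by (rule c1.N_ver_prop)
    then show False using d by simp
  qed
  then show "\<exists>i. x = pt (axis i 1)" using at_vertex[OF assms v(1)] v(3) by blast
next
  assume "\<exists>i. x = pt (axis i 1)"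
  then show "node 4 (tc k) x" using vertex_preimages[OF assms] by blast
qed

text \<open>Singularity may be witnessed by any reduced equation; by uniqueness it is a multiple of
  \<open>F\<close>. Its gradient can vanish only on the coordinate triangle, which the curve meets
  in the vertices alone.\<close>

lemma tc_nodal:
  assumes "goodf k"
  shows "nodal (tc k) (Ctheta 4 (tc k) ` CP)"
proof -
  interpret c1: cremona_triple "k 1" "k 2" "k 3" using assms by unfold_locales (simp add: goodf_def)
  let ?C = "Ctheta 4 (tc k) ` CP"
  have ce: "curve_equation 4 c1.F ?C" using c1.F_curve_equation by (simp add: tc_def)
  have tn: "\<And>v. v \<noteq> 0 \<Longrightarrow> lift4 (tc k) v \<noteq> 0" unfolding tc_def by (rule c1.theta_nonzero)
  have "node 4 (tc k) x" if "singular_point 4 ?C x" for x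
  proof -
    obtain G where x: "x \<in> ?C" and G: "curve_equation 4 G ?C"
      and dG: "\<And>y. y \<in> x \<Longrightarrow> (G has_derivative (\<lambda>_. 0)) (at y)"
      using \<open>singular_point 4 ?C x\<close> unfolding singular_point_def by blast
    obtain v where v: "v \<noteq> 0" "x = pt (lift4 (tc k) v)" using x by (auto elim!: CP_cases simp: Ctheta_pt)
    have "G (lift4 (cremona (k 1) (k 2) (k 3)) v) = 0" if "v \<noteq> 0" for v
    proof -
      have "?C \<subseteq> zero_locus G" using G by (simp add: curve_equation_def)
      then show ?thesis using zero_locus_theta[OF tn, of G] that by (simp add: tc_def)
    qed
    then obtain m where m: "\<And>y. G y = m * c1.F y"
      using c1.quartic_unique[of G] G unfolding curve_equation_def by blast
    have "m \<noteq> 0"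
    proof
      assume "m = 0"
      then have "G = (\<lambda>_. 0)" using m by auto
      then show False using G by (simp add: curve_equation_def)
    qed
    define y where "y = lift4 (tc k) v"
    have "(G has_derivative (\<lambda>_. 0)) (at y)" by (rule dG) (simp add: v y_def pt_self)
    then have "((\<lambda>y. (1 / m) * G y) has_derivative (\<lambda>h. (1 / m) * 0)) (at y)" by (rule has_derivative_mult_right)
    moreover have "(\<lambda>y. (1 / m) * G y) = c1.F" using \<open>m \<noteq> 0\<close> by (simp add: m fun_eq_iff)
    ultimately have "(c1.F has_derivative (\<lambda>_. 0)) (at y)" by simp
    then have "y $ 1 = 0 \<or> y $ 2 = 0 \<or> y $ 3 = 0" by (rule c1.F_gradient)
    then have "c1.Q2 v * c1.Q3 v = 0 \<or> c1.Q1 v * c1.Q3 v = 0 \<or> c1.Q1 v * c1.Q2 v = 0"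
      by (simp add: y_def tc_def c1.theta_Q)
    then have "\<exists>i. qf (cvec (k i)) v = 0" by (auto simp: c1.Q1_def c1.Q2_def c1.Q3_def)
    then show ?thesis using at_vertex[OF assms v(1)] v(2) vertex_preimages(2)[OF assms] by metis
  qed
  then show ?thesis using ce tn unfolding nodal_parametrization_def parametrizes_def plane_curve_def by blast
qed

lemma param_curve:
  assumes "det M \<noteq> 0"
  shows "curve M k = act (cm M) ` (Ctheta 4 (tc k) ` CP)"
  unfolding curve_def image_image
  by (rule image_cong[OF refl]) (simp add: Ctheta_matrix param_def[abs_def])

lemma param_nodal:
  assumes "goodf k" "det M \<noteq> 0"
  shows "nodal (param M k) (curve M k)"
  unfolding param_curve[OF assms(2)] param_def[abs_def] by (rule nodal_matrix[OF tc_nodal[OF assms(1)] assms(2)])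

definition vertex :: "real ^ 3 ^ 3 \<Rightarrow> 3 \<Rightarrow> (complex ^ 3) set" where
  "vertex M i = pt (cvec (column i M))"

lemma vertex_act: "vertex M i = act (cm M) (pt (axis i 1))"
  by (simp add: vertex_def act_pt cm_axis)

lemma param_preimages:
  assumes "goodf k" "det M \<noteq> 0"
  shows "preimages 4 (param M k) (vertex M i) = {pt v | v. v \<noteq> 0 \<and> qf (cvec (k i)) v = 0}"
  unfolding vertex_act param_def[abs_def] preimages_matrix[OF assms(2)] by (rule vertex_preimages[OF assms(1)])

lemma param_node_iff:
  assumes "goodf k" "det M \<noteq> 0"
  shows "node 4 (param M k) x \<longleftrightarrow> (\<exists>i. x = vertex M i)"
proof
  assume "\<exists>i. x = vertex M i"
  then show "node 4 (param M k) x"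
    unfolding vertex_act param_def[abs_def] using node_matrix[OF assms(2)] vertex_preimages(2)[OF assms(1)] by blast
next
  assume n: "node 4 (param M k) x"
  obtain M' where M': "M ** M' = mat 1" "M' ** M = mat 1" "cm M ** cm M' = mat 1" "cm M' ** cm M = mat 1" "det M' \<noteq> 0"
    by (rule cm_inverse[OF assms(2)])
  have "node 4 (\<lambda>n. M' *v param M k n) (act (cm M') x)" by (rule node_matrix[OF M'(5) n])
  moreover have "(\<lambda>n. M' *v param M k n) = tc k"
    by (simp add: param_def matrix_vector_mul_assoc M' fun_eq_iff)
  ultimately obtain i where "act (cm M') x = pt (axis i 1)" using tc_node_iff[OF assms(1)] by auto
  then have "act (cm M) (act (cm M') x) = vertex M i" by (simp add: vertex_act)
  then show "\<exists>i. x = vertex M i" by (auto simp: act_act M' act_mat1)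
qed

lemma column_nonzero:
  fixes M :: "real ^ 3 ^ 3"
  assumes "det M \<noteq> 0" shows "column i M \<noteq> 0"
proof
  assume "column i M = 0"
  then have "row i (transpose M) = 0" by (simp add: row_transpose)
  then have "det (transpose M) = 0" by (rule det_zero_row)
  then show False using assms by simp
qed

lemma vertex_real: "det M \<noteq> 0 \<Longrightarrow> vertex M i \<in> RP"
  unfolding vertex_def by (intro pt_cvec_RP column_nonzero)

lemma vertex_inj:
  assumes "det M \<noteq> 0" "vertex M i = vertex M j"
  shows "i = j"
proof -
  obtain M' where M': "cm M' ** cm M = mat 1" using cm_inverse[OF assms(1)] by metis
  have "pt (axis i 1) = pt (axis j (1 :: complex))" using assms(2) act_inj[OF M'] unfolding vertex_act by blast
  then obtain c where "axis j 1 = c *s axis i (1 :: complex)" unfolding pt_eq_iff by blast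
  then have "axis j 1 $ j = c * axis i (1 :: complex) $ j" by simp
  then show ?thesis by (auto simp: axis_def split: if_splits)
qed

section \<open>Real roots of the forms and the chords they define\<close>

definition zset :: "real ^ 3 \<Rightarrow> complex set" where
  "zset q = {circle_point u | u. u \<noteq> 0 \<and> qf q u = 0}"

lemma qf_cvec: "qf (cvec q) (cvec u) = complex_of_real (qf q u)"
  by (simp add: qf_def)

lemma real_roots:
  fixes q :: "real ^ 3"
  assumes "disc q > 0"
  obtains r s where "r \<noteq> 0" "s \<noteq> 0" "det2 r s \<noteq> 0" "q = lq r s"
proof -
  have "\<exists>r s. q = lq r s"
  proof (cases "q $ 1 = 0")
    case True
    have "q = lq (vector [q $ 3, - q $ 2]) (vector [1, 0])"
      by (rule vec3_eqI) (simp_all add: lq_nth True)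
    then show ?thesis by blast
  next
    case False
    define t where "t = sqrt (disc q)"
    have t: "t * t = q $ 2 * q $ 2 - 4 * q $ 1 * q $ 3" using assms by (simp add: t_def) (simp add: bp_def)
    have "q = lq (vector [(- q $ 2 + t) / 2, q $ 1]) (vector [(- q $ 2 - t) / (2 * q $ 1), 1])"
      by (rule vec3_eqI) (use False t in \<open>simp_all add: lq_nth field_simps\<close>)
    then show ?thesis by blast
  qed
  then obtain r s where q: "q = lq r s" by blast
  have d: "det2 r s \<noteq> 0" using assms by (auto simp: q disc_lq)
  then have "r \<noteq> 0" "s \<noteq> 0" by (auto simp: det2_def)
  with q d that show ?thesis by blast
qed

lemma definite_no_root:
  fixes q :: "real ^ 3"
  assumes "disc q < 0" "u \<noteq> 0"
  shows "qf q u \<noteq> 0"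
proof
  assume z: "qf q u = 0"
  have "4 * q $ 1 * qf q u = (2 * q $ 1 * u $ 1 + q $ 2 * u $ 2)\<^sup>2 - disc q * (u $ 2)\<^sup>2"
    "4 * q $ 3 * qf q u = (2 * q $ 3 * u $ 2 + q $ 2 * u $ 1)\<^sup>2 - disc q * (u $ 1)\<^sup>2"
    by (simp_all add: qf_def bp_def power2_eq_square algebra_simps)
  then have "(2 * q $ 1 * u $ 1 + q $ 2 * u $ 2)\<^sup>2 = disc q * (u $ 2)\<^sup>2"
    "(2 * q $ 3 * u $ 2 + q $ 2 * u $ 1)\<^sup>2 = disc q * (u $ 1)\<^sup>2" using z by simp_all
  then have "disc q * (u $ 2)\<^sup>2 \<ge> 0" "disc q * (u $ 1)\<^sup>2 \<ge> 0" by (metis zero_le_power2)+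
  then have "u $ 2 = 0" "u $ 1 = 0" using assms(1) by (auto simp: zero_le_mult_iff)
  then show False using assms(2) by (simp add: vec_eq_iff forall_2)
qed

lemma lq_cvec: "lq (cvec r) (cvec s) = cvec (lq r s)"
  by (rule vec3_eqI) (simp_all add: lq_nth)

lemma real_preimages_iff:
  assumes "disc q \<noteq> 0"
  shows "{pt v | v. v \<noteq> 0 \<and> qf (cvec q) v = 0} \<subseteq> RP \<longleftrightarrow> disc q > 0"
proof
  assume sub: "{pt v | v. v \<noteq> 0 \<and> qf (cvec q) v = 0} \<subseteq> RP"
  show "disc q > 0"
  proof (rule ccontr)
    assume "\<not> disc q > 0"
    then have neg: "disc q < 0" using assms by simp
    obtain v where v: "v \<noteq> 0" "qf (cvec q) v = 0" using qf_root by blast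
    then have "pt v \<in> RP" using sub by blast
    then obtain u where u: "u \<noteq> 0" "pt v = pt (cvec u)" unfolding RP_def by blast
    then obtain c where "c \<noteq> 0" "cvec u = c *s v" unfolding pt_eq_iff by blast
    then have "qf (cvec q) (cvec u) = 0" using v by (simp add: qf_scale)
    then have "qf q u = 0" by (simp add: qf_cvec)
    then show False using definite_no_root[OF neg u(1)] by blast
  qed
next
  assume "disc q > 0"
  then obtain r s where rs: "r \<noteq> 0" "s \<noteq> 0" "det2 r s \<noteq> 0" "q = lq r s" by (rule real_roots)
  show "{pt v | v. v \<noteq> 0 \<and> qf (cvec q) v = 0} \<subseteq> RP"
  proof
    fix P assume "P \<in> {pt v | v. v \<noteq> 0 \<and> qf (cvec q) v = 0}"
    then obtain v where v: "P = pt v" "v \<noteq> 0" "qf (cvec q) v = 0" by blast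
    then have "det2 (cvec r) v = 0 \<or> det2 (cvec s) v = 0" by (simp add: rs qf_lq flip: lq_cvec)
    then have "pt (cvec r) = P \<or> pt (cvec s) = P" using pt_eq_det2 v rs by auto
    then show "P \<in> RP" using pt_cvec_RP rs by blast
  qed
qed

lemma param_diagram:
  assumes "goodf k" "det M \<noteq> 0"
  shows "real_chord_diagram 4 (param M k) = {zset (k i) | i. disc (k i) > 0}"
proof -
  have d: "disc (k i) \<noteq> 0" for i using assms(1) exhaust_3[of i] by (auto simp: goodf_def good_def)
  have R: "preimages 4 (param M k) (vertex M i) \<subseteq> RP \<longleftrightarrow> disc (k i) > 0" for i
    unfolding param_preimages[OF assms] by (rule real_preimages_iff[OF d])
  have ns: "non_solitary 4 (param M k) x \<longleftrightarrow> (\<exists>i. x = vertex M i \<and> disc (k i) > 0)" for x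
  proof
    assume h: "non_solitary 4 (param M k) x"
    then obtain i where i: "x = vertex M i"
      unfolding non_solitary_def real_node_def param_node_iff[OF assms] by blast
    have "disc (k i) > 0" using h unfolding non_solitary_def i R by blast
    then show "\<exists>i. x = vertex M i \<and> disc (k i) > 0" using i by blast
  next
    assume "\<exists>i. x = vertex M i \<and> disc (k i) > 0"
    then obtain i where i: "x = vertex M i" "disc (k i) > 0" by blast
    then have "preimages 4 (param M k) x \<subseteq> RP" using R by simp
    then show "non_solitary 4 (param M k) x"
      unfolding non_solitary_def real_node_def param_node_iff[OF assms]
      using i vertex_real[OF assms(2)] by blast
  qed
  have ch: "chord 4 (param M k) (vertex M i) = zset (k i)" for i
  proof -
    have "pt (cvec u) \<in> preimages 4 (param M k) (vertex M i) \<longleftrightarrow> qf (k i) u = 0" if "u \<noteq> 0" for u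
    proof
      assume "pt (cvec u) \<in> preimages 4 (param M k) (vertex M i)"
      then obtain v where v: "v \<noteq> 0" "qf (cvec (k i)) v = 0" "pt (cvec u) = pt v"
        unfolding param_preimages[OF assms] by blast
      then obtain c where "v = c *s cvec u" "c \<noteq> 0" unfolding pt_eq_iff by blast
      then have "qf (cvec (k i)) (cvec u) = 0" using v(2) by (simp add: qf_scale)
      then show "qf (k i) u = 0" by (simp add: qf_cvec)
    next
      assume "qf (k i) u = 0"
      then have "cvec u \<noteq> 0 \<and> qf (cvec (k i)) (cvec u) = 0" using that by (simp add: qf_cvec)
      then show "pt (cvec u) \<in> preimages 4 (param M k) (vertex M i)"
        unfolding param_preimages[OF assms] by blast
    qed
    then show ?thesis unfolding chord_def zset_def by blast
  qed
  show ?thesis unfolding real_chord_diagram_def ns using ch by blast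
qed

lemma param_singular:
  assumes "goodf k" "det M \<noteq> 0"
  shows "singular_point 4 (curve M k) (vertex M i)"
  using node_singular[of 4 "param M k"] param_nodal[OF assms] param_node_iff[OF assms]
  by (auto simp: nodal_parametrization_def)

text \<open>Being a singular point depends only on the point set, which frees the set of nodes from
  the parametrization.\<close>

lemma curve_vertices:
  assumes "goodf k" "det M \<noteq> 0" "goodf k'" "det M' \<noteq> 0" "curve M k = curve M' k'"
  shows "\<exists>j. vertex M i = vertex M' j"
proof -
  have "singular_point 4 (curve M' k') (vertex M i)" using param_singular[OF assms(1,2)] assms(5) by metis
  then have "node 4 (param M' k') (vertex M i)"
    using param_nodal[OF assms(3,4)] unfolding nodal_parametrization_def by blast
  then show ?thesis using param_node_iff[OF assms(3,4)] by blast
qed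

section \<open>The Gram matrix determines the curve\<close>

text \<open>The matrix of \<open>bp\<close>. Its inverse \<open>Bi\<close> is, up to sign, the
  matrix of the standard conic z1 z3 = z2^2, so conic and discriminant form are dual to each
  other.\<close>

definition Bm :: "complex ^ 3 ^ 3" where
  "Bm = vector [vector [0, 0, - 2], vector [0, 1, 0], vector [- 2, 0, 0]]"

definition Bi :: "complex ^ 3 ^ 3" where
  "Bi = vector [vector [0, 0, - 1 / 2], vector [0, 1, 0], vector [- 1 / 2, 0, 0]]"

lemma Bm_nth: "(Bm *v x) $ 1 = - 2 * x $ 3" "(Bm *v x) $ 2 = x $ 2" "(Bm *v x) $ 3 = - 2 * x $ 1"
  by (simp_all add: Bm_def matrix_vector_mult_def sum_3)

lemma Bi_nth: "(Bi *v x) $ 1 = - x $ 3 / 2" "(Bi *v x) $ 2 = x $ 2" "(Bi *v x) $ 3 = - x $ 1 / 2"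
  by (simp_all add: Bi_def matrix_vector_mult_def sum_3)

lemma Bm_Bi: "Bm *v (Bi *v x) = x" "Bi *v (Bm *v x) = x"
  by (rule vec3_eqI; simp add: Bm_nth Bi_nth)+

lemma bp_Bm: "bp x y = lin x (Bm *v y)"
  by (simp add: bp_def lin_3 Bm_nth)

lemma conic_Bi: "z $ 1 * z $ 3 - z $ 2 * z $ 2 = - lin z (Bi *v z)"
  by (simp add: lin_3 Bi_nth)

lemma Bi_symmetric: "lin x (Bi *v y) = lin y (Bi *v x)"
  by (simp add: lin_3 Bi_nth algebra_simps)

lemma lin_transpose: "lin (A *v x) y = lin x (transpose A *v y)"
  by (simp add: lin_3 matrix_vector_mult_def transpose_def sum_3 algebra_simps)

lemma lin_eqI: "(\<And>x. lin x y = lin x z) \<Longrightarrow> y = z"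
  by (rule lin_all_eqI)

text \<open>A linear map multiplies the conic by \<open>t\<close> iff its transpose multiplies the dual conic
  by \<open>t\<close>.\<close>

lemma conic_dual:
  assumes A: "A ** A' = mat 1" "A' ** A = mat 1"
  shows "(\<forall>z. lin (A *v z) (Bi *v (A *v z)) = t * lin z (Bi *v z)) \<longleftrightarrow>
    (\<forall>x y. bp (transpose A *v x) (transpose A *v y) = t * bp x y)"
proof
  have AA: "A *v (A' *v x) = x" "A' *v (A *v x) = x" for x by (simp_all add: matrix_vector_mul_assoc A)
  note [simp del] = transpose_matrix_vector
  have tA: "transpose A *v (transpose A' *v x) = x" "transpose A' *v (transpose A *v x) = x" for x
    by (simp_all only: matrix_vector_mul_assoc A matrix_transpose_mul[symmetric] transpose_mat matrix_vector_mul_lid)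
  {
    assume c: "\<forall>z. lin (A *v z) (Bi *v (A *v z)) = t * lin z (Bi *v z)"
    have pol: "lin (A *v x) (Bi *v (A *v y)) = t * lin x (Bi *v y)" for x y
    proof -
      have sq: "lin (u + w) (Bi *v (u + w)) = lin u (Bi *v u) + 2 * lin u (Bi *v w) + lin w (Bi *v w)" for u w
        by (simp add: lin_add matrix_vector_right_distrib Bi_symmetric[of w u])
      have "lin (A *v (x + y)) (Bi *v (A *v (x + y))) = t * lin (x + y) (Bi *v (x + y))" using c by blast
      then show ?thesis
        unfolding matrix_vector_right_distrib[of A] sq using c by (simp add: algebra_simps)
    qed
    have 1: "transpose A *v (Bi *v (A *v y)) = t *s (Bi *v y)" for y
      by (rule lin_eqI) (simp add: pol lin_scale flip: lin_transpose)
    have 2: "Bi *v (A *v y) = t *s (transpose A' *v (Bi *v y))" for y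
      using arg_cong[OF 1[of y], of "(*v) (transpose A')"] by (simp add: tA matrix_vector_smult)
    have 3: "A *v (Bm *v (transpose A *v w)) = t *s (Bm *v w)" for w
      using arg_cong[OF 2[of "Bm *v (transpose A *v w)"], of "(*v) Bm"]
      by (simp add: Bm_Bi tA matrix_vector_smult)
    show "\<forall>x y. bp (transpose A *v x) (transpose A *v y) = t * bp x y"
    proof (intro allI)
      fix x y
      have "bp (transpose A *v x) (transpose A *v y) = lin x (A *v (Bm *v (transpose A *v y)))"
        using lin_transpose[of "transpose A" x] by (simp add: bp_Bm)
      then show "bp (transpose A *v x) (transpose A *v y) = t * bp x y" by (simp add: 3 lin_scale bp_Bm)
    qed
  next
    assume b: "\<forall>x y. bp (transpose A *v x) (transpose A *v y) = t * bp x y"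
    have 3: "A *v (Bm *v (transpose A *v w)) = t *s (Bm *v w)" for w
    proof (rule lin_eqI)
      fix x
      have "lin x (A *v (Bm *v (transpose A *v w))) = bp (transpose A *v x) (transpose A *v w)"
        using lin_transpose[of "transpose A" x] by (simp add: bp_Bm)
      then show "lin x (A *v (Bm *v (transpose A *v w))) = lin x (t *s (Bm *v w))"
        using b by (simp add: lin_scale bp_Bm)
    qed
    have 2: "A *v y = t *s (Bm *v (transpose A' *v (Bi *v y)))" for y
      using 3[of "transpose A' *v (Bi *v y)"] by (simp add: tA Bm_Bi)
    have 1: "transpose A *v (Bi *v (A *v y)) = t *s (Bi *v y)" for y
      by (subst 2) (simp add: matrix_vector_smult Bm_Bi tA)
    show "\<forall>z. lin (A *v z) (Bi *v (A *v z)) = t * lin z (Bi *v z)"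
      by (simp add: lin_transpose 1 lin_scale)
  }
qed

definition gram_prop :: "real \<Rightarrow> (3 \<Rightarrow> real ^ 3) \<Rightarrow> (3 \<Rightarrow> real ^ 3) \<Rightarrow> bool" where
  "gram_prop t k k' \<longleftrightarrow> (\<forall>i j. bp (k i) (k j) = t * bp (k' i) (k' j))"

text \<open>The determinant of the Gram matrix of a triple is the square of its determinant times
  the determinant of \<open>Bm\<close>, which is - 4.\<close>

lemma det3_gram:
  fixes p q r :: "real ^ 3"
  shows "- 4 * (det3 p q r)\<^sup>2 = disc p * (disc q * disc r - bp q r * bp q r) -
    bp p q * (bp p q * disc r - bp q r * bp p r) + bp p r * (bp p q * bp q r - disc q * bp p r)"
  by (simp add: det3_def bp_def power2_eq_square algebra_simps)

lemma gram_prop_pos: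
  assumes g: "gram_prop t k k'" and "goodf k" "goodf k'"
  shows "t > 0"
proof -
  have "- 4 * (det3 (k 1) (k 2) (k 3))\<^sup>2 = t ^ 3 * (- 4 * (det3 (k' 1) (k' 2) (k' 3))\<^sup>2)"
    unfolding det3_gram using g unfolding gram_prop_def by (simp add: power3_eq_cube algebra_simps)
  then have e: "(det3 (k 1) (k 2) (k 3))\<^sup>2 = t ^ 3 * (det3 (k' 1) (k' 2) (k' 3))\<^sup>2" by simp
  have "det3 (k 1) (k 2) (k 3) \<noteq> 0" "det3 (k' 1) (k' 2) (k' 3) \<noteq> 0"
    using assms by (simp_all add: goodf_def good_def)
  then have "(det3 (k 1) (k 2) (k 3))\<^sup>2 > 0" "(det3 (k' 1) (k' 2) (k' 3))\<^sup>2 > 0" by simp_all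
  then have "t ^ 3 > 0" using e by (metis zero_less_mult_pos2)
  then show ?thesis by (simp add: zero_less_power_eq)
qed

definition qmat :: "(3 \<Rightarrow> real ^ 3) \<Rightarrow> complex ^ 3 ^ 3" where
  "qmat k = cm (vector [k 1, k 2, k 3] :: real ^ 3 ^ 3)"

lemma transpose_qmat: "transpose (qmat k) *v axis i 1 = cvec (k i)"
  using exhaust_3[of i] by (elim disjE) (rule vec3_eqI; simp add: qmat_def cm_def transpose_def matrix_vector_mult_def sum_3 axis_def)+

lemma bilinear_axis:
  fixes P R :: "complex ^ 3 ^ 3"
  assumes "\<And>i j. bp (P *v axis i 1) (P *v axis j 1) = t * bp (R *v axis i (1 :: complex)) (R *v axis j 1)"
  shows "bp (P *v x) (P *v y) = t * bp (R *v x) (R *v y)"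
proof -
  have dec: "S *v x = x $ 1 *s (S *v axis 1 1) + x $ 2 *s (S *v axis 2 1) + x $ 3 *s (S *v axis 3 1)" for S :: "complex ^ 3 ^ 3" and x
    by (simp add: vec_eq_iff matrix_vector_mult_def sum_3 axis_def algebra_simps)
  have add: "bp (u + w) z = bp u z + bp w z" "bp z (u + w) = bp z u + bp z w" for u w z :: "complex ^ 3"
    by (simp_all add: bp_def algebra_simps)
  show ?thesis
    unfolding dec[of P x] dec[of P y] dec[of R x] dec[of R y] add bp_scale assms by (simp add: algebra_simps)
qed

text \<open>The linear map \<open>A\<close> takes the values of the forms of \<open>k\<close> to
  those of \<open>k'\<close>. By duality of the conic and \<open>bp\<close> it multiplies the conic
  by \<open>t\<close> iff it relates the Gram matrices by \<open>t\<close>. The factor is complex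
  here because comparison of complex conics yields it only as a complex number.\<close>

lemma gram_matrix:
  assumes g: "goodf k" "goodf k'"
  obtains A A' :: "real ^ 3 ^ 3" where "A ** A' = mat 1" "A' ** A = mat 1" "qmat k = qmat k' ** cm A"
    "\<And>i z. k' i \<bullet> (A *v z) = k i \<bullet> z"
    "\<And>t. (\<forall>z. lin (cm A *v z) (Bi *v (cm A *v z)) = t * lin z (Bi *v z)) \<longleftrightarrow>
      (\<forall>i j. complex_of_real (bp (k i) (k j)) = t * complex_of_real (bp (k' i) (k' j)))"
proof -
  note [simp del] = transpose_matrix_vector
  define K :: "real ^ 3 ^ 3" where "K = vector [k 1, k 2, k 3]"
  define K' :: "real ^ 3 ^ 3" where "K' = vector [k' 1, k' 2, k' 3]"
  have "det K \<noteq> 0" "det K' \<noteq> 0"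
    using g unfolding K_def K'_def det_vector3 by (simp_all add: goodf_def good_def)
  then obtain I I' where I: "K ** I = mat 1" "I ** K = mat 1" and I': "K' ** I' = mat 1" "I' ** K' = mat 1"
    unfolding invertible_det_nz[symmetric] invertible_def by blast
  define A where "A = I' ** K"
  define A' where "A' = I ** K'"
  have AA: "A ** A' = mat 1" "A' ** A = mat 1"
  proof -
    have "A ** A' = I' ** (K ** I) ** K'" "A' ** A = I ** (K' ** I') ** K"
      unfolding A_def A'_def by (simp_all add: matrix_mul_assoc)
    then show "A ** A' = mat 1" "A' ** A = mat 1" by (simp_all add: I I')
  qed
  have KA: "K' ** A = K" unfolding A_def by (simp add: matrix_mul_assoc I')
  have row: "k i \<bullet> z = (K *v z) $ i" "k' i \<bullet> z = (K' *v z) $ i" for i z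
    using exhaust_3[of i] by (auto simp: K_def K'_def matrix_vector_mul_component)
  have q: "qmat k = cm K" "qmat k' = cm K'" by (simp_all add: qmat_def K_def K'_def)
  have qA: "qmat k = qmat k' ** cm A" unfolding q cm_mult[symmetric] KA ..
  have tA: "transpose (qmat k) *v z = transpose (cm A) *v (transpose (qmat k') *v z)" for z
    by (simp only: qA matrix_vector_mul_assoc matrix_transpose_mul)
  have tI: "transpose (qmat k') *v (transpose (cm I') *v z) = z" for z
    by (simp only: q matrix_vector_mul_assoc matrix_transpose_mul[symmetric] cm_mult[symmetric] I' cm_mat transpose_mat matrix_vector_mul_lid)
  have kk: "cvec (k i) = transpose (cm A) *v cvec (k' i)" for i
    unfolding transpose_qmat[symmetric] by (rule tA)
  have cA: "cm A ** cm A' = mat 1" "cm A' ** cm A = mat 1" unfolding cm_mult[symmetric] AA by (simp_all add: cm_mat)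
  have "(\<forall>x y. bp (transpose (cm A) *v x) (transpose (cm A) *v y) = t * bp x y) \<longleftrightarrow>
      (\<forall>i j. complex_of_real (bp (k i) (k j)) = t * complex_of_real (bp (k' i) (k' j)))" (is "?B \<longleftrightarrow> ?G") for t
  proof
    assume ?B
    then have "bp (cvec (k i)) (cvec (k j)) = t * bp (cvec (k' i)) (cvec (k' j))" for i j unfolding kk by blast
    then show ?G by (simp add: bp_cvec)
  next
    assume G: ?G
    have "bp (transpose (qmat k) *v x) (transpose (qmat k) *v y) = t * bp (transpose (qmat k') *v x) (transpose (qmat k') *v y)" for x y
      by (rule bilinear_axis) (use G in \<open>simp add: transpose_qmat bp_cvec\<close>)
    from this[of "transpose (cm I') *v _" "transpose (cm I') *v _"] show ?B by (simp only: tA tI) blast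
  qed
  then show ?thesis using that[OF AA qA] conic_dual[OF cA] row by (simp add: matrix_vector_mul_assoc KA)
qed

text \<open>Proportional Gram matrices mean that \<open>cm A\<close> preserves the standard conic,
  so both triples trace the same conic, and the quadratic transformation gives the same
  quartic.\<close>

lemma curve_subset_of_gram:
  assumes g: "goodf k" "goodf k'" and gp: "gram_prop t k k'"
  shows "Ctheta 4 (tc k) ` CP \<subseteq> Ctheta 4 (tc k') ` CP"
proof
  interpret c1: cremona_triple "k 1" "k 2" "k 3" using g by unfold_locales (simp add: goodf_def)
  interpret c2: cremona_triple "k' 1" "k' 2" "k' 3" using g by unfold_locales (simp add: goodf_def)
  have N: "c1.N = qmat k" "c2.N = qmat k'" by (simp_all add: c1.N_def c2.N_def qmat_def)
  obtain A A' where A: "qmat k = qmat k' ** cm A"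
    and cg: "\<And>t. (\<forall>z. lin (cm A *v z) (Bi *v (cm A *v z)) = t * lin z (Bi *v z)) \<longleftrightarrow>
      (\<forall>i j. complex_of_real (bp (k i) (k j)) = t * complex_of_real (bp (k' i) (k' j)))"
    by (rule gram_matrix[OF g]) (rule that)
  have "\<forall>i j. complex_of_real (bp (k i) (k j)) = complex_of_real t * complex_of_real (bp (k' i) (k' j))"
    using gp by (simp add: gram_prop_def)
  then have con: "lin (cm A *v z) (Bi *v (cm A *v z)) = t * lin z (Bi *v z)" for z unfolding cg[symmetric] by blast
  have NA: "c2.N' *v (c1.N *v z) = cm A *v z" for z
    unfolding N A by (simp add: matrix_vector_mul_assoc matrix_mul_assoc c2.NN flip: N)
  fix x assume "x \<in> Ctheta 4 (tc k) ` CP"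
  then obtain v where v: "v \<noteq> 0" "x = pt (lift4 (tc k) v)" by (auto elim!: CP_cases simp: Ctheta_pt)
  have "lin (ver v) (Bi *v ver v) = 0"
    using conic_Bi[of "ver v"] by (simp add: ver_nth power2_eq_square)
  then have "c2.K (c1.N *v ver v) = 0" unfolding c2.K_def conic_Bi NA con by simp
  moreover have "c1.N *v ver v \<noteq> 0"
  proof
    assume "c1.N *v ver v = 0"
    then have "lift4 (tc k) v = 0" unfolding tc_def c1.theta_eq by (simp add: vec_eq_iff forall_3 cr_nth)
    then show False using c1.theta_nonzero[OF v(1)] by (simp add: tc_def)
  qed
  ultimately obtain w s where w: "w \<noteq> 0" "s \<noteq> 0" "c2.N *v ver w = s *s (c1.N *v ver v)" using c2.K_zero by metis
  then have "lift4 (tc k') w = s\<^sup>2 *s lift4 (tc k) v"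
    by (simp add: tc_def c1.theta_eq c2.theta_eq cr_scale)
  then have "x = Ctheta 4 (tc k') (pt w)" using w(2) by (simp add: v(2) Ctheta_pt pt_scale)
  then show "x \<in> Ctheta 4 (tc k') ` CP" using w(1) by (simp add: pt_in_CP)
qed

lemma curve_of_gram:
  assumes g: "goodf k" "goodf k'" and gp: "gram_prop t k k'" and M: "det M \<noteq> 0"
  shows "curve M k = curve M k'"
proof -
  have "t > 0" by (rule gram_prop_pos[OF gp g])
  then have "gram_prop (1 / t) k' k" using gp by (simp add: gram_prop_def)
  then have "Ctheta 4 (tc k) ` CP = Ctheta 4 (tc k') ` CP"
    using curve_subset_of_gram[OF g gp] curve_subset_of_gram[OF g(2,1)] by blast
  then show ?thesis by (simp add: param_curve[OF M])
qed

text \<open>Transforming back, equal quartics give equal conics: \<open>c2.K\<close> vanishes on the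
  conic of the first triple where the product of its forms is nonzero, then everywhere by
  cancellation. A quadric through the conic is a multiple of its equation, and the multiple is the
  factor \<open>t\<close>.\<close>

lemma gram_of_curve:
  assumes g: "goodf k" "goodf k'" and eq: "Ctheta 4 (tc k) ` CP = Ctheta 4 (tc k') ` CP"
  shows "\<exists>t. gram_prop t k k'"
proof -
  interpret c1: cremona_triple "k 1" "k 2" "k 3" using g by unfold_locales (simp add: goodf_def)
  interpret c2: cremona_triple "k' 1" "k' 2" "k' 3" using g by unfold_locales (simp add: goodf_def)
  obtain s where s: "\<And>u. c2.K u = kq s u" using c2.K_kq by blast
  have K0: "c2.K (c1.N *v ver v) = 0" if "v \<noteq> 0" for v
  proof (rule c1.triple_cancel[OF _ _ that])
    show "continuous_on UNIV (\<lambda>v. c2.K (c1.N *v ver v))"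
      unfolding s kq_def c1.N_ver vector_3 c1.Q1_def c1.Q2_def c1.Q3_def by (intro continuous_intros continuous_qf)
    fix v :: "complex ^ 2" assume v: "v \<noteq> 0"
    have "pt (lift4 (tc k) v) \<in> Ctheta 4 (tc k') ` CP"
      using v by (simp add: pt_in_CP flip: eq Ctheta_pt)
    then obtain w where w: "w \<noteq> 0" "pt (lift4 (tc k) v) = pt (lift4 (tc k') w)"
      by (auto elim!: CP_cases simp: Ctheta_pt)
    then obtain c where "c \<noteq> 0" "lift4 (tc k') w = c *s lift4 (tc k) v" unfolding pt_eq_iff by blast
    then have "cr (lift4 (tc k') w) = c\<^sup>2 *s cr (lift4 (tc k) v)" by (simp add: cr_scale)
    then have "c2.K (cr (lift4 (tc k') w)) = c2.K (c\<^sup>2 *s cr (lift4 (tc k) v))" by simp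
    then have "c2.K (cr (lift4 (tc k) v)) = 0"
      using \<open>c \<noteq> 0\<close> by (simp add: c2.K_scale tc_def c2.theta_eq cr_cr c2.K_ver)
    then have "(c1.Q1 v * c1.Q2 v * c1.Q3 v)\<^sup>2 * c2.K (c1.N *v ver v) = 0"
      by (simp add: c2.K_scale tc_def c1.theta_eq cr_cr c1.N_ver)
    then show "c1.Q1 v * c1.Q2 v * c1.Q3 v * c2.K (c1.N *v ver v) = 0" by auto
  qed
  obtain t' where t': "\<And>z. kq s (c1.N *v z) = kq t' z" using kq_compose[of s c1.N] by blast
  have "kq t' (ver v) = 0" if "v \<noteq> 0" for v using K0[OF that] by (simp add: s t')
  then have KN: "c2.K (c1.N *v z) = t' 4 * (z $ 1 * z $ 3 - z $ 2 * z $ 2)" for z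
    unfolding s t' by (rule kq_veronese)
  obtain A A' where A: "qmat k = qmat k' ** cm A"
    and cg: "\<And>t. (\<forall>z. lin (cm A *v z) (Bi *v (cm A *v z)) = t * lin z (Bi *v z)) \<longleftrightarrow>
      (\<forall>i j. complex_of_real (bp (k i) (k j)) = t * complex_of_real (bp (k' i) (k' j)))"
    by (rule gram_matrix[OF g]) (rule that)
  have N: "c1.N = qmat k" "c2.N = qmat k'" by (simp_all add: c1.N_def c2.N_def qmat_def)
  have NA: "c2.N' *v (c1.N *v z) = cm A *v z" for z
    unfolding N A by (simp add: matrix_vector_mul_assoc matrix_mul_assoc c2.NN flip: N)
  have "lin (cm A *v z) (Bi *v (cm A *v z)) = t' 4 * lin z (Bi *v z)" for z
    using KN[of z] unfolding c2.K_def conic_Bi NA by simp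
  then have g': "complex_of_real (bp (k i) (k j)) = t' 4 * complex_of_real (bp (k' i) (k' j))" for i j
    using cg by blast
  \<comment> \<open>The complex factor is real, being a quotient of two real diagonal entries of the
    Gram matrices.\<close>
  define t where "t = disc (k 1) / disc (k' 1)"
  have d: "disc (k' 1) \<noteq> 0" using g by (simp add: goodf_def good_def)
  have t4: "t' 4 = complex_of_real t" using g'[of 1 1] d by (simp add: t_def)
  have "bp (k i) (k j) = t * bp (k' i) (k' j)" for i j
    using g'[of i j] unfolding t4 by (metis of_real_eq_iff of_real_mult)
  then show ?thesis unfolding gram_prop_def by blast
qed

section \<open>Chords on the circle\<close>

abbreviation circle_homeo :: "(complex \<Rightarrow> complex) \<Rightarrow> (complex \<Rightarrow> complex) \<Rightarrow> bool" where
  "circle_homeo \<equiv> homeomorphism (sphere 0 1) (sphere 0 1)"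

text \<open>The form divided by s^2 + t^2, seen as a function on the circle: by the double angle
  formulas it is affine in \<open>z\<close>, and its zero line is the line carrying the
  chord.\<close>

definition cform :: "real ^ 3 \<Rightarrow> complex \<Rightarrow> real" where
  "cform q z = (q $ 1 + q $ 3) / 2 + (q $ 1 - q $ 3) / 2 * Re z + q $ 2 / 2 * Im z"

lemma circle_point_coords:
  assumes "u \<noteq> 0"
  shows "Re (circle_point u) = ((u $ 1)\<^sup>2 - (u $ 2)\<^sup>2) / ((u $ 1)\<^sup>2 + (u $ 2)\<^sup>2)"
    and "Im (circle_point u) = 2 * u $ 1 * u $ 2 / ((u $ 1)\<^sup>2 + (u $ 2)\<^sup>2)"
    and "(u $ 1)\<^sup>2 + (u $ 2)\<^sup>2 > 0"
    and "norm (circle_point u) = 1"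
proof -
  have "u $ 1 \<noteq> 0 \<or> u $ 2 \<noteq> 0" using assms by (auto simp: vec_eq_iff forall_2)
  then show p: "(u $ 1)\<^sup>2 + (u $ 2)\<^sup>2 > 0" by (auto simp: add_pos_nonneg add_nonneg_pos)
  have n: "(norm (Complex (u $ 1) (u $ 2)))\<^sup>2 = (u $ 1)\<^sup>2 + (u $ 2)\<^sup>2" by (simp add: cmod_power2)
  have e: "circle_point u = (Complex (u $ 1) (u $ 2))\<^sup>2 / of_real ((u $ 1)\<^sup>2 + (u $ 2)\<^sup>2)"
    unfolding circle_point_def sgn_eq power_divide n[symmetric] by simp
  show "Re (circle_point u) = ((u $ 1)\<^sup>2 - (u $ 2)\<^sup>2) / ((u $ 1)\<^sup>2 + (u $ 2)\<^sup>2)"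
    "Im (circle_point u) = 2 * u $ 1 * u $ 2 / ((u $ 1)\<^sup>2 + (u $ 2)\<^sup>2)"
    unfolding e Re_divide_of_real Im_divide_of_real by (simp_all add: power2_eq_square)
  have "Complex (u $ 1) (u $ 2) \<noteq> 0" using p by (auto simp: complex_eq_iff)
  then show "norm (circle_point u) = 1" by (simp add: circle_point_def norm_power norm_sgn)
qed

lemma cform_circle_point:
  assumes "u \<noteq> 0"
  shows "cform q (circle_point u) = qf q u / ((u $ 1)\<^sup>2 + (u $ 2)\<^sup>2)"
proof -
  have e: "(a + b) / 2 + (a - b) / 2 * ((x\<^sup>2 - y\<^sup>2) / n) + c / 2 * (2 * x * y / n) = (a * x\<^sup>2 + c * (x * y) + b * y\<^sup>2) / n"
    if "n = x\<^sup>2 + y\<^sup>2" "n > 0" for a b c x y n :: real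
  proof -
    have "((a + b) / 2 + (a - b) / 2 * ((x\<^sup>2 - y\<^sup>2) / n) + c / 2 * (2 * x * y / n)) * n =
        (a + b) / 2 * n + (a - b) / 2 * (x\<^sup>2 - y\<^sup>2) + c / 2 * (2 * x * y)"
      using that(2) by (simp add: distrib_right)
    also have "\<dots> = a * x\<^sup>2 + c * (x * y) + b * y\<^sup>2" unfolding that(1) by (simp add: field_simps)
    finally show ?thesis using that(2) by (simp add: eq_divide_eq)
  qed
  show ?thesis unfolding cform_def qf_def circle_point_coords(1,2)[OF assms]
    by (rule e) (use circle_point_coords(3)[OF assms] in simp_all)
qed

lemma circle_point_surj:
  assumes "norm z = 1"
  obtains u where "u \<noteq> 0" "circle_point u = z"
proof
  let ?w = "csqrt z"
  have w: "norm ?w = 1" using assms by (simp add: norm_csqrt)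
  have c: "Complex (Re ?w) (Im ?w) = ?w" by (rule complex_surj)
  show "circle_point (vector [Re ?w, Im ?w]) = z"
    unfolding circle_point_def vector_2 c sgn_eq w by (simp del: csqrt.simps)
  show "vector [Re ?w, Im ?w] \<noteq> (0 :: real ^ 2)"
  proof
    assume "vector [Re ?w, Im ?w] = (0 :: real ^ 2)"
    then have "Re ?w = 0" "Im ?w = 0" by (simp_all add: vec_eq_iff forall_2 del: csqrt.simps)
    then have "?w = 0" by (simp add: complex_eq_iff del: csqrt.simps)
    with w show False by simp
  qed
qed

lemma zset_eq: "zset q = {z. norm z = 1 \<and> cform q z = 0}"
proof (intro equalityI subsetI)
  fix z assume "z \<in> zset q"
  then obtain u where "u \<noteq> 0" "qf q u = 0" "z = circle_point u" by (auto simp: zset_def)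
  then show "z \<in> {z. norm z = 1 \<and> cform q z = 0}" by (simp add: cform_circle_point circle_point_coords)
next
  fix z assume "z \<in> {z. norm z = 1 \<and> cform q z = 0}"
  then obtain u where "u \<noteq> 0" "circle_point u = z" "cform q z = 0" using circle_point_surj by blast
  then show "z \<in> zset q" using circle_point_coords(3)[of u] by (auto simp: zset_def cform_circle_point)
qed

text \<open>With \<open>cform q z = A + Re (cnj w * z)\<close>, the condition
  \<open>norm z = 1\<close> forces \<open>cnj w * z\<close> to be - A plus or minus i times half the
  square root of the discriminant; \<open>e\<close> is that sign. The explicit formula makes the end
  points continuous in \<open>q\<close>.\<close>

definition zroot :: "real \<Rightarrow> real ^ 3 \<Rightarrow> complex" where
  "zroot e q = Complex ((q $ 1 - q $ 3) / 2) (q $ 2 / 2) *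
     Complex (- ((q $ 1 + q $ 3) / 2)) (e * (sqrt (disc q) / 2)) /
     of_real (((q $ 1 - q $ 3) / 2)\<^sup>2 + (q $ 2 / 2)\<^sup>2)"

lemma disc_circle: "disc q = 4 * (((q $ 1 - q $ 3) / 2)\<^sup>2 + (q $ 2 / 2)\<^sup>2 - ((q $ 1 + q $ 3) / 2)\<^sup>2)"
  for q :: "real ^ 3"
  by (simp add: bp_def power2_eq_square field_simps)

lemma zset_roots:
  assumes d: "disc q > 0"
  shows "zset q = {zroot 1 q, zroot (- 1) q}" "zroot 1 q \<noteq> zroot (- 1) q"
    "norm (zroot 1 q) = 1" "norm (zroot (- 1) q) = 1"
proof -
  define A where "A = (q $ 1 + q $ 3) / 2"
  define w where "w = Complex ((q $ 1 - q $ 3) / 2) (q $ 2 / 2)"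
  define D where "D = sqrt (disc q) / 2"
  have D: "D > 0" "D\<^sup>2 = disc q / 4" using d by (simp_all add: D_def power_divide)
  have n2: "(norm w)\<^sup>2 = A\<^sup>2 + D\<^sup>2" unfolding D disc_circle[of q] A_def w_def cmod_power2 by (simp add: field_simps)
  have w0: "w \<noteq> 0" using n2 D(1) by (auto simp: add_nonneg_eq_0_iff)
  have np: "A\<^sup>2 + D\<^sup>2 > 0" using D(1) by (simp add: add_nonneg_pos)
  have zr: "zroot e q = w * Complex (- A) (e * D) / of_real (A\<^sup>2 + D\<^sup>2)" for e
    unfolding n2[symmetric] unfolding zroot_def w_def A_def D_def cmod_power2 complex.sel ..
  have cf: "cform q z = A + Re (cnj w * z)" for z by (simp add: cform_def A_def w_def)
  have cz: "cnj w * z = Complex (- A) (e * D) \<longleftrightarrow> z = zroot e q" for z e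
  proof -
    have "cnj w * zroot e q = Complex (- A) (e * D)"
    proof -
      have "cnj w * zroot e q = (w * cnj w) * Complex (- A) (e * D) / of_real (A\<^sup>2 + D\<^sup>2)" by (simp add: zr)
      also have "w * cnj w = of_real (A\<^sup>2 + D\<^sup>2)" unfolding n2[symmetric] by (rule complex_norm_square[symmetric])
      finally show ?thesis using np by (metis less_irrefl nonzero_mult_div_cancel_left of_real_eq_0_iff)
    qed
    then show ?thesis using w0 by (metis complex_cnj_zero_iff mult_left_cancel)
  qed
  have n1: "norm (zroot e q) = 1" if "e\<^sup>2 = 1" for e
  proof -
    have "norm (Complex (- A) (e * D)) = norm w"
      by (rule power2_eq_imp_eq) (simp_all add: n2 cmod_power2[of "Complex _ _"] power_mult_distrib that)
    then have "norm (zroot e q) = (norm w)\<^sup>2 / (A\<^sup>2 + D\<^sup>2)"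
      using np by (simp add: zr norm_mult norm_divide power2_eq_square del: of_real_add)
    then show ?thesis unfolding n2 using np by (metis divide_self less_irrefl)
  qed
  then show nn: "norm (zroot 1 q) = 1" "norm (zroot (- 1) q) = 1" by simp_all
  have "z = zroot 1 q \<or> z = zroot (- 1) q" if "norm z = 1" "cform q z = 0" for z
  proof -
    have "(Re (cnj w * z))\<^sup>2 + (Im (cnj w * z))\<^sup>2 = A\<^sup>2 + D\<^sup>2"
      unfolding n2[symmetric] cmod_power2[symmetric] by (simp add: norm_mult that(1))
    moreover have R: "Re (cnj w * z) = - A" using that(2) cf by (simp add: eq_neg_iff_add_eq_0 add.commute)
    ultimately have "(Im (cnj w * z))\<^sup>2 = D\<^sup>2" by simp
    then have "Im (cnj w * z) = 1 * D \<or> Im (cnj w * z) = - 1 * D" by (simp add: power2_eq_iff)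
    then have "cnj w * z = Complex (- A) (1 * D) \<or> cnj w * z = Complex (- A) (- 1 * D)"
      using R by (simp only: complex_eq_iff complex.sel)  blast
    then show ?thesis unfolding cz .
  qed
  moreover have "cform q (zroot e q) = 0" for e
    using cz[of "zroot e q" e] cf[of "zroot e q"] by (metis add.right_inverse complex.sel(1))
  ultimately show "zset q = {zroot 1 q, zroot (- 1) q}" using nn unfolding zset_eq by auto
  show "zroot 1 q \<noteq> zroot (- 1) q"
  proof
    assume "zroot 1 q = zroot (- 1) q"
    then have "Complex (- A) (1 * D) = Complex (- A) (- 1 * D)" using cz by metis
    then show False using D(1) by simp
  qed
qed

lemma tendsto_zroot:
  fixes q :: "real ^ 3"
  assumes q: "(f \<longlongrightarrow> q) F" and d: "disc q > 0"
  shows "((\<lambda>x. zroot e (f x)) \<longlongrightarrow> zroot e q) F"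
proof -
  have "((q $ 1 - q $ 3) / 2)\<^sup>2 + (q $ 2 / 2)\<^sup>2 \<noteq> 0"
  proof -
    define X where "X = ((q $ 1 + q $ 3) / 2)\<^sup>2"
    have "4 * (((q $ 1 - q $ 3) / 2)\<^sup>2 + (q $ 2 / 2)\<^sup>2 - X) > 0" "X \<ge> 0"
      using d unfolding disc_circle[of q] X_def by simp_all
    then have "((q $ 1 - q $ 3) / 2)\<^sup>2 + (q $ 2 / 2)\<^sup>2 > 0" by argo
    then show ?thesis by (rule less_imp_neq[symmetric])
  qed
  then show ?thesis unfolding zroot_def bp_def
    by (intro tendsto_intros tendsto_Complex tendsto_vec_nth q) (simp_all del: of_real_add)
qed

lemma zset_definite:
  assumes "disc q < 0" shows "zset q = {}"
  using definite_no_root[OF assms] by (auto simp: zset_def)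

lemma zset_disjnt:
  assumes "res p q \<noteq> 0" "disc p > 0" "disc q > 0"
  shows "zset p \<inter> zset q = {}"
proof (rule ccontr)
  assume "zset p \<inter> zset q \<noteq> {}"
  then obtain z where "norm z = 1" "cform p z = 0" "cform q z = 0" by (auto simp: zset_eq)
  then obtain u where u: "u \<noteq> 0" "qf p u = 0" "qf q u = 0"
    using circle_point_surj circle_point_coords(3) by (metis cform_circle_point divide_eq_0_iff less_irrefl)
  obtain r s where p: "r \<noteq> 0" "s \<noteq> 0" "p = lq r s" using real_roots[OF assms(2)] by metis
  obtain r' s' where q: "r' \<noteq> 0" "s' \<noteq> 0" "q = lq r' s'" using real_roots[OF assms(3)] by metis
  have "det2 r u = 0 \<or> det2 s u = 0" "det2 r' u = 0 \<or> det2 s' u = 0"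
    using u(2,3) unfolding p(3) q(3) qf_lq by auto
  moreover have "det2 x y = 0" if "det2 x u = 0" "det2 y u = 0" for x y
  proof -
    have "det2 x y * u $ 1 = det2 x u * y $ 1 - det2 y u * x $ 1" "det2 x y * u $ 2 = det2 x u * y $ 2 - det2 y u * x $ 2"
      by (simp_all add: det2_def algebra_simps)
    then show ?thesis using that u(1) by (auto simp: vec_eq_iff forall_2)
  qed
  ultimately have "det2 r' r = 0 \<or> det2 s' r = 0 \<or> det2 r' s = 0 \<or> det2 s' s = 0" by blast
  then have "res p q = 0" unfolding p(3) q(3) res_lq qf_lq mult_eq_0_iff by blast
  then show False using assms by simp
qed

text \<open>Rotating by a sum of bump functions with small Lipschitz constant is bijective, because
  inverting it is a fixed point problem for a contraction of the circle.\<close>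

lemma circle_move:
  fixes z :: "'j \<Rightarrow> complex" and b :: "'j \<Rightarrow> real"
  assumes fin: "finite J" and n: "\<And>j. j \<in> J \<Longrightarrow> norm (z j) = 1"
    and r: "\<And>i j. i \<in> J \<Longrightarrow> j \<in> J \<Longrightarrow> i \<noteq> j \<Longrightarrow> dist (z i) (z j) \<ge> r"
    and b: "(\<Sum>j\<in>J. \<bar>b j\<bar>) < r"
  shows "\<exists>f g. circle_homeo f g \<and> (\<forall>j\<in>J. f (z j) = z j * cis (b j))"
proof -
  have rp: "r > 0" using b sum_nonneg[of J "\<lambda>j. \<bar>b j\<bar>"] by linarith
  \<comment> \<open>Hat functions of radius \<open>r\<close>: value 1 at the own point and 0 at all
    others, since these have distance at least \<open>r\<close>.\<close>
  define \<phi> where "\<phi> j w = max 0 (1 - dist w (z j) / r)" for j w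
  define g where "g w = (\<Sum>j\<in>J. b j * \<phi> j w)" for w
  define L where "L = (\<Sum>j\<in>J. \<bar>b j\<bar>) / r"
  have L: "0 \<le> L" "L < 1" using b rp by (auto simp: L_def intro!: divide_nonneg_pos sum_nonneg)
  have phi: "\<bar>\<phi> j v - \<phi> j w\<bar> \<le> dist v w / r" for j v w
  proof -
    have "\<bar>dist v (z j) - dist w (z j)\<bar> \<le> dist v w"
      using dist_triangle[of v "z j" w] dist_triangle[of w "z j" v] by (simp add: dist_commute)
    then have "\<bar>dist v (z j) / r - dist w (z j) / r\<bar> \<le> dist v w / r"
      using rp by (simp add: divide_right_mono flip: diff_divide_distrib)
    then show ?thesis unfolding \<phi>_def by linarith
  qed
  have g: "\<bar>g v - g w\<bar> \<le> L * dist v w" for v w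
  proof -
    have "\<bar>g v - g w\<bar> = \<bar>\<Sum>j\<in>J. b j * (\<phi> j v - \<phi> j w)\<bar>"
      by (simp add: g_def right_diff_distrib sum_subtractf)
    also have "\<dots> \<le> (\<Sum>j\<in>J. \<bar>b j\<bar> * (dist v w / r))"
      by (intro order.trans[OF sum_abs] sum_mono) (simp only: abs_mult, intro mult_left_mono phi abs_ge_zero)
    also have "\<dots> = L * dist v w" by (simp add: L_def sum_distrib_right sum_divide_distrib)
    finally show ?thesis .
  qed
  have cis: "norm (cis x - cis y) \<le> \<bar>x - y\<bar>" for x y
  proof -
    have "norm (cis x - cis y) = norm (cis y * (cis (x - y) - 1))"
      by (simp add: right_diff_distrib cis_mult)
    also have "\<dots> = norm (cis (x - y) - 1)" by (simp add: norm_mult)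
    also have "\<dots> \<le> \<bar>x - y\<bar>"
    proof (rule power2_le_imp_le)
      have "(norm (cis t - 1))\<^sup>2 = (2 * sin (t / 2))\<^sup>2" for t
      proof -
        have "(norm (cis t - 1))\<^sup>2 = (cos t - 1)\<^sup>2 + (sin t)\<^sup>2" by (simp add: cmod_power2)
        also have "\<dots> = 2 - 2 * cos t" using sin_cos_squared_add[of t] by (simp add: power2_eq_square algebra_simps)
        also have "\<dots> = (2 * sin (t / 2))\<^sup>2" using cos_double_sin[of "t / 2"] by (simp add: power_mult_distrib)
        finally show ?thesis .
      qed
      moreover have "\<bar>2 * sin (t / 2)\<bar> \<le> \<bar>t\<bar>" for t :: real
        using abs_sin_x_le_abs_x[of "t / 2"] by (simp add: abs_mult)
      ultimately show "(norm (cis (x - y) - 1))\<^sup>2 \<le> \<bar>x - y\<bar>\<^sup>2"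
        by (metis abs_le_square_iff abs_abs)
    qed simp
    finally show ?thesis .
  qed
  define f where "f w = w * cis (g w)" for w
  have gc: "continuous_on UNIV g"
    unfolding g_def \<phi>_def using rp by (intro continuous_intros) auto
  have cont: "continuous_on (sphere 0 1) f"
    unfolding f_def by (intro continuous_intros continuous_on_cis continuous_on_subset[OF gc]) auto
  have inv: "\<exists>!w. w \<in> sphere 0 1 \<and> y * cis (- g w) = w" if y: "y \<in> sphere 0 1" for y
  proof (rule Banach_fix)
    show "complete (sphere (0 :: complex) 1)" by (simp add: compact_imp_complete)
    show "sphere (0 :: complex) 1 \<noteq> {}" by simp
    show "0 \<le> L" "L < 1" using L by auto
    show "(\<lambda>w. y * cis (- g w)) ` sphere 0 1 \<subseteq> sphere 0 1" using y by (auto simp: norm_mult)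
    fix v w :: complex
    have "dist (y * cis (- g v)) (y * cis (- g w)) = norm (cis (- g v) - cis (- g w))"
      using y by (simp add: dist_norm norm_mult flip: right_diff_distrib)
    also have "\<dots> \<le> \<bar>g v - g w\<bar>" using cis[of "- g v" "- g w"] by (simp add: abs_minus_commute)
    also have "\<dots> \<le> L * dist v w" by (rule g)
    finally show "dist (y * cis (- g v)) (y * cis (- g w)) \<le> L * dist v w" .
  qed
  have eq: "f w = y \<longleftrightarrow> y * cis (- g w) = w" for w y
  proof
    assume "f w = y"
    then show "y * cis (- g w) = w" unfolding f_def by (auto simp: mult.assoc cis_mult)
  next
    assume "y * cis (- g w) = w"
    then have "f w = y * (cis (- g w) * cis (g w))" by (simp add: f_def mult.assoc)
    then show "f w = y" by (simp add: cis_mult)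
  qed
  have onto: "f ` sphere 0 1 = sphere 0 1"
  proof
    show "f ` sphere 0 1 \<subseteq> sphere 0 1" by (auto simp: f_def norm_mult)
    show "sphere 0 1 \<subseteq> f ` sphere 0 1"
    proof
      fix y :: complex assume "y \<in> sphere 0 1"
      from ex1_implies_ex[OF inv[OF this]] obtain w where "w \<in> sphere 0 1" "f w = y" unfolding eq[symmetric] by blast
      then show "y \<in> f ` sphere 0 1" by blast
    qed
  qed
  have inj: "inj_on f (sphere 0 1)"
  proof (rule inj_onI)
    fix v w assume v: "v \<in> sphere 0 1" and w: "w \<in> sphere 0 1" and "f v = f w"
    have "f v \<in> sphere 0 1" using onto v by blast
    from inv[OF this, folded eq] show "v = w" using v w \<open>f v = f w\<close> by (metis (no_types))
  qed
  obtain f' where f': "circle_homeo f f'"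
    using homeomorphism_compact[OF _ cont onto inj] by auto
  have "f (z j) = z j * cis (b j)" if "j \<in> J" for j
  proof -
    have "g (z j) = (\<Sum>i\<in>J. if i = j then b j else 0)" unfolding g_def
    proof (rule sum.cong[OF refl])
      fix i assume "i \<in> J"
      show "b i * \<phi> i (z j) = (if i = j then b j else 0)"
        using r[OF \<open>j \<in> J\<close> \<open>i \<in> J\<close>] rp by (auto simp: \<phi>_def max_def field_simps)
    qed
    then show ?thesis using fin that by (simp add: f_def)
  qed
  with f' show ?thesis by blast
qed

text \<open>Each point has to be turned by the argument of the quotient of target and source; these
  angles tend to 0, so their sum eventually falls below the minimal distance of the points.\<close>

lemma circle_move_tendsto:
  fixes z :: "'j \<Rightarrow> complex" and w :: "'i \<Rightarrow> 'j \<Rightarrow> complex"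
  assumes fin: "finite J" and inj: "inj_on z J" and n: "\<And>j. j \<in> J \<Longrightarrow> norm (z j) = 1"
    and lim: "\<And>j. j \<in> J \<Longrightarrow> ((\<lambda>x. w x j) \<longlongrightarrow> z j) F"
    and nw: "\<forall>\<^sub>F x in F. \<forall>j\<in>J. norm (w x j) = 1"
  shows "\<forall>\<^sub>F x in F. \<exists>f g. circle_homeo f g \<and> (\<forall>j\<in>J. f (z j) = w x j)"
proof -
  obtain r where r: "r > 0" "\<And>i j. i \<in> J \<Longrightarrow> j \<in> J \<Longrightarrow> i \<noteq> j \<Longrightarrow> dist (z i) (z j) \<ge> r"
  proof -
    \<comment> \<open>The inserted 1 keeps the minimum defined and positive when there are fewer
      than two points.\<close>
    define S where "S = insert 1 {dist (z i) (z j) | i j. i \<in> J \<and> j \<in> J \<and> i \<noteq> j}"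
    have "{dist (z i) (z j) | i j. i \<in> J \<and> j \<in> J \<and> i \<noteq> j} \<subseteq> (\<lambda>p. dist (z (fst p)) (z (snd p))) ` (J \<times> J)" by force
    moreover have "finite ((\<lambda>p. dist (z (fst p)) (z (snd p))) ` (J \<times> J))" using fin by simp
    ultimately have S: "finite S" unfolding S_def using finite_subset by blast
    have "\<forall>s\<in>S. s > 0" using inj by (auto simp: S_def inj_on_def)
    then have "Min S > 0" using S by (simp add: S_def)
    then show ?thesis using that[of "Min S"] Min_le[OF S] by (auto simp: S_def)
  qed
  define b where "b x j = Arg (w x j / z j)" for x j
  have "((\<lambda>x. b x j) \<longlongrightarrow> 0) F" if "j \<in> J" for j
  proof -
    have z: "z j \<noteq> 0" using n[OF that] by auto
    have "((\<lambda>x. w x j / z j) \<longlongrightarrow> 1) F" using tendsto_divide[OF lim[OF that] tendsto_const[of "z j"]] z by simp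
    moreover have "isCont Arg 1" by (rule continuous_at_Arg) simp
    ultimately have "((\<lambda>x. Arg (w x j / z j)) \<longlongrightarrow> Arg 1) F" by (metis isCont_tendsto_compose)
    then show ?thesis by (simp add: b_def)
  qed
  then have "((\<lambda>x. \<Sum>j\<in>J. \<bar>b x j\<bar>) \<longlongrightarrow> (\<Sum>j\<in>J. \<bar>0\<bar>)) F" by (intro tendsto_sum tendsto_rabs) auto
  then have "\<forall>\<^sub>F x in F. (\<Sum>j\<in>J. \<bar>b x j\<bar>) < r" using r(1) by (intro order_tendstoD(2)) auto
  with nw show ?thesis
  proof eventually_elim
    case (elim x)
    obtain f g where f: "circle_homeo f g" "\<forall>j\<in>J. f (z j) = z j * cis (b x j)"
      using circle_move[of J z r "b x", OF fin n r(2) elim(2)] by blast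
    have "z j * cis (b x j) = w x j" if "j \<in> J" for j
    proof -
      have "norm (w x j / z j) = 1" using elim n that by (simp add: norm_divide)
      then have "cis (b x j) = w x j / z j" unfolding b_def by (subst cis_Arg) (auto simp: sgn_eq)
      then show ?thesis using n[OF that] by (auto simp: field_simps)
    qed
    with f show ?case by (intro exI[of _ f] exI[of _ g]) simp
  qed
qed

text \<open>If \<open>z\<close> is the circle point of \<open>(s, t)\<close>, this is
  \<open>(s^2, s t, t^2) / (s^2 + t^2)\<close>: the identification of the circle with the real
  points of the standard conic. Its inverse \<open>cone_proj\<close> is invariant under nonzero
  scaling, so linear maps preserving the conic act on the circle.\<close>

definition cone_lift :: "complex \<Rightarrow> real ^ 3" where
  "cone_lift z = vector [(1 + Re z) / 2, Im z / 2, (1 - Re z) / 2]"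

definition cone_proj :: "real ^ 3 \<Rightarrow> complex" where
  "cone_proj y = Complex ((y $ 1 - y $ 3) / (y $ 1 + y $ 3)) (2 * y $ 2 / (y $ 1 + y $ 3))"

lemma cform_cone_lift: "cform q z = q \<bullet> cone_lift z"
  by (simp add: cform_def cone_lift_def inner_vec_def sum_3 field_simps)

lemma cone_lift_conic: "norm z = 1 \<Longrightarrow> cone_lift z $ 1 * cone_lift z $ 3 - cone_lift z $ 2 * cone_lift z $ 2 = 0"
  using cmod_power2[of z] by (simp add: cone_lift_def power2_eq_square field_simps)

lemma cone_lift_nonzero: "cone_lift z \<noteq> 0"
  by (auto simp: cone_lift_def vec_eq_iff forall_3)

lemma cone_sum_nonzero:
  fixes y :: "real ^ 3"
  assumes "y $ 1 * y $ 3 - y $ 2 * y $ 2 = 0" "y \<noteq> 0"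
  shows "y $ 1 + y $ 3 \<noteq> 0"
proof
  assume "y $ 1 + y $ 3 = 0"
  then have e: "y $ 3 = - y $ 1" by simp
  have "- (y $ 1 * y $ 1 + y $ 2 * y $ 2) = 0" using assms(1) unfolding e by argo
  then have "y $ 1 = 0 \<and> y $ 2 = 0" unfolding neg_equal_0_iff_equal by (rule sum_squares_eq_zero_iff[THEN iffD1])
  with e assms(2) show False by (simp add: vec_eq_iff forall_3)
qed

lemma cone_proj:
  fixes y :: "real ^ 3"
  assumes "y $ 1 * y $ 3 - y $ 2 * y $ 2 = 0" "y \<noteq> 0"
  shows "norm (cone_proj y) = 1" "cone_lift (cone_proj y) = (1 / (y $ 1 + y $ 3)) *s y"
proof -
  let ?s = "y $ 1 + y $ 3"
  have s: "?s \<noteq> 0" by (rule cone_sum_nonzero[OF assms])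
  have "(norm (cone_proj y))\<^sup>2 = ((y $ 1 - y $ 3)\<^sup>2 + (2 * y $ 2)\<^sup>2) / ?s\<^sup>2"
    by (simp add: cmod_power2 cone_proj_def power_divide add_divide_distrib)
  also have "(y $ 1 - y $ 3)\<^sup>2 + (2 * y $ 2)\<^sup>2 = ?s\<^sup>2" using assms(1) by (simp add: power2_eq_square algebra_simps)
  finally show "norm (cone_proj y) = 1" using s by (simp add: power2_eq_1_iff) (use norm_ge_zero[of "cone_proj y"] in linarith)
  show "cone_lift (cone_proj y) = (1 / ?s) *s y"
  proof -
    have "(1 + (a - c) / t) / 2 = 1 / t * a" "(1 - (a - c) / t) / 2 = 1 / t * c" "2 * b / t / 2 = 1 / t * b"
      if "t \<noteq> 0" "t = a + c" for a b c t :: real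
    proof -
      have c: "c = t - a" using that(2) by simp
      show "(1 + (a - c) / t) / 2 = 1 / t * a" "(1 - (a - c) / t) / 2 = 1 / t * c" "2 * b / t / 2 = 1 / t * b"
        unfolding c using that(1) by (simp_all add: field_simps)
    qed
    from this[OF s refl] show ?thesis
      by (simp only: vec_eq_iff forall_3 cone_lift_def cone_proj_def vector_3 vector_smult_component complex.sel)
  qed
qed

lemma cone_proj_scale_lift:
  assumes "c \<noteq> 0" shows "cone_proj (c *s cone_lift z) = z"
proof -
  have "c * ((1 + Re z) / 2) + c * ((1 - Re z) / 2) = c" "c * ((1 + Re z) / 2) - c * ((1 - Re z) / 2) = c * Re z"
    by (simp_all add: field_simps)
  then show ?thesis using assms by (simp add: cone_proj_def cone_lift_def complex_eq_iff)
qed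

text \<open>The linear map \<open>A\<close> preserves the real conic up to a positive factor and
  matches the forms \<open>k i\<close> with \<open>k' i\<close>; acting on the circle it is a
  homeomorphism that carries roots to roots.\<close>

lemma zset_of_gram:
  assumes g: "goodf k" "goodf k'" and gp: "gram_prop t k k'"
  shows "\<exists>f h. circle_homeo f h \<and> (\<forall>i. f ` zset (k i) = zset (k' i))"
proof -
  have t: "t > 0" by (rule gram_prop_pos[OF gp g])
  obtain A A' :: "real ^ 3 ^ 3" where AA: "A ** A' = mat 1" "A' ** A = mat 1"
    and kA: "\<And>i z. k' i \<bullet> (A *v z) = k i \<bullet> z"
    and cg: "\<And>t. (\<forall>z. lin (cm A *v z) (Bi *v (cm A *v z)) = t * lin z (Bi *v z)) \<longleftrightarrow>
      (\<forall>i j. complex_of_real (bp (k i) (k j)) = t * complex_of_real (bp (k' i) (k' j)))"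
    by (rule gram_matrix[OF g]) (rule that)
  have con: "(A *v z) $ 1 * (A *v z) $ 3 - (A *v z) $ 2 * (A *v z) $ 2 = t * (z $ 1 * z $ 3 - z $ 2 * z $ 2)" for z
  proof -
    have "\<forall>i j. complex_of_real (bp (k i) (k j)) = complex_of_real t * complex_of_real (bp (k' i) (k' j))"
      using gp by (simp add: gram_prop_def)
    then have "lin (cm A *v cvec z) (Bi *v (cm A *v cvec z)) = complex_of_real t * lin (cvec z) (Bi *v cvec z)"
      unfolding cg[symmetric] by blast
    then have "cvec (A *v z) $ 1 * cvec (A *v z) $ 3 - cvec (A *v z) $ 2 * cvec (A *v z) $ 2 =
        t * (cvec z $ 1 * cvec z $ 3 - cvec z $ 2 * cvec z $ 2)"
      unfolding conic_Bi cm_cvec[symmetric] by simp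
    then show ?thesis unfolding cvec_nth by (simp only: of_real_eq_iff flip: of_real_mult of_real_diff)
  qed
  have con': "\<forall>z. z $ 1 * z $ 3 - z $ 2 * z $ 2 = 0 \<longrightarrow> (A' *v z) $ 1 * (A' *v z) $ 3 - (A' *v z) $ 2 * (A' *v z) $ 2 = 0"
  proof (intro allI impI)
    fix z :: "real ^ 3" assume "z $ 1 * z $ 3 - z $ 2 * z $ 2 = 0"
    then show "(A' *v z) $ 1 * (A' *v z) $ 3 - (A' *v z) $ 2 * (A' *v z) $ 2 = 0"
      using con[of "A' *v z"] t by (simp add: matrix_vector_mul_assoc AA)
  qed
  have main: "norm (cone_proj (B *v cone_lift z)) = 1 \<and>
      cone_proj (B' *v cone_lift (cone_proj (B *v cone_lift z))) = z \<and>
      (\<exists>c. c \<noteq> 0 \<and> cone_lift (cone_proj (B *v cone_lift z)) = c *s (B *v cone_lift z)) \<and>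
      (B *v cone_lift z) $ 1 + (B *v cone_lift z) $ 3 \<noteq> 0"
    if z: "norm z = 1" and B: "B' ** B = mat 1"
      "\<forall>z. z $ 1 * z $ 3 - z $ 2 * z $ 2 = 0 \<longrightarrow> (B *v z) $ 1 * (B *v z) $ 3 - (B *v z) $ 2 * (B *v z) $ 2 = 0"
    for B B' :: "real ^ 3 ^ 3" and z
  proof -
    let ?y = "B *v cone_lift z"
    have c: "?y $ 1 * ?y $ 3 - ?y $ 2 * ?y $ 2 = 0" by (rule B(2)[rule_format, OF cone_lift_conic[OF z]])
    have b: "B' *v ?y = cone_lift z" by (simp add: matrix_vector_mul_assoc B)
    have y: "?y \<noteq> 0" using b cone_lift_nonzero[of z] by (metis matrix_vector_mult_0_right)
    note s = cone_sum_nonzero[OF c y]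
    have "cone_proj (B' *v cone_lift (cone_proj ?y)) = z"
      unfolding cone_proj(2)[OF c y] matrix_vector_smult b using s by (intro cone_proj_scale_lift) simp
    then show ?thesis using cone_proj[OF c y] s by (metis divide_eq_0_iff one_neq_zero)
  qed
  have fA: "\<forall>z. z $ 1 * z $ 3 - z $ 2 * z $ 2 = 0 \<longrightarrow> (A *v z) $ 1 * (A *v z) $ 3 - (A *v z) $ 2 * (A *v z) $ 2 = 0"
    by (simp add: con)
  note m = main[OF _ AA(2) fA] and m' = main[OF _ AA(1) con']
  define f where "f z = cone_proj (A *v cone_lift z)" for z
  define h where "h z = cone_proj (A' *v cone_lift z)" for z
  have cont: "continuous_on (sphere 0 1) (\<lambda>z. cone_proj (B *v cone_lift z))"
    if nz: "\<And>z. norm z = 1 \<Longrightarrow> (B *v cone_lift z) $ 1 + (B *v cone_lift z) $ 3 \<noteq> 0" for B :: "real ^ 3 ^ 3"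
    unfolding cone_proj_def
  proof (intro continuous_on_Complex continuous_on_divide)
    have c: "continuous_on (sphere 0 1) (\<lambda>z. (B *v cone_lift z) $ i)" for i
      unfolding matrix_vector_mult_def cone_lift_def by (simp add: sum_3) (intro continuous_intros; simp)
    show "continuous_on (sphere 0 1) (\<lambda>z. (B *v cone_lift z) $ 1 - (B *v cone_lift z) $ 3)"
      "continuous_on (sphere 0 1) (\<lambda>z. (B *v cone_lift z) $ 1 + (B *v cone_lift z) $ 3)"
      "continuous_on (sphere 0 1) (\<lambda>z. (B *v cone_lift z) $ 1 + (B *v cone_lift z) $ 3)"
      "continuous_on (sphere 0 1) (\<lambda>z. 2 * (B *v cone_lift z) $ 2)"
      by (intro continuous_intros c)+
    show "\<forall>z\<in>sphere 0 1. (B *v cone_lift z) $ 1 + (B *v cone_lift z) $ 3 \<noteq> 0"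
      "\<forall>z\<in>sphere 0 1. (B *v cone_lift z) $ 1 + (B *v cone_lift z) $ 3 \<noteq> 0" using nz by auto
  qed
  have hom: "circle_homeo f h"
  proof (rule homeomorphismI)
    show "continuous_on (sphere 0 1) f" "continuous_on (sphere 0 1) h"
      unfolding f_def h_def using cont m m' by auto
    show "f ` sphere 0 1 \<subseteq> sphere 0 1" "h ` sphere 0 1 \<subseteq> sphere 0 1"
      unfolding f_def h_def using m m' by auto
  qed (use m m' in \<open>auto simp: f_def h_def\<close>)
  have cf: "cform (k' i) (f z) = 0 \<longleftrightarrow> cform (k i) z = 0" if zn: "norm z = 1" for i z
  proof -
    obtain c where "c \<noteq> 0" "cone_lift (f z) = c *s (A *v cone_lift z)" using m[OF zn] unfolding f_def by blast
    then show ?thesis unfolding cform_cone_lift by (simp add: kA scalar_mult_eq_scaleR)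
  qed
  have "f ` zset (k i) = zset (k' i)" for i
  proof
    have "norm (f z) = 1" if "norm z = 1" for z using m[OF that] by (simp add: f_def)
    then show "f ` zset (k i) \<subseteq> zset (k' i)" by (auto simp: zset_eq cf)
    show "zset (k' i) \<subseteq> f ` zset (k i)"
    proof
      fix y assume y: "y \<in> zset (k' i)"
      then have n: "norm y = 1" by (simp add: zset_eq)
      then have e: "f (h y) = y" "norm (h y) = 1" using m'[OF n] by (simp_all add: f_def h_def)
      have "cform (k i) (h y) = 0" using y cf[of "h y" i] e by (simp add: zset_eq)
      then have "h y \<in> zset (k i)" using e by (simp add: zset_eq)
      then show "y \<in> f ` zset (k i)" using e(1) by (metis image_eqI)
    qed
  qed
  with hom show ?thesis by blast
qed

section \<open>The quadratic triples of a given curve\<close>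

text \<open>\<open>goodf\<close> without linear independence: the part of the condition that moving
  the roots without collisions preserves.\<close>

definition nondeg :: "(3 \<Rightarrow> real ^ 3) \<Rightarrow> bool" where
  "nondeg k \<longleftrightarrow> (\<forall>i. disc (k i) \<noteq> 0) \<and> (\<forall>i j. i \<noteq> j \<longrightarrow> res (k i) (k j) \<noteq> 0)"

definition diagram :: "(3 \<Rightarrow> real ^ 3) \<Rightarrow> complex set set" where
  "diagram k = {zset (k i) | i. disc (k i) > 0}"

definition rep :: "(complex ^ 3) set set \<Rightarrow> (3 \<Rightarrow> real ^ 3) \<Rightarrow> bool" where
  "rep C k \<longleftrightarrow> goodf k \<and> (\<exists>M. det M \<noteq> 0 \<and> C = curve M k)"

lemma goodf_iff: "goodf k \<longleftrightarrow> nondeg k \<and> det (\<chi> i. k i) \<noteq> 0"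
proof -
  have "(\<chi> i. k i) = (vector [k 1, k 2, k 3] :: real ^ 3 ^ 3)" by (simp add: vec_eq_iff forall_3)
  then have d: "det (\<chi> i. k i) = det3 (k 1) (k 2) (k 3)" by (simp add: det_vector3)
  show ?thesis unfolding goodf_def good_def nondeg_def forall_3 d by (auto simp: res_commute)
qed

lemma tc_nth:
  assumes "i \<noteq> j" "i \<noteq> l" "j \<noteq> l"
  shows "tc k n $ i = qm (k j) (k l) n"
  using assms exhaust_3[of i] exhaust_3[of j] exhaust_3[of l]
  by (auto simp: tc_def cremona_def qm_commute)

lemma others_3:
  fixes i :: 3
  obtains j l where "i \<noteq> j" "i \<noteq> l" "j \<noteq> l"
proof -
  have n: "1 \<noteq> (2 :: 3)" "2 \<noteq> (1 :: 3)" "1 \<noteq> (3 :: 3)" "3 \<noteq> (1 :: 3)" "2 \<noteq> (3 :: 3)" "3 \<noteq> (2 :: 3)"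
    by simp_all
  consider "i = 1" | "i = 2" | "i = 3" using exhaust_3[of i] by blast
  then show ?thesis
  proof cases
    case 1 show ?thesis by (rule that[of 2 3]) (simp_all only: 1 n not_False_eq_True)
  next
    case 2 show ?thesis by (rule that[of 1 3]) (simp_all only: 2 n not_False_eq_True)
  next
    case 3 show ?thesis by (rule that[of 1 2]) (simp_all only: 3 n not_False_eq_True)
  qed
qed

lemma qm_scale: "qm (c *s p) (d *s q) n = c * d * qm p q n"
  by (simp add: qm_def algebra_simps)

text \<open>Scaling the forms multiplies the product that omits form \<open>j\<close> by all factors
  except \<open>c j\<close>; the factor on column \<open>j\<close> supplies the missing one.\<close>

lemma param_scale: "param (\<chi> i j. M $ i $ j * c j) (\<lambda>i. c i *s k i) n = (c 1 * c 2 * c 3) *s param M k n"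
proof -
  have e: "c j * tc (\<lambda>i. c i *s k i) n $ j = (c 1 * c 2 * c 3) * tc k n $ j" for j
    using exhaust_3[of j] by (auto simp: tc_def cremona_def qm_scale)
  then have "M $ i $ j * c j * tc (\<lambda>i. c i *s k i) n $ j = (c 1 * c 2 * c 3) * (M $ i $ j * tc k n $ j)" for i j
  proof -
    have "M $ i $ j * c j * tc (\<lambda>i. c i *s k i) n $ j = M $ i $ j * (c j * tc (\<lambda>i. c i *s k i) n $ j)" by (rule mult.assoc)
    also note e[of j]
    finally show ?thesis by simp
  qed
  then have "(\<Sum>j\<in>UNIV. M $ i $ j * c j * tc (\<lambda>i. c i *s k i) n $ j) = (c 1 * c 2 * c 3) * (\<Sum>j\<in>UNIV. M $ i $ j * tc k n $ j)" for i
    unfolding sum_distrib_left by (intro sum.cong refl)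
  then show ?thesis unfolding param_def vec_eq_iff matrix_vector_mult_def vector_smult_component vec_lambda_beta by blast
qed

lemma curve_smult:
  assumes "c \<noteq> 0" "\<And>n. n \<le> 4 \<Longrightarrow> param M k n = c *s param M' k' n"
  shows "curve M k = curve M' k'"
proof -
  have "lift4 (param M k) v = complex_of_real c *s lift4 (param M' k') v" for v
    using assms(2) by (simp add: vec_eq_iff theta_nth sum_distrib_left mult.assoc)
  then have "Ctheta 4 (param M k) = Ctheta 4 (param M' k')"
    using assms(1) by (simp add: Ctheta_def fun_eq_iff pt_scale)
  then show ?thesis by (simp add: curve_def)
qed

lemma curve_scale:
  assumes "\<forall>i. c i \<noteq> 0"
  shows "curve (\<chi> i j. M $ i $ j * c j) (\<lambda>i. c i *s k i) = curve M k"
  by (rule curve_smult[where c = "c 1 * c 2 * c 3"]) (simp_all add: assms param_scale)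

lemma det_columns_scale:
  fixes M :: "real ^ 3 ^ 3"
  shows "det (\<chi> i j. M $ i $ j * c j) = det M * (c 1 * c 2 * c 3)"
  by (simp add: det_3 algebra_simps)

lemma nondeg_scale:
  assumes "\<forall>i. c i \<noteq> 0" "nondeg k"
  shows "nondeg (\<lambda>i. c i *s k i)"
proof -
  have "res (c *s p) (d *s q) = (c * d)\<^sup>2 * res p q" for c d and p q :: "real ^ 3"
    by (simp add: res_def bp_scale power2_eq_square algebra_simps)
  then show ?thesis using assms by (simp add: nondeg_def bp_scale)
qed

lemma goodf_scale:
  assumes "\<forall>i. c i \<noteq> 0" "goodf k"
  shows "goodf (\<lambda>i. c i *s k i)"
proof -
  have "det (\<chi> i. c i *s k i) = c 1 * c 2 * c 3 * det (\<chi> i. k i)" by (simp add: det_3 algebra_simps)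
  then show ?thesis using assms nondeg_scale unfolding goodf_iff by auto
qed

lemma rep_scale:
  assumes "rep C k" "\<forall>i. c i \<noteq> 0"
  shows "rep C (\<lambda>i. c i *s k i)"
proof -
  obtain M where M: "goodf k" "det M \<noteq> 0" "C = curve M k" using assms(1) unfolding rep_def by blast
  have "det (\<chi> i j. M $ i $ j * c j) \<noteq> 0" using M(2) assms(2) by (simp add: det_columns_scale)
  moreover have "C = curve (\<chi> i j. M $ i $ j * c j) (\<lambda>i. c i *s k i)" using curve_scale[OF assms(2), where M = M and k = k] M(3) by simp
  ultimately show ?thesis unfolding rep_def using goodf_scale[OF assms(2) M(1)] by blast
qed

lemma curve_perm:
  assumes "bij p"
  shows "curve (\<chi> i j. M $ i $ p j) (\<lambda>i. k (p i)) = curve M k"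
proof (rule curve_smult[where c = 1])
  fix n
  have "tc (\<lambda>i. k (p i)) n $ j = tc k n $ p j" for j
  proof -
    obtain a b where "j \<noteq> a" "j \<noteq> b" "a \<noteq> b" by (rule others_3)
    then have "p j \<noteq> p a" "p j \<noteq> p b" "p a \<noteq> p b" using bij_is_inj[OF assms] by (simp_all add: inj_eq)
    then show ?thesis using \<open>j \<noteq> a\<close> \<open>j \<noteq> b\<close> \<open>a \<noteq> b\<close> by (simp add: tc_nth[of j a b] tc_nth[of "p j" "p a" "p b"])
  qed
  then have "(\<Sum>j\<in>UNIV. M $ i $ p j * tc (\<lambda>i. k (p i)) n $ j) = (\<Sum>j\<in>UNIV. M $ i $ j * tc k n $ j)" for i
    using sum.reindex_bij_betw[OF assms, of "\<lambda>j. M $ i $ j * tc k n $ j"] by simp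
  then show "param (\<chi> i j. M $ i $ p j) (\<lambda>i. k (p i)) n = 1 *s param M k n"
    by (simp add: param_def vec_eq_iff matrix_vector_mult_def)
qed simp

lemma goodf_perm:
  assumes "bij p" "goodf k"
  shows "goodf (\<lambda>i. k (p i))"
proof -
  have p: "p permutes UNIV" using assms(1) by (intro bij_imp_permutes) auto
  have "det (\<chi> i. k (p i)) = of_int (sign p) * det (\<chi> i. k i)"
    using det_permute_rows[OF p, of "\<chi> i. k i"] by simp
  moreover have "sign p \<noteq> 0" by (simp add: sign_def)
  ultimately show ?thesis using assms(2) inj_eq[OF bij_is_inj[OF assms(1)]] unfolding goodf_iff nondeg_def by simp
qed

lemma det_columns_perm:
  fixes M :: "real ^ 3 ^ 3"
  assumes "bij p" "det M \<noteq> 0"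
  shows "det (\<chi> i j. M $ i $ p j) \<noteq> 0"
proof -
  have "p permutes UNIV" using assms(1) by (intro bij_imp_permutes) auto
  from det_permute_columns[OF this, of M] show ?thesis using assms(2) by (simp add: sign_def)
qed

lemma rep_perm:
  assumes "rep C k" "bij p"
  shows "rep C (\<lambda>i. k (p i))"
proof -
  obtain M where M: "goodf k" "det M \<noteq> 0" "C = curve M k" using assms(1) unfolding rep_def by blast
  have "C = curve (\<chi> i j. M $ i $ p j) (\<lambda>i. k (p i))" using curve_perm[OF assms(2), of M k] M(3) by simp
  then show ?thesis unfolding rep_def
    using goodf_perm[OF assms(2) M(1)] det_columns_perm[OF assms(2) M(2)] by blast
qed

lemma rep_gram:
  assumes "rep C k" "goodf k'" "gram_prop t k k'"
  shows "rep C k'"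
proof -
  obtain M where M: "goodf k" "det M \<noteq> 0" "C = curve M k" using assms(1) unfolding rep_def by blast
  then show ?thesis unfolding rep_def using assms(2) curve_of_gram[OF M(1) assms(2,3) M(2)] by blast
qed

text \<open>The nodes are intrinsic, so the columns of the two matrices agree up to a permutation
  and scalars. Absorbing both into the second triple leaves two triples with the same matrix, to
  which \<open>gram_of_curve\<close> applies.\<close>

lemma rep_unique:
  assumes "rep C k" "rep C k'"
  shows "\<exists>p c t. bij p \<and> (\<forall>i. c i \<noteq> 0) \<and> gram_prop t k (\<lambda>i. c i *s k' (p i)) \<and> goodf (\<lambda>i. c i *s k' (p i))"
proof -
  obtain M where M: "goodf k" "det M \<noteq> 0" "C = curve M k" using assms(1) unfolding rep_def by blast
  obtain M' where M': "goodf k'" "det M' \<noteq> 0" "C = curve M' k'" using assms(2) unfolding rep_def by blast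
  have "\<forall>i. \<exists>j. vertex M i = vertex M' j" using curve_vertices[OF M(1,2) M'(1,2)] M(3) M'(3) by simp
  then obtain p where p: "\<And>i. vertex M i = vertex M' (p i)" by metis
  have "inj p" by (rule injI) (metis p vertex_inj[OF M(2)])
  then have bp: "bij p" by (simp add: bij_def finite_UNIV_inj_surj)
  have "\<exists>c. c \<noteq> 0 \<and> column i M = c *s column (p i) M'" for i
  proof -
    obtain c where c: "c \<noteq> 0" "cvec (column (p i) M') = c *s cvec (column i M)"
      using p[of i] unfolding vertex_def pt_eq_iff by blast
    obtain r where "c = of_real r" "column (p i) M' = r *s column i M"
      using cvec_proportional[OF c(2) column_nonzero[OF M(2)]] by blast
    then show ?thesis using c(1) by (intro exI[of _ "1 / r"]) (simp add: vec_eq_iff)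
  qed
  then obtain c where c: "\<forall>i. c i \<noteq> 0" "\<And>i. column i M = c i *s column (p i) M'" by metis
  define k'' where "k'' = (\<lambda>i. c i *s k' (p i))"
  have g: "goodf k''" unfolding k''_def by (rule goodf_scale[OF c(1) goodf_perm[OF bp M'(1)]])
  have "M = (\<chi> i j. (\<chi> i j. M' $ i $ p j) $ i $ j * c j)"
    using c(2) by (simp add: vec_eq_iff column_def mult.commute)
  then have "curve M k'' = curve M' k'"
    using curve_scale[OF c(1), where M = "\<chi> i j. M' $ i $ p j" and k = "\<lambda>i. k' (p i)"] curve_perm[OF bp, of M' k'] by (simp add: k''_def)
  then have "curve M k = curve M k''" using M(3) M'(3) by simp
  then have im: "act (cm M) ` (Ctheta 4 (tc k) ` CP) = act (cm M) ` (Ctheta 4 (tc k'') ` CP)"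
    unfolding param_curve[OF M(2)] .
  obtain I where I: "cm I ** cm M = mat 1" using cm_inverse[OF M(2)] by metis
  have "inj (act (cm M))" by (rule injI) (rule act_inj[OF I])
  then have "Ctheta 4 (tc k) ` CP = Ctheta 4 (tc k'') ` CP" using im by (simp add: inj_image_eq_iff)
  from gram_of_curve[OF M(1) g this] obtain t where "gram_prop t k k''" by blast
  then show ?thesis using bp c(1) g unfolding k''_def by blast
qed

lemma zset_scale: "c \<noteq> 0 \<Longrightarrow> zset (c *s q) = zset q"
  unfolding zset_def qf_scale by simp

lemma diagram_scale:
  assumes "\<forall>i. c i \<noteq> 0"
  shows "diagram (\<lambda>i. c i *s k i) = diagram k"
proof -
  have "disc (c i *s k i) > 0 \<longleftrightarrow> disc (k i) > 0" for i
    using assms[rule_format, of i] by (auto simp: bp_scale zero_less_mult_iff linorder_neq_iff mult_less_0_iff)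
  then show ?thesis by (simp add: diagram_def zset_scale assms)
qed

lemma diagram_perm:
  assumes "bij p"
  shows "diagram (\<lambda>i. k (p i)) = diagram k"
proof (intro equalityI subsetI)
  fix x assume "x \<in> diagram k"
  then obtain i where "x = zset (k i)" "disc (k i) > 0" by (auto simp: diagram_def)
  moreover obtain j where "i = p j" using bij_is_surj[OF assms] by (metis surjD)
  ultimately show "x \<in> diagram (\<lambda>i. k (p i))" by (auto simp: diagram_def)
qed (auto simp: diagram_def)

lemma same_diagram_image:
  assumes "circle_homeo f h" "\<And>i. 0 < disc (k i) \<longleftrightarrow> 0 < disc (k' i)"
    and "\<And>i. 0 < disc (k i) \<Longrightarrow> f ` zset (k i) = zset (k' i)"
  shows "same_diagram (diagram k) (diagram k')"
proof -
  have "diagram k' = (\<lambda>c. f ` c) ` diagram k"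
    unfolding diagram_def using assms(2,3) by (fastforce simp: image_iff)
  then show ?thesis unfolding same_diagram_def using assms(1) by blast
qed

lemma same_diagram_trans:
  assumes "same_diagram D D'" "same_diagram D' D''"
  shows "same_diagram D D''"
proof -
  obtain f g where f: "circle_homeo f g" "D' = (\<lambda>c. f ` c) ` D"
    using assms(1) unfolding same_diagram_def by blast
  obtain f' g' where f': "circle_homeo f' g'" "D'' = (\<lambda>c. f' ` c) ` D'"
    using assms(2) unfolding same_diagram_def by blast
  have "D'' = (\<lambda>c. (f' \<circ> f) ` c) ` D" unfolding f' f by (simp add: image_image image_comp comp_def)
  then show ?thesis unfolding same_diagram_def using homeomorphism_compose[OF f(1) f'(1)] by blast
qed

lemma same_diagram_sym:
  assumes "same_diagram D D'" "\<Union> D \<subseteq> sphere 0 1"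
  shows "same_diagram D' D"
proof -
  obtain f g where f: "circle_homeo f g" "D' = (\<lambda>c. f ` c) ` D"
    using assms(1) unfolding same_diagram_def by blast
  have "g ` f ` c = c" if "c \<in> D" for c
  proof -
    have "g (f x) = x" if "x \<in> c" for x
      using that \<open>c \<in> D\<close> assms(2) homeomorphism_apply1[OF f(1), of x] by blast
    then show ?thesis by (simp add: image_image)
  qed
  then have "D = (\<lambda>c. g ` c) ` D'" unfolding f(2) image_image by simp
  then show ?thesis unfolding same_diagram_def using homeomorphism_symD[OF f(1)] by blast
qed

lemma diagram_on_circle: "\<Union> (diagram k) \<subseteq> sphere 0 1"
  by (auto simp: diagram_def zset_eq)

lemma diagram_unique:
  assumes "rep C k" "rep C k'"
  shows "same_diagram (diagram k) (diagram k')"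
proof -
  obtain p c t where h: "bij p" "\<forall>i. c i \<noteq> 0" "gram_prop t k (\<lambda>i. c i *s k' (p i))" "goodf (\<lambda>i. c i *s k' (p i))"
    using rep_unique[OF assms] by blast
  have g: "goodf k" using assms(1) by (simp add: rep_def)
  have t: "t > 0" by (rule gram_prop_pos[OF h(3) g h(4)])
  obtain f f' where f: "circle_homeo f f'" "\<And>i. f ` zset (k i) = zset (c i *s k' (p i))"
    using zset_of_gram[OF g h(4,3)] by blast
  have "0 < disc (k i) \<longleftrightarrow> 0 < disc (c i *s k' (p i))" for i
    using h(3) t unfolding gram_prop_def by (simp add: zero_less_mult_iff)
  from same_diagram_image[where k = k and k' = "\<lambda>i. c i *s k' (p i)", OF f(1) this f(2)] show ?thesis
    using diagram_scale[OF h(2), where k = "\<lambda>i. k' (p i)"] diagram_perm[OF h(1), of k'] by simp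
qed

lemma diagram_cong:
  assumes "\<And>n. n \<le> d \<Longrightarrow> a n = b n"
  shows "real_chord_diagram d a = real_chord_diagram d b" "node d a = node d b" "preimages d a = preimages d b"
proof -
  have t: "theta_lift d a = theta_lift d b" by (rule theta_cong) (rule assms)
  then have c: "Ctheta d a = Ctheta d b" by (simp add: Ctheta_def fun_eq_iff)
  then show p: "preimages d a = preimages d b" by (simp add: preimages_def fun_eq_iff)
  have "transversal_branches d a = transversal_branches d b"
    by (simp add: transversal_branches_def tangent_cone_def t fun_eq_iff)
  with p show n: "node d a = node d b" by (simp add: node_def fun_eq_iff)
  show "real_chord_diagram d a = real_chord_diagram d b"
    by (simp add: real_chord_diagram_def chord_def non_solitary_def real_node_def n p)
qed

lemma rep_structure:
  assumes n: "nodal a C" and r: "real_crit a"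
  obtains k where "rep C k" "real_chord_diagram 4 a = diagram k" "\<And>i. crit a (cvec (k i))"
proof -
  obtain M k1 k2 k3 where M: "good k1 k2 k3" "det M \<noteq> 0" "\<And>n. n \<le> 4 \<Longrightarrow> a n = M *v cremona k1 k2 k3 n"
    "crit a (cvec k1)" "crit a (cvec k2)" "crit a (cvec k3)"
    by (rule structure_theorem[OF n r]) (rule that)
  define k where "k = (\<lambda>i :: 3. if i = 1 then k1 else if i = 2 then k2 else k3)"
  have kk: "k 1 = k1" "k 2 = k2" "k 3 = k3" by (simp_all add: k_def)
  have g: "goodf k" using M(1) by (simp add: goodf_def kk)
  have a: "a n = param M k n" if "n \<le> 4" for n using M(3)[OF that] by (simp add: param_def tc_def kk)
  have "C = curve M k"
  proof -
    have "lift4 a = lift4 (param M k)" by (rule theta_cong) (rule a)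
    then have "Ctheta 4 a = Ctheta 4 (param M k)" by (simp add: Ctheta_def fun_eq_iff)
    then show ?thesis using n by (simp add: nodal_parametrization_def parametrizes_def curve_def)
  qed
  then have "rep C k" using g M(2) unfolding rep_def by blast
  moreover have "real_chord_diagram 4 a = diagram k"
    using diagram_cong(1)[OF a] param_diagram[OF g M(2)] by (simp add: diagram_def)
  moreover have "crit a (cvec (k i))" for i using M(4-6) by (simp add: k_def)
  ultimately show ?thesis by (rule that)
qed

text \<open>Reality of the nodes is a property of the point set, so one representation by a real
  triple settles it for every nodal parametrization.\<close>

lemma real_crit_rep:
  assumes n: "nodal a C" and r: "rep C k"
  shows "real_crit a"
proof (rule real_crit_of_real_nodes[OF n])
  fix x assume x: "node 4 a x"
  obtain M where M: "goodf k" "det M \<noteq> 0" "C = curve M k" using r unfolding rep_def by blast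
  have "singular_point 4 C x" using node_singular[OF _ _ x] n by (simp add: nodal_parametrization_def)
  then have "node 4 (param M k) x" using param_nodal[OF M(1,2)] M(3) by (simp add: nodal_parametrization_def)
  then obtain i where "x = vertex M i" using param_node_iff[OF M(1,2)] by blast
  then show "real_node 4 a x" using x vertex_real[OF M(2)] by (simp add: real_node_def)
qed

section \<open>Isotopies from paths of quadratic triples\<close>

abbreviation GL3 :: "(real ^ 3 ^ 3) set" where
  "GL3 \<equiv> {A. det A \<noteq> 0}"

abbreviation rows :: "real ^ 3 \<Rightarrow> real ^ 3 \<Rightarrow> real ^ 3 \<Rightarrow> real ^ 3 ^ 3" where
  "rows x y z \<equiv> vector [x, y, z]"

text \<open>If the determinant is affine along the segment, as when a single row changes, equal
  signs at the ends exclude a zero between them.\<close>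

lemma GL3_segment:
  assumes "\<And>u. 0 \<le> u \<Longrightarrow> u \<le> 1 \<Longrightarrow> det ((1 - u) *\<^sub>R A + u *\<^sub>R B) = (1 - u) * det A + u * det B"
    and "det A * det B > 0"
  shows "path_component GL3 A B"
proof (rule path_component_linepath, rule subsetI)
  fix X assume "X \<in> closed_segment A B"
  then obtain u where u: "0 \<le> u" "u \<le> 1" "X = (1 - u) *\<^sub>R A + u *\<^sub>R B" by (auto simp: closed_segment_def)
  have e: "det A * det X = (1 - u) * (det A * det A) + u * (det A * det B)"
    unfolding u(3) assms(1)[OF u(1,2)] by (simp add: algebra_simps)
  have p: "det A * det A > 0" using assms(2) by (auto simp: zero_less_mult_iff)
  have "det A * det X > 0"
  proof (cases "u = 1")
    case False
    then have "(1 - u) * (det A * det A) > 0" "u * (det A * det B) \<ge> 0" using u assms(2) p by simp_all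
    then show ?thesis unfolding e by simp
  qed (use assms(2) u(3) in simp)
  then show "X \<in> GL3" by auto
qed

lemma GL3_row:
  assumes "det3 x y z * det3 x' y z > 0" shows "path_component GL3 (rows x y z) (rows x' y z)"
  by (rule GL3_segment) (use assms in \<open>simp_all add: det_vector3 det_3 det3_def algebra_simps\<close>)

lemma GL3_row2:
  assumes "det3 x y z * det3 x y' z > 0" shows "path_component GL3 (rows x y z) (rows x y' z)"
  by (rule GL3_segment) (use assms in \<open>simp_all add: det_vector3 det_3 det3_def algebra_simps\<close>)

lemma GL3_row3:
  assumes "det3 x y z * det3 x y z' > 0" shows "path_component GL3 (rows x y z) (rows x y z')"
  by (rule GL3_segment) (use assms in \<open>simp_all add: det_vector3 det_3 det3_def algebra_simps\<close>)

lemma det3_row_ops: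
  fixes x y z :: "real ^ 3"
  shows "det3 (x + y) y z = det3 x y z" "det3 x (x + y) z = det3 x y z" "det3 y (- x) z = det3 x y z"
    "det3 x (y + z) z = det3 x y z" "det3 x y (y + z) = det3 x y z" "det3 x z (- y) = det3 x y z"
  by (simp_all add: det3_def algebra_simps)

text \<open>A quarter turn of two rows is a product of three shears, and along a shear the
  determinant is constant.\<close>

lemma GL3_turn12:
  assumes "det3 x y z \<noteq> 0" shows "path_component GL3 (rows x y z) (rows y (- x) z)"
proof -
  have p: "det3 x y z * det3 x y z > 0" using assms by (simp add: zero_less_mult_iff linorder_neq_iff disj_commute)
  have 1: "path_component GL3 (rows x y z) (rows (x + y) y z)" by (rule GL3_row) (simp only: det3_row_ops p)
  have 2: "path_component GL3 (rows (x + y) y z) (rows (x + y) (- x) z)" by (rule GL3_row2) (simp only: det3_row_ops p)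
  have 3: "path_component GL3 (rows (x + y) (- x) z) (rows y (- x) z)" by (rule GL3_row) (simp only: det3_row_ops p)
  show ?thesis by (rule path_component_trans[OF 1 path_component_trans[OF 2 3]])
qed

lemma GL3_turn23:
  assumes "det3 x y z \<noteq> 0" shows "path_component GL3 (rows x y z) (rows x z (- y))"
proof -
  have p: "det3 x y z * det3 x y z > 0" using assms by (simp add: zero_less_mult_iff linorder_neq_iff disj_commute)
  have 1: "path_component GL3 (rows x y z) (rows x (y + z) z)" by (rule GL3_row2) (simp only: det3_row_ops p)
  have 2: "path_component GL3 (rows x (y + z) z) (rows x (y + z) (- y))" by (rule GL3_row3) (simp only: det3_row_ops p)
  have 3: "path_component GL3 (rows x (y + z) (- y)) (rows x z (- y))" by (rule GL3_row2) (simp only: det3_row_ops p)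
  show ?thesis by (rule path_component_trans[OF 1 path_component_trans[OF 2 3]])
qed

lemma sign_choice:
  fixes a b :: real
  assumes "a \<noteq> 0" "b \<noteq> 0"
  obtains c where "c = 1 \<or> c = - 1" "a * (c * b) > 0"
proof (cases "a * b > 0")
  case True then show ?thesis using that[of 1] by simp
next
  case False
  then have "a * b < 0" using assms by (simp add: linorder_neq_iff not_less le_less)
  then show ?thesis using that[of "- 1"] by simp
qed

text \<open>Gaussian elimination along paths: single row moves and quarter turns bring the rows to
  signed unit vectors. Two quarter turns flip a pair of signs, so only one overall sign is
  left.\<close>

lemma GL3_standard:
  assumes "det A \<noteq> 0"
  shows "path_component GL3 A (mat 1) \<or> path_component GL3 A (- mat 1)"
proof -
  define R where "R = (\<lambda>x y z. path_component GL3 A (rows x y z))"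
  have RD: "det3 x y z \<noteq> 0" if "R x y z" for x y z
    using path_component_mem(2)[OF that[unfolded R_def]] by (simp add: det_vector3)
  have tr: "R x' y' z'" if "R x y z" "path_component GL3 (rows x y z) (rows x' y' z')" for x y z x' y' z'
    using that unfolding R_def by (rule path_component_trans)
  have t12: "R y (- x) z" if "R x y z" for x y z by (rule tr[OF that GL3_turn12[OF RD[OF that]]])
  have t23: "R x z (- y)" if "R x y z" for x y z by (rule tr[OF that GL3_turn23[OF RD[OF that]]])
  define e1 :: "real ^ 3" where "e1 = vector [1, 0, 0]"
  define e2 :: "real ^ 3" where "e2 = vector [0, 1, 0]"
  define e3 :: "real ^ 3" where "e3 = vector [0, 0, 1]"
  have sc: "det3 (c *s x) y z = c * det3 x y z" "det3 x (c *s y) z = c * det3 x y z" "det3 x y (c *s z) = c * det3 x y z"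
    for c and x y z :: "real ^ 3" by (simp_all add: det3_def algebra_simps)
  have s1: "\<exists>c. (c = 1 \<or> c = - 1) \<and> R (c *s x') y z" if R: "R x y z" and d: "det3 x' y z \<noteq> 0" for x y z x'
  proof -
    obtain c where c: "c = 1 \<or> c = - 1" "det3 x y z * (c * det3 x' y z) > 0" by (rule sign_choice[OF RD[OF R] d])
    then show ?thesis using tr[OF R GL3_row[of x y z "c *s x'"]] by (auto simp: sc)
  qed
  have s2: "\<exists>c. (c = 1 \<or> c = - 1) \<and> R x (c *s y') z" if R: "R x y z" and d: "det3 x y' z \<noteq> 0" for x y z y'
  proof -
    obtain c where c: "c = 1 \<or> c = - 1" "det3 x y z * (c * det3 x y' z) > 0" by (rule sign_choice[OF RD[OF R] d])
    then show ?thesis using tr[OF R GL3_row2[of x y z "c *s y'"]] by (auto simp: sc)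
  qed
  have s3: "\<exists>c. (c = 1 \<or> c = - 1) \<and> R x y (c *s z')" if R: "R x y z" and d: "det3 x y z' \<noteq> 0" for x y z z'
  proof -
    obtain c where c: "c = 1 \<or> c = - 1" "det3 x y z * (c * det3 x y z') > 0" by (rule sign_choice[OF RD[OF R] d])
    then show ?thesis using tr[OF R GL3_row3[of x y z "c *s z'"]] by (auto simp: sc)
  qed
  have "rows (A $ 1) (A $ 2) (A $ 3) = A" by (simp add: vec_eq_iff forall_3)
  then have R0: "R (A $ 1) (A $ 2) (A $ 3)" using assms by (simp add: R_def path_component_refl)
  have ex1: "\<exists>y z c. (c = 1 \<or> c = - 1) \<and> R (c *s e1) y z" if R: "R x y z" for x y z
  proof -
    \<comment> \<open>Expansion along the first column: some row can be replaced by the first unit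
      vector, up to sign, without leaving the invertible matrices.\<close>
    have "det3 x y z = x $ 1 * det3 e1 y z + y $ 1 * det3 x e1 z + z $ 1 * det3 x y e1"
      by (simp add: det3_def e1_def algebra_simps)
    then have "det3 e1 y z \<noteq> 0 \<or> det3 x e1 z \<noteq> 0 \<or> det3 x y e1 \<noteq> 0" using RD[OF R] by auto
    then consider "det3 e1 y z \<noteq> 0" | "det3 x e1 z \<noteq> 0" | "det3 x y e1 \<noteq> 0" by blast
    then show ?thesis
    proof cases
      case 1 then show ?thesis using s1[OF R] by blast
    next
      case 2
      then obtain c where c: "c = 1 \<or> c = - 1" "R x (c *s e1) z" using s2[OF R] by blast
      show ?thesis using t12[OF c(2)] c(1) by blast
    next
      case 3
      then obtain c where c: "c = 1 \<or> c = - 1" "R x y (c *s e1)" using s3[OF R] by blast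
      show ?thesis using t12[OF t23[OF c(2)]] c(1) by blast
    qed
  qed
  obtain y z c1 where 1: "c1 = 1 \<or> c1 = - 1" "R (c1 *s e1) y z" using ex1[OF R0] by blast
  have "\<exists>z c. (c = 1 \<or> c = - 1) \<and> R (c1 *s e1) (c *s e2) z"
  proof -
    have "det3 (c1 *s e1) y z = y $ 2 * det3 (c1 *s e1) e2 z + z $ 2 * det3 (c1 *s e1) y e2"
      by (simp add: det3_def e1_def e2_def algebra_simps)
    then consider "det3 (c1 *s e1) e2 z \<noteq> 0" | "det3 (c1 *s e1) y e2 \<noteq> 0" using RD[OF 1(2)] by force
    then show ?thesis
    proof cases
      case 1 then show ?thesis using s2[OF \<open>R (c1 *s e1) y z\<close>] by blast
    next
      case 2
      then obtain c where c: "c = 1 \<or> c = - 1" "R (c1 *s e1) y (c *s e2)" using s3[OF \<open>R (c1 *s e1) y z\<close>] by blast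
      show ?thesis using t23[OF c(2)] c(1) by blast
    qed
  qed
  then obtain z c2 where 2: "c2 = 1 \<or> c2 = - 1" "R (c1 *s e1) (c2 *s e2) z" by blast
  have "det3 (c1 *s e1) (c2 *s e2) z = z $ 3 * det3 (c1 *s e1) (c2 *s e2) e3"
    by (simp add: det3_def e1_def e2_def e3_def)
  then have "det3 (c1 *s e1) (c2 *s e2) e3 \<noteq> 0" using RD[OF 2(2)] by auto
  then obtain c3 where 3: "c3 = 1 \<or> c3 = - 1" "R (c1 *s e1) (c2 *s e2) (c3 *s e3)" using s3[OF 2(2)] by blast
  have f12: "R (- x) (- y) z" if "R x y z" for x y z using t12[OF t12[OF that]] .
  have f23: "R x (- y) (- z)" if "R x y z" for x y z using t23[OF t23[OF that]] .
  have I: "mat 1 = rows e1 e2 e3" by (simp add: vec_eq_iff forall_3 mat_def e1_def e2_def e3_def)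
  have m: "- rows x y z = rows (- x) (- y) (- z)" for x y z by (simp add: vec_eq_iff forall_3)
  have n: "(- 1) *s x = - x" for x :: "real ^ 3" by (simp add: vec_eq_iff)
  have one: "1 *s x = x" for x :: "real ^ 3" by (simp add: vec_eq_iff)
  have "\<exists>c d. (d = 1 \<or> d = - 1) \<and> (c = 1 \<or> c = - 1) \<and> R e1 (c *s e2) (d *s e3)"
    using 1(1)
  proof
    assume "c1 = 1"
    then have "R e1 (c2 *s e2) (c3 *s e3)" using 3(2) by (simp only: one)
    then show ?thesis using 2(1) 3(1) by blast
  next
    assume "c1 = - 1"
    then have "- (c1 *s e1) = e1" "- (c2 *s e2) = (- c2) *s e2" by (simp_all add: vec_eq_iff)
    then have "R e1 ((- c2) *s e2) (c3 *s e3)" using f12[OF 3(2)] by (simp only:)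
    moreover have "- c2 = 1 \<or> - c2 = - 1" using 2(1) by auto
    ultimately show ?thesis using 3(1) by blast
  qed
  then obtain c d where cd: "d = 1 \<or> d = - 1" "c = 1 \<or> c = - 1" "R e1 (c *s e2) (d *s e3)" by blast
  have "\<exists>d. (d = 1 \<or> d = - 1) \<and> R e1 e2 (d *s e3)"
    using cd(2)
  proof
    assume "c = 1"
    then have "R e1 e2 (d *s e3)" using cd(3) by (simp only: one)
    then show ?thesis using cd(1) by blast
  next
    assume "c = - 1"
    then have "- (c *s e2) = e2" "- (d *s e3) = (- d) *s e3" by (simp_all add: vec_eq_iff)
    then have "R e1 e2 ((- d) *s e3)" using f23[OF cd(3)] by (simp only:)
    moreover have "- d = 1 \<or> - d = - 1" using cd(1) by auto
    ultimately show ?thesis by blast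
  qed
  then obtain d where "d = 1 \<or> d = - 1" "R e1 e2 (d *s e3)" by blast
  then have "R e1 e2 e3 \<or> R (- e1) (- e2) (- e3)" using f12[of e1 e2 "- e3"] by (auto simp: n one)
  then show ?thesis unfolding R_def I m .
qed

text \<open>In odd dimension - 1 has negative determinant, so it joins the two sign classes;
  projectively it is invisible.\<close>

lemma GL3_path:
  assumes "det A \<noteq> 0" "det B \<noteq> 0"
  shows "path_component GL3 A B \<or> path_component GL3 (- A) B"
proof -
  have neg: "path_component GL3 (- X) (- Y)" if XY: "path_component GL3 X Y" for X Y :: "real ^ 3 ^ 3"
  proof -
    obtain g where g: "path g" "path_image g \<subseteq> GL3" "pathstart g = X" "pathfinish g = Y"
      using XY unfolding path_component_def by blast
    have "det (- Z) = - det Z" for Z :: "real ^ 3 ^ 3" by (simp add: det_3)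
    then have "path_image (\<lambda>t. - g t) \<subseteq> GL3" using g(2) by (auto simp: path_image_def)
    moreover have "path (\<lambda>t. - g t)" using g(1) unfolding path_def by (intro continuous_intros)
    ultimately show ?thesis
      unfolding path_component_def using g(3,4) by (intro exI[of _ "\<lambda>t. - g t"]) (simp add: pathstart_def pathfinish_def)
  qed
  consider "path_component GL3 A (mat 1)" "path_component GL3 B (mat 1)" | "path_component GL3 A (mat 1)" "path_component GL3 B (- mat 1)"
    | "path_component GL3 A (- mat 1)" "path_component GL3 B (mat 1)" | "path_component GL3 A (- mat 1)" "path_component GL3 B (- mat 1)"
    using GL3_standard[OF assms(1)] GL3_standard[OF assms(2)] by blast
  then show ?thesis
  proof cases
    case 1 then show ?thesis using path_component_trans[OF 1(1) path_component_sym[OF 1(2)]] by blast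
  next
    case 2 then show ?thesis using path_component_trans[OF neg[OF 2(1)] path_component_sym[OF 2(2)]] by blast
  next
    case 3
    have "path_component GL3 (- A) (mat 1)" using neg[OF 3(1)] by simp
    then show ?thesis using path_component_trans[OF _ path_component_sym[OF 3(2)]] by blast
  next
    case 4 then show ?thesis using path_component_trans[OF 4(1) path_component_sym[OF 4(2)]] by blast
  qed
qed

text \<open>The matrices of the two end curves are joined by a path of invertible matrices after
  possibly replacing the first by its negative, which parametrizes the same curve.\<close>

lemma isotopy_of_good_path:
  fixes K :: "real \<Rightarrow> 3 \<Rightarrow> real ^ 3"
  assumes K: "\<And>i. continuous_on {0..1} (\<lambda>t. K t i)" and g: "\<And>t. t \<in> {0..1} \<Longrightarrow> goodf (K t)"
    and r: "rep C (K 0)" "rep C' (K 1)"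
  shows "rigidly_isotopic 4 C C'"
proof -
  obtain A where A: "det A \<noteq> 0" "C = curve A (K 0)" using r(1) unfolding rep_def by blast
  obtain B where B: "det B \<noteq> 0" "C' = curve B (K 1)" using r(2) unfolding rep_def by blast
  have "curve (- A) (K 0) = curve A (K 0)"
    by (rule curve_smult[where c = "- 1"]) (simp_all add: param_def vec_eq_iff matrix_vector_mult_def sum_negf)
  then obtain A' where A': "path_component GL3 A' B" "C = curve A' (K 0)" using GL3_path[OF A(1) B(1)] A(2) by metis
  then obtain M where M: "path M" "path_image M \<subseteq> GL3" "pathstart M = A'" "pathfinish M = B"
    unfolding path_component_def by blast
  define a where "a t = param (M t) (K t)" for t
  have cM: "continuous_on {0..1} (\<lambda>t. M t $ i $ j)" for i j
    using M(1) unfolding path_def by (intro continuous_intros)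
  have cK: "continuous_on {0..1} (\<lambda>t. K t i $ j)" for i j by (intro continuous_intros K)
  have "continuous_on {0..1} (\<lambda>t. tc (K t) n $ j)" for n j
  proof -
    have "continuous_on {0..1} (\<lambda>t. qm (K t i) (K t l) n)" for i l
      by (cases "n = 0"; cases "n = 1"; cases "n = 2"; cases "n = 3"; simp add: qm_def;
          intro continuous_on_add continuous_on_mult cK)
    then show ?thesis using exhaust_3[of j] by (elim disjE; simp add: tc_def cremona_def)
  qed
  then have "continuous_on {0..1} (\<lambda>t. a t n)" for n
    unfolding a_def param_def matrix_vector_mult_def
    by (intro continuous_on_vec_lambda continuous_on_sum continuous_on_mult cM)
  moreover have "nodal (a t) (curve (M t) (K t))" if "t \<in> {0..1}" for t
  proof -
    have "M t \<in> path_image M" unfolding path_image_def using that by blast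
    then have "det (M t) \<noteq> 0" using M(2) by blast
    then show ?thesis unfolding a_def by (rule param_nodal[OF g[OF that]])
  qed
  ultimately have "rigid_isotopy 4 (\<lambda>t. curve (M t) (K t))" unfolding rigid_isotopy_def by blast
  moreover have "curve (M 0) (K 0) = C" "curve (M 1) (K 1) = C'"
    using M(3,4) A'(2) B(2) by (simp_all add: pathstart_def pathfinish_def)
  ultimately show ?thesis unfolding rigidly_isotopic_def by blast
qed

text \<open>If the triple becomes linearly dependent along a path, the third form is reflected, with
  respect to \<open>bp\<close>, in the plane of the other two whenever it lies on the negative side of that
  plane, and then pushed slightly off it. The reflection does not change the Gram matrix.\<close>

definition normal :: "real ^ 3 \<Rightarrow> real ^ 3 \<Rightarrow> real ^ 3" where
  "normal p q = vector [- (p $ 1 * q $ 2 - p $ 2 * q $ 1) / 2, p $ 3 * q $ 1 - p $ 1 * q $ 3, - (p $ 2 * q $ 3 - p $ 3 * q $ 2) / 2]"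

text \<open>\<open>normal p q\<close> is the cross product transported by the inverse of the matrix
  of \<open>bp\<close>, whence the halves; pairing with it is therefore the determinant with
  \<open>p\<close> and \<open>q\<close>.\<close>

lemma normal:
  "bp (normal p q) p = 0" "bp (normal p q) q = 0" "bp (normal p q) r = det3 p q r" "4 * disc (normal p q) = res p q"
  by (simp_all add: normal_def bp_def det3_def res_def field_simps)

lemma isotopy_of_nondeg_path:
  fixes K :: "real \<Rightarrow> 3 \<Rightarrow> real ^ 3"
  assumes K: "\<And>i. continuous_on {0..1} (\<lambda>t. K t i)" and nd: "\<And>t. t \<in> {0..1} \<Longrightarrow> nondeg (K t)"
    and r: "rep C (K 0)" "rep C' (K 1)"
  shows "rigidly_isotopic 4 C C'"
proof -
  define n where "n t = normal (K t 1) (K t 2)" for t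
  define d where "d t = det3 (K t 1) (K t 2) (K t 3)" for t
  \<comment> \<open>The coefficient of the third form along the normal of the other two: the signed
    distance from their plane.\<close>
  define h where "h t = d t / disc (n t)" for t
  have cK: "continuous_on {0..1} (\<lambda>t. K t i $ j)" for i j by (intro continuous_intros K)
  have cn: "continuous_on {0..1} (\<lambda>t. n t $ j)" for j
    using exhaust_3[of j] by (elim disjE) (simp_all add: n_def normal_def, (intro continuous_intros cK; simp)+)
  have cbp: "continuous_on {0..1} (\<lambda>t. bp (f t) (g t))"
    if "\<And>j. continuous_on {0..1} (\<lambda>t. f t $ j)" "\<And>j. continuous_on {0..1} (\<lambda>t. g t $ j)" for f g :: "real \<Rightarrow> real ^ 3"
    unfolding bp_def by (intro continuous_intros that)
  have cd: "continuous_on {0..1} d" unfolding d_def det3_def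
    by (intro continuous_on_add continuous_on_diff continuous_on_mult cK)
  have ne: "disc (K t i) \<noteq> 0" "i \<noteq> j \<Longrightarrow> res (K t i) (K t j) \<noteq> 0" if "t \<in> {0..1}" for t i j
    using nd[OF that] by (simp_all add: nondeg_def)
  have n0: "disc (n t) \<noteq> 0" if "t \<in> {0..1}" for t using ne(2)[OF that, of 1 2] normal(4)[of "K t 1" "K t 2"] by (simp add: n_def)
  have ch: "continuous_on {0..1} h" unfolding h_def using n0 by (intro continuous_on_divide cd cbp cn) auto
  \<comment> \<open>Replacing the coefficient \<open>h\<close> by \<open>g\<close> changes the
    discriminant of the third form by \<open>(g^2 - h^2) * disc n\<close> and its resultants
    proportionally. The numerator bounds the admissible change; the denominator is the factor by
    which a push of size at most 1 is magnified.\<close>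
  define w where "w t = min \<bar>disc (K t 3)\<bar> (min (\<bar>res (K t 3) (K t 1)\<bar> / \<bar>disc (K t 1)\<bar>)
      (\<bar>res (K t 3) (K t 2)\<bar> / \<bar>disc (K t 2)\<bar>)) / ((2 * \<bar>h t\<bar> + 1) * \<bar>disc (n t)\<bar>)" for t
  have cw: "continuous_on {0..1} w" unfolding w_def res_def
    by (intro continuous_on_divide continuous_on_min continuous_on_rabs continuous_on_mult continuous_on_add continuous_on_diff continuous_on_const cbp cn cK ch)
       (use ne n0 in auto)
  obtain m where m: "m > 0" "\<And>t. t \<in> {0..1} \<Longrightarrow> m \<le> w t"
  proof -
    obtain t0 where "t0 \<in> {0..1}" "\<And>t. t \<in> {0..1} \<Longrightarrow> w t0 \<le> w t"
      using continuous_attains_inf[OF _ _ cw] by auto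
    moreover have "w t0 > 0" using ne[OF \<open>t0 \<in> {0..1}\<close>] n0[OF \<open>t0 \<in> {0..1}\<close>] by (auto simp: w_def intro!: divide_pos_pos mult_pos_pos)
    ultimately show ?thesis using that by blast
  qed
  define \<epsilon> where "\<epsilon> = min 1 (m / 2)"
  have eps: "0 < \<epsilon>" "\<epsilon> \<le> 1" "\<epsilon> < m" using m by (auto simp: \<epsilon>_def)
  \<comment> \<open>The distance is made nonnegative and lifted off zero; the bump vanishes at both
    ends, where \<open>h\<close> is nonzero already, so that the Gram matrices at the ends are
    unchanged.\<close>
  define g where "g t = \<bar>h t\<bar> + \<epsilon> * (t * (1 - t))" for t
  define \<delta> where "\<delta> t = g t - h t" for t
  define J where "J t i = (if i = 3 then K t 3 + \<delta> t *s n t else K t i)" for t and i :: 3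
  have J: "J t 1 = K t 1" "J t 2 = K t 2" "J t 3 = K t 3 + \<delta> t *s n t" for t by (simp_all add: J_def)
  have add: "bp (x + y) z = bp x z + bp y z" "bp z (x + y) = bp z x + bp z y" for x y z :: "real ^ 3"
    by (simp_all add: bp_def algebra_simps)
  have nb: "bp (n t) (K t 1) = 0" "bp (n t) (K t 2) = 0" "bp (n t) (K t 3) = d t" for t
    by (simp_all add: n_def d_def normal)
  have hd: "d t = h t * disc (n t)" if "t \<in> {0..1}" for t using n0[OF that] by (simp add: h_def)
  have b1: "bp (J t 3) (K t 1) = bp (K t 3) (K t 1)" "bp (J t 3) (K t 2) = bp (K t 3) (K t 2)" for t
    by (simp_all add: J add bp_scale nb)
  have b3: "disc (J t 3) = disc (K t 3) + ((g t)\<^sup>2 - (h t)\<^sup>2) * disc (n t)" if "t \<in> {0..1}" for t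
  proof -
    have "disc (J t 3) = disc (K t 3) + 2 * \<delta> t * d t + \<delta> t * \<delta> t * disc (n t)"
      by (simp add: J add bp_scale nb bp_commute[of "K t 3" "n t"] algebra_simps)
    then show ?thesis unfolding hd[OF that] \<delta>_def by (simp add: power2_eq_square algebra_simps)
  qed
  have dJ: "det3 (J t 1) (J t 2) (J t 3) = g t * disc (n t)" if "t \<in> {0..1}" for t
  proof -
    have "det3 (J t 1) (J t 2) (J t 3) = bp (n t) (J t 3)" by (simp add: J(1,2) n_def normal)
    also have "\<dots> = g t * disc (n t)" unfolding J add bp_scale nb hd[OF that] \<delta>_def by (simp add: algebra_simps)
    finally show ?thesis .
  qed
  have ends: "h 0 \<noteq> 0" "h 1 \<noteq> 0"
  proof -
    have "goodf (K 0)" "goodf (K 1)" using r by (simp_all add: rep_def)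
    then have "d 0 \<noteq> 0" "d 1 \<noteq> 0" by (simp_all add: d_def goodf_def good_def)
    then show "h 0 \<noteq> 0" "h 1 \<noteq> 0" using n0 by (simp_all add: h_def)
  qed
  have gp: "g t > 0" if "t \<in> {0..1}" for t
  proof (cases "t = 0 \<or> t = 1")
    case True then show ?thesis using ends by (auto simp: g_def)
  next
    case False then show ?thesis using that eps by (auto simp: g_def intro!: add_nonneg_pos mult_pos_pos)
  qed
  have small: "\<bar>((g t)\<^sup>2 - (h t)\<^sup>2) * disc (n t)\<bar> < min \<bar>disc (K t 3)\<bar> (min (\<bar>res (K t 3) (K t 1)\<bar> / \<bar>disc (K t 1)\<bar>)
      (\<bar>res (K t 3) (K t 2)\<bar> / \<bar>disc (K t 2)\<bar>))" (is "_ < ?W") if t: "t \<in> {0..1}" for t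
  proof -
    define s where "s = \<epsilon> * (t * (1 - t))"
    have "t * (1 - t) \<le> 1 * 1" using t by (intro mult_mono) auto
    then have s: "0 \<le> s" "s \<le> \<epsilon>" "s \<le> 1" using t eps by (auto simp: s_def intro: mult_left_le order.trans[OF mult_left_le])
    have "(g t)\<^sup>2 - (h t)\<^sup>2 = s * (2 * \<bar>h t\<bar> + s)" unfolding g_def s_def[symmetric] by (simp add: power2_eq_square algebra_simps)
    moreover have "s * (2 * \<bar>h t\<bar> + s) \<le> \<epsilon> * (2 * \<bar>h t\<bar> + 1)" using s by (intro mult_mono) auto
    ultimately have "\<bar>(g t)\<^sup>2 - (h t)\<^sup>2\<bar> \<le> \<epsilon> * (2 * \<bar>h t\<bar> + 1)" using s by simp
    then have "\<bar>((g t)\<^sup>2 - (h t)\<^sup>2) * disc (n t)\<bar> \<le> \<epsilon> * ((2 * \<bar>h t\<bar> + 1) * \<bar>disc (n t)\<bar>)"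
      unfolding abs_mult mult.assoc[symmetric] by (rule mult_right_mono) simp
    also have "\<dots> < w t * ((2 * \<bar>h t\<bar> + 1) * \<bar>disc (n t)\<bar>)"
      using eps m(2)[OF t] n0[OF t] by (intro mult_strict_right_mono mult_pos_pos) auto
    also have "\<dots> = ?W" using n0[OF t] by (simp add: w_def add_nonneg_eq_0_iff)
    finally show ?thesis .
  qed
  have gJ: "goodf (J t)" if t: "t \<in> {0..1}" for t
  proof -
    let ?e = "((g t)\<^sup>2 - (h t)\<^sup>2) * disc (n t)"
    have "disc (J t 3) \<noteq> 0" unfolding b3[OF t] using small[OF t] by linarith
    moreover have rr: "res (J t 3) (K t i) \<noteq> 0" if i: "bp (J t 3) (K t i) = bp (K t 3) (K t i)"
      "\<bar>?e\<bar> < \<bar>res (K t 3) (K t i)\<bar> / \<bar>disc (K t i)\<bar>" for i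
    proof -
      have "res (J t 3) (K t i) = res (K t 3) (K t i) - ?e * disc (K t i)"
        unfolding res_def i(1) b3[OF t] by (simp add: algebra_simps)
      moreover have "\<bar>?e * disc (K t i)\<bar> < \<bar>res (K t 3) (K t i)\<bar>"
        using i(2) ne(1)[OF t, of i] by (simp add: abs_mult pos_less_divide_eq)
      ultimately show ?thesis by linarith
    qed
    have "res (J t 3) (K t 1) \<noteq> 0" "res (J t 3) (K t 2) \<noteq> 0" using rr b1 small[OF t] by simp_all
    moreover have "det3 (J t 1) (J t 2) (J t 3) \<noteq> 0" using dJ[OF t] gp[OF t] n0[OF t] by simp
    ultimately show ?thesis using ne(1)[OF t] ne(2)[OF t, of 1 2] unfolding goodf_def good_def J(1,2) by (simp add: res_commute)
  qed
  have gram: "gram_prop 1 (K t) (J t)" if t: "t = 0 \<or> t = 1" for t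
  proof -
    have "g t = \<bar>h t\<bar>" using t by (auto simp: g_def)
    then have "disc (J t 3) = disc (K t 3)" using b3[of t] t by auto
    then show ?thesis unfolding gram_prop_def forall_3 J(1,2) using b1[of t] by (simp add: bp_commute)
  qed
  have "continuous_on {0..1} (\<lambda>t. J t i)" for i
  proof (cases "i = 3")
    case True
    have "continuous_on {0..1} (\<lambda>t. \<delta> t * n t $ j)" for j
      unfolding \<delta>_def g_def by (intro continuous_intros ch cn)
    then have "continuous_on {0..1} (\<lambda>t. \<chi> j. K t 3 $ j + \<delta> t * n t $ j)"
      by (intro continuous_on_vec_lambda continuous_on_add cK)
    moreover have "J t i = (\<chi> j. K t 3 $ j + \<delta> t * n t $ j)" for t by (simp add: True J vec_eq_iff)
    ultimately show ?thesis by simp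
  qed (simp add: J_def K)
  then show ?thesis
    by (rule isotopy_of_good_path[OF _ gJ]) (use rep_gram[OF r(1) gJ gram] rep_gram[OF r(2) gJ gram] in auto)
qed

section \<open>Curves with the same chord diagram\<close>

lemma continuous_inj_increasing:
  fixes h :: "real \<Rightarrow> real"
  assumes c: "continuous_on {a..b} h" and i: "inj_on h {a..b}" and ab: "h a < h b"
    and xy: "a \<le> x" "x < y" "y \<le> b"
  shows "h x < h y"
proof -
  have x: "h a \<le> h x" "h x < h b" if "a \<le> x" "x < b" for x
  proof -
    have "x = a \<or> h a < h x \<and> h x < h b"
      using continuous_inj_imp_mono[OF _ _ c i, of x] that ab by (cases "x = a") auto
    then show "h a \<le> h x" "h x < h b" using ab by auto
  qed
  show ?thesis
  proof (cases "y = b")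
    case True then show ?thesis using x xy by auto
  next
    case False
    have "continuous_on {x..b} h" "inj_on h {x..b}"
      using xy by (auto intro: continuous_on_subset[OF c] inj_on_subset[OF i])
    from continuous_inj_imp_mono[OF _ _ this, of y] show ?thesis using x(2)[of x] xy False by auto
  qed
qed

text \<open>A continuous injection is monotone on each compact subinterval; comparing its values at
  1/3 and 1/2, two points contained in all subintervals used, fixes one direction
  throughout.\<close>

lemma continuous_inj_monotone:
  fixes h :: "real \<Rightarrow> real"
  assumes c: "continuous_on {0<..<1} h" and i: "inj_on h {0<..<1}"
  shows "(\<forall>x y. 0 < x \<and> x < y \<and> y < 1 \<longrightarrow> h x < h y) \<or> (\<forall>x y. 0 < x \<and> x < y \<and> y < 1 \<longrightarrow> h y < h x)"
proof -
  have *: "g x < g y"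
    if g: "continuous_on {0<..<1} g" "inj_on g {0<..<1}" "g (1 / 3) < g (1 / 2)" and xy: "0 < x" "x < y" "y < 1"
    for x y and g :: "real \<Rightarrow> real"
  proof -
    define a where "a = min x (1 / 3)"
    define b where "b = max y (1 / 2)"
    have ab: "0 < a" "a < b" "b < 1" "a \<le> x" "y \<le> b" "a \<le> 1 / 3" "1 / 2 \<le> b" using xy by (auto simp: a_def b_def)
    have s: "{a..b} \<subseteq> {0<..<1}" using ab by auto
    note cg = continuous_on_subset[OF g(1) s] and ig = inj_on_subset[OF g(2) s]
    have "g a < g b"
    proof (rule ccontr)
      assume "\<not> g a < g b"
      moreover have "g a \<noteq> g b" using ig ab by (auto dest: inj_onD)
      ultimately have l: "- g a < - g b" by simp
      have "continuous_on {a..b} (\<lambda>x. - g x)" "inj_on (\<lambda>x. - g x) {a..b}"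
        using cg ig by (auto intro: continuous_on_minus simp: inj_on_def)
      from continuous_inj_increasing[OF this l, of "1 / 3" "1 / 2"] show False using g(3) ab by simp
    qed
    from continuous_inj_increasing[OF cg ig this] show ?thesis using ab xy by simp
  qed
  have "h (1 / 3) \<noteq> h (1 / 2)" using i by (auto dest!: inj_onD[of h _ "1 / 3" "1 / 2"])
  then consider "h (1 / 3) < h (1 / 2)" | "- h (1 / 3) < - h (1 / 2)" by linarith
  then show ?thesis
  proof cases
    case 1 then show ?thesis using *[OF c i] by blast
  next
    case 2
    have "continuous_on {0<..<1} (\<lambda>x. - h x)" "inj_on (\<lambda>x. - h x) {0<..<1}"
      using c i by (auto intro: continuous_on_minus simp: inj_on_def)
    from *[OF this 2] show ?thesis by simp
  qed
qed

section \<open>Circle homeomorphisms in the angular parameter\<close>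

definition ec :: "real \<Rightarrow> complex" where
  "ec x = cis (2 * pi * x)"

lemma norm_ec [simp]: "norm (ec x) = 1"
  by (simp add: ec_def)

lemma Arg2pi_ec: "0 \<le> x \<Longrightarrow> x < 1 \<Longrightarrow> Arg2pi (ec x) = 2 * pi * x"
  by (rule Arg2pi_unique[of 1]) (simp_all add: ec_def cis_conv_exp)

lemma ec_eq_iff:
  assumes "0 \<le> x" "x < 1" "0 \<le> y" "y < 1"
  shows "ec x = ec y \<longleftrightarrow> x = y"
proof
  assume "ec x = ec y"
  from arg_cong[OF this, of Arg2pi] have "2 * pi * x = 2 * pi * y"
    unfolding Arg2pi_ec[OF assms(1,2)] Arg2pi_ec[OF assms(3,4)] .
  then show "x = y" by simp
qed simp

lemma ec_surj:
  assumes "norm z = 1"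
  shows "0 \<le> Arg2pi z / (2 * pi)" "Arg2pi z / (2 * pi) < 1" "ec (Arg2pi z / (2 * pi)) = z"
proof -
  show "0 \<le> Arg2pi z / (2 * pi)" "Arg2pi z / (2 * pi) < 1" using Arg2pi[of z] by (simp_all add: divide_simps)
  show "ec (Arg2pi z / (2 * pi)) = z" using Arg2pi_eq[of z] assms by (simp add: ec_def cis_conv_exp)
qed

lemma ec_0 [simp]: "ec 0 = 1"
  by (simp add: ec_def)

lemma ec_reflect: "ec (1 - x) = cnj (ec x)"
  by (simp add: ec_def complex_eq_iff right_diff_distrib cos_diff sin_diff)

text \<open>Cut at the fixed point 1, the circle becomes an interval, on which the homeomorphism is
  strictly monotone. A decreasing one becomes increasing after conjugation.\<close>

lemma circle_lift:
  assumes hom: "circle_homeo f g" and f1: "f 1 = 1"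
  shows "\<exists>h. (\<forall>x y. 0 \<le> x \<and> x < y \<and> y < 1 \<longrightarrow> h x < h y) \<and>
    (\<forall>x. 0 \<le> x \<and> x < 1 \<longrightarrow> 0 \<le> h x \<and> h x < 1) \<and>
    ((\<forall>x. 0 \<le> x \<and> x < 1 \<longrightarrow> f (ec x) = ec (h x)) \<or> (\<forall>x. 0 \<le> x \<and> x < 1 \<longrightarrow> cnj (f (ec x)) = ec (h x)))"
proof -
  have n: "norm (f z) = 1" if "norm z = 1" for z
    using homeomorphism_image1[OF hom] that by (metis dist_0_norm image_eqI mem_sphere)
  have inj: "f z = f w \<Longrightarrow> z = w" if "norm z = 1" "norm w = 1" for z w
    using homeomorphism_apply1[OF hom] that by (metis dist_0_norm mem_sphere)
  define h where "h x = Arg2pi (f (ec x)) / (2 * pi)" for x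
  have h: "0 \<le> h x" "h x < 1" "f (ec x) = ec (h x)" for x
    using ec_surj[OF n[OF norm_ec[of x]]] by (simp_all add: h_def)
  have h0: "h 0 = 0" using Arg2pi_ec[of 0] by (simp add: h_def f1)
  have hinj: "x = y" if "0 \<le> x" "x < 1" "0 \<le> y" "y < 1" "h x = h y" for x y
    using that h(3)[of x] h(3)[of y] inj[of "ec x" "ec y"] ec_eq_iff[of x y] by simp
  have pos: "0 < h x" if "0 < x" "x < 1" for x
  proof -
    have "h x \<noteq> 0" using hinj[of x 0] that h0 by auto
    then show ?thesis using h(1)[of x] by simp
  qed
  have "isCont (\<lambda>x. h x) x" if "0 < x" "x < 1" for x
  proof -
    have "f (ec x) \<notin> \<real>\<^sub>\<ge>\<^sub>0"
    proof
      assume "f (ec x) \<in> \<real>\<^sub>\<ge>\<^sub>0"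
      then have "Arg2pi (f (ec x)) = 0" by (auto simp: Arg2pi_eq_0 nonneg_Reals_def)
      then show False using pos[OF that] by (simp add: h_def)
    qed
    then have "isCont Arg2pi (f (ec x))" by (rule continuous_at_Arg2pi)
    moreover have "isCont (\<lambda>x. f (ec x)) x"
    proof -
      have "continuous_on UNIV (\<lambda>x. f (ec x))"
        by (rule continuous_on_compose2[OF homeomorphism_cont1[OF hom]])
           (auto simp: ec_def intro!: continuous_intros)
      then show ?thesis by (simp add: continuous_on_eq_continuous_at)
    qed
    ultimately have "isCont (\<lambda>x. Arg2pi (f (ec x))) x" by (rule isCont_o2[rotated])
    then show ?thesis unfolding h_def by (intro continuous_intros) auto
  qed
  then have "continuous_on {0<..<1} h" by (intro continuous_at_imp_continuous_on) auto
  moreover have "inj_on h {0<..<1}" by (rule inj_onI, rule hinj) auto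
  ultimately consider "\<forall>x y. 0 < x \<and> x < y \<and> y < 1 \<longrightarrow> h x < h y" | "\<forall>x y. 0 < x \<and> x < y \<and> y < 1 \<longrightarrow> h y < h x"
    using continuous_inj_monotone by blast
  then show ?thesis
  proof cases
    case 1
    have "h x < h y" if "0 \<le> x" "x < y" "y < 1" for x y
      using 1 that pos[of y] h0 by (cases "x = 0") auto
    then show ?thesis using h by (intro exI[of _ h]) blast
  next
    case 2
    \<comment> \<open>Conjugation sends the parameter \<open>x\<close> to \<open>1 - x\<close>; at 0
      this would leave the half-open interval, so the value 0 is kept there.\<close>
    define h' where "h' x = (if x = 0 then 0 else 1 - h x)" for x
    have p: "0 < h' x" "h' x < 1" if "0 < x" "x < 1" for x using pos[OF that] h(2)[of x] that by (auto simp: h'_def)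
    have "h' x < h' y" if "0 \<le> x" "x < y" "y < 1" for x y
      using 2 that p[of y] by (cases "x = 0") (auto simp: h'_def)
    moreover have "0 \<le> h' x \<and> h' x < 1" if "0 \<le> x" "x < 1" for x using p[of x] that by (cases "x = 0") (auto simp: h'_def)
    moreover have "cnj (f (ec x)) = ec (h' x)" for x by (simp add: h'_def f1 ec_reflect flip: h(3))
    ultimately show ?thesis by blast
  qed
qed

text \<open>With \<open>cform q z = A + Re (cnj w * z)\<close>, the constant \<open>A\<close> is
  kept and \<open>w\<close> is replaced by its image: the action of an orthogonal map of the plane
  on the lines carrying the chords.\<close>

definition twist :: "(complex \<Rightarrow> complex) \<Rightarrow> real ^ 3 \<Rightarrow> real ^ 3" where
  "twist \<phi> q = (let A = (q $ 1 + q $ 3) / 2; w = \<phi> (Complex ((q $ 1 - q $ 3) / 2) (q $ 2 / 2)) in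
     vector [A + Re w, 2 * Im w, A - Re w])"

lemma twist:
  assumes iso: "\<And>w v. Re (cnj (\<phi> w) * \<phi> v) = Re (cnj w * v)" and "surj \<phi>"
  shows "bp (twist \<phi> p) (twist \<phi> q) = bp p q" "zset (twist \<phi> q) = \<phi> ` zset q"
proof -
  define A where "A q = (q $ 1 + q $ 3) / 2" for q :: "real ^ 3"
  define W where "W q = Complex ((q $ 1 - q $ 3) / 2) (q $ 2 / 2)" for q :: "real ^ 3"
  have t: "twist \<phi> q = vector [A q + Re (\<phi> (W q)), 2 * Im (\<phi> (W q)), A q - Re (\<phi> (W q))]" for q
    by (simp add: twist_def Let_def A_def W_def)
  have b: "bp p q = 4 * (Re (cnj (W p) * W q) - A p * A q)" for p q by (simp add: bp_def W_def A_def field_simps)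
  have AW: "A (twist \<phi> q) = A q" "W (twist \<phi> q) = \<phi> (W q)" for q by (simp_all add: t A_def W_def)
  show "bp (twist \<phi> p) (twist \<phi> q) = bp p q" unfolding b[of "twist \<phi> p"] AW iso by (simp add: b)
  have cf: "cform q z = A q + Re (cnj (W q) * z)" for q z by (simp add: cform_def A_def W_def)
  have n: "norm (\<phi> w) = norm w" for w
  proof -
    have "(norm z)\<^sup>2 = Re (cnj z * z)" for z unfolding cmod_power2 by (simp add: power2_eq_square)
    then have "(norm (\<phi> w))\<^sup>2 = (norm w)\<^sup>2" by (simp only: iso)
    then show ?thesis by (simp add: power2_eq_iff_nonneg)
  qed
  have c: "cform (twist \<phi> q) (\<phi> z) = cform q z" for z unfolding cf AW iso ..
  show "zset (twist \<phi> q) = \<phi> ` zset q"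
  proof
    show "\<phi> ` zset q \<subseteq> zset (twist \<phi> q)" by (auto simp: zset_eq n c)
    show "zset (twist \<phi> q) \<subseteq> \<phi> ` zset q"
    proof
      fix y assume y: "y \<in> zset (twist \<phi> q)"
      obtain z where "y = \<phi> z" using assms(2) by (metis surjD)
      then show "y \<in> \<phi> ` zset q" using y by (auto simp: zset_eq n c)
    qed
  qed
qed

text \<open>Twisting preserves \<open>bp\<close>, hence the Gram matrix, hence the curve: rotations
  and reflections of the diagram cost nothing.\<close>

lemma rep_twist:
  assumes r: "rep C k" and iso: "\<And>w v. Re (cnj (\<phi> w) * \<phi> v) = Re (cnj w * v)" and s: "surj \<phi>"
  shows "rep C (\<lambda>i. twist \<phi> (k i))"
proof -
  let ?k = "\<lambda>i. twist \<phi> (k i)"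
  note b = twist(1)[OF iso s]
  have g: "goodf k" using r by (simp add: rep_def)
  have "- 4 * (det3 (?k 1) (?k 2) (?k 3))\<^sup>2 = - 4 * (det3 (k 1) (k 2) (k 3))\<^sup>2" unfolding det3_gram b ..
  then have "goodf ?k" using g unfolding goodf_def good_def res_def b by auto
  then show ?thesis by (rule rep_gram[OF r, of _ 1]) (simp add: gram_prop_def b)
qed

lemma rotation_isometry:
  assumes "norm c = 1"
  shows "Re (cnj (c * w) * (c * v)) = Re (cnj w * v)" "surj ((*) c)"
proof -
  have "cnj c * c = 1" using assms by (metis complex_norm_square mult.commute of_real_1 power_one)
  moreover have "cnj (c * w) * (c * v) = (cnj c * c) * (cnj w * v)" by simp
  ultimately show "Re (cnj (c * w) * (c * v)) = Re (cnj w * v)" by (simp only: mult_1)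
  have "c \<noteq> 0" using assms by auto
  then show "surj ((*) c)" by (intro surjI[of _ "\<lambda>x. x / c"]) simp
qed

text \<open>\<open>circle_point\<close> doubles angles, so the roots are placed at half the angles
  of \<open>ec x\<close> and \<open>ec y\<close>.\<close>

definition chq :: "real \<Rightarrow> real \<Rightarrow> real ^ 3" where
  "chq x y = lq (vector [cos (pi * x), sin (pi * x)]) (vector [cos (pi * y), sin (pi * y)])"

lemma det2_angles:
  "det2 (vector [cos (pi * x), sin (pi * x)]) (vector [cos (pi * y), sin (pi * y)]) = sin (pi * (y - x))"
  by (simp add: det2_def right_diff_distrib sin_diff algebra_simps)

lemma sin_angles:
  assumes "0 \<le> x" "x < 1" "0 \<le> y" "y < 1" "x \<noteq> y"
  shows "sin (pi * (y - x)) \<noteq> 0"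
proof
  assume s: "sin (pi * (y - x)) = 0"
  have "\<bar>y - x\<bar> < 1" using assms by linarith
  then have "\<bar>pi * (y - x)\<bar> < pi" by (simp add: abs_mult)
  then have "- pi < pi * (y - x)" "pi * (y - x) < pi" by linarith+
  then have "pi * (y - x) = 0" using s by (rule sin_eq_0_pi)
  then show False using assms by simp
qed

lemma chq_disc:
  assumes "0 \<le> x" "x < 1" "0 \<le> y" "y < 1" "x \<noteq> y"
  shows "disc (chq x y) > 0"
  unfolding chq_def disc_lq det2_angles using sin_angles[OF assms] by (simp add: zero_less_mult_iff linorder_neq_iff disj_commute)

lemma circle_point_angle: "circle_point (vector [cos (pi * x), sin (pi * x)]) = ec x"
proof -
  have "Complex (cos (pi * x)) (sin (pi * x)) = cis (pi * x)" by (simp add: complex_eq_iff)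
  moreover have "(cis a)\<^sup>2 = cis (2 * a)" for a by (simp add: power2_eq_square cis_mult)
  ultimately show ?thesis by (simp add: circle_point_def sgn_eq ec_def mult.assoc)
qed

lemma chq_zset:
  assumes "0 \<le> x" "x < 1" "0 \<le> y" "y < 1" "x \<noteq> y"
  shows "zset (chq x y) = {ec x, ec y}"
proof -
  define u where "u x = (vector [cos (pi * x), sin (pi * x)] :: real ^ 2)" for x
  have "u x \<noteq> 0" for x using sin_zero_abs_cos_one[of "pi * x"] by (auto simp: u_def vec_eq_iff forall_2)
  moreover have "qf (chq x y) (u x) = 0" "qf (chq x y) (u y) = 0"
    by (simp_all add: chq_def u_def qf_lq det2_angles)
  ultimately have "{ec x, ec y} \<subseteq> zset (chq x y)" unfolding zset_def circle_point_angle[symmetric] u_def by blast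
  moreover have "ec x \<noteq> ec y" using assms ec_eq_iff by blast
  ultimately show ?thesis using zset_roots(1)[OF chq_disc[OF assms]] by auto
qed

lemma zset_determines:
  assumes d: "disc q > 0" "disc q' > 0" and z: "zset q = zset q'"
  shows "\<exists>c. c \<noteq> 0 \<and> q = c *s q'"
proof -
  obtain r s where rs: "r \<noteq> 0" "s \<noteq> 0" "det2 r s \<noteq> 0" "q' = lq r s" by (rule real_roots[OF d(2)]) (rule that)
  have "qf q u = 0" if u: "u \<noteq> 0" "qf q' u = 0" for u
  proof -
    have "circle_point u \<in> zset q" unfolding z using u by (auto simp: zset_def)
    then show ?thesis using circle_point_coords(3)[OF u(1)] by (auto simp: zset_eq cform_circle_point[OF u(1)])
  qed
  then have q0: "qf q r = 0" "qf q s = 0" using rs by (simp_all add: qf_lq det2_def mult.commute)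
  define D where "D = det2 r s"
  have "D * D * qf q t = det2 t s * det2 t s * qf q r + det2 r t * det2 r t * qf q s +
      det2 t s * det2 r t * (qf q (r + s) - qf q r - qf q s)" for t
    by (simp add: D_def qf_def det2_def power2_eq_square algebra_simps)
  then have "D * D * qf q t = det2 t s * det2 r t * qf q (r + s)" for t by (simp add: q0)
  moreover have "det2 t s = - det2 s t" for t by (simp add: det2_def)
  ultimately have e: "D * D * qf q t = - (qf q (r + s) * qf q' t)" for t by (simp add: rs(4) qf_lq)
  define c where "c = - qf q (r + s) / (D * D)"
  have e': "qf q t = c * qf q' t" for t using e[of t] rs(3) by (simp add: c_def D_def field_simps)
  have "q $ 1 = c * q' $ 1" "q $ 3 = c * q' $ 3" using e'[of "vector [1, 0]"] e'[of "vector [0, 1]"] by (simp_all add: qf_def)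
  moreover have "q $ 2 = c * q' $ 2" using e'[of "vector [1, 1]"] calculation by (simp add: qf_def algebra_simps)
  ultimately have q: "q = c *s q'" by (simp add: vec_eq_iff forall_3)
  moreover have "c \<noteq> 0" using d(1) unfolding q by (auto simp: bp_scale)
  ultimately show ?thesis by blast
qed

section \<open>Moving definite forms\<close>

lemma definite_leading:
  fixes q :: "real ^ 3"
  assumes "disc q < 0" shows "q $ 1 \<noteq> 0"
  using assms by (auto simp: bp_def mult_less_0_iff)

lemma definite_segment:
  fixes p q :: "real ^ 3"
  assumes "p $ 1 = 1" "q $ 1 = 1" "disc p < 0" "disc q < 0" "0 \<le> s" "s \<le> 1"
  shows "disc ((1 - s) *s p + s *s q) < 0"
proof -
  have "disc ((1 - s) *s p + s *s q) = (1 - s) * disc p + s * disc q - s * (1 - s) * (p $ 2 - q $ 2)\<^sup>2"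
    using assms(1,2) by (simp add: bp_def power2_eq_square algebra_simps)
  moreover have "s * (1 - s) * (p $ 2 - q $ 2)\<^sup>2 \<ge> 0" using assms by simp
  moreover have "(1 - s) * disc p + s * disc q < 0"
  proof (cases "s = 0")
    case False
    then have "s * disc q < 0" "(1 - s) * disc p \<le> 0" using assms by (simp_all add: mult_less_0_iff mult_le_0_iff)
    then show ?thesis by simp
  qed (use assms in simp)
  ultimately show ?thesis by linarith
qed

text \<open>Definite forms with leading coefficient 1 are the points \<open>(b, c)\<close> with \<open>4 * c > b\<^sup>2\<close>. Two
  families of such points are joined without collisions through points on the parabola
  \<open>c = b\<^sup>2\<close>: a collision on a segment towards \<open>b\<^sub>i, b\<^sub>j\<close> fixes the slope \<open>b\<^sub>i + b\<^sub>j\<close>.\<close>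

lemma definite_path:
  fixes d d' :: "3 \<Rightarrow> real ^ 3"
  assumes d: "\<And>i. i \<in> S \<Longrightarrow> d i $ 1 = 1 \<and> disc (d i) < 0" "\<And>i j. i \<in> S \<Longrightarrow> j \<in> S \<Longrightarrow> i \<noteq> j \<Longrightarrow> d i \<noteq> d j"
    and d': "\<And>i. i \<in> S \<Longrightarrow> d' i $ 1 = 1 \<and> disc (d' i) < 0" "\<And>i j. i \<in> S \<Longrightarrow> j \<in> S \<Longrightarrow> i \<noteq> j \<Longrightarrow> d' i \<noteq> d' j"
  shows "\<exists>D :: real \<Rightarrow> 3 \<Rightarrow> real ^ 3. (\<forall>i. continuous_on {0..1} (\<lambda>t. D t i)) \<and> D 0 = d \<and> D 1 = d' \<and>
    (\<forall>t\<in>{0..1}. (\<forall>i\<in>S. D t i $ 1 = 1 \<and> disc (D t i) < 0) \<and> (\<forall>i\<in>S. \<forall>j\<in>S. i \<noteq> j \<longrightarrow> D t i \<noteq> D t j))"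
proof -
  define \<iota> :: "3 \<Rightarrow> real" where "\<iota> i = (if i = 1 then 1 else if i = 2 then 2 else 3)" for i
  have iota: "\<iota> i \<noteq> \<iota> j" if "i \<noteq> j" for i j using that exhaust_3[of i] exhaust_3[of j] by (auto simp: \<iota>_def)
  have iota0: "\<iota> i > 0" for i by (simp add: \<iota>_def)
  \<comment> \<open>A collision of forms \<open>i\<close> and \<open>j\<close> on the segments
    towards \<open>m\<close> would force the slope of their difference to be
    \<open>2 * x + \<iota> i + \<iota> j\<close>. Solved for \<open>x\<close>, this leaves finitely
    many values to avoid.\<close>
  define bad where "bad = (\<lambda>(i, j). ((d i $ 3 - d j $ 3) / (d i $ 2 - d j $ 2) - \<iota> i - \<iota> j) / 2) ` UNIV \<union>
    (\<lambda>(i, j). ((d' i $ 3 - d' j $ 3) / (d' i $ 2 - d' j $ 2) - \<iota> i - \<iota> j) / 2) ` (UNIV :: (3 \<times> 3) set)"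
  have "finite bad" by (simp add: bad_def)
  then have "\<not> {0<..} \<subseteq> bad" using infinite_Ioi[of "0 :: real"] finite_subset by blast
  then obtain x where x: "x > 0" "x \<notin> bad" by auto
  define m :: "3 \<Rightarrow> real ^ 3" where "m i = vector [1, x + \<iota> i, (x + \<iota> i)\<^sup>2]" for i
  have m: "m i $ 1 = 1" "disc (m i) < 0" for i
    using x(1) iota0[of i] by (simp_all add: m_def bp_def power2_eq_square add_pos_pos)
  have nc: "(1 - s) *s p i + s *s m i \<noteq> (1 - s) *s p j + s *s m j"
    if s: "0 \<le> s" "s \<le> 1" and ij: "i \<noteq> j" and p: "p i \<noteq> p j" "p i $ 1 = p j $ 1"
      and xp: "x \<noteq> ((p i $ 3 - p j $ 3) / (p i $ 2 - p j $ 2) - \<iota> i - \<iota> j) / 2" for s i j and p :: "3 \<Rightarrow> real ^ 3"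
  proof
    assume eq: "(1 - s) *s p i + s *s m i = (1 - s) *s p j + s *s m j"
    define b where "b = p i $ 2 - p j $ 2"
    define c where "c = p i $ 3 - p j $ 3"
    define a where "a = \<iota> i - \<iota> j"
    define S where "S = 2 * x + \<iota> i + \<iota> j"
    have e2: "(1 - s) * b + s * a = 0"
      using arg_cong[OF eq, of "\<lambda>v. v $ 2"] by (simp add: m_def a_def b_def algebra_simps)
    have e3: "(1 - s) * c + s * (a * S) = 0"
      using arg_cong[OF eq, of "\<lambda>v. v $ 3"] by (simp add: m_def a_def c_def S_def power2_eq_square algebra_simps)
    have a0: "a \<noteq> 0" using iota[OF ij] by (simp add: a_def)
    have "(1 - s) * (c - b * S) = ((1 - s) * c + s * (a * S)) - S * ((1 - s) * b + s * a)" by (simp add: algebra_simps)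
    then have "(1 - s) * (c - b * S) = 0" unfolding e2 e3 by simp
    moreover have "s \<noteq> 1" using e2 a0 by auto
    ultimately have cS: "c = b * S" by simp
    show False
    proof (cases "b = 0")
      case True
      then have "p i = p j" using cS p(2) by (simp add: b_def c_def vec_eq_iff forall_3)
      then show False using p by simp
    next
      case False
      then have "x = (c / b - \<iota> i - \<iota> j) / 2" using cS by (simp add: S_def)
      then show False using xp by (simp add: b_def c_def)
    qed
  qed
  define D where "D t i = (if t \<le> 1 / 2 then (1 - 2 * t) *s d i + (2 * t) *s m i
    else (1 - (2 - 2 * t)) *s d' i + (2 - 2 * t) *s m i)" for t i
  have D: "D t i = max 0 (1 - 2 * t) *s d i + (1 - \<bar>2 * t - 1\<bar>) *s m i + max 0 (2 * t - 1) *s d' i" for t i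
    by (simp add: D_def max_def vec_eq_iff algebra_simps)
  have "continuous_on {0..1} (\<lambda>t. D t i)" for i
    unfolding D scalar_mult_eq_scaleR by (intro continuous_intros)
  moreover have "D 0 = d" "D 1 = d'" by (auto simp: D_def fun_eq_iff vec_eq_iff)
  moreover have "D t i $ 1 = 1 \<and> disc (D t i) < 0" if "t \<in> {0..1}" "i \<in> S" for t i
  proof (cases "t \<le> 1 / 2")
    case True then show ?thesis using that d(1)[OF that(2)] m[of i] definite_segment[of "d i" "m i" "2 * t"] by (simp add: D_def)
  next
    case False then show ?thesis using that d'(1)[OF that(2)] m[of i] definite_segment[of "d' i" "m i" "2 - 2 * t"] by (simp add: D_def)
  qed
  moreover have "D t i \<noteq> D t j" if t: "t \<in> {0..1}" and ij: "i \<in> S" "j \<in> S" "i \<noteq> j" for t i j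
  proof (cases "t \<le> 1 / 2")
    case True
    have "x \<noteq> ((d i $ 3 - d j $ 3) / (d i $ 2 - d j $ 2) - \<iota> i - \<iota> j) / 2" 
    proof -
      have "((d i $ 3 - d j $ 3) / (d i $ 2 - d j $ 2) - \<iota> i - \<iota> j) / 2 \<in> bad"
        unfolding bad_def by (intro UnI1 image_eqI[of _ _ "(i, j)"]) simp_all
      then show ?thesis using x(2) by metis
    qed
    from nc[where p = d, OF _ _ ij(3) d(2)[OF ij] _ this, of "2 * t"] show ?thesis
      using True t d(1)[OF ij(1)] d(1)[OF ij(2)] by (simp add: D_def)
  next
    case False
    have "x \<noteq> ((d' i $ 3 - d' j $ 3) / (d' i $ 2 - d' j $ 2) - \<iota> i - \<iota> j) / 2" 
    proof -
      have "((d' i $ 3 - d' j $ 3) / (d' i $ 2 - d' j $ 2) - \<iota> i - \<iota> j) / 2 \<in> bad"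
        unfolding bad_def by (intro UnI2 image_eqI[of _ _ "(i, j)"]) simp_all
      then show ?thesis using x(2) by metis
    qed
    from nc[where p = d', OF _ _ ij(3) d'(2)[OF ij] _ this, of "2 - 2 * t"] show ?thesis
      using False t d'(1)[OF ij(1)] d'(1)[OF ij(2)] by (simp add: D_def)
  qed
  ultimately show ?thesis by blast
qed

text \<open>For monic forms the resultant is a quadratic form in the difference of the remaining
  coefficients, positive definite when \<open>p\<close> is definite.\<close>

lemma res_definite:
  fixes p q :: "real ^ 3"
  assumes "p $ 1 = 1" "q $ 1 = 1" "disc p < 0" "p \<noteq> q"
  shows "res p q \<noteq> 0"
proof
  assume r: "res p q = 0"
  define \<beta> where "\<beta> = q $ 2 - p $ 2"
  define \<gamma> where "\<gamma> = q $ 3 - p $ 3"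
  have q: "q $ 2 = p $ 2 + \<beta>" "q $ 3 = p $ 3 + \<gamma>" by (simp_all add: \<beta>_def \<gamma>_def)
  have "res p q = (p $ 2 * \<beta> - 2 * \<gamma>)\<^sup>2 + (- disc p) * \<beta>\<^sup>2"
    using assms(1,2) by (simp add: res_def bp_def q power2_eq_square algebra_simps)
  moreover have "(- disc p) * \<beta>\<^sup>2 \<ge> 0" using assms(3) by (intro mult_nonneg_nonneg) auto
  ultimately have "(p $ 2 * \<beta> - 2 * \<gamma>)\<^sup>2 = 0" "(- disc p) * \<beta>\<^sup>2 = 0" using r zero_le_power2[of "p $ 2 * \<beta> - 2 * \<gamma>"] by linarith+
  then have "\<beta> = 0" "\<gamma> = 0" using assms(3) by auto
  then show False using assms q by (simp add: vec_eq_iff forall_3)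
qed

lemma res_of_disjoint:
  assumes d: "disc p > 0" and z: "zset p \<inter> zset q = {}"
  shows "res p q \<noteq> 0"
proof -
  obtain r s where p: "r \<noteq> 0" "s \<noteq> 0" "p = lq r s" using real_roots[OF d] by metis
  have "qf p r = 0" "qf p s = 0" by (simp_all add: p(3) qf_lq det2_def mult.commute)
  then have "circle_point r \<in> zset p" "circle_point s \<in> zset p" using p by (auto simp: zset_def)
  then have "circle_point r \<notin> zset q" "circle_point s \<notin> zset q" using z by blast+
  then have "qf q r \<noteq> 0" "qf q s \<noteq> 0" using p by (auto simp: zset_def)
  then show ?thesis by (simp add: p(3) res_lq)
qed

lemma nondegI:
  assumes pos: "\<And>i. i \<in> T \<Longrightarrow> disc (k i) > 0" "\<And>i j. i \<in> T \<Longrightarrow> j \<in> T \<Longrightarrow> i \<noteq> j \<Longrightarrow> zset (k i) \<inter> zset (k j) = {}"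
    and neg: "\<And>i. i \<notin> T \<Longrightarrow> k i $ 1 = 1 \<and> disc (k i) < 0" "\<And>i j. i \<notin> T \<Longrightarrow> j \<notin> T \<Longrightarrow> i \<noteq> j \<Longrightarrow> k i \<noteq> k j"
  shows "nondeg k"
proof -
  have "res (k i) (k j) \<noteq> 0" if ij: "i \<noteq> j" for i j
  proof -
    have z: "zset (k i) = {}" if "i \<notin> T" for i using neg(1)[OF that] by (simp add: zset_definite)
    consider "i \<in> T" | "j \<in> T" | "i \<notin> T" "j \<notin> T" by blast
    then show ?thesis
    proof cases
      case 1 then show ?thesis using pos z[of j] ij by (intro res_of_disjoint; cases "j \<in> T") auto
    next
      case 2 then show ?thesis
        unfolding res_commute[of "k i"] using pos z[of i] ij by (intro res_of_disjoint; cases "i \<in> T") auto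
    next
      case 3 then show ?thesis using neg ij by (intro res_definite) auto
    qed
  qed
  moreover have "disc (k i) \<noteq> 0" for i using pos(1)[of i] neg(1)[of i] by (cases "i \<in> T") auto
  ultimately show ?thesis unfolding nondeg_def by blast
qed

lemma rep_proportional:
  assumes "rep C k" "\<And>i. \<exists>c. c \<noteq> 0 \<and> k' i = c *s k i"
  shows "rep C k'"
proof -
  obtain c where c: "\<forall>i. c i \<noteq> 0" "\<And>i. k' i = c i *s k i" using assms(2) by metis
  have "k' = (\<lambda>i. c i *s k i)" using c(2) by auto
  then show ?thesis using rep_scale[OF assms(1) c(1)] by simp
qed

text \<open>Chord ends move by linear interpolation between the parameters \<open>x\<close> and
  \<open>h x\<close>; both are increasing, so no two ends meet. The definite forms are made monic
  and moved by \<open>definite_path\<close>. At the ends of the path each form agrees with the given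
  one up to a scalar.\<close>

lemma isotopy_of_matching:
  assumes r: "rep C k" "rep C' k'"
    and h: "\<And>x y. 0 \<le> x \<Longrightarrow> x < y \<Longrightarrow> y < 1 \<Longrightarrow> h x < h y" "\<And>x. 0 \<le> x \<Longrightarrow> x < 1 \<Longrightarrow> 0 \<le> h x \<and> h x < 1"
    and D: "\<And>i. disc (k i) > 0 \<longleftrightarrow> disc (k' i) > 0"
    and z: "\<And>i. disc (k i) > 0 \<Longrightarrow> \<exists>x y. 0 \<le> x \<and> x < 1 \<and> 0 \<le> y \<and> y < 1 \<and> x \<noteq> y \<and>
       zset (k i) = {ec x, ec y} \<and> zset (k' i) = {ec (h x), ec (h y)}"
  shows "rigidly_isotopic 4 C C'"
proof -
  have g: "nondeg k" "nondeg k'" using r by (simp_all add: rep_def goodf_iff)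
  define T where "T = {i. disc (k i) > 0}"
  have neg: "disc (k i) < 0" "disc (k' i) < 0" if "i \<notin> T" for i
    using that g D[of i] by (auto simp: T_def nondeg_def linorder_neq_iff)
  have T': "disc (k' i) > 0" if "i \<in> T" for i using that D by (simp add: T_def)
  obtain x y where xy: "\<And>i. i \<in> T \<Longrightarrow> 0 \<le> x i \<and> x i < 1 \<and> 0 \<le> y i \<and> y i < 1 \<and> x i \<noteq> y i \<and>
       zset (k i) = {ec (x i), ec (y i)} \<and> zset (k' i) = {ec (h (x i)), ec (h (y i))}"
    using z unfolding T_def mem_Collect_eq by metis
  define mv where "mv t x = (1 - t) * x + t * h x" for t x
  have mv: "0 \<le> mv t x \<and> mv t x < 1" if "t \<in> {0..1}" "0 \<le> x" "x < 1" for t x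
  proof -
    have "(1 - t) * x + t * h x < 1"
      by (rule convex_bound_lt) (use that h(2)[of x] in auto)
    then show ?thesis using that h(2)[of x] by (simp add: mv_def)
  qed
  have mlt: "mv t x < mv t y" if t: "t \<in> {0..1}" and "0 \<le> x" "x < y" "y < 1" for t x y
  proof (cases "t = 0")
    case False
    then have "t * h x < t * h y" "(1 - t) * x \<le> (1 - t) * y" using that h(1)[of x y] by (auto intro: mult_left_mono)
    then show ?thesis by (simp add: mv_def)
  qed (use that in \<open>simp add: mv_def\<close>)
  have minj: "mv t x \<noteq> mv t y" if "t \<in> {0..1}" "0 \<le> x" "x < 1" "0 \<le> y" "y < 1" "x \<noteq> y" for t x y
    using mlt[of t x y] mlt[of t y x] that by (cases "x < y") auto
  define d where "d i = (1 / k i $ 1) *s k i" for i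
  define d' where "d' i = (1 / k' i $ 1) *s k' i" for i
  have norm: "((1 / p $ 1) *s p) $ 1 = 1 \<and> disc ((1 / p $ 1) *s p) < 0" if "disc p < 0" for p :: "real ^ 3"
    using definite_leading[OF that] that by (simp add: bp_scale divide_less_0_iff zero_less_mult_iff linorder_neq_iff disj_commute mult_less_0_iff)
  have dist: "(1 / p $ 1) *s p \<noteq> (1 / q $ 1) *s q" if "disc p < 0" "disc q < 0" "res p q \<noteq> 0" for p q :: "real ^ 3"
  proof
    assume e: "(1 / p $ 1) *s p = (1 / q $ 1) *s q"
    have "q = (q $ 1 / p $ 1) *s p"
      using arg_cong[OF e, of "\<lambda>v. q $ 1 *s v"] definite_leading[OF that(2)] by (simp add: vec_eq_iff)
    then have "res p q = 0" by (metis (no_types, lifting) bp_scale cancel_comm_monoid_add_class.diff_cancel mult.assoc mult.commute mult.left_commute res_def)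
    then show False using that by simp
  qed
  obtain E :: "real \<Rightarrow> 3 \<Rightarrow> real ^ 3" where E: "\<And>i. continuous_on {0..1} (\<lambda>t. E t i)" "E 0 = d" "E 1 = d'"
    "\<And>t i. t \<in> {0..1} \<Longrightarrow> i \<notin> T \<Longrightarrow> E t i $ 1 = 1 \<and> disc (E t i) < 0"
    "\<And>t i j. t \<in> {0..1} \<Longrightarrow> i \<notin> T \<Longrightarrow> j \<notin> T \<Longrightarrow> i \<noteq> j \<Longrightarrow> E t i \<noteq> E t j"
  proof -
    have a: "d i $ 1 = 1 \<and> disc (d i) < 0" "d' i $ 1 = 1 \<and> disc (d' i) < 0" if "i \<in> - T" for i
      using norm neg that by (simp_all add: d_def d'_def)
    have b: "d i \<noteq> d j" "d' i \<noteq> d' j" if "i \<in> - T" "j \<in> - T" "i \<noteq> j" for i j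
      using dist neg that g by (simp_all add: d_def d'_def nondeg_def)
    obtain E :: "real \<Rightarrow> 3 \<Rightarrow> real ^ 3" where "\<forall>i. continuous_on {0..1} (\<lambda>t. E t i)" "E 0 = d" "E 1 = d'"
      "\<forall>t\<in>{0..1}. (\<forall>i\<in>- T. E t i $ 1 = 1 \<and> disc (E t i) < 0) \<and> (\<forall>i\<in>- T. \<forall>j\<in>- T. i \<noteq> j \<longrightarrow> E t i \<noteq> E t j)"
      using definite_path[of "- T" d d', OF a(1) b(1) a(2) b(2)] by blast
    then show ?thesis by (intro that[of E]) auto
  qed
  define K where "K t i = (if i \<in> T then chq (mv t (x i)) (mv t (y i)) else E t i)" for t i
  have "continuous_on {0..1} (\<lambda>t. K t i)" for i
  proof (cases "i \<in> T")
    case True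
    have "continuous_on {0..1} (\<lambda>t. chq (mv t u) (mv t v) $ j)" for u v j
      using exhaust_3[of j] by (elim disjE; simp add: chq_def lq_nth mv_def; intro continuous_intros)
    then have "continuous_on {0..1} (\<lambda>t. \<chi> j. chq (mv t (x i)) (mv t (y i)) $ j)" by (intro continuous_on_vec_lambda)
    then show ?thesis using True by (simp add: K_def)
  qed (simp add: K_def E(1))
  moreover have "nondeg (K t)" if t: "t \<in> {0..1}" for t
  proof (rule nondegI[of T])
    have K: "zset (K t i) = {ec (mv t (x i)), ec (mv t (y i))}" "disc (K t i) > 0" if "i \<in> T" for i
      unfolding K_def using that xy[OF that] mv[OF t] minj[OF t] by (simp_all add: chq_zset chq_disc)
    then show "disc (K t i) > 0" if "i \<in> T" for i using that by blast
    show "K t i $ 1 = 1 \<and> disc (K t i) < 0" if "i \<notin> T" for i using that E(4)[OF t that] by (simp add: K_def)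
    show "K t i \<noteq> K t j" if "i \<notin> T" "j \<notin> T" "i \<noteq> j" for i j using that E(5)[OF t that] by (simp add: K_def)
    fix i j assume ij: "i \<in> T" "j \<in> T" "i \<noteq> j"
    have "zset (k i) \<inter> zset (k j) = {}" using ij g(1) by (intro zset_disjnt) (auto simp: nondeg_def T_def)
    then have "x i \<noteq> x j" "x i \<noteq> y j" "y i \<noteq> x j" "y i \<noteq> y j" using xy[OF ij(1)] xy[OF ij(2)] by auto
    then have "ec (mv t (x i)) \<noteq> ec (mv t (x j))" "ec (mv t (x i)) \<noteq> ec (mv t (y j))"
      "ec (mv t (y i)) \<noteq> ec (mv t (x j))" "ec (mv t (y i)) \<noteq> ec (mv t (y j))"
      using xy[OF ij(1)] xy[OF ij(2)] minj[OF t] mv[OF t] by (simp_all add: ec_eq_iff)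
    then show "zset (K t i) \<inter> zset (K t j) = {}" using K(1)[OF ij(1)] K(1)[OF ij(2)] by simp
  qed
  moreover have "rep C (K 0)"
  proof (rule rep_proportional[OF r(1)])
    fix i show "\<exists>c. c \<noteq> 0 \<and> K 0 i = c *s k i"
    proof (cases "i \<in> T")
      case True
      have "K 0 i = chq (x i) (y i)" using True by (simp add: K_def mv_def)
      then show ?thesis using xy[OF True] True by (auto simp: T_def chq_zset intro!: zset_determines chq_disc)
    next
      case False then show ?thesis using definite_leading[OF neg(1)[OF False]] by (intro exI[of _ "1 / k i $ 1"]) (simp add: K_def E(2) d_def)
    qed
  qed
  moreover have "rep C' (K 1)"
  proof (rule rep_proportional[OF r(2)])
    fix i show "\<exists>c. c \<noteq> 0 \<and> K 1 i = c *s k' i"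
    proof (cases "i \<in> T")
      case True
      have "K 1 i = chq (h (x i)) (h (y i))" using True by (simp add: K_def mv_def)
      moreover have "h (x i) \<noteq> h (y i)" using minj[of 1 "x i" "y i"] xy[OF True] by (simp add: mv_def)
      ultimately show ?thesis using xy[OF True] T'[OF True] h(2) by (auto simp: chq_zset intro!: zset_determines chq_disc)
    next
      case False then show ?thesis using definite_leading[OF neg(2)[OF False]] by (intro exI[of _ "1 / k' i $ 1"]) (simp add: K_def E(3) d'_def)
    qed
  qed
  ultimately show ?thesis by (intro isotopy_of_nondeg_path[of K])
qed

text \<open>Disjointness of the chords makes form and chord correspond bijectively, so
  \<open>f\<close> matches the indefinite forms. The definite ones are equally many on both sides
  and may be matched arbitrarily.\<close>

lemma matching_permutation:
  assumes g: "nondeg k" "nondeg k'" and hom: "circle_homeo f g"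
    and eq: "diagram k' = (\<lambda>c. f ` c) ` diagram k"
  shows "\<exists>p. bij p \<and> (\<forall>i. disc (k i) > 0 \<longleftrightarrow> disc (k' (p i)) > 0) \<and>
    (\<forall>i. disc (k i) > 0 \<longrightarrow> zset (k' (p i)) = f ` zset (k i))"
proof -
  define T where "T k = {i. disc (k i) > 0}" for k :: "3 \<Rightarrow> real ^ 3"
  have dg: "diagram k = (\<lambda>i. zset (k i)) ` T k" for k by (auto simp: diagram_def T_def)
  have inj: "inj_on (\<lambda>i. zset (k i)) (T k)" if "nondeg k" for k
  proof (rule inj_onI, rule ccontr)
    fix i j assume ij: "i \<in> T k" "j \<in> T k" "zset (k i) = zset (k j)" "i \<noteq> j"
    then have "zset (k i) \<inter> zset (k j) = {}" using that by (intro zset_disjnt) (auto simp: nondeg_def T_def)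
    then show False using zset_roots(1)[of "k i"] ij by (auto simp: T_def)
  qed
  have "inj_on f (sphere 0 1)" using homeomorphism_apply1[OF hom] by (metis inj_onI)
  then have finj: "c = c'" if "c \<in> diagram k" "c' \<in> diagram k" "f ` c = f ` c'" for c c'
    using that diagram_on_circle[of k] inj_on_image_eq_iff[of f "sphere 0 1" c c'] by blast
  then have "inj_on (\<lambda>c. f ` c) (diagram k)" by (meson inj_onI)
  then have card: "card (T k) = card (T k')"
    using card_image[OF inj[OF g(1)]] card_image[OF inj[OF g(2)]] unfolding dg[symmetric] eq by (simp add: card_image)
  have "\<exists>j\<in>T k'. zset (k' j) = f ` zset (k i)" if "i \<in> T k" for i
  proof -
    have "f ` zset (k i) \<in> diagram k'" using that unfolding eq unfolding dg by blast
    then show ?thesis unfolding dg by auto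
  qed
  then obtain b where b: "\<And>i. i \<in> T k \<Longrightarrow> b i \<in> T k' \<and> zset (k' (b i)) = f ` zset (k i)" by metis
  have "inj_on b (T k)"
  proof (rule inj_onI)
    fix i j assume ij: "i \<in> T k" "j \<in> T k" "b i = b j"
    then have "zset (k i) = zset (k j)" using finj[of "zset (k i)" "zset (k j)"] b unfolding dg by (metis imageI)
    then show "i = j" using inj[OF g(1)] ij by (auto dest: inj_onD)
  qed
  then have bT: "bij_betw b (T k) (T k')"
    using b card by (metis bij_betw_def card_image card_subset_eq finite_class.finite_code image_subsetI)
  have "card (- T k) = card (- T k')" using card by (simp add: Compl_eq_Diff_UNIV card_Diff_subset)
  then obtain b' where b': "bij_betw b' (- T k) (- T k')" using finite_same_card_bij[of "- T k" "- T k'"] by auto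
  define p where "p i = (if i \<in> T k then b i else b' i)" for i
  have "bij_betw p (T k) (T k')" "bij_betw p (- T k) (- T k')"
    by (rule bij_betw_cong[THEN iffD1, OF _ bT], simp add: p_def)
       (rule bij_betw_cong[THEN iffD1, OF _ b'], simp add: p_def)
  from bij_betw_combine[OF this] have p: "bij p" by simp
  have "disc (k i) > 0 \<longleftrightarrow> disc (k' (p i)) > 0" for i
  proof (cases "i \<in> T k")
    case True then show ?thesis using b[OF True] by (simp add: p_def T_def)
  next
    case False
    then have "b' i \<notin> T k'" using b' by (auto dest: bij_betwE)
    then show ?thesis using False by (simp add: p_def T_def)
  qed
  moreover have "zset (k' (p i)) = f ` zset (k i)" if "disc (k i) > 0" for i using b[of i] that by (simp add: p_def T_def)
  ultimately show ?thesis using p by blast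
qed

lemma homeomorphism_rotation:
  assumes "norm c = 1"
  shows "circle_homeo ((*) c) ((*) (cnj c))"
proof -
  have "cnj c * c = 1" using assms by (metis complex_norm_square mult.commute of_real_1 power_one)
  then have "cnj c * (c * z) = z" "c * (cnj c * z) = z" for z by (simp_all flip: mult.assoc) (simp add: mult.commute)
  then show ?thesis by (intro homeomorphismI) (auto intro!: continuous_intros simp: norm_mult assms)
qed

lemma isotopy_of_lift:
  assumes r: "rep C k" "rep C' k'"
    and h: "\<forall>x y. 0 \<le> x \<and> x < y \<and> y < 1 \<longrightarrow> h x < h y" "\<forall>x. 0 \<le> x \<and> x < 1 \<longrightarrow> 0 \<le> h x \<and> h x < 1"
    and f: "\<forall>x. 0 \<le> x \<and> x < 1 \<longrightarrow> f (ec x) = ec (h x)"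
    and D: "\<And>i. disc (k i) > 0 \<longleftrightarrow> disc (k' i) > 0" and z: "\<And>i. disc (k i) > 0 \<Longrightarrow> zset (k' i) = f ` zset (k i)"
  shows "rigidly_isotopic 4 C C'"
proof (rule isotopy_of_matching[OF r, of h])
  fix i assume d: "disc (k i) > 0"
  have 1: "\<exists>x. 0 \<le> x \<and> x < 1 \<and> w = ec x" if "norm w = 1" for w using ec_surj[OF that] by metis
  obtain x y where "0 \<le> x" "x < 1" "zroot 1 (k i) = ec x" "0 \<le> y" "y < 1" "zroot (- 1) (k i) = ec y"
    using 1 zset_roots(3,4)[OF d] by metis
  moreover from this have "x \<noteq> y" using zset_roots(2)[OF d] by auto
  ultimately show "\<exists>x y. 0 \<le> x \<and> x < 1 \<and> 0 \<le> y \<and> y < 1 \<and> x \<noteq> y \<and>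
       zset (k i) = {ec x, ec y} \<and> zset (k' i) = {ec (h x), ec (h y)}"
    using z[OF d] f zset_roots(1)[OF d] by (intro exI[of _ x] exI[of _ y]) simp
qed (use h D in blast)+

text \<open>The lift to the interval requires a homeomorphism that fixes 1 and preserves
  orientation. Rotations and a conjugation achieve this, and as twists they do not affect the
  curves.\<close>

lemma isotopy_of_same_diagram:
  assumes r: "rep C k" "rep C' k'" and s: "same_diagram (diagram k) (diagram k')"
  shows "rigidly_isotopic 4 C C'"
proof -
  obtain f g where f: "circle_homeo f g" "diagram k' = (\<lambda>c. f ` c) ` diagram k"
    using s unfolding same_diagram_def by blast
  have nd: "nondeg k" "nondeg k'" using r by (simp_all add: rep_def goodf_iff)
  obtain p where p: "bij p" "\<And>i. disc (k i) > 0 \<longleftrightarrow> disc (k' (p i)) > 0" "\<And>i. disc (k i) > 0 \<Longrightarrow> zset (k' (p i)) = f ` zset (k i)"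
    using matching_permutation[OF nd f] by blast
  note r' = rep_perm[OF r(2) p(1)]
  show ?thesis
  proof (cases "\<exists>i. disc (k i) > 0")
    case False
    show ?thesis by (rule isotopy_of_matching[OF r(1) r', of id]) (use False p(2) in auto)
  next
    case True
    then obtain i0 where i0: "disc (k i0) > 0" by blast
    define z0 where "z0 = zroot 1 (k i0)"
    have n0: "norm z0 = 1" using zset_roots(3)[OF i0] by (simp add: z0_def)
    have nf: "norm (f z) = 1" if "norm z = 1" for z
      using homeomorphism_image1[OF f(1)] that by (metis dist_0_norm image_eqI mem_sphere)
    \<comment> \<open>The rotations by \<open>c\<close> and \<open>c'\<close> bring an end point
      \<open>z0\<close> of a chord and its image \<open>f z0\<close> to 1.\<close>
    define c where "c = cnj z0"
    define c' where "c' = cnj (f z0)"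
    have c: "norm c = 1" "norm c' = 1" "norm (cnj c) = 1" using n0 nf[OF n0] by (simp_all add: c_def c'_def)
    define k2 where "k2 = (\<lambda>i. twist ((*) c) (k i))"
    define k2' where "k2' = (\<lambda>i. twist ((*) c') (k' (p i)))"
    have r2: "rep C k2" "rep C' k2'" unfolding k2_def k2'_def
      by (rule rep_twist[OF r(1) rotation_isometry[OF c(1)]], rule rep_twist[OF r' rotation_isometry[OF c(2)]])
    note t2 = twist[OF rotation_isometry[OF c(1)]] and t2' = twist[OF rotation_isometry[OF c(2)]]
    define f2 where "f2 = (*) c' \<circ> (f \<circ> (*) (cnj c))"
    obtain g2 where h2: "circle_homeo f2 g2"
      using homeomorphism_compose[OF homeomorphism_compose[OF homeomorphism_rotation[OF c(3)] f(1)] homeomorphism_rotation[OF c(2)]]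
      unfolding f2_def by blast
    have "f2 1 = 1"
    proof -
      have "cnj (f z0) * f z0 = 1" using nf[OF n0] by (metis complex_norm_square mult.commute of_real_1 power_one)
      then show ?thesis by (simp add: f2_def c_def c'_def)
    qed
    from circle_lift[OF h2 this] obtain h where h: "\<forall>x y. 0 \<le> x \<and> x < y \<and> y < 1 \<longrightarrow> h x < h y"
      "\<forall>x. 0 \<le> x \<and> x < 1 \<longrightarrow> 0 \<le> h x \<and> h x < 1"
      "(\<forall>x. 0 \<le> x \<and> x < 1 \<longrightarrow> f2 (ec x) = ec (h x)) \<or> (\<forall>x. 0 \<le> x \<and> x < 1 \<longrightarrow> cnj (f2 (ec x)) = ec (h x))"
      by blast
    have D2: "disc (k2 i) > 0 \<longleftrightarrow> disc (k2' i) > 0" for i using p(2) by (simp add: k2_def k2'_def t2 t2')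
    have z2: "zset (k2' i) = f2 ` zset (k2 i)" if "disc (k2 i) > 0" for i
    proof -
      have "disc (k i) > 0" using that by (simp add: k2_def t2)
      have "cnj c * c = 1" using c(1) by (metis complex_norm_square mult.commute of_real_1 power_one)
      then have e: "cnj c * (c * z) = z" for z by (simp flip: mult.assoc)
      show ?thesis using p(3)[OF \<open>disc (k i) > 0\<close>] by (simp add: k2_def k2'_def t2 t2' f2_def image_image e)
    qed
    show ?thesis using h(3)
    proof
      assume "\<forall>x. 0 \<le> x \<and> x < 1 \<longrightarrow> f2 (ec x) = ec (h x)"
      then show ?thesis by (rule isotopy_of_lift[OF r2 h(1,2) _ D2 z2])
    next
      assume cf: "\<forall>x. 0 \<le> x \<and> x < 1 \<longrightarrow> cnj (f2 (ec x)) = ec (h x)"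
      have iso: "Re (cnj (cnj w) * cnj v) = Re (cnj w * v)" "surj cnj" for w v :: complex
        by (simp, rule surjI[of _ cnj], simp)
      note t3 = twist[OF iso]
      have "rep C' (\<lambda>i. twist cnj (k2' i))" by (rule rep_twist[OF r2(2) iso])
      then show ?thesis
        by (rule isotopy_of_lift[where f = "cnj \<circ> f2", OF r2(1) _ h(1,2)]) (use cf D2 z2 in \<open>auto simp: t3 image_image\<close>)
    qed
  qed
qed

section \<open>Limits of curves\<close>

text \<open>Signs of discriminants are locally constant on \<open>nondeg\<close> triples and the end
  points \<open>zroot\<close> depend continuously on the forms, so a small motion of the circle
  carries one diagram to the other.\<close>

lemma diagram_eventually:
  assumes nd: "nondeg k" and lim: "\<And>i. ((\<lambda>n. K n i) \<longlongrightarrow> k i) F"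
  shows "\<forall>\<^sub>F n in F. same_diagram (diagram k) (diagram (K n))" "\<forall>\<^sub>F n in F. nondeg (K n)"
proof -
  have lb: "((\<lambda>n. bp (K n i) (K n j)) \<longlongrightarrow> bp (k i) (k j)) F" for i j
    unfolding bp_def by (intro tendsto_intros tendsto_vec_nth lim)
  have all: "(\<forall>\<^sub>F n in F. \<forall>i. P n i) \<longleftrightarrow> (\<forall>i. \<forall>\<^sub>F n in F. P n i)" for P :: "_ \<Rightarrow> 3 \<Rightarrow> bool"
    unfolding forall_3 by (auto simp: eventually_conj_iff)
  have sg: "\<forall>\<^sub>F n in F. \<forall>i. (disc (k i) > 0 \<longleftrightarrow> disc (K n i) > 0)" unfolding all
  proof
    fix i
    show "\<forall>\<^sub>F n in F. disc (k i) > 0 \<longleftrightarrow> disc (K n i) > 0"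
    proof (cases "disc (k i) > 0")
      case True then show ?thesis using order_tendstoD(1)[OF lb True] by (auto elim: eventually_mono)
    next
      case False
      then have "disc (k i) < 0" using nd by (auto simp: nondeg_def linorder_neq_iff)
      then show ?thesis using order_tendstoD(2)[OF lb, of i i 0] False by (auto elim: eventually_mono)
    qed
  qed
  have "\<forall>\<^sub>F n in F. \<forall>i. disc (K n i) \<noteq> 0" unfolding all
    using nd tendsto_imp_eventually_ne[OF lb] by (auto simp: nondeg_def)
  moreover have "\<forall>\<^sub>F n in F. \<forall>i j. i \<noteq> j \<longrightarrow> res (K n i) (K n j) \<noteq> 0" unfolding all
  proof (intro allI)
    fix i j :: 3
    have "((\<lambda>n. res (K n i) (K n j)) \<longlongrightarrow> res (k i) (k j)) F" unfolding res_def by (intro tendsto_intros lb)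
    then show "\<forall>\<^sub>F n in F. i \<noteq> j \<longrightarrow> res (K n i) (K n j) \<noteq> 0"
      using nd tendsto_imp_eventually_ne[of _ "res (k i) (k j)" F 0] by (cases "i = j") (auto simp: nondeg_def)
  qed
  ultimately show "\<forall>\<^sub>F n in F. nondeg (K n)" unfolding nondeg_def by (rule eventually_conj)
  define J where "J = {i. disc (k i) > 0} \<times> {1, - 1 :: real}"
  define z where "z p = zroot (snd p) (k (fst p))" for p
  define w where "w n p = zroot (snd p) (K n (fst p))" for n p
  have "finite J" by (simp add: J_def)
  moreover have "inj_on z J"
  proof (rule inj_onI)
    fix p q assume pq: "p \<in> J" "q \<in> J" "z p = z q"
    have m: "z p \<in> zset (k (fst p))" if "p \<in> J" for p using that zset_roots(1)[of "k (fst p)"] by (auto simp: J_def z_def)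
    have "fst p = fst q"
    proof (rule ccontr)
      assume "fst p \<noteq> fst q"
      then have "zset (k (fst p)) \<inter> zset (k (fst q)) = {}" using pq nd by (intro zset_disjnt) (auto simp: nondeg_def J_def)
      then show False using m[OF pq(1)] m[OF pq(2)] pq(3) by auto
    qed
    moreover have "snd p = snd q"
      using pq zset_roots(2)[of "k (fst p)"] \<open>fst p = fst q\<close> by (auto simp: J_def z_def)
    ultimately show "p = q" by (rule prod_eqI)
  qed
  moreover have "norm (z p) = 1" if "p \<in> J" for p using that zset_roots(3,4) by (auto simp: J_def z_def)
  moreover have "((\<lambda>n. w n p) \<longlongrightarrow> z p) F" if "p \<in> J" for p
    unfolding w_def z_def by (rule tendsto_zroot[OF lim]) (use that in \<open>auto simp: J_def\<close>)
  moreover have "\<forall>\<^sub>F n in F. \<forall>p\<in>J. norm (w n p) = 1"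
    using sg by eventually_elim (auto simp: J_def w_def zset_roots(3,4))
  ultimately have "\<forall>\<^sub>F n in F. \<exists>f g. circle_homeo f g \<and> (\<forall>p\<in>J. f (z p) = w n p)"
    by (rule circle_move_tendsto)
  with sg show "\<forall>\<^sub>F n in F. same_diagram (diagram k) (diagram (K n))"
  proof eventually_elim
    case (elim n)
    then obtain f g where f: "circle_homeo f g" "\<forall>p\<in>J. f (z p) = w n p" by blast
    have "f ` zset (k i) = zset (K n i)" if "disc (k i) > 0" for i
    proof -
      have "f (zroot e (k i)) = zroot e (K n i)" if "e = 1 \<or> e = - 1" for e
        using f(2)[rule_format, of "(i, e)"] that \<open>disc (k i) > 0\<close> by (auto simp: J_def z_def w_def)
      then show ?thesis using that elim(1) by (simp add: zset_roots(1))
    qed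
    from same_diagram_image[where k = k and k' = "K n", OF f(1) _ this] show ?case using elim(1) by blast
  qed
qed

lemma prow_limit:
  assumes "(\<lambda>j. a j n) \<longlonglongrightarrow> b n" "m \<longlonglongrightarrow> (m0 :: complex ^ 3)"
  shows "(\<lambda>j. prow (a j) (m j) n) \<longlonglongrightarrow> prow b m0 n"
proof -
  have r: "(\<lambda>j. complex_of_real (a j n $ i)) \<longlonglongrightarrow> complex_of_real (b n $ i)" for i
    by (intro tendsto_of_real tendsto_vec_nth assms(1))
  show ?thesis unfolding prow_def lin_3 cvec_nth by (intro tendsto_add tendsto_mult r tendsto_vec_nth assms(2))
qed

lemma unit_subseq:
  fixes x :: "nat \<Rightarrow> 'a::euclidean_space"
  assumes "\<And>j. norm (x j) = 1"
  obtains x0 r where "norm x0 = 1" "strict_mono r" "(\<lambda>j. x (r j)) \<longlonglongrightarrow> x0"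
proof -
  have "seq_compact (sphere (0 :: 'a) 1)" by (simp add: compact_imp_seq_compact)
  then obtain x0 r where "x0 \<in> sphere 0 1" "strict_mono r" "(x \<circ> r) \<longlonglongrightarrow> x0"
    using assms unfolding seq_compact_def by (metis dist_0_norm mem_sphere)
  then show ?thesis using that by (simp add: comp_def)
qed

lemma norm_of_real_smult: "norm (complex_of_real r *s x) = \<bar>r\<bar> * norm x"
  by (simp add: norm_vec_def L2_set_def norm_mult power_mult_distrib real_sqrt_mult flip: sum_distrib_left)

text \<open>The lines \<open>m j\<close> may have unbounded norm; only their directions
  \<open>M j\<close> converge, on a subsequence. Regularity makes the limit line have nonzero
  pullback, and cross multiplication eliminates the norms.\<close>

lemma inW_limit:
  assumes reg: "regular b" and a: "\<And>n. n \<le> 4 \<Longrightarrow> (\<lambda>j. a j n) \<longlonglongrightarrow> b n"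
    and h: "\<And>n. n \<le> 4 \<Longrightarrow> (\<lambda>j. h j n) \<longlonglongrightarrow> h0 n" and W: "\<And>j. inW (a j) (h j)"
  shows "inW b h0"
proof -
  obtain m where m: "\<And>j n. n \<le> 4 \<Longrightarrow> h j n = prow (a j) (m j) n" using W unfolding inW_def by metis
  define M where "M j = (if m j = 0 then axis 1 1 else of_real (1 / norm (m j)) *s m j)" for j
  have M1: "norm (M j) = 1" for j using norm_of_real_smult[of "1 / norm (m j)" "m j"] by (simp add: M_def)
  have hM: "h j n = of_real (norm (m j)) * prow (a j) (M j) n" if "n \<le> 4" for j n
    unfolding m[OF that] by (simp add: M_def prow_def lin_3 field_simps)
  obtain M0 r where r: "norm M0 = 1" "strict_mono r" "(\<lambda>j. M (r j)) \<longlonglongrightarrow> M0" by (rule unit_subseq[OF M1])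
  have a': "(\<lambda>j. a (r j) n) \<longlonglongrightarrow> b n" if "n \<le> 4" for n using LIMSEQ_subseq_LIMSEQ[OF a[OF that] r(2)] by (simp add: comp_def)
  have h': "(\<lambda>j. h (r j) n) \<longlonglongrightarrow> h0 n" if "n \<le> 4" for n using LIMSEQ_subseq_LIMSEQ[OF h[OF that] r(2)] by (simp add: comp_def)
  have P: "(\<lambda>j. prow (a (r j)) (M (r j)) n) \<longlonglongrightarrow> prow b M0 n" if "n \<le> 4" for n
    by (rule prow_limit[where a = "\<lambda>j. a (r j)" and b = b, OF a'[OF that] r(3)])
  have "\<exists>n\<le>4. prow b M0 n \<noteq> 0"
  proof (rule ccontr)
    assume "\<not> (\<exists>n\<le>4. prow b M0 n \<noteq> 0)"
    then have "M0 = 0" by (intro regular_no_line[OF reg]) (simp add: lin_theta')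
    then show False using r(1) by simp
  qed
  then obtain n1 where n1: "n1 \<le> 4" "prow b M0 n1 \<noteq> 0" by blast
  have "h0 n = prow b ((h0 n1 / prow b M0 n1) *s M0) n" if n: "n \<le> 4" for n
  proof -
    have "h (r j) n * prow (a (r j)) (M (r j)) n1 = h (r j) n1 * prow (a (r j)) (M (r j)) n" for j
      unfolding hM[OF n] hM[OF n1(1)] by simp
    moreover have "(\<lambda>j. h (r j) n * prow (a (r j)) (M (r j)) n1) \<longlonglongrightarrow> h0 n * prow b M0 n1"
      "(\<lambda>j. h (r j) n1 * prow (a (r j)) (M (r j)) n) \<longlonglongrightarrow> h0 n1 * prow b M0 n"
      by (intro tendsto_mult h' P n n1(1))+
    ultimately have "h0 n * prow b M0 n1 = h0 n1 * prow b M0 n" using LIMSEQ_unique by simp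
    then have "h0 n = h0 n1 / prow b M0 n1 * prow b M0 n" using n1(2) by (simp add: field_simps)
    moreover have "prow b (x *s M0) n = x * prow b M0 n" for x by (simp add: prow_def lin_3 algebra_simps)
    ultimately show ?thesis by simp
  qed
  then show ?thesis unfolding inW_def by blast
qed

text \<open>All conditions on a degenerate functional are closed once it is normalized, and the unit
  sphere is compact.\<close>

lemma crit_limit:
  assumes a: "\<And>n. n \<le> 4 \<Longrightarrow> (\<lambda>j. a j n) \<longlonglongrightarrow> b n"
    and k: "k \<longlonglongrightarrow> k0" "k0 \<noteq> 0" and c: "\<And>j. crit (a j) (k j)"
  shows "crit b k0"
proof -
  obtain l where l: "\<And>j. deg (a j) (k j) (l j)" using c unfolding crit_def by metis
  define N where "N j = norm (to5 (l j))" for j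
  have N: "N j \<noteq> 0" for j
  proof
    assume "N j = 0"
    then have "l j n = 0" if "n \<le> 4" for n using from5_to5[OF that, of "l j"] by (simp add: N_def from5_def)
    then show False using degD(2)[OF l[of j]] by (auto simp: nz_def)
  qed
  have "norm (of_real (1 / N j) *s to5 (l j)) = 1" for j using N[of j] unfolding norm_of_real_smult by (simp add: N_def)
  then obtain L0 r where r: "norm L0 = 1" "strict_mono r" "(\<lambda>j. of_real (1 / N (r j)) *s to5 (l (r j))) \<longlonglongrightarrow> L0"
    by (rule unit_subseq)
  define l' where "l' j n = of_real (1 / N (r j)) * l (r j) n" for j n
  define l0 where "l0 = from5 L0"
  have t: "(\<lambda>j. l' j n) \<longlonglongrightarrow> l0 n" if "n \<le> 4" for n
    using tendsto_vec_nth[OF r(3), of "of_nat n"] from5_to5[OF that] by (simp add: l'_def l0_def from5_def)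
  have "nz l0"
  proof (rule ccontr)
    assume "\<not> nz l0"
    then have z: "L0 $ of_nat n = 0" if "n \<le> 4" for n using that by (auto simp: nz_def l0_def from5_def)
    from z[of 0] z[of 1] z[of 2] z[of 3] z[of 4] have "L0 $ i = 0" for i using exhaust_5[of i] by (elim disjE) simp_all
    then have "L0 = 0" by (simp add: vec_eq_iff)
    then show False using r(1) by simp
  qed
  moreover have "ann b l0" unfolding ann_def
  proof
    fix m
    have P: "(\<lambda>j. prow (a (r j)) m n) \<longlonglongrightarrow> prow b m n" if "n \<le> 4" for n
      by (rule prow_limit[where a = "\<lambda>j. a (r j)"]) (use LIMSEQ_subseq_LIMSEQ[OF a[OF that] r(2)] in \<open>simp_all add: comp_def\<close>)
    have "(\<lambda>j. pr (l' j) (prow (a (r j)) m)) \<longlonglongrightarrow> pr l0 (prow b m)"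
      unfolding pr_simps by (intro tendsto_add tendsto_mult t P; simp)
    moreover have "pr (l' j) (prow (a (r j)) m) = 0" for j
    proof -
      have "pr (l' j) h = of_real (1 / N (r j)) * pr (l (r j)) h" for h by (simp add: pr_simps l'_def algebra_simps)
      then show ?thesis using degD(1)[OF l] by (simp add: ann_def)
    qed
    ultimately show "pr l0 (prow b m) = 0" using LIMSEQ_unique[OF _ tendsto_const] by simp
  qed
  moreover have "qker k0 l0"
  proof -
    have kr: "(\<lambda>j. k (r j) $ i) \<longlonglongrightarrow> k0 $ i" for i
      using tendsto_vec_nth[OF LIMSEQ_subseq_LIMSEQ[OF k(1) r(2)]] by (simp add: comp_def)
    have "qker (k (r j)) (l' j)" for j
    proof -
      have e: "k $ 3 * (c * x) + k $ 2 * (c * y) + k $ 1 * (c * z) = c * (k $ 3 * x + k $ 2 * y + k $ 1 * z)" for k :: "complex ^ 3" and c x y z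
        by (simp add: algebra_simps)
      show ?thesis using degD(4)[OF l[of "r j"]] unfolding qker_def l'_def e by simp
    qed
    then have q: "k (r j) $ 3 * l' j 0 + k (r j) $ 2 * l' j 1 + k (r j) $ 1 * l' j 2 = 0"
      "k (r j) $ 3 * l' j 1 + k (r j) $ 2 * l' j 2 + k (r j) $ 1 * l' j 3 = 0"
      "k (r j) $ 3 * l' j 2 + k (r j) $ 2 * l' j 3 + k (r j) $ 1 * l' j 4 = 0" for j by (simp_all add: qker_def)
    have "(\<lambda>j. k (r j) $ 3 * l' j 0 + k (r j) $ 2 * l' j 1 + k (r j) $ 1 * l' j 2) \<longlonglongrightarrow> k0 $ 3 * l0 0 + k0 $ 2 * l0 1 + k0 $ 1 * l0 2"
      "(\<lambda>j. k (r j) $ 3 * l' j 1 + k (r j) $ 2 * l' j 2 + k (r j) $ 1 * l' j 3) \<longlonglongrightarrow> k0 $ 3 * l0 1 + k0 $ 2 * l0 2 + k0 $ 1 * l0 3"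
      "(\<lambda>j. k (r j) $ 3 * l' j 2 + k (r j) $ 2 * l' j 3 + k (r j) $ 1 * l' j 4) \<longlonglongrightarrow> k0 $ 3 * l0 2 + k0 $ 2 * l0 3 + k0 $ 1 * l0 4"
      by (intro tendsto_add tendsto_mult kr t; simp)+
    then show ?thesis unfolding q qker_def using LIMSEQ_unique[OF _ tendsto_const] by metis
  qed
  ultimately have "deg b k0 l0" using k(2) by (simp add: deg_def)
  then show ?thesis unfolding crit_def by blast
qed

text \<open>The product of two distinct kernels lies in \<open>W\<close>, and this passes to the
  limit. If the kernels merged, the square of the limit kernel would lie in \<open>W\<close>,
  against transversality of the limit curve.\<close>

lemma crit_limit_distinct:
  assumes n: "nodal b C" "\<And>j. nodal (a j) (D j)"
    and a: "\<And>n. n \<le> 4 \<Longrightarrow> (\<lambda>j. a j n) \<longlonglongrightarrow> b n"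
    and p: "p \<longlonglongrightarrow> p0" "p0 \<noteq> 0" "\<And>j. crit (a j) (p j)" and q: "q \<longlonglongrightarrow> q0" "q0 \<noteq> 0" "\<And>j. crit (a j) (q j)"
    and d: "\<And>j c. q j \<noteq> c *s p j"
  shows "q0 \<noteq> c *s p0"
proof
  assume qp: "q0 = c *s p0"
  have reg: "regular b" "\<And>j. regular (a j)"
    using n regular_of_parametrizes unfolding nodal_parametrization_def by blast+
  have W: "inW (a j) (qm (p j) (q j))" for j
  proof -
    obtain l l' where "deg (a j) (p j) l" "deg (a j) (q j) l'" using p(3)[of j] q(3)[of j] unfolding crit_def by blast
    then show ?thesis using inW_product[OF reg(2)] indep_of_kernels[OF reg(2)] d by metis
  qed
  have "(\<lambda>j. qm (p j) (q j) n) \<longlonglongrightarrow> qm p0 q0 n" for n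
  proof -
    have "(\<lambda>j. p j $ i) \<longlonglongrightarrow> p0 $ i" "(\<lambda>j. q j $ i) \<longlonglongrightarrow> q0 $ i" for i by (intro tendsto_vec_nth p(1) q(1))+
    then show ?thesis
      by (cases "n = 0"; cases "n = 1"; cases "n = 2"; cases "n = 3"; simp add: qm_def; intro tendsto_add tendsto_mult; assumption?)
  qed
  from inW_limit[OF reg(1) a this W] obtain m where m: "\<forall>n\<le>4. qm p0 q0 n = prow b m n" unfolding inW_def by blast
  have c: "c \<noteq> 0" using qp q(2) by auto
  have "qm p0 p0 n = prow b ((1 / c) *s m) n" if "n \<le> 4" for n
  proof -
    have "qm p0 q0 n = c * qm p0 p0 n" unfolding qp by (simp add: qm_def algebra_simps)
    then have e: "qm p0 p0 n = (1 / c) * prow b m n" using m that c by simp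
    have "prow b (x *s m) n = x * prow b m n" for x by (simp add: prow_def lin_3 algebra_simps)
    then show ?thesis using e by simp
  qed
  then have "inW b (qm p0 p0)" unfolding inW_def by blast
  moreover have "crit b p0" by (rule crit_limit[OF a p])
  ultimately show False using square_notin_W[OF n(1)] unfolding crit_def by blast
qed

lemma crit_cnj:
  assumes "crit a k" shows "crit a (\<chi> i. cnj (k $ i))"
proof -
  obtain l where l: "deg a k l" using assms unfolding crit_def by blast
  define l' where "l' n = cnj (l n)" for n
  have "ann a l'" unfolding ann_def
  proof
    fix m
    have "pr l' (prow a m) = cnj (pr l (prow a (\<chi> i. cnj (m $ i))))"
      by (simp add: pr_simps l'_def prow_def lin_3)
    then show "pr l' (prow a m) = 0" using degD(1)[OF l] by (simp add: ann_def)
  qed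
  moreover have "nz l'" using degD(2)[OF l] by (simp add: nz_def l'_def)
  moreover have "(\<chi> i. cnj (k $ i)) \<noteq> 0" using degD(3)[OF l] by (auto simp: vec_eq_iff)
  moreover have "qker (\<chi> i. cnj (k $ i)) l'"
  proof -
    have "k $ 3 * x + k $ 2 * y + k $ 1 * z = 0 \<longleftrightarrow> cnj (k $ 3) * cnj x + cnj (k $ 2) * cnj y + cnj (k $ 1) * cnj z = 0" for x y z
      by (simp only: complex_cnj_mult[symmetric] complex_cnj_add[symmetric] complex_cnj_zero_iff)
    then show ?thesis using degD(4)[OF l] by (simp add: qker_def l'_def)
  qed
  ultimately show ?thesis unfolding crit_def deg_def by blast
qed

lemma rep_of_crit:
  assumes n: "nodal a C" and c: "\<And>i. crit a (cvec (k i))" and d: "\<And>i j c. i \<noteq> j \<Longrightarrow> k i \<noteq> c *s k j"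
  shows "rep C k"
proof -
  have g: "good (k 1) (k 2) (k 3) \<and> (\<exists>M. det M \<noteq> 0 \<and> (\<forall>n\<le>4. a n = M *v cremona (k 1) (k 2) (k 3) n))"
    by (rule structure_of_crit[OF n c c c]) (rule d; simp)+
  then obtain M where M: "det M \<noteq> 0" "\<And>n. n \<le> 4 \<Longrightarrow> a n = M *v cremona (k 1) (k 2) (k 3) n" by blast
  have "lift4 a = lift4 (param M k)" by (rule theta_cong) (simp add: M(2) param_def tc_def)
  then have "Ctheta 4 a = Ctheta 4 (param M k)" by (simp add: Ctheta_def fun_eq_iff)
  then have "C = curve M k" using n by (simp add: nodal_parametrization_def parametrizes_def curve_def)
  then show ?thesis using g M(1) unfolding rep_def goodf_def by blast
qed

lemma normalized_triple:
  assumes "nodal a C" "real_crit a"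
  shows "\<exists>k. rep C k \<and> (\<forall>i. crit a (cvec (k i)) \<and> norm (k i) = 1)"
proof -
  obtain k where k: "rep C k" "\<And>i. crit a (cvec (k i))" by (rule rep_structure[OF assms]) (rule that)
  have k0: "k i \<noteq> 0" for i using crit_nonzero[OF k(2)[of i]] by (auto simp: vec_eq_iff)
  have "rep C (\<lambda>i. (1 / norm (k i)) *s k i)" by (rule rep_scale[OF k(1)]) (simp add: k0)
  moreover have "crit a (cvec ((1 / norm (k i)) *s k i))" for i
    unfolding cvec_smult by (rule crit_scale[OF _ k(2)]) (simp add: k0)
  moreover have "norm ((1 / norm (k i)) *s k i) = 1" for i using k0[of i] by (simp add: scalar_mult_eq_scaleR)
  ultimately show ?thesis by (intro exI[of _ "\<lambda>i. (1 / norm (k i)) *s k i"]) blast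
qed

text \<open>Normalized triples have a convergent subsequence; since the limits are again kernels and
  pairwise distinct, they form a triple of the limit curve.\<close>

lemma triple_limit:
  assumes n: "nodal b C" "\<And>j. nodal (a j) (D j)"
    and a: "\<And>n. n \<le> 4 \<Longrightarrow> (\<lambda>j. a j n) \<longlonglongrightarrow> b n" and r: "\<And>j. real_crit (a j)"
  shows "\<exists>k k0. (\<forall>j. rep (D j) (k j)) \<and> rep C k0 \<and>
    (\<exists>s. strict_mono s \<and> (\<forall>i. (\<lambda>j. k (s j) i) \<longlonglongrightarrow> k0 i))"
proof -
  obtain k where k: "\<And>j. rep (D j) (k j)" "\<And>j i. crit (a j) (cvec (k j i))" "\<And>j i. norm (k j i) = 1"
    using normalized_triple[OF n(2) r] by metis
  obtain p1 s1 where 1: "norm p1 = 1" "strict_mono s1" "(\<lambda>j. k (s1 j) 1) \<longlonglongrightarrow> p1"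
    by (rule unit_subseq[OF k(3)])
  obtain p2 s2 where 2: "norm p2 = 1" "strict_mono s2" "(\<lambda>j. k (s1 (s2 j)) 2) \<longlonglongrightarrow> p2"
    by (rule unit_subseq[OF k(3)])
  obtain p3 s3 where 3: "norm p3 = 1" "strict_mono s3" "(\<lambda>j. k (s1 (s2 (s3 j))) 3) \<longlonglongrightarrow> p3"
    by (rule unit_subseq[OF k(3)])
  define s where "s = s1 \<circ> (s2 \<circ> s3)"
  define k0 where "k0 i = (if i = 1 then p1 else if i = 2 then p2 else p3)" for i :: 3
  have s: "strict_mono s" unfolding s_def by (intro strict_mono_o 1 2 3)
  have lim: "(\<lambda>j. k (s j) i) \<longlonglongrightarrow> k0 i" for i
    using LIMSEQ_subseq_LIMSEQ[OF 1(3) strict_mono_o[OF 2(2) 3(2)]] LIMSEQ_subseq_LIMSEQ[OF 2(3) 3(2)] 3(3) exhaust_3[of i]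
    by (auto simp: k0_def s_def comp_def)
  have k0: "k0 i \<noteq> 0" for i using 1(1) 2(1) 3(1) by (auto simp: k0_def)
  have cl: "(\<lambda>j. cvec (k (s j) i)) \<longlonglongrightarrow> cvec (k0 i)" for i
    unfolding cvec_def by (intro tendsto_vec_lambda tendsto_of_real tendsto_vec_nth lim)
  have c0: "cvec (k0 i) \<noteq> 0" for i using k0[of i] by (auto simp: vec_eq_iff)
  have as: "(\<lambda>j. a (s j) n) \<longlonglongrightarrow> b n" if "n \<le> 4" for n
    using LIMSEQ_subseq_LIMSEQ[OF a[OF that] s] by (simp add: comp_def)
  have "crit b (cvec (k0 i))" for i by (rule crit_limit[OF as cl c0 k(2)])
  moreover have "k0 i \<noteq> c *s k0 j" if "i \<noteq> j" for i j c
  proof -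
    have "cvec (k (s m) i) \<noteq> e *s cvec (k (s m) j)" for m e
    proof
      assume e: "cvec (k (s m) i) = e *s cvec (k (s m) j)"
      have "res (cvec (k (s m) i)) (cvec (k (s m) j)) = 0" unfolding e by (simp add: res_def bp_scale algebra_simps)
      then have "res (k (s m) i) (k (s m) j) = 0" by (simp add: res_cvec)
      then show False using k(1)[of "s m"] that by (simp add: rep_def goodf_iff nondeg_def)
    qed
    from crit_limit_distinct[OF n(1) n(2) as cl c0 k(2) cl c0 k(2) this]
    have "cvec (k0 i) \<noteq> of_real c *s cvec (k0 j)" .
    then show ?thesis by (auto simp: cvec_smult)
  qed
  ultimately have "rep C k0" by (rule rep_of_crit[OF n(1)])
  then show ?thesis using k(1) s lim by blast
qed

text \<open>A non-real kernel is not proportional to its conjugate, which is again a kernel. In a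
  limit with real kernels the two would become proportional, which is impossible for distinct
  kernels.\<close>

lemma real_crit_open:
  assumes n: "nodal b C" "\<And>j. nodal (a j) (D j)"
    and a: "\<And>n. n \<le> 4 \<Longrightarrow> (\<lambda>j. a j n) \<longlonglongrightarrow> b n" and r: "real_crit b"
  shows "\<exists>j. real_crit (a j)"
proof (rule ccontr)
  assume "\<not> (\<exists>j. real_crit (a j))"
  then have "\<forall>j. \<exists>k. crit (a j) k \<and> (\<forall>c u. c \<noteq> 0 \<and> u \<noteq> 0 \<longrightarrow> k \<noteq> c *s cvec u)" unfolding real_crit_def by blast
  then obtain q where q: "\<And>j. crit (a j) (q j)" "\<And>j c u. c \<noteq> 0 \<Longrightarrow> u \<noteq> 0 \<Longrightarrow> q j \<noteq> c *s cvec u" by metis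
  have q0: "q j \<noteq> 0" for j by (rule crit_nonzero[OF q(1)])
  define p where "p j = of_real (1 / norm (q j)) *s q j" for j
  have "norm (p j) = 1" for j using norm_of_real_smult[of "1 / norm (q j)" "q j"] q0[of j] by (simp add: p_def)
  then obtain p0 s where s: "norm p0 = 1" "strict_mono s" and lim: "(\<lambda>j. p (s j)) \<longlonglongrightarrow> p0" by (rule unit_subseq)
  have pc: "crit (a j) (p j)" for j unfolding p_def by (rule crit_scale[OF _ q(1)]) (simp add: q0)
  have as: "(\<lambda>j. a (s j) n) \<longlonglongrightarrow> b n" if "n \<le> 4" for n
    using LIMSEQ_subseq_LIMSEQ[OF a[OF that] s(2)] by (simp add: comp_def)
  define cj where "cj x = (\<chi> i. cnj (x $ i))" for x :: "complex ^ 3"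
  have cl: "(\<lambda>j. cj (p (s j))) \<longlonglongrightarrow> cj p0"
    unfolding cj_def by (intro tendsto_vec_lambda tendsto_cnj tendsto_vec_nth lim)
  have p0: "p0 \<noteq> 0" using s(1) by auto
  then have cp0: "cj p0 \<noteq> 0" by (auto simp: cj_def vec_eq_iff)
  have "cj (p (s j)) \<noteq> c *s p (s j)" for j c
  proof
    assume "cj (p (s j)) = c *s p (s j)"
    then obtain l u where lu: "l \<noteq> 0" "u \<noteq> 0" "p (s j) = l *s cvec u"
      using conj_prop_real[of "p (s j)" c] crit_nonzero[OF pc] unfolding cj_def by blast
    have "q (s j) = of_real (norm (q (s j))) *s p (s j)" using q0[of "s j"] by (simp add: p_def vec_eq_iff)
    then have "q (s j) = (of_real (norm (q (s j))) * l) *s cvec u" by (simp add: lu(3))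
    then show False using q(2)[of "of_real (norm (q (s j))) * l" u "s j"] lu q0[of "s j"] by simp
  qed
  from crit_limit_distinct[OF n(1) n(2) as lim p0 pc cl cp0 crit_cnj[OF pc, folded cj_def] this]
  have d: "cj p0 \<noteq> c *s p0" for c .
  have "crit b p0" by (rule crit_limit[OF as lim p0 pc])
  then obtain c u where "c \<noteq> 0" "u \<noteq> 0" "p0 = c *s cvec u" using r unfolding real_crit_def by blast
  then have "cj p0 = (cnj c / c) *s p0" by (simp add: cj_def vec_eq_iff)
  then show False using d by blast
qed

text \<open>The times whose curve has a real triple with the diagram of \<open>k\<close> form a set
  that is both closed and relatively open in the unit interval. Membership includes reality of the
  nodes, which is not known in advance for intermediate times.\<close>

lemma same_diagram_of_isotopy:
  assumes iso: "rigidly_isotopic 4 C C'" and r: "rep C k" "rep C' k'"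
  shows "same_diagram (diagram k) (diagram k')"
proof -
  obtain K a where K: "K 0 = C" "K 1 = C'" and c: "\<And>n. n \<le> 4 \<Longrightarrow> continuous_on {0..1} (\<lambda>t. a t n)"
    and n: "\<And>t. t \<in> {0..1 :: real} \<Longrightarrow> nodal (a t) (K t)"
    using iso unfolding rigidly_isotopic_def rigid_isotopy_def by blast
  define A where "A = {t \<in> {0..1}. \<exists>m. rep (K t) m \<and> same_diagram (diagram k) (diagram m)}"
  have lim: "(\<lambda>j. a (x j) n) \<longlonglongrightarrow> a l n" if "\<forall>j. x j \<in> {0..1}" "x \<longlonglongrightarrow> l" "l \<in> {0..1}" "n \<le> 4" for x l n
    by (rule continuous_on_tendsto_compose[OF c[OF that(4)] that(2,3)]) (use that(1) in simp)
  have main: "\<exists>j. x j \<in> A \<longleftrightarrow> l \<in> A"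
    if x: "\<forall>j. x j \<in> {0..1}" "x \<longlonglongrightarrow> l" "l \<in> {0..1}" and rc: "\<And>j. real_crit (a (x j))" for x l
  proof -
    obtain m m0 s where m: "\<And>j. rep (K (x j)) (m j)" "rep (K l) m0" "strict_mono s" "\<And>i. (\<lambda>j. m (s j) i) \<longlonglongrightarrow> m0 i"
      using triple_limit[where a = "\<lambda>j. a (x j)" and b = "a l" and D = "\<lambda>j. K (x j)", OF n[OF x(3)] n[OF x(1)[rule_format]] lim[OF x] rc] by blast
    have "nondeg m0" using m(2) by (simp add: rep_def goodf_iff)
    from diagram_eventually(1)[OF this m(4)] obtain j where sj: "same_diagram (diagram m0) (diagram (m (s j)))"
      unfolding eventually_sequentially by blast
    have in_A: "t \<in> A \<longleftrightarrow> same_diagram (diagram k) (diagram w)" if "t \<in> {0..1}" "rep (K t) w" for t w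
    proof
      assume "t \<in> A"
      then obtain w' where "rep (K t) w'" "same_diagram (diagram k) (diagram w')" unfolding A_def by blast
      then show "same_diagram (diagram k) (diagram w)" using diagram_unique[OF _ that(2)] same_diagram_trans by blast
    qed (use that in \<open>auto simp: A_def\<close>)
    have "x (s j) \<in> A \<longleftrightarrow> l \<in> A"
      using in_A[OF x(1)[rule_format] m(1)] in_A[OF x(3) m(2)] sj same_diagram_sym[OF sj diagram_on_circle] same_diagram_trans
      by blast
    then show ?thesis by blast
  qed
  have rcA: "real_crit (a t)" if "t \<in> A" for t using that real_crit_rep[OF n] unfolding A_def by blast
  have lc: "l \<in> {0..1}" if "\<forall>j. x j \<in> {0..1}" "x \<longlonglongrightarrow> l" for x and l :: real
    using that closed_sequentially[of "{0..1 :: real}" x l] by auto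
  have "closed A" unfolding closed_sequential_limits
  proof (intro allI impI, elim conjE)
    fix x l assume x: "\<forall>j. x j \<in> A" "x \<longlonglongrightarrow> l"
    then have x01: "\<forall>j. x j \<in> {0..1}" by (auto simp: A_def)
    then show "l \<in> A" using main[OF x01 x(2) lc[OF x01 x(2)]] x(1) rcA by blast
  qed
  moreover have "closed ({0..1} - A)" unfolding closed_sequential_limits
  proof (intro allI impI, elim conjE)
    fix x l assume x: "\<forall>j. x j \<in> {0..1} - A" "x \<longlonglongrightarrow> l"
    then have x01: "\<forall>j. x j \<in> {0..1}" by auto
    note l = lc[OF x01 x(2)]
    show "l \<in> {0..1} - A"
    proof (rule ccontr)
      assume "l \<notin> {0..1} - A"
      then have lA: "l \<in> A" using l by blast
      \<comment> \<open>\<open>real_crit_open\<close> yields a single good index for each sequence;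
        applied to a subsequence of bad indices, it shows that there are only finitely many of
        these.\<close>
      have "finite {j. \<not> real_crit (a (x j))}"
      proof (rule ccontr)
        assume "infinite {j. \<not> real_crit (a (x j))}"
        then obtain s :: "nat \<Rightarrow> nat" where s: "strict_mono s" "\<And>j. s j \<in> {j. \<not> real_crit (a (x j))}" using infinite_enumerate by blast
        have xs: "\<forall>j. x (s j) \<in> {0..1}" "(\<lambda>j. x (s j)) \<longlonglongrightarrow> l"
          using x01 LIMSEQ_subseq_LIMSEQ[OF x(2) s(1)] by (auto simp: comp_def)
        have "\<exists>j. real_crit (a (x (s j)))"
          by (rule real_crit_open[where D = "\<lambda>j. K (x (s j))", OF n[OF l] _ lim[OF xs l] rcA[OF lA]]) (use n xs in blast)
        then show False using s(2) by blast
      qed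
      then obtain N where N: "\<And>j. real_crit (a (x (j + N)))"
        by (metis (mono_tags, lifting) finite_nat_set_iff_bounded_le mem_Collect_eq not_less_eq_eq le_add2 add_Suc_right)
      have xN: "\<forall>j. x (j + N) \<in> {0..1}" "(\<lambda>j. x (j + N)) \<longlonglongrightarrow> l" using x01 LIMSEQ_ignore_initial_segment[OF x(2)] by auto
      show False using main[OF xN l N] x(1) lA by blast
    qed
  qed
  moreover have "0 \<in> A" using r(1) K(1) diagram_unique[OF r(1) r(1)] by (auto simp: A_def)
  ultimately have "{0..1} - A = {}"
    using connected_closedD[OF connected_Icc[of 0 "1 :: real"], of A "{0..1} - A"] by auto
  then have "1 \<in> A" by auto
  then obtain m where "rep C' m" "same_diagram (diagram k) (diagram m)" unfolding A_def K(2)[symmetric] by blast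
  then show ?thesis using diagram_unique[OF _ r(2)] same_diagram_trans by blast
qed

section \<open>Realizing chord diagrams\<close>

lemma chord_diagram_nondeg:
  assumes D: "chord_diagram D" "card D \<le> 3"
  shows "\<exists>k. nondeg k \<and> diagram k = D"
proof -
  obtain T :: "3 set" where T: "card T = card D" using D(2) obtain_subset_with_card_n[of "card D" "UNIV :: 3 set"] by auto
  obtain e where e: "bij_betw e T D"
    using finite_same_card_bij[of T D] T D(1) by (auto simp: chord_diagram_def)
  have "\<exists>x y. 0 \<le> x \<and> x < 1 \<and> 0 \<le> y \<and> y < 1 \<and> x \<noteq> y \<and> e i = {ec x, ec y}" if "i \<in> T" for i
  proof -
    have "e i \<in> D" using e that by (auto dest: bij_betwE)
    then have "e i \<subseteq> sphere 0 1" "card (e i) = 2" using D(1) by (auto simp: chord_diagram_def)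
    then obtain v w where vw: "v \<noteq> w" "e i = {v, w}" "norm v = 1" "norm w = 1" by (auto simp: card_2_iff)
    then show ?thesis using ec_surj[OF vw(3)] ec_surj[OF vw(4)] by metis
  qed
  then obtain x y where xy: "\<And>i. i \<in> T \<Longrightarrow> 0 \<le> x i \<and> x i < 1 \<and> 0 \<le> y i \<and> y i < 1 \<and> x i \<noteq> y i \<and> e i = {ec (x i), ec (y i)}" by metis
  define \<iota> :: "3 \<Rightarrow> real" where "\<iota> i = (if i = 1 then 1 else if i = 2 then 2 else 3)" for i
  have iota: "\<iota> i \<noteq> \<iota> j" if "i \<noteq> j" for i j using that exhaust_3[of i] exhaust_3[of j] by (auto simp: \<iota>_def)
  define k :: "3 \<Rightarrow> real ^ 3" where "k i = (if i \<in> T then chq (x i) (y i) else vector [1, \<iota> i, (\<iota> i)\<^sup>2])" for i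
  have pos: "disc (k i) > 0" "zset (k i) = e i" if "i \<in> T" for i using xy[OF that] that by (simp_all add: k_def chq_disc chq_zset)
  have neg: "disc (k i) < 0" "k i $ 1 = 1" if "i \<notin> T" for i using that by (simp_all add: k_def bp_def \<iota>_def)
  have "nondeg k"
  proof (rule nondegI[of T])
    fix i j assume ij: "i \<in> T" "j \<in> T" "i \<noteq> j"
    then have "e i \<noteq> e j" "e i \<in> D" "e j \<in> D" using e by (auto simp: bij_betw_def dest: inj_onD)
    then have "e i \<inter> e j = {}" using D(1) unfolding chord_diagram_def pairwise_def disjnt_def by blast
    then show "zset (k i) \<inter> zset (k j) = {}" using pos(2) ij by simp
  next
    fix i j :: 3 assume ij: "i \<notin> T" "j \<notin> T" "i \<noteq> j"
    then have "k i $ 2 \<noteq> k j $ 2" using iota by (simp add: k_def)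
    then show "k i \<noteq> k j" by auto
  qed (use pos neg in auto)
  moreover have "diagram k = D"
  proof -
    have "disc (k i) > 0 \<longleftrightarrow> i \<in> T" for i using pos(1)[of i] neg(1)[of i] by force
    then have "diagram k = (\<lambda>i. zset (k i)) ` T" by (auto simp: diagram_def)
    also have "\<dots> = e ` T" by (intro image_cong refl pos(2))
    finally show ?thesis using e by (simp add: bij_betw_def)
  qed
  ultimately show ?thesis by blast
qed

text \<open>If the triple is dependent, a small push of the third form along the normal of the other
  two makes it independent, and a small enough push keeps the diagram.\<close>

lemma goodf_nearby:
  assumes nd: "nondeg k"
  shows "\<exists>k'. goodf k' \<and> same_diagram (diagram k) (diagram k')"
proof -
  define n where "n = normal (k 1) (k 2)"
  define \<epsilon> where "\<epsilon> j = 1 / real (Suc j)" for j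
  define K where "K j i = (if i = 3 then k 3 + \<epsilon> j *s n else k i)" for j and i :: 3
  have e0: "\<epsilon> \<longlonglongrightarrow> 0" unfolding \<epsilon>_def by (rule lim_inverse_n'[THEN LIMSEQ_Suc])
  have dn: "disc n \<noteq> 0" using nd normal(4)[of "k 1" "k 2"] by (auto simp: n_def nondeg_def)
  have lim: "(\<lambda>j. K j i) \<longlonglongrightarrow> k i" for i
  proof (cases "i = 3")
    case True
    have "(\<lambda>j. k 3 + \<epsilon> j *\<^sub>R n) \<longlonglongrightarrow> k 3 + 0 *\<^sub>R n" by (intro tendsto_intros e0)
    then show ?thesis using True by (simp add: K_def scalar_mult_eq_scaleR)
  qed (simp add: K_def)
  have "det (\<chi> i. K j i) = det3 (k 1) (k 2) (k 3) + \<epsilon> j * disc n" for j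
  proof -
    have "(\<chi> i. K j i) = (vector [K j 1, K j 2, K j 3] :: real ^ 3 ^ 3)" by (simp add: vec_eq_iff forall_3)
    then have "det (\<chi> i. K j i) = bp n (k 3 + \<epsilon> j *s n)" by (simp add: det_vector3 K_def n_def normal(3))
    also have "\<dots> = bp n (k 3) + \<epsilon> j * disc n" by (simp add: bp_def algebra_simps)
    finally show ?thesis by (simp add: n_def normal(3))
  qed
  moreover have "\<forall>\<^sub>F j in sequentially. det3 (k 1) (k 2) (k 3) + \<epsilon> j * disc n \<noteq> 0"
  proof (cases "det3 (k 1) (k 2) (k 3) = 0")
    case True then show ?thesis using dn by (simp add: \<epsilon>_def)
  next
    case False
    have "(\<lambda>j. det3 (k 1) (k 2) (k 3) + \<epsilon> j * disc n) \<longlonglongrightarrow> det3 (k 1) (k 2) (k 3) + 0 * disc n"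
      by (intro tendsto_intros e0)
    then show ?thesis using tendsto_imp_eventually_ne False by fastforce
  qed
  ultimately have "\<forall>\<^sub>F j in sequentially. det (\<chi> i. K j i) \<noteq> 0" by simp
  then have "\<forall>\<^sub>F j in sequentially. goodf (K j) \<and> same_diagram (diagram k) (diagram (K j))"
    using diagram_eventually[OF nd lim] unfolding goodf_iff by eventually_elim blast
  then show ?thesis unfolding eventually_sequentially by blast
qed

theorem mainTheorem1:
  "(\<forall>D. chord_diagram D \<and> card D \<le> 3 \<longrightarrow>
      (\<exists>C a. nodal_parametrization 4 a C \<and> same_diagram (real_chord_diagram 4 a) D))
   \<and>
   (\<forall>C\<^sub>1 C\<^sub>2 a\<^sub>1 a\<^sub>2.
      nodal_parametrization 4 a\<^sub>1 C\<^sub>1 \<and> (\<forall>x. node 4 a\<^sub>1 x \<longrightarrow> real_node 4 a\<^sub>1 x) \<and>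
      nodal_parametrization 4 a\<^sub>2 C\<^sub>2 \<and> (\<forall>x. node 4 a\<^sub>2 x \<longrightarrow> real_node 4 a\<^sub>2 x) \<longrightarrow>
      (rigidly_isotopic 4 C\<^sub>1 C\<^sub>2 \<longleftrightarrow>
       same_diagram (real_chord_diagram 4 a\<^sub>1) (real_chord_diagram 4 a\<^sub>2)))"
proof (intro conjI allI impI; elim conjE)
  fix D assume "chord_diagram D" "card D \<le> 3"
  then obtain k where k: "nondeg k" "diagram k = D" using chord_diagram_nondeg by blast
  obtain k' where k': "goodf k'" "same_diagram (diagram k) (diagram k')" using goodf_nearby[OF k(1)] by blast
  have I: "det (mat 1 :: real ^ 3 ^ 3) \<noteq> 0" by simp
  have "real_chord_diagram 4 (param (mat 1) k') = diagram k'"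
    using param_diagram[OF k'(1) I] by (simp add: diagram_def)
  then have "same_diagram (real_chord_diagram 4 (param (mat 1) k')) D"
    using same_diagram_sym[OF k'(2) diagram_on_circle] k(2) by simp
  then show "\<exists>C a. nodal a C \<and> same_diagram (real_chord_diagram 4 a) D"
    using param_nodal[OF k'(1) I] by blast
next
  fix C\<^sub>1 C\<^sub>2 a\<^sub>1 a\<^sub>2
  assume n: "nodal a\<^sub>1 C\<^sub>1" "nodal a\<^sub>2 C\<^sub>2"
    and r: "\<forall>x. node 4 a\<^sub>1 x \<longrightarrow> real_node 4 a\<^sub>1 x" "\<forall>x. node 4 a\<^sub>2 x \<longrightarrow> real_node 4 a\<^sub>2 x"
  obtain k where k: "rep C\<^sub>1 k" "real_chord_diagram 4 a\<^sub>1 = diagram k"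
    by (rule rep_structure[OF n(1) real_crit_of_real_nodes[OF n(1)]]) (use r(1) that in blast)+
  obtain k' where k': "rep C\<^sub>2 k'" "real_chord_diagram 4 a\<^sub>2 = diagram k'"
    by (rule rep_structure[OF n(2) real_crit_of_real_nodes[OF n(2)]]) (use r(2) that in blast)+
  show "rigidly_isotopic 4 C\<^sub>1 C\<^sub>2 \<longleftrightarrow> same_diagram (real_chord_diagram 4 a\<^sub>1) (real_chord_diagram 4 a\<^sub>2)"
    unfolding k(2) k'(2)
    using same_diagram_of_isotopy[OF _ k(1) k'(1)] isotopy_of_same_diagram[OF k(1) k'(1)] by blast
qed

end
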